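(* Let $Pr=0$ and $N\ge3$. There exist constants $M_0>0$, $\delta>0$, $C>0$ such that the following holds. Let $f$ be a local-in-time classical solution, on $0\le t<T_*$, of $$\partial_t f+v\cdot\nabla_x f=\frac1{\tau_0}L_{Pr}f+\Gamma(f),\qquad f(x,v,0)=f_0(x,v),$$ with $F_0=m+\sqrt m f_0\ge0$, $F=m+\sqrt m f\ge0$, $\mathcal{S}_{Pr}(F)\ge 0$, $\sup_{0\le t\le T_*}\mathcal{E}(f)(t)\le M_0$, and satisfying conservation of $\int_{\mathbb{T}^3\times\mathbb{R}^3} f(1,v,|v|^2)\sqrt m\,dvdx$. Assume that $F_0$ has the same total mass, momentum and energy as $m$, i.e. $\int_{\mathbb{T}^3\times\mathbb{R}^3} f_0\,(1,v,|v|^2)\sqrt m\,dvdx=0$, and that its total third moment vanishes: $$\int_{\mathbb{T}^3\times\mathbb{R}^3}F_0(x,v)\,v_i|v|^2\,dvdx=0,\qquad i=1,2,3 .$$ Then, for $0\le t<T_*$, $$\sum_{|\alpha|\le N}\langle L_{Pr}\partial^\alpha f,\partial^\alpha f\rangle_{L^2_{x,v}}\le-\delta\sum_{|\alpha|\le N}\|\partial^\alpha f\|_{L^2_{x,v}}^2+C\,\mathcal{E}^2(t).$$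
   Context: Position $x\in\mathbb{T}^3$, velocity $v\in\mathbb{R}^3$, time $t\ge0$. Constants $\tau_0>0$, $\eta\ge0$, $w\in\mathbb{R}$ are fixed. Macroscopic fields of $F(x,v,t)$: $\rho=\int_{\mathbb{R}^3} F\,dv$, $\rho U=\int_{\mathbb{R}^3} Fv\,dv$, $3\rho T=\int_{\mathbb{R}^3} F|v-U|^2dv$, $q=\int_{\mathbb{R}^3} F(v-U)|v-U|^2dv$. $\mathcal{M}(F)=\frac{\rho}{\sqrt{2\pi T}^3}\exp\left(-\frac{|v-U|^2}{2T}\right)$ and $$\mathcal{S}_{Pr}(F)=\mathcal{M}(F)\left[1+\frac{1-Pr}{5}\frac{q\cdot(v-U)}{\rho T^2}\left(\frac{|v-U|^2}{2T}-\frac52\right)\right],\qquad \frac1\tau=\frac1{\tau_0}\rho^\eta T^w.$$ $m(v)=(2\pi)^{-3/2}e^{-|v|^2/2}$, $F=m+\sqrt m f$. Define $$P_cf=\Big(\int f\sqrt m\,dv\Big)\sqrt m+\Big(\int fv\sqrt m\,dv\Big)\cdot v\sqrt m+\Big(\int f\tfrac{|v|^2-3}{\sqrt6}\sqrt m\,dv\Big)\tfrac{|v|^2-3}{\sqrt6}\sqrt m,$$ $$P_{nc}f=\Big(\int f\tfrac{v(|v|^2-5)}{\sqrt{10}}\sqrt m\,dv\Big)\cdot\tfrac{v(|v|^2-5)}{\sqrt{10}}\sqrt m,$$ $P_{Pr}=P_c+(1-Pr)P_{nc}$, $L_{Pr}f=P_{Pr}f-f$, and $\Gamma(f)=\frac1{\sqrt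 m}\frac1\tau(\mathcal{S}_{Pr}(F)-F)-\frac1{\tau_0}L_{Pr}f$; thus the equation for $f$ is equivalent to $\partial_tF+v\cdot\nabla_xF=\frac1\tau(\mathcal{S}_{Pr}(F)-F)$. Multi-indices: $\alpha=(\alpha_0,\dots,\alpha_3)$, $\beta=(\beta_1,\beta_2,\beta_3)$, $\partial^\alpha_\beta=\partial_t^{\alpha_0}\partial_{x_1}^{\alpha_1}\partial_{x_2}^{\alpha_2}\partial_{x_3}^{\alpha_3}\partial_{v_1}^{\beta_1}\partial_{v_2}^{\beta_2}\partial_{v_3}^{\beta_3}$, $\partial^\alpha=\partial^\alpha_0$ (time derivatives included). $\langle\cdot,\cdot\rangle_{L^2_{x,v}}$ and $\|\cdot\|_{L^2_{x,v}}$ are those of $L^2(\mathbb{T}^3\times\mathbb{R}^3)$. Energy functional, also written $\mathcal{E}(t)$: $$\mathcal{E}(f)(t)=\frac12\sum_{|\alpha|+|\beta|\le N}\|\partial^\alpha_\beta f(t)\|_{L^2_{x,v}}^2+\sum_{|\alpha|+|\beta|\le N}\int_0^t\|\partial^\alpha_\beta f(s)\|_{L^2_{x,v}}^2ds .$$ *)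

theory Defs
  imports "HOL-Analysis.Analysis"
begin

section \<open>Velocity distributions and the Shakhov relaxation operator\<close>

type_synonym velocity_fn = "real^3 \<Rightarrow> real"

definition mass_density :: "velocity_fn \<Rightarrow> real" where
  "mass_density F = (LINT v|lborel. F v)"

definition bulk_velocity :: "velocity_fn \<Rightarrow> real^3" where
  "bulk_velocity F = (1 / mass_density F) *\<^sub>R (LINT v|lborel. F v *\<^sub>R v)"

definition temperature :: "velocity_fn \<Rightarrow> real" where
  "temperature F = (LINT v|lborel. F v * (norm (v - bulk_velocity F))\<^sup>2) / (3 * mass_density F)"

definition heat_flux :: "velocity_fn \<Rightarrow> real^3" where
  "heat_flux F = (LINT v|lborel.
     (F v * (norm (v - bulk_velocity F))\<^sup>2) *\<^sub>R (v - bulk_velocity F))"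

definition local_maxwellian :: "velocity_fn \<Rightarrow> velocity_fn" where
  "local_maxwellian F v =
     mass_density F / sqrt (2 * pi * temperature F) ^ 3
       * exp (- (norm (v - bulk_velocity F))\<^sup>2 / (2 * temperature F))"

definition shakhov :: "real \<Rightarrow> velocity_fn \<Rightarrow> velocity_fn" where
  "shakhov Pr F v = local_maxwellian F v *
     (1 + (1 - Pr) / 5
        * ((heat_flux F \<bullet> (v - bulk_velocity F)) / (mass_density F * (temperature F)\<^sup>2))
        * ((norm (v - bulk_velocity F))\<^sup>2 / (2 * temperature F) - 5 / 2))"

text \<open>The collision frequency \<open>1/\<tau>\<close>.\<close>

definition inv_tau :: "real \<Rightarrow> real \<Rightarrow> real \<Rightarrow> velocity_fn \<Rightarrow> real" where
  "inv_tau \<tau>\<^sub>0 \<eta> w F = 1 / \<tau>\<^sub>0 * mass_density F powr \<eta> * temperature F powr w"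

section \<open>Linearization around the global Maxwellian\<close>

definition maxwellian :: velocity_fn where
  "maxwellian v = (2 * pi) powr (- 3 / 2) * exp (- (norm v)\<^sup>2 / 2)"

definition perturbed :: "velocity_fn \<Rightarrow> velocity_fn" where
  "perturbed g v = maxwellian v + sqrt (maxwellian v) * g v"

definition P_c :: "velocity_fn \<Rightarrow> velocity_fn" where
  "P_c g v =
     (LINT u|lborel. g u * sqrt (maxwellian u)) * sqrt (maxwellian v)
   + ((LINT u|lborel. (g u * sqrt (maxwellian u)) *\<^sub>R u) \<bullet> v) * sqrt (maxwellian v)
   + (LINT u|lborel. g u * (((norm u)\<^sup>2 - 3) / sqrt 6) * sqrt (maxwellian u))
       * (((norm v)\<^sup>2 - 3) / sqrt 6) * sqrt (maxwellian v)"

definition P_nc :: "velocity_fn \<Rightarrow> velocity_fn" where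
  "P_nc g v =
     ((LINT u|lborel. (g u * sqrt (maxwellian u)) *\<^sub>R ((((norm u)\<^sup>2 - 5) / sqrt 10) *\<^sub>R u))
        \<bullet> ((((norm v)\<^sup>2 - 5) / sqrt 10) *\<^sub>R v)) * sqrt (maxwellian v)"

definition P_Pr :: "real \<Rightarrow> velocity_fn \<Rightarrow> velocity_fn" where
  "P_Pr Pr g v = P_c g v + (1 - Pr) * P_nc g v"

definition L_Pr :: "real \<Rightarrow> velocity_fn \<Rightarrow> velocity_fn" where
  "L_Pr Pr g v = P_Pr Pr g v - g v"

definition Gamma_Pr :: "real \<Rightarrow> real \<Rightarrow> real \<Rightarrow> real \<Rightarrow> velocity_fn \<Rightarrow> velocity_fn" where
  "Gamma_Pr \<tau>\<^sub>0 \<eta> w Pr g v =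
     1 / sqrt (maxwellian v)
       * (inv_tau \<tau>\<^sub>0 \<eta> w (perturbed g) * (shakhov Pr (perturbed g) v - perturbed g v))
     - 1 / \<tau>\<^sub>0 * L_Pr Pr g v"

section \<open>Phase space\<close>

text \<open>
  Functions on the torus (of side length 1) are functions on \<^typ>\<open>real^3\<close> with period 1 in
  each coordinate; integrals over the torus are integrals over the unit cube.
\<close>

type_synonym phase_fn = "real^3 \<Rightarrow> velocity_fn"

text \<open>Time-dependent functions take their arguments in the order \<open>t\<close>, \<open>x\<close>, \<open>v\<close>.\<close>

type_synonym kinetic_fn = "real \<Rightarrow> phase_fn"

definition torus_periodic :: "phase_fn \<Rightarrow> bool" where
  "torus_periodic g \<longleftrightarrow> (\<forall>i x v. g (x + axis i 1) v = g x v)"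

definition phase_space :: "((real^3) \<times> (real^3)) measure" where
  "phase_space = restrict_space lborel (cbox 0 One) \<Otimes>\<^sub>M lborel"

definition L2_inner :: "phase_fn \<Rightarrow> phase_fn \<Rightarrow> real" where
  "L2_inner g h = (LINT (x, v)|phase_space. g x v * h x v)"

text \<open>Squared norm, with value \<open>\<infinity>\<close> if the function is not square integrable.\<close>

definition L2_norm_sq :: "phase_fn \<Rightarrow> ennreal" where
  "L2_norm_sq g = (\<integral>\<^sup>+ (x, v). ennreal ((g x v)\<^sup>2) \<partial>phase_space)"

section \<open>Derivatives and energy\<close>

text \<open>
  The time derivative is one-sided at \<open>t = 0\<close>.  At each \<open>t < T\<^sub>*\<close> it depends only on the values
  of the function near \<open>t\<close>, hence not on its values at times \<open>\<ge> T\<^sub>*\<close>.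
\<close>

definition deriv_t :: "kinetic_fn \<Rightarrow> kinetic_fn" where
  "deriv_t f t x v = vector_derivative (\<lambda>s. f s x v) (at t within {0..})"

definition deriv_x :: "3 \<Rightarrow> kinetic_fn \<Rightarrow> kinetic_fn" where
  "deriv_x i f t x v = deriv (\<lambda>s. f t (x + s *\<^sub>R axis i 1) v) 0"

definition deriv_v :: "3 \<Rightarrow> kinetic_fn \<Rightarrow> kinetic_fn" where
  "deriv_v i f t x v = deriv (\<lambda>s. f t x (v + s *\<^sub>R axis i 1)) 0"

text \<open>
  The components of \<open>\<alpha>\<close> are \<open>\<alpha>$0\<close> (time) and \<open>\<alpha>$1\<close>, \<open>\<alpha>$2\<close>, \<open>\<alpha>$3\<close> (space); in the index
  type of \<open>\<beta>\<close> the literal \<open>3\<close> coincides with \<open>0\<close>.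
\<close>

definition mult_deriv :: "nat^4 \<Rightarrow> nat^3 \<Rightarrow> kinetic_fn \<Rightarrow> kinetic_fn" where
  "mult_deriv \<alpha> \<beta> =
     (deriv_t ^^ (\<alpha>$0)) \<circ> (deriv_x 1 ^^ (\<alpha>$1)) \<circ> (deriv_x 2 ^^ (\<alpha>$2)) \<circ> (deriv_x 3 ^^ (\<alpha>$3))
     \<circ> (deriv_v 1 ^^ (\<beta>$1)) \<circ> (deriv_v 2 ^^ (\<beta>$2)) \<circ> (deriv_v 3 ^^ (\<beta>$3))"

definition mi_length :: "nat^'n \<Rightarrow> nat" where
  "mi_length \<alpha> = (\<Sum>i\<in>UNIV. \<alpha>$i)"

text \<open>
  With values in \<^typ>\<open>ennreal\<close>, a finite bound on the energy includes square integrability of all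
  the derivatives involved.
\<close>

definition energy :: "nat \<Rightarrow> kinetic_fn \<Rightarrow> real \<Rightarrow> ennreal" where
  "energy N f t =
     1 / 2 * (\<Sum>(\<alpha>, \<beta>) | mi_length \<alpha> + mi_length \<beta> \<le> N. L2_norm_sq (mult_deriv \<alpha> \<beta> f t))
     + (\<Sum>(\<alpha>, \<beta>) | mi_length \<alpha> + mi_length \<beta> \<le> N.
          \<integral>\<^sup>+ s\<in>{0..t}. L2_norm_sq (mult_deriv \<alpha> \<beta> f s) \<partial>lborel)"

section \<open>Classical solutions\<close>

text \<open>\<open>k\<close> times continuously differentiable in \<open>(t, x, v)\<close> on \<open>[0, T) \<times> \<real>\<^sup>3 \<times> \<real>\<^sup>3\<close>.\<close>

primrec C_k_on :: "nat \<Rightarrow> real \<Rightarrow> kinetic_fn \<Rightarrow> bool" where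
  "C_k_on 0 T f \<longleftrightarrow> continuous_on ({0..<T} \<times> UNIV \<times> UNIV) (\<lambda>(t, x, v). f t x v)"
| "C_k_on (Suc k) T f \<longleftrightarrow>
     continuous_on ({0..<T} \<times> UNIV \<times> UNIV) (\<lambda>(t, x, v). f t x v)
   \<and> (\<forall>t\<in>{0..<T}. \<forall>x v.
         (\<lambda>s. f s x v) differentiable (at t within {0..})
       \<and> (\<forall>i. (\<lambda>s. f t (x + s *\<^sub>R axis i 1) v) differentiable (at 0))
       \<and> (\<forall>i. (\<lambda>s. f t x (v + s *\<^sub>R axis i 1)) differentiable (at 0)))
   \<and> C_k_on k T (deriv_t f)
   \<and> (\<forall>i. C_k_on k T (deriv_x i f))
   \<and> (\<forall>i. C_k_on k T (deriv_v i f))"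

text \<open>
  A classical solution on \<open>[0, T)\<close> for which all derivatives occurring in \<open>energy N\<close> exist in the
  classical sense.
\<close>

definition classical_solution ::
  "real \<Rightarrow> real \<Rightarrow> real \<Rightarrow> real \<Rightarrow> nat \<Rightarrow> real \<Rightarrow> phase_fn \<Rightarrow> kinetic_fn \<Rightarrow> bool" where
  "classical_solution \<tau>\<^sub>0 \<eta> w Pr N T f\<^sub>0 f \<longleftrightarrow>
     (\<forall>t\<in>{0..<T}. torus_periodic (f t))
   \<and> C_k_on N T f
   \<and> (\<forall>t\<in>{0..<T}. \<forall>x v.
        deriv_t f t x v + (\<Sum>i\<in>UNIV. v$i * deriv_x i f t x v)
          = 1 / \<tau>\<^sub>0 * L_Pr Pr (f t x) v + Gamma_Pr \<tau>\<^sub>0 \<eta> w Pr (f t x) v)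
   \<and> (\<forall>x v. f 0 x v = f\<^sub>0 x v)"

text \<open>The integrals of \<open>g (1, v, |v|\<^sup>2) \<surd>m\<close> over phase space.\<close>

definition collision_moments :: "phase_fn \<Rightarrow> real \<times> (real^3) \<times> real" where
  "collision_moments g =
     (LINT (x, v)|phase_space. g x v * sqrt (maxwellian v),
      LINT (x, v)|phase_space. (g x v * sqrt (maxwellian v)) *\<^sub>R v,
      LINT (x, v)|phase_space. g x v * (norm v)\<^sup>2 * sqrt (maxwellian v))"

end

theory Submission
  imports Defs "HOL-Probability.Distributions"
begin

text \<open>
  The operator \<open>L_Pr\<close> with \<open>Pr = 0\<close> controls only the part of \<open>f\<close> orthogonal to the eight directions
  \<open>\<surd>m (1, v, |v|\<^sup>2 - 3, v (|v|\<^sup>2 - 5))\<close>.  The coefficients of \<open>f\<close> in these directions are recovered from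
  the moment equations, up to the dissipation and terms quadratic in the energy.  The traceless
  second moments \<open>v\<^sub>i v\<^sub>j\<close> and \<open>v\<^sub>i v\<^sub>j (|v|\<^sup>2 - 7)\<close> are microscopic, and their fluxes are the
  symmetrized traceless gradients of the velocity and of the heat flux; Korn's inequality on the
  torus then gives the full gradients.  The conservation laws give the time derivatives of density
  and temperature, and the momentum and heat flux equations give the remaining gradients.
  Undifferentiated coefficients are bounded by Poincare's inequality: the means of the conserved
  ones vanish, and the mean of the heat flux vanishes initially and has a quadratic time derivative
  because \<open>Pr = 0\<close> removes its damping.
\<close>

subsection \<open>Gaussian moments of polynomials in the velocity\<close>

text \<open>The constants must not depend on the solution, so every estimate is made for the set of
  all small solutions at once, with the constant chosen before the solution. The yardstick is
  \<kappa> = sqrt D + 2 E, with D the dissipation and E the energy. Once all hydrodynamic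
  coefficients are O(\<kappa>), their squared norms sum to at most C (2 D + 8 E^2); the full sum of
  squared norms is D plus this, which gives \<delta> = 1 / (1 + 2 C). The obstacle is regularity.
  Top-order derivatives are only square integrable and nothing dominates difference quotients
  uniformly in v, so moments cannot be differentiated pointwise under the velocity integral. They do
  have one-sided derivatives in mean square over the cube. The moment equations are proved pointwise
  for f alone and differentiated in that sense. A second obstacle is circularity: the heat flux
  equation ties the time derivative of the heat flux to the temperature gradient, and neither is
  known. It is broken by distinguishing whether a time derivative can be split off the multi-index,
  in which case it is moved onto the temperature, whose evolution is a divergence already under
  control. Velocity and density are treated alike.\<close>

lemma has_bochner_integral_prod_vec:
  fixes f :: "'n::finite \<Rightarrow> real \<Rightarrow> real"
  assumes "\<And>i. integrable lborel (f i)"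
  shows "has_bochner_integral lborel (\<lambda>v::real^'n. \<Prod>i\<in>UNIV. f i (v$i)) (\<Prod>i\<in>UNIV. integral\<^sup>L lborel (f i))"
proof -
  interpret product_sigma_finite "\<lambda>b::real^'n. lborel :: real measure" ..
  \<comment> \<open>\<open>lborel_eq\<close> presents the measure as a product over basis vectors;
    \<open>THE\<close> recovers the coordinate \<open>i\<close> from \<open>axis i 1\<close>, so
    that both products can be reindexed along this bijection.\<close>
  define F where "F b = f (THE i. b = axis i (1::real))" for b :: "real^'n"
  have F: "F (axis i 1) = f i" for i
    unfolding F_def by (rule arg_cong[where f=f]) (auto simp: axis_eq_axis)
  have B: "(Basis :: (real^'n) set) = range (\<lambda>i. axis i 1)"
    by (auto simp: Basis_vec_def)
  have inj: "inj (\<lambda>i::'n. axis i (1::real))" by (auto simp: inj_on_def axis_eq_axis)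
  have comp: "(\<Sum>b\<in>Basis. x b *\<^sub>R b) $ i = x (axis i 1)" for x :: "real^'n \<Rightarrow> real" and i
  proof -
    have "(\<Sum>b\<in>Basis. x b *\<^sub>R b) $ i = (\<Sum>j\<in>UNIV. x (axis j 1) * (axis j 1 $ i))"
      unfolding B using inj by (simp add: sum.reindex)
    also have "\<dots> = (\<Sum>j\<in>UNIV. if j = i then x (axis i 1) else 0)"
      by (rule sum.cong) (auto simp: axis_def)
    finally show ?thesis by simp
  qed
  have eq: "(\<Prod>i\<in>UNIV. f i ((\<Sum>b\<in>Basis. x b *\<^sub>R b) $ i)) = (\<Prod>b\<in>Basis. F b (x b))" for x
    unfolding comp unfolding B using inj by (simp add: prod.reindex F)
  have meas[measurable]: "f i \<in> borel_measurable borel" for i using assms[of i] by auto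
  have int: "integrable lborel (F b)" for b
    unfolding F_def using assms by auto
  have 1: "integrable (PiM Basis (\<lambda>b::real^'n. lborel)) (\<lambda>x. \<Prod>b\<in>Basis. F b (x b))"
    by (rule product_integrable_prod) (auto intro: int)
  have 2: "integral\<^sup>L (PiM Basis (\<lambda>b::real^'n. lborel)) (\<lambda>x. \<Prod>b\<in>Basis. F b (x b)) = (\<Prod>b\<in>Basis. integral\<^sup>L lborel (F b))"
    by (rule product_integral_prod) (auto intro: int)
  have 3: "(\<Prod>b\<in>Basis. integral\<^sup>L lborel (F b)) = (\<Prod>i\<in>UNIV. integral\<^sup>L lborel (f i))"
    unfolding B using inj by (simp add: prod.reindex F)
  have mf: "(\<lambda>v::real^'n. \<Prod>i\<in>UNIV. f i (v$i)) \<in> borel_measurable borel"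
    by measurable
  have mg: "(\<lambda>x. \<Sum>b\<in>Basis. x b *\<^sub>R b :: real^'n) \<in> PiM Basis (\<lambda>b. lborel) \<rightarrow>\<^sub>M borel"
    by measurable
  define D where "D = distr (PiM Basis (\<lambda>b::real^'n. lborel)) borel (\<lambda>x. \<Sum>b\<in>Basis. x b *\<^sub>R b)"
  have D: "(lborel :: (real^'n) measure) = D" unfolding D_def by (rule lborel_eq)
  have "integrable D (\<lambda>v::real^'n. \<Prod>i\<in>UNIV. f i (v$i))"
    unfolding D_def integrable_distr_eq[OF mg mf] eq by (rule 1)
  moreover have "integral\<^sup>L D (\<lambda>v::real^'n. \<Prod>i\<in>UNIV. f i (v$i)) = (\<Prod>i\<in>UNIV. integral\<^sup>L lborel (f i))"
    unfolding D_def integral_distr[OF mg mf] eq 2 3 ..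
  ultimately show ?thesis by (simp only: D has_bochner_integral_iff)
qed

text \<open>A polynomial in v is a list of monomials, each a coefficient with three exponents. In
  this form a Gaussian expectation is a finite computation, which the simplifier carries out in all
  orthogonality and flux identities.\<close>

type_synonym poly3 = "(real \<times> nat \<times> nat \<times> nat) list"

definition mono3 :: "real \<times> nat \<times> nat \<times> nat \<Rightarrow> real^3 \<Rightarrow> real" where
  "mono3 = (\<lambda>(c,k,l,m) v. c * v$1^k * v$2^l * v$3^m)"

definition peval :: "poly3 \<Rightarrow> real^3 \<Rightarrow> real" where
  "peval L v = (\<Sum>t\<leftarrow>L. mono3 t v)"

text \<open>The moments of a standard normal variable, by the recursion that integration by parts
  gives.\<close>

fun gmom :: "nat \<Rightarrow> real" where
  "gmom 0 = 1"
| "gmom (Suc 0) = 0"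
| "gmom (Suc (Suc n)) = (real n + 1) * gmom n"

definition gmono :: "real \<times> nat \<times> nat \<times> nat \<Rightarrow> real" where
  "gmono = (\<lambda>(c,k,l,m). c * gmom k * gmom l * gmom m)"

definition pE :: "poly3 \<Rightarrow> real" where
  "pE L = (\<Sum>t\<leftarrow>L. gmono t)"

definition mmul :: "real \<times> nat \<times> nat \<times> nat \<Rightarrow> real \<times> nat \<times> nat \<times> nat \<Rightarrow> real \<times> nat \<times> nat \<times> nat" where
  "mmul = (\<lambda>(c,k,l,m) (c',k',l',m'). (c*c',k+k',l+l',m+m'))"

definition pmul :: "poly3 \<Rightarrow> poly3 \<Rightarrow> poly3" where
  "pmul L L' = concat (map (\<lambda>t. map (mmul t) L') L)"

definition pscale :: "real \<Rightarrow> poly3 \<Rightarrow> poly3" where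
  "pscale a L = map (mmul (a,0,0,0)) L"

lemma peval_Nil[simp]: "peval [] v = 0" by (simp add: peval_def)
lemma peval_append[simp]: "peval (L @ L') v = peval L v + peval L' v" by (simp add: peval_def)
lemma peval_Cons: "peval (t # L) v = mono3 t v + peval L v" by (simp add: peval_def)
lemma pE_append[simp]: "pE (L @ L') = pE L + pE L'" by (simp add: pE_def)
lemma mono3_mmul: "mono3 (mmul s t) v = mono3 s v * mono3 t v"
  by (cases s; cases t) (simp add: mono3_def mmul_def power_add)
lemma peval_map_mmul: "peval (map (mmul t) L) v = mono3 t v * peval L v"
  by (induction L) (simp_all add: peval_Cons mono3_mmul algebra_simps)
lemma peval_pmul[simp]: "peval (pmul L L') v = peval L v * peval L' v"
  by (induction L) (simp_all add: pmul_def peval_Cons peval_map_mmul algebra_simps)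
lemma peval_pscale[simp]: "peval (pscale a L) v = a * peval L v"
  by (simp add: pscale_def peval_map_mmul) (simp add: mono3_def)
lemma pE_pscale[simp]: "pE (pscale a L) = a * pE L"
  by (induction L) (auto simp: pE_def pscale_def gmono_def mmul_def algebra_simps split: prod.splits)

lemma continuous_on_peval[continuous_intros]: "continuous_on A (peval L)"
proof (induction L)
  case Nil
  have "peval [] = (\<lambda>v. 0)" by (simp add: fun_eq_iff)
  then show ?case by simp
next
  case (Cons t L)
  have "peval (t # L) = (\<lambda>v. mono3 t v + peval L v)" by (simp add: fun_eq_iff peval_Cons)
  moreover have "continuous_on A (mono3 t)"
    unfolding mono3_def case_prod_beta by (intro continuous_intros)
  ultimately show ?case using Cons by (simp add: continuous_on_add)
qed

lemma peval_measurable[measurable]: "peval L \<in> borel_measurable borel"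
  by (rule borel_measurable_continuous_onI[OF continuous_on_peval])

abbreviation wt :: "poly3 \<Rightarrow> real^3 \<Rightarrow> real" where
  "wt L v \<equiv> peval L v * sqrt (maxwellian v)"
abbreviation sqn :: "velocity_fn \<Rightarrow> ennreal" where
  "sqn h \<equiv> \<integral>\<^sup>+v. ennreal ((h v)\<^sup>2) \<partial>lborel"

lemma prod3: "(\<Prod>i\<in>UNIV. f i) = f (1::3) * f 2 * f 3"
  for f :: "3 \<Rightarrow> 'a::comm_monoid_mult"
  unfolding UNIV_3 by (simp add: ac_simps)

lemma norm_sq3: "(norm (v::real^3))\<^sup>2 = (v$1)\<^sup>2 + (v$2)\<^sup>2 + (v$3)\<^sup>2"
  by (simp only: power2_norm_eq_inner inner_vec_def) (simp add: power2_eq_square sum_3)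

lemma maxwellian_prod: "maxwellian v = (\<Prod>i\<in>UNIV. std_normal_density (v$i))"
proof -
  have 1: "(2*pi) powr (-3/2) = (1 / sqrt (2*pi))^3"
  proof -
    have "(2*pi) powr (-3/2) = ((2*pi) powr (-(1/2))) powr 3"
      by (simp only: powr_powr) simp
    also have "\<dots> = ((2*pi) powr (-(1/2)))^3"
      by (subst powr_numeral) auto
    also have "(2*pi) powr (-(1/2)) = 1 / sqrt (2*pi)"
      by (simp add: powr_minus_divide powr_half_sqrt)
    finally show ?thesis .
  qed
  have 2: "exp (- (norm v)\<^sup>2 / 2) = exp (- (v$1)\<^sup>2 / 2) * exp (- (v$2)\<^sup>2 / 2) * exp (- (v$3)\<^sup>2 / 2)"
    unfolding exp_add[symmetric] norm_sq3 by (rule arg_cong[where f=exp]) (simp add: field_simps)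
  have 3: "(\<Prod>i\<in>UNIV. std_normal_density (v$i)) = std_normal_density (v$1) * std_normal_density (v$2) * std_normal_density (v$3)"
    by (simp add: prod3)
  show ?thesis
    unfolding maxwellian_def 1 2 unfolding 3 unfolding std_normal_density_def by (simp only: power3_eq_cube mult_ac)
qed

lemma maxwellian_pos: "maxwellian v > 0" by (simp add: maxwellian_def)
lemma maxwellian_nonneg[simp]: "maxwellian v \<ge> 0" using maxwellian_pos[of v] by simp
lemma maxwellian_neq0[simp]: "maxwellian v \<noteq> 0" using maxwellian_pos[of v] by simp

lemma continuous_on_maxwellian[continuous_intros]: "continuous_on A maxwellian"
proof -
  have "continuous_on A (\<lambda>v. (2 * pi) powr (- 3 / 2) * exp (- (norm v)\<^sup>2 / 2))"
    by (intro continuous_on_mult continuous_on_const continuous_on_exp continuous_on_divide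
        continuous_on_minus continuous_on_power continuous_on_norm continuous_on_id) simp
  moreover have "maxwellian = (\<lambda>v. (2 * pi) powr (- 3 / 2) * exp (- (norm v)\<^sup>2 / 2))"
    by (simp add: fun_eq_iff maxwellian_def)
  ultimately show ?thesis by (simp only:)
qed
lemma maxwellian_measurable[measurable]: "maxwellian \<in> borel_measurable borel"
  by (rule borel_measurable_continuous_onI[OF continuous_on_maxwellian])

lemma gmom_even: "gmom (2*k) = fact (2*k) / (2^k * fact k)"
proof (induction k)
  case (Suc k)
  have "gmom (2 * Suc k) = (2 * real k + 1) * gmom (2*k)" by simp
  also have "\<dots> = (2 * real k + 1) * (fact (2*k) / (2^k * fact k))" by (simp only: Suc)
  also have "\<dots> = fact (2 * Suc k) / (2^Suc k * fact (Suc k))"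
  proof -
    have c: "2 * (real k + 1) \<noteq> 0" by (simp add: add_nonneg_eq_0_iff)
    have "(fact (2 * Suc k) :: real) = (2 * (real k + 1)) * ((2 * real k + 1) * fact (2*k))"
      by (simp add: algebra_simps)
    moreover have "(2^Suc k * fact (Suc k) :: real) = (2 * (real k + 1)) * (2^k * fact k)"
      by simp
    ultimately show ?thesis
      by (simp only: mult_divide_mult_cancel_left[OF c] times_divide_eq_right)
  qed
  finally show ?case .
qed simp

lemma gmom_odd: "gmom (2*k+1) = 0"
  by (induction k) simp_all

lemma gmom_integral: "has_bochner_integral lborel (\<lambda>x. std_normal_density x * x ^ n) (gmom n)"
proof (cases "even n")
  case True
  then obtain k where "n = 2*k" by (auto elim: evenE)
  then show ?thesis using std_normal_moment_even[of k] by (simp add: gmom_even)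
next
  case False
  then obtain k where "n = 2*k+1" by (auto elim: oddE)
  then show ?thesis using std_normal_moment_odd[of k] gmom_odd[of k] by simp
qed

lemma gmono_integral: "has_bochner_integral lborel (\<lambda>v. maxwellian v * mono3 t v) (gmono t)"
proof -
  obtain c k l m where t: "t = (c,k,l,m)" by (cases t)
  define n where "n = (\<lambda>i::3. if i = 1 then k else if i = 2 then l else m)"
  have i: "integrable lborel (\<lambda>x. std_normal_density x * x ^ j)"
    and v: "integral\<^sup>L lborel (\<lambda>x. std_normal_density x * x ^ j) = gmom j" for j
    using gmom_integral[of j] by (auto simp: has_bochner_integral_iff)
  have "has_bochner_integral lborel (\<lambda>v::real^3. \<Prod>i\<in>UNIV. std_normal_density (v$i) * v$i^n i)
      (\<Prod>i\<in>UNIV. integral\<^sup>L lborel (\<lambda>x. std_normal_density x * x ^ n i))"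
    by (rule has_bochner_integral_prod_vec[of "\<lambda>i x. std_normal_density x * x ^ n i"]) (rule i)
  then have "has_bochner_integral lborel (\<lambda>v::real^3. c * (\<Prod>i\<in>UNIV. std_normal_density (v$i) * v$i^n i))
     (c * (\<Prod>i\<in>UNIV. integral\<^sup>L lborel (\<lambda>x. std_normal_density x * x ^ n i)))"
    by (rule has_bochner_integral_mult_right[rotated])
  moreover have "c * (\<Prod>i\<in>UNIV. std_normal_density (v$i) * v$i^n i) = maxwellian v * mono3 t v" for v
    by (simp add: maxwellian_prod prod.distrib t mono3_def) (simp add: prod3 n_def algebra_simps)
  moreover have "c * (\<Prod>i\<in>UNIV. integral\<^sup>L lborel (\<lambda>x. std_normal_density x * x ^ n i)) = gmono t"
    by (simp add: v t gmono_def) (simp add: prod3 n_def algebra_simps)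
  ultimately show ?thesis by simp
qed

lemma pE_integral: "has_bochner_integral lborel (\<lambda>v. maxwellian v * peval L v) (pE L)"
proof (induction L)
  case Nil then show ?case by (auto simp: pE_def)
next
  case (Cons t L)
  then have "has_bochner_integral lborel (\<lambda>v. maxwellian v * mono3 t v + maxwellian v * peval L v) (gmono t + pE L)"
    by (intro has_bochner_integral_add gmono_integral)
  then show ?case by (simp add: peval_Cons pE_def algebra_simps)
qed

lemma integrable_maxwellian_peval: "integrable lborel (\<lambda>v. maxwellian v * peval L v)"
  using pE_integral has_bochner_integral_iff by blast
lemma integral_maxwellian_peval: "(LINT v|lborel. maxwellian v * peval L v) = pE L"
  using pE_integral has_bochner_integral_iff by blast

subsection \<open>Cauchy--Schwarz\<close>

text \<open>Discriminant argument: the integral of (f + t g)^2 is a nonnegative quadratic in t.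
  Integrability of f g comes from 2 |f g| \<le> f^2 + g^2.\<close>

lemma Cauchy_Schwarz_integral:
  fixes f g :: "'a \<Rightarrow> real"
  assumes [measurable]: "f \<in> borel_measurable M" "g \<in> borel_measurable M"
    and f: "integrable M (\<lambda>x. (f x)\<^sup>2)" and g: "integrable M (\<lambda>x. (g x)\<^sup>2)"
  shows "integrable M (\<lambda>x. f x * g x)"
    and "(\<integral>x. f x * g x \<partial>M)\<^sup>2 \<le> (\<integral>x. (f x)\<^sup>2 \<partial>M) * (\<integral>x. (g x)\<^sup>2 \<partial>M)"
proof -
  show fg: "integrable M (\<lambda>x. f x * g x)"
  proof (rule Bochner_Integration.integrable_bound[OF Bochner_Integration.integrable_add[OF f g]])
    show "AE x in M. norm (f x * g x) \<le> norm ((f x)\<^sup>2 + (g x)\<^sup>2)"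
    proof (rule AE_I2)
      fix x
      have "2 * (\<bar>f x\<bar> * \<bar>g x\<bar>) \<le> (f x)\<^sup>2 + (g x)\<^sup>2"
        using sum_squares_bound[of "\<bar>f x\<bar>" "\<bar>g x\<bar>"] by simp
      moreover have "0 \<le> \<bar>f x\<bar> * \<bar>g x\<bar>" by simp
      ultimately have "\<bar>f x\<bar> * \<bar>g x\<bar> \<le> (f x)\<^sup>2 + (g x)\<^sup>2" by linarith
      then show "norm (f x * g x) \<le> norm ((f x)\<^sup>2 + (g x)\<^sup>2)" by (simp add: abs_mult)
    qed
  qed simp
  define a b c where "a = (\<integral>x. (f x)\<^sup>2 \<partial>M)" "b = (\<integral>x. f x * g x \<partial>M)" "c = (\<integral>x. (g x)\<^sup>2 \<partial>M)"
  have q: "0 \<le> a + 2 * b * t + c * t\<^sup>2" for t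
  proof -
    have "0 \<le> (\<integral>x. (f x + t * g x)\<^sup>2 \<partial>M)" by simp
    also have "\<dots> = (\<integral>x. (f x)\<^sup>2 + (2 * t) * (f x * g x) + t\<^sup>2 * (g x)\<^sup>2 \<partial>M)"
      by (rule Bochner_Integration.integral_cong) (auto simp: power2_eq_square algebra_simps)
    also have "\<dots> = (\<integral>x. (f x)\<^sup>2 \<partial>M) + (2 * t) * (\<integral>x. f x * g x \<partial>M) + t\<^sup>2 * (\<integral>x. (g x)\<^sup>2 \<partial>M)"
      using f g fg by simp
    also have "\<dots> = a + 2 * b * t + c * t\<^sup>2" by (simp add: a_b_c_def)
    finally show ?thesis .
  qed
  have c0: "c \<ge> 0" by (simp add: a_b_c_def)
  have "b\<^sup>2 \<le> a * c"
  proof (cases "c = 0")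
    case True
    have "b = 0"
    proof (rule ccontr)
      \<comment> \<open>For c = 0 the quadratic is a + 2 b t, and the value of t chosen here makes
        it -1.\<close>
      assume "b \<noteq> 0"
      then show False using q[of "- (a + 1) / (2 * b)"] True by simp
    qed
    then show ?thesis using True by simp
  next
    case False
    then have c: "c > 0" using c0 by simp
    have "0 \<le> a + 2 * b * (- b / c) + c * (- b / c)\<^sup>2" by (rule q)
    also have "\<dots> = (a * c - b\<^sup>2) / c" using c by (simp add: field_simps power2_eq_square)
    finally show ?thesis using c by (simp add: zero_le_divide_iff)
  qed
  then show "(\<integral>x. f x * g x \<partial>M)\<^sup>2 \<le> (\<integral>x. (f x)\<^sup>2 \<partial>M) * (\<integral>x. (g x)\<^sup>2 \<partial>M)"
    by (simp add: a_b_c_def)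
qed

lemma integrable_sq_iff:
  fixes f :: "'a \<Rightarrow> real"
  assumes [measurable]: "f \<in> borel_measurable M"
  shows "integrable M (\<lambda>x. (f x)\<^sup>2) \<longleftrightarrow> (\<integral>\<^sup>+x. ennreal ((f x)\<^sup>2) \<partial>M) < \<infinity>"
  unfolding integrable_iff_bounded by simp

section \<open>Polynomial moments of velocity functions\<close>

definition mom :: "(real^3 \<Rightarrow> real) \<Rightarrow> velocity_fn \<Rightarrow> real" where
  "mom p h = (LINT v|lborel. h v * (p v * sqrt (maxwellian v)))"

definition wsq :: poly3 where "wsq = [(1,0,0,0),(1,2,0,0),(1,0,2,0),(1,0,0,2)]"

lemma peval_wsq: "peval wsq v = 1 + (norm v)\<^sup>2"
  by (simp add: wsq_def peval_Cons mono3_def norm_sq3)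

lemma one_plus_norm_sq_pos[simp]: "1 + (norm (v::real^3))\<^sup>2 > 0" "0 < 1 + (norm (v::real^3))\<^sup>2" "1 + (norm (v::real^3))\<^sup>2 \<noteq> 0"
  by (simp_all add: add_pos_nonneg add_nonneg_eq_0_iff)

text \<open>The constant of the weighted Cauchy-Schwarz bound. The summand 1 keeps it positive, so
  that it can be divided by and an infinite right side stays infinite after multiplication.\<close>

definition cw :: "poly3 \<Rightarrow> real" where "cw L = 1 + pE (pmul (pmul L L) wsq)"

lemma cw_ge1: "cw L \<ge> 1"
proof -
  have "pE (pmul (pmul L L) wsq) = (LINT v|lborel. maxwellian v * peval (pmul (pmul L L) wsq) v)"
    by (simp only: integral_maxwellian_peval)
  also have "\<dots> \<ge> 0" by (rule Bochner_Integration.integral_nonneg) (simp add: peval_wsq)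
  finally show ?thesis by (simp add: cw_def)
qed

text \<open>Cauchy-Schwarz after moving a factor sqrt (1 + |v|^2) from h to the Gaussian side, where
  it costs only a larger constant. The gain is the decaying weight on h: it makes large velocities
  negligible in \<open>mom_averaging\<close>.\<close>

lemma mom_weighted:
  assumes [measurable]: "h \<in> borel_measurable borel"
    and fin: "(\<integral>\<^sup>+v. ennreal ((h v)\<^sup>2 / (1 + (norm v)\<^sup>2)) \<partial>lborel) < \<infinity>"
  shows "integrable lborel (\<lambda>v. h v * (wt L v))"
    and "ennreal ((mom (peval L) h)\<^sup>2) \<le> ennreal (cw L) * (\<integral>\<^sup>+v. ennreal ((h v)\<^sup>2 / (1 + (norm v)\<^sup>2)) \<partial>lborel)"
proof -
  define f where "f v = h v / sqrt (1 + (norm v)\<^sup>2)" for v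
  define g where "g v = sqrt (1 + (norm v)\<^sup>2) * peval L v * sqrt (maxwellian v)" for v :: "real^3"
  have [measurable]: "f \<in> borel_measurable borel" "g \<in> borel_measurable borel"
    unfolding f_def[abs_def] g_def[abs_def] by measurable
  have fg: "f v * g v = h v * (wt L v)" for v
    by (simp add: f_def g_def)
  have f2: "(f v)\<^sup>2 = (h v)\<^sup>2 / (1 + (norm v)\<^sup>2)" for v
    by (simp add: f_def power_divide)
  have g2: "(g v)\<^sup>2 = maxwellian v * peval (pmul (pmul L L) wsq) v" for v
    by (simp add: g_def power_mult_distrib peval_wsq) (simp add: algebra_simps power2_eq_square)
  have f: "integrable lborel (\<lambda>v. (f v)\<^sup>2)"
    by (subst integrable_sq_iff) (use fin in \<open>simp_all add: f2\<close>)
  have g: "integrable lborel (\<lambda>v. (g v)\<^sup>2)"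
    unfolding g2 by (rule integrable_maxwellian_peval)
  note CS = Cauchy_Schwarz_integral[OF _ _ f g]
  show "integrable lborel (\<lambda>v. h v * (wt L v))"
    using CS(1) by (simp add: fg)
  have "(mom (peval L) h)\<^sup>2 \<le> (\<integral>v. (f v)\<^sup>2 \<partial>lborel) * pE (pmul (pmul L L) wsq)"
    using CS(2) by (simp only: fg g2 mom_def integral_maxwellian_peval) simp
  also have "\<dots> \<le> (\<integral>v. (f v)\<^sup>2 \<partial>lborel) * cw L"
    by (intro mult_left_mono) (simp_all add: cw_def)
  finally have "ennreal ((mom (peval L) h)\<^sup>2) \<le> ennreal (cw L * (\<integral>v. (f v)\<^sup>2 \<partial>lborel))"
    by (intro ennreal_leI) (simp add: mult.commute)
  also have "\<dots> = ennreal (cw L) * ennreal (\<integral>v. (f v)\<^sup>2 \<partial>lborel)"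
    using cw_ge1[of L] by (simp add: ennreal_mult)
  also have "ennreal (\<integral>v. (f v)\<^sup>2 \<partial>lborel) = (sqn f)"
    by (rule nn_integral_eq_integral[symmetric]) (use f in auto)
  finally show "ennreal ((mom (peval L) h)\<^sup>2) \<le> ennreal (cw L) * (\<integral>\<^sup>+v. ennreal ((h v)\<^sup>2 / (1 + (norm v)\<^sup>2)) \<partial>lborel)"
    by (simp add: f2)
qed

lemma mom_bound_weighted:
  assumes [measurable]: "h \<in> borel_measurable borel"
  shows "ennreal ((mom (peval L) h)\<^sup>2) \<le> ennreal (cw L) * (\<integral>\<^sup>+v. ennreal ((h v)\<^sup>2 / (1 + (norm v)\<^sup>2)) \<partial>lborel)"
proof (cases "(\<integral>\<^sup>+v. ennreal ((h v)\<^sup>2 / (1 + (norm v)\<^sup>2)) \<partial>lborel) < \<infinity>")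
  case True then show ?thesis by (intro mom_weighted) auto
next
  case False
  then have "(\<integral>\<^sup>+v. ennreal ((h v)\<^sup>2 / (1 + (norm v)\<^sup>2)) \<partial>lborel) = \<infinity>" by (simp add: less_top[symmetric])
  then show ?thesis using cw_ge1[of L] by (simp add: ennreal_mult_top)
qed

lemma weighted_le:
  fixes h :: velocity_fn
  shows "(\<integral>\<^sup>+v. ennreal ((h v)\<^sup>2 / (1 + (norm v)\<^sup>2)) \<partial>lborel) \<le> (sqn h)"
proof (intro nn_integral_mono ennreal_leI)
  fix v :: "real^3"
  have "(h v)\<^sup>2 / (1 + (norm v)\<^sup>2) \<le> (h v)\<^sup>2 / 1"
    by (intro divide_left_mono) auto
  then show "(h v)\<^sup>2 / (1 + (norm v)\<^sup>2) \<le> (h v)\<^sup>2" by simp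
qed

lemma mom_bound:
  assumes [measurable]: "h \<in> borel_measurable borel"
  shows "ennreal ((mom (peval L) h)\<^sup>2) \<le> ennreal (cw L) * (sqn h)"
  using order_trans[OF mom_bound_weighted[of h L] mult_left_mono[OF weighted_le[of h]]] by simp

lemma mom_integrable:
  assumes [measurable]: "h \<in> borel_measurable borel"
    and "sqn h < \<infinity>"
  shows "integrable lborel (\<lambda>v. h v * (wt L v))"
  using assms le_less_trans[OF weighted_le[of h]] by (intro mom_weighted) auto

subsection \<open>Square integrals over the periodic cube\<close>

abbreviation MQ :: "(real^3) measure" where
  "MQ \<equiv> restrict_space lborel (cbox 0 One)"

abbreviation PM :: "((real^3) \<times> (real^3)) measure" where
  "PM \<equiv> MQ \<Otimes>\<^sub>M lborel"

definition per :: "(real^3 \<Rightarrow> 'a) \<Rightarrow> bool" where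
  "per u \<longleftrightarrow> (\<forall>x i. u (x + axis i 1) = u x)"

definition n2 :: "(real^3 \<Rightarrow> real) \<Rightarrow> ennreal" where
  "n2 u = (\<integral>\<^sup>+x. ennreal ((u x)\<^sup>2) \<partial>MQ)"

lemma sum_Basis_nth[simp]: "(\<Sum>x\<in>(Basis::(real^'n) set). x $ j) = 1"
proof -
  have "(\<Sum>x\<in>(Basis::(real^'n) set). x $ j) = (\<Sum>x\<in>(Basis::(real^'n) set). if x = axis j 1 then 1 else 0)"
  proof (rule sum.cong)
    fix x :: "real^'n" assume "x \<in> Basis"
    then have "x \<bullet> axis j 1 = (if x = axis j 1 then 1 else 0)"
      by (subst inner_Basis) auto
    then show "x $ j = (if x = axis j 1 then 1 else 0)" by (simp add: inner_axis)
  qed simp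
  also have "\<dots> = 1" by simp
  finally show ?thesis .
qed

lemma prob_space_MQ: "prob_space MQ"
proof (rule prob_spaceI)
  have "emeasure lborel (cbox 0 (One::real^3)) = 1"
    by (subst emeasure_lborel_cbox) auto
  then show "emeasure MQ (space MQ) = 1"
    by (simp add: emeasure_restrict_space)
qed

interpretation MQ: prob_space MQ by (rule prob_space_MQ)

lemma measurable_MQ[measurable (raw)]: "f \<in> borel_measurable borel \<Longrightarrow> f \<in> borel_measurable MQ"
  by (rule measurable_restrict_space1) simp

lemma nn_integral_lborel_translate:
  fixes f :: "real^3 \<Rightarrow> ennreal"
  assumes [measurable]: "f \<in> borel_measurable borel"
  shows "(\<integral>\<^sup>+x. f (x + a) \<partial>lborel) = (\<integral>\<^sup>+x. f x \<partial>lborel)"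
proof -
  have "(\<integral>\<^sup>+x. f x \<partial>lborel) = (\<integral>\<^sup>+x. f x \<partial>distr lborel borel ((+) a))"
    by (simp add: lborel_distr_plus)
  also have "\<dots> = (\<integral>\<^sup>+x. f (a + x) \<partial>lborel)"
    by (subst nn_integral_distr) auto
  finally show ?thesis by (simp add: add.commute)
qed

text \<open>The half-open cube: cutting it by a coordinate hyperplane and moving one piece by a
  period gives an exact disjoint partition, which closed cubes give only up to null sets.\<close>

definition HC :: "(real^3) set" where "HC = {x. \<forall>j. 0 \<le> x$j \<and> x$j < 1}"

lemma HC_measurable[measurable]: "HC \<in> sets borel"
  unfolding HC_def by measurable

lemma nn_integral_MQ_HC:
  fixes f :: "real^3 \<Rightarrow> ennreal"
  shows "(\<integral>\<^sup>+x. f x \<partial>MQ) = (\<integral>\<^sup>+x. f x * indicator HC x \<partial>lborel)"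
proof -
  have "AE x in lborel. x \<notin> cbox 0 One - box 0 (One::real^3)"
    using null_sets_cbox_Diff_box by (rule AE_not_in)
  then have "AE x in lborel. indicator (cbox 0 One) x = (indicator HC x :: ennreal)"
  proof (eventually_elim)
    case (elim x)
    have "x \<in> HC \<Longrightarrow> x \<in> cbox 0 One"
      by (auto simp: HC_def mem_box_cart less_imp_le)
    moreover have "x \<in> box 0 One \<Longrightarrow> x \<in> HC"
      by (auto simp: HC_def mem_box_cart less_imp_le)
    ultimately show ?case using elim by (auto simp: indicator_def)
  qed
  then show ?thesis
    by (subst nn_integral_restrict_space) (auto intro!: nn_integral_cong_AE)
qed

text \<open>The shift turns the slab [0,1) in coordinate i into [h,1+h); the part beyond 1 moves
  back by one period and fills [0,h).\<close>

lemma nn_integral_MQ_translate_aux: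
  fixes f :: "real^3 \<Rightarrow> ennreal"
  assumes [measurable]: "f \<in> borel_measurable borel" and p: "per f" and h: "0 \<le> h" "h \<le> 1"
  shows "(\<integral>\<^sup>+x. f (x + h *\<^sub>R axis i 1) \<partial>MQ) = (\<integral>\<^sup>+x. f x \<partial>MQ)"
proof -
  let ?e = "axis i 1 :: real^3"
  define R where "R a b = {x::real^3. a \<le> x$i \<and> x$i < b \<and> (\<forall>j. j \<noteq> i \<longrightarrow> 0 \<le> x$j \<and> x$j < 1)}" for a b
  have [measurable]: "R a b \<in> sets borel" for a b unfolding R_def by measurable
  have HR: "HC = R 0 1" unfolding HC_def R_def by auto
  have sh: "indicator (R a b) x = (indicator (R (a+c) (b+c)) (x + c *\<^sub>R ?e) :: ennreal)" for a b c x
    by (auto simp: R_def indicator_def axis_def)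
  have "(\<integral>\<^sup>+x. f (x + h *\<^sub>R ?e) \<partial>MQ) = (\<integral>\<^sup>+x. f (x + h *\<^sub>R ?e) * indicator (R (0+h) (1+h)) (x + h *\<^sub>R ?e) \<partial>lborel)"
    unfolding nn_integral_MQ_HC HR sh[of 0 1 _ h] ..
  also have "\<dots> = (\<integral>\<^sup>+x. f x * indicator (R (0+h) (1+h)) x \<partial>lborel)"
    by (rule nn_integral_lborel_translate[of "\<lambda>x. f x * indicator (R (0+h) (1+h)) x"]) measurable
  also have "\<dots> = (\<integral>\<^sup>+x. f x * indicator (R h 1) x + f x * indicator (R 1 (1+h)) x \<partial>lborel)"
    using h by (intro nn_integral_cong) (auto simp: R_def indicator_def split: if_splits)
  also have "\<dots> = (\<integral>\<^sup>+x. f x * indicator (R h 1) x \<partial>lborel) + (\<integral>\<^sup>+x. f x * indicator (R 1 (1+h)) x \<partial>lborel)"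
    by (rule nn_integral_add) auto
  also have "(\<integral>\<^sup>+x. f x * indicator (R 1 (1+h)) x \<partial>lborel) = (\<integral>\<^sup>+x. f (x + 1 *\<^sub>R ?e) * indicator (R (0+1) (h+1)) (x + 1 *\<^sub>R ?e) \<partial>lborel)"
    by (subst nn_integral_lborel_translate[of "\<lambda>x. f x * indicator (R (0+1) (h+1)) x"]) (simp_all add: add.commute)
  also have "\<dots> = (\<integral>\<^sup>+x. f x * indicator (R 0 h) x \<partial>lborel)"
    unfolding sh[of 0 h _ 1] using p by (simp add: per_def)
  also have "(\<integral>\<^sup>+x. f x * indicator (R h 1) x \<partial>lborel) + (\<integral>\<^sup>+x. f x * indicator (R 0 h) x \<partial>lborel)
    = (\<integral>\<^sup>+x. f x * indicator (R h 1) x + f x * indicator (R 0 h) x \<partial>lborel)"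
    by (rule nn_integral_add[symmetric]) auto
  also have "\<dots> = (\<integral>\<^sup>+x. f x \<partial>MQ)"
    unfolding nn_integral_MQ_HC HR
    using h by (intro nn_integral_cong) (auto simp: R_def indicator_def split: if_splits)
  finally show ?thesis .
qed

lemma per_int_shift: "per f \<Longrightarrow> f (x + real n *\<^sub>R axis i 1) = f x"
proof (induction n)
  case (Suc n)
  have "f (x + real (Suc n) *\<^sub>R axis i 1) = f ((x + real n *\<^sub>R axis i 1) + axis i 1)"
    by (rule arg_cong[where f=f]) (simp add: scaleR_add_left add_ac)
  then show ?case using Suc by (simp add: per_def)
qed simp

lemma nn_integral_MQ_translate:
  fixes f :: "real^3 \<Rightarrow> ennreal"
  assumes f: "f \<in> borel_measurable borel" and p: "per f" and h: "0 \<le> h"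
  shows "(\<integral>\<^sup>+x. f (x + h *\<^sub>R axis i 1) \<partial>MQ) = (\<integral>\<^sup>+x. f x \<partial>MQ)"
proof -
  have "f (x + h *\<^sub>R axis i 1) = f (x + frac h *\<^sub>R axis i 1)" for x
  proof -
    have "h = frac h + real (nat \<lfloor>h\<rfloor>)" using h by (simp add: frac_def)
    then have "f (x + h *\<^sub>R axis i 1) = f ((x + frac h *\<^sub>R axis i 1) + real (nat \<lfloor>h\<rfloor>) *\<^sub>R axis i 1)"
      by (metis add.assoc scaleR_add_left)
    then show ?thesis using per_int_shift[OF p] by simp
  qed
  then show ?thesis
    using nn_integral_MQ_translate_aux[OF f p, of "frac h" i] by (simp add: frac_lt_1 less_imp_le)
qed

lemma n2_add:
  assumes [measurable]: "u \<in> borel_measurable borel" "w \<in> borel_measurable borel"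
  shows "n2 (\<lambda>x. u x + w x) \<le> 2 * n2 u + 2 * n2 w"
proof -
  have "n2 (\<lambda>x. u x + w x) \<le> (\<integral>\<^sup>+x. 2 * ennreal ((u x)\<^sup>2) + 2 * ennreal ((w x)\<^sup>2) \<partial>MQ)"
    unfolding n2_def
  proof (rule nn_integral_mono)
    fix x
    have "(u x + w x)\<^sup>2 \<le> 2 * (u x)\<^sup>2 + 2 * (w x)\<^sup>2"
      using sum_squares_bound[of "u x" "w x"] by (simp add: power2_sum)
    then have "ennreal ((u x + w x)\<^sup>2) \<le> ennreal (2 * (u x)\<^sup>2 + 2 * (w x)\<^sup>2)"
      by (rule ennreal_leI)
    also have "\<dots> = 2 * ennreal ((u x)\<^sup>2) + 2 * ennreal ((w x)\<^sup>2)"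
      by (simp add: ennreal_plus ennreal_mult)
    finally show "ennreal ((u x + w x)\<^sup>2) \<le> 2 * ennreal ((u x)\<^sup>2) + 2 * ennreal ((w x)\<^sup>2)" .
  qed
  also have "\<dots> = 2 * n2 u + 2 * n2 w"
    unfolding n2_def by (subst nn_integral_add) (auto simp: nn_integral_cmult)
  finally show ?thesis .
qed

lemma n2_cmult:
  assumes [measurable]: "u \<in> borel_measurable borel"
  shows "n2 (\<lambda>x. c * u x) = ennreal (c\<^sup>2) * n2 u"
  unfolding n2_def power_mult_distrib by (simp add: ennreal_mult nn_integral_cmult)

lemma n2_minus: "n2 (\<lambda>x. - u x) = n2 u" by (simp add: n2_def)

lemma n2_diff:
  assumes [measurable]: "u \<in> borel_measurable borel" "w \<in> borel_measurable borel"
  shows "n2 (\<lambda>x. u x - w x) \<le> 2 * n2 u + 2 * n2 w"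
  using n2_add[of u "\<lambda>x. - w x"] by (simp add: n2_minus)

lemma n2_zero[simp]: "n2 (\<lambda>x. 0) = 0" by (simp add: n2_def)

lemma n2_mono: "(\<And>x. \<bar>u x\<bar> \<le> \<bar>w x\<bar>) \<Longrightarrow> n2 u \<le> n2 w"
  unfolding n2_def by (intro nn_integral_mono ennreal_leI) (simp add: abs_le_square_iff)

lemma n2_bound: assumes "\<And>x. \<bar>u x\<bar> \<le> B" shows "n2 u \<le> ennreal (B\<^sup>2)"
proof -
  have "B \<ge> 0" using assms[of 0] by simp
  then have "n2 u \<le> n2 (\<lambda>x. B)" using assms by (intro n2_mono) simp
  also have "\<dots> = ennreal (B\<^sup>2)"
    unfolding n2_def by (subst nn_integral_const) (simp_all only: MQ.emeasure_space_1 mult_1_right)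
  finally show ?thesis .
qed

lemma tendsto0_ennrealI:
  assumes "\<And>\<epsilon>::real. \<epsilon> > 0 \<Longrightarrow> eventually (\<lambda>x. f x \<le> ennreal \<epsilon>) F"
  shows "(f \<longlongrightarrow> (0::ennreal)) F"
proof (rule order_tendstoI)
  fix a :: ennreal assume a: "0 < a"
  obtain b :: real where b: "0 < b" "ennreal b < a"
  proof (cases a)
    case (real r)
    then have "0 < r" using a by (simp add: zero_less_iff_neq_zero)
    then show ?thesis using real that[of "r/2"] by (auto simp: ennreal_less_iff)
  next
    case top then show ?thesis using that[of 1] by simp
  qed
  show "eventually (\<lambda>x. f x < a) F"
    using assms[OF b(1)] by eventually_elim (use b(2) in auto)
qed simp

lemma tendsto0_ennreal_le:
  assumes "(g \<longlongrightarrow> (0::ennreal)) F" "eventually (\<lambda>x. f x \<le> g x) F"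
  shows "(f \<longlongrightarrow> 0) F"
  by (rule tendsto_sandwich[OF _ assms(2) tendsto_const assms(1)]) simp

lemma tendsto0_ennreal_cmult:
  assumes "(f \<longlongrightarrow> (0::ennreal)) F" "c < top"
  shows "((\<lambda>x. c * f x) \<longlongrightarrow> 0) F"
  using ennreal_tendsto_cmult[OF assms(2,1)] by simp

lemma tendsto0_ennreal_add:
  assumes "(f \<longlongrightarrow> (0::ennreal)) F" "(g \<longlongrightarrow> 0) F"
  shows "((\<lambda>x. f x + g x) \<longlongrightarrow> 0) F"
  using tendsto_add[OF assms] by simp

lemma n2_add_tendsto0:
  assumes "\<forall>\<^sub>F h in F. u h \<in> borel_measurable borel \<and> w h \<in> borel_measurable borel"
    and "((\<lambda>h. n2 (u h)) \<longlongrightarrow> 0) F" "((\<lambda>h. n2 (w h)) \<longlongrightarrow> 0) F"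
  shows "((\<lambda>h. n2 (\<lambda>x. u h x + w h x)) \<longlongrightarrow> 0) F"
proof (rule tendsto0_ennreal_le)
  show "((\<lambda>h. 2 * n2 (u h) + 2 * n2 (w h)) \<longlongrightarrow> 0) F"
    by (intro tendsto0_ennreal_add tendsto0_ennreal_cmult assms) auto
  show "\<forall>\<^sub>F h in F. n2 (\<lambda>x. u h x + w h x) \<le> 2 * n2 (u h) + 2 * n2 (w h)"
    using assms(1) by eventually_elim (auto intro: n2_add)
qed

text \<open>The fixed factor g is only square integrable, so it is cut at height n: where |g| \<le>
  n the product is small because W tends to 0, and the remaining tail of g is small in mean square
  while W is bounded by B.\<close>

lemma n2_L2_times_bounded:
  assumes [measurable]: "g \<in> borel_measurable borel" and g: "n2 g < \<infinity>"
    and W: "\<forall>\<^sub>F h in F. W h \<in> borel_measurable borel \<and> (\<forall>x. \<bar>W h x\<bar> \<le> B)"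
    and W0: "((\<lambda>h. n2 (W h)) \<longlongrightarrow> 0) F"
  shows "((\<lambda>h. n2 (\<lambda>x. g x * W h x)) \<longlongrightarrow> 0) F"
proof -
  \<comment> \<open>\<open>gM n\<close> is the tail of g, where |g| exceeds n; the truncation is g
    minus \<open>gM n\<close>.\<close>
  define gM where "gM n x = g x * indicator {x. \<bar>g x\<bar> > real n} x" for n x
  have [measurable]: "gM n \<in> borel_measurable borel" for n unfolding gM_def[abs_def] by measurable
  have "(\<lambda>n. n2 (gM n)) \<longlonglongrightarrow> (\<integral>\<^sup>+x. 0 \<partial>MQ)"
    unfolding n2_def
  proof (rule nn_integral_dominated_convergence[where w="\<lambda>x. ennreal ((g x)\<^sup>2)"])
    show "AE x in MQ. (\<lambda>i. ennreal ((gM i x)\<^sup>2)) \<longlonglongrightarrow> 0"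
    proof (rule AE_I2)
      fix x
      obtain N where "\<bar>g x\<bar> \<le> real N" using real_arch_simple by blast
      then have "\<forall>n\<ge>N. ennreal ((gM n x)\<^sup>2) = 0" by (auto simp: gM_def indicator_def)
      then show "(\<lambda>i. ennreal ((gM i x)\<^sup>2)) \<longlonglongrightarrow> 0"
        by (intro tendsto_eventually eventually_sequentiallyI) auto
    qed
    show "(\<integral>\<^sup>+x. ennreal ((g x)\<^sup>2) \<partial>MQ) < \<infinity>" using g by (simp add: n2_def)
  qed (auto simp: gM_def indicator_def)
  then have gM0: "(\<lambda>n. n2 (gM n)) \<longlonglongrightarrow> 0" by simp
  show ?thesis
  proof (rule tendsto0_ennrealI)
    fix \<epsilon> :: real assume e: "\<epsilon> > 0"
    have e2: "0 < ennreal (\<epsilon>/2)" using e by simp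
    have "(\<lambda>n. ennreal (2 * B\<^sup>2) * n2 (gM n)) \<longlonglongrightarrow> 0"
      by (intro tendsto0_ennreal_cmult gM0) auto
    from order_tendstoD(2)[OF this e2]
    obtain n where n: "ennreal (2 * B\<^sup>2) * n2 (gM n) < ennreal (\<epsilon>/2)"
      by (auto simp: eventually_sequentially)
    have "((\<lambda>h. ennreal (2 * (real n)\<^sup>2) * n2 (W h)) \<longlongrightarrow> 0) F"
      by (intro tendsto0_ennreal_cmult W0) auto
    from order_tendstoD(2)[OF this e2] W
    show "\<forall>\<^sub>F h in F. n2 (\<lambda>x. g x * W h x) \<le> ennreal \<epsilon>"
    proof eventually_elim
      case (elim h)
      then have [measurable]: "W h \<in> borel_measurable borel" and B: "\<And>x. \<bar>W h x\<bar> \<le> B" by auto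
      have B0: "B \<ge> 0" using B[of 0] by linarith
      have "n2 (\<lambda>x. g x * W h x) = n2 (\<lambda>x. (g x - gM n x) * W h x + gM n x * W h x)"
        by (simp add: algebra_simps)
      also have "\<dots> \<le> 2 * n2 (\<lambda>x. (g x - gM n x) * W h x) + 2 * n2 (\<lambda>x. gM n x * W h x)"
        by (rule n2_add) auto
      also have "\<dots> \<le> 2 * (ennreal ((real n)\<^sup>2) * n2 (W h)) + 2 * (ennreal (B\<^sup>2) * n2 (gM n))"
      proof (intro add_mono mult_left_mono)
        have "n2 (\<lambda>x. (g x - gM n x) * W h x) \<le> n2 (\<lambda>x. real n * W h x)"
          by (rule n2_mono) (auto simp: gM_def indicator_def abs_mult intro!: mult_right_mono)
        also have "\<dots> = ennreal ((real n)\<^sup>2) * n2 (W h)" by (rule n2_cmult) simp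
        finally show "n2 (\<lambda>x. (g x - gM n x) * W h x) \<le> ennreal ((real n)\<^sup>2) * n2 (W h)" .
        have "n2 (\<lambda>x. gM n x * W h x) \<le> n2 (\<lambda>x. B * gM n x)"
          using B B0 by (intro n2_mono) (auto simp: abs_mult mult.commute[of "\<bar>gM n _\<bar>"] intro!: mult_right_mono)
        also have "\<dots> = ennreal (B\<^sup>2) * n2 (gM n)" by (rule n2_cmult) simp
        finally show "n2 (\<lambda>x. gM n x * W h x) \<le> ennreal (B\<^sup>2) * n2 (gM n)" .
      qed auto
      also have "\<dots> = ennreal (2 * (real n)\<^sup>2) * n2 (W h) + ennreal (2 * B\<^sup>2) * n2 (gM n)"
        by (simp add: ennreal_mult mult.assoc)
      also have "\<dots> \<le> ennreal (\<epsilon>/2) + ennreal (\<epsilon>/2)"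
        using elim n by (intro add_mono) auto
      also have "\<dots> = ennreal \<epsilon>" using e by (simp add: ennreal_plus[symmetric] del: ennreal_plus)
      finally show ?case .
    qed
  qed
qed

subsection \<open>One-sided strong derivatives in mean square\<close>

text \<open>One notation for all four directions: \<open>None\<close> is time, \<open>Some i\<close>
  the i-th space coordinate.\<close>

fun sf :: "3 option \<Rightarrow> real \<Rightarrow> (real \<Rightarrow> real^3 \<Rightarrow> 'a) \<Rightarrow> real \<Rightarrow> real^3 \<Rightarrow> 'a" where
  "sf None h u t x = u (t + h) x"
| "sf (Some i) h u t x = u t (x + h *\<^sub>R axis i 1)"

text \<open>Step sizes are positive and below the remaining lifetime, so t = 0 is no special case
  and t + h stays below T.\<close>

abbreviation Fil :: "real \<Rightarrow> real \<Rightarrow> real filter" where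
  "Fil T t \<equiv> at 0 within {0<..<T - t}"

text \<open>A derivative in mean square over the cube at each fixed time. It determines
  \<open>u'\<close> up to null sets, see \<open>HD_unique\<close>.\<close>

definition HD :: "real \<Rightarrow> 3 option \<Rightarrow> (real \<Rightarrow> real^3 \<Rightarrow> real) \<Rightarrow> (real \<Rightarrow> real^3 \<Rightarrow> real) \<Rightarrow> bool" where
  "HD T e u u' \<longleftrightarrow> (\<forall>t\<in>{0..<T}. ((\<lambda>h. n2 (\<lambda>x. (sf e h u t x - u t x) / h - u' t x)) \<longlongrightarrow> 0) (Fil T t))"

definition reg :: "real \<Rightarrow> (real \<Rightarrow> real^3 \<Rightarrow> real) \<Rightarrow> bool" where
  "reg T u \<longleftrightarrow> (\<forall>t\<in>{0..<T}. u t \<in> borel_measurable borel \<and> per (u t))"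

lemma Fil_pos: "\<forall>\<^sub>F h in Fil T t. 0 < h \<and> h < T - t"
  by (simp add: eventually_at_filter)

lemma Fil_nontrivial: "t < T \<Longrightarrow> Fil T t \<noteq> bot"
  using trivial_limit_within[of 0 "{0<..<T-t}"] islimpt_greaterThanLessThan1[of 0 "T-t"] by (simp add: trivial_limit_def)

lemma reg_meas: "reg T u \<Longrightarrow> t \<in> {0..<T} \<Longrightarrow> u t \<in> borel_measurable borel"
  by (simp add: reg_def)

lemma sf_meas: "reg T u \<Longrightarrow> t \<in> {0..<T} \<Longrightarrow> 0 < h \<and> h < T - t \<Longrightarrow> sf e h u t \<in> borel_measurable borel"
proof (cases e)
  case None
  assume "reg T u" "t \<in> {0..<T}" "0 < h \<and> h < T - t"
  moreover have "sf None h u t = u (t + h)" by (simp add: fun_eq_iff)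
  ultimately show ?thesis using None by (simp add: reg_def)
next
  case (Some i)
  assume "reg T u" "t \<in> {0..<T}"
  then have [measurable]: "u t \<in> borel_measurable borel" by (simp add: reg_def)
  have "sf (Some i) h u t = (\<lambda>x. u t (x + h *\<^sub>R axis i 1))" by (simp add: fun_eq_iff)
  then show ?thesis using Some by simp
qed

lemma sf_apply:
  "sf e h (\<lambda>t x. F (u t x)) t x = F (sf e h u t x)"
  "sf e h (\<lambda>t x. G (u t x) (w t x)) t x = G (sf e h u t x) (sf e h w t x)"
  by (cases e; simp)+

lemma sf_const: "sf e h (\<lambda>t x. c) t x = c" by (cases e) auto

lemma sf_bound: "(\<And>t x. t \<in> {0..<T} \<Longrightarrow> P (u t x)) \<Longrightarrow> t \<in> {0..<T} \<Longrightarrow> 0 < h \<and> h < T - t \<Longrightarrow> P (sf e h u t x)"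
  by (cases e) auto

lemma reg_const: "reg T (\<lambda>t x. c)" by (simp add: reg_def per_def)
lemma reg_comp1: "reg T u \<Longrightarrow> F \<in> borel_measurable borel \<Longrightarrow> reg T (\<lambda>t x. F (u t x))"
  by (auto simp: reg_def per_def intro: measurable_compose[of _ _ borel])
lemma reg_add: "reg T u \<Longrightarrow> reg T w \<Longrightarrow> reg T (\<lambda>t x. u t x + w t x)"
  by (auto simp: reg_def per_def intro!: borel_measurable_add)
lemma reg_mult: "reg T u \<Longrightarrow> reg T w \<Longrightarrow> reg T (\<lambda>t x. u t x * w t x)"
  by (auto simp: reg_def per_def intro!: borel_measurable_times)

lemma n2_sf_Some:
  assumes "u t \<in> borel_measurable borel" "per (u t)" "h \<ge> 0"
  shows "n2 (sf (Some i) h u t) = n2 (u t)"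
proof -
  have "(\<integral>\<^sup>+x. ennreal ((u t (x + h *\<^sub>R axis i 1))\<^sup>2) \<partial>MQ) = n2 (u t)"
    unfolding n2_def using assms
    by (intro nn_integral_MQ_translate[of "\<lambda>x. ennreal ((u t x)\<^sup>2)"]) (auto simp: per_def)
  then show ?thesis by (simp add: n2_def)
qed

lemma HD_add:
  assumes "HD T e u u'" "HD T e w w'" "reg T u" "reg T u'" "reg T w" "reg T w'"
  shows "HD T e (\<lambda>t x. u t x + w t x) (\<lambda>t x. u' t x + w' t x)"
  unfolding HD_def
proof
  fix t assume t: "t \<in> {0..<T}"
  have "((\<lambda>h. n2 (\<lambda>x. ((sf e h u t x - u t x) / h - u' t x) + ((sf e h w t x - w t x) / h - w' t x))) \<longlongrightarrow> 0) (Fil T t)"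
  proof (rule n2_add_tendsto0)
    show "\<forall>\<^sub>F h in Fil T t. (\<lambda>x. (sf e h u t x - u t x) / h - u' t x) \<in> borel_measurable borel \<and>
       (\<lambda>x. (sf e h w t x - w t x) / h - w' t x) \<in> borel_measurable borel"
      using Fil_pos
    proof eventually_elim
      case (elim h)
      note [measurable] = sf_meas[OF assms(3) t elim] sf_meas[OF assms(5) t elim] assms(3-6)[THEN reg_meas, OF t]
      show ?case by simp
    qed
  qed (use assms(1,2) t in \<open>auto simp: HD_def\<close>)
  moreover have eq: "((sf e h u t x - u t x) / h - u' t x) + ((sf e h w t x - w t x) / h - w' t x)
     = (sf e h (\<lambda>t x. u t x + w t x) t x - (u t x + w t x)) / h - (u' t x + w' t x)" for h x
    unfolding sf_apply(2)[of e h "(+)" u w] by (simp add: diff_divide_distrib add_divide_distrib)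
  ultimately show "((\<lambda>h. n2 (\<lambda>x. (sf e h (\<lambda>t x. u t x + w t x) t x - (u t x + w t x)) / h - (u' t x + w' t x))) \<longlongrightarrow> 0) (Fil T t)"
    by (simp only:)
qed

lemma HD_cmult:
  assumes "HD T e u u'" "reg T u" "reg T u'"
  shows "HD T e (\<lambda>t x. c * u t x) (\<lambda>t x. c * u' t x)"
  unfolding HD_def
proof
  fix t assume t: "t \<in> {0..<T}"
  have "((\<lambda>h. ennreal (c\<^sup>2) * n2 (\<lambda>x. (sf e h u t x - u t x) / h - u' t x)) \<longlongrightarrow> 0) (Fil T t)"
    using assms(1) t by (intro tendsto0_ennreal_cmult) (auto simp: HD_def)
  then show "((\<lambda>h. n2 (\<lambda>x. (sf e h (\<lambda>t x. c * u t x) t x - c * u t x) / h - c * u' t x)) \<longlongrightarrow> 0) (Fil T t)"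
  proof (rule tendsto0_ennreal_le)
    show "\<forall>\<^sub>F h in Fil T t. n2 (\<lambda>x. (sf e h (\<lambda>t x. c * u t x) t x - c * u t x) / h - c * u' t x)
       \<le> ennreal (c\<^sup>2) * n2 (\<lambda>x. (sf e h u t x - u t x) / h - u' t x)"
      using Fil_pos
    proof eventually_elim
      case (elim h)
      note [measurable] = sf_meas[OF assms(2) t elim] assms(2-3)[THEN reg_meas, OF t]
      have "n2 (\<lambda>x. c * ((sf e h u t x - u t x) / h - u' t x)) = ennreal (c\<^sup>2) * n2 (\<lambda>x. (sf e h u t x - u t x) / h - u' t x)"
        by (rule n2_cmult) simp
      then show ?case unfolding sf_apply(1)[of e h "(*) c" u] by (simp add: right_diff_distrib)
    qed
  qed
qed

lemma HD_const: "HD T e (\<lambda>t x. c) (\<lambda>t x. 0)"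
  by (simp add: HD_def sf_const)

lemma HD_add_const: "HD T e u u' \<Longrightarrow> HD T e (\<lambda>t x. u t x + c) u'"
  unfolding HD_def sf_apply(1)[of _ _ "\<lambda>y. y + c" u] by simp

text \<open>The increment is h times the difference quotient, and the quotient stays bounded in mean
  square.\<close>

lemma HD_shift_tendsto:
  assumes "HD T e u u'" "reg T u" "reg T u'" and t: "t \<in> {0..<T}" and fin: "n2 (u' t) < \<infinity>"
  shows "((\<lambda>h. n2 (\<lambda>x. sf e h u t x - u t x)) \<longlongrightarrow> 0) (Fil T t)"
proof (rule tendsto0_ennreal_le)
  let ?Q = "\<lambda>h. n2 (\<lambda>x. (sf e h u t x - u t x) / h - u' t x)"
  have Q: "(?Q \<longlongrightarrow> 0) (Fil T t)" using assms(1) t by (auto simp: HD_def)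
  have h0: "((\<lambda>h. ennreal (h\<^sup>2)) \<longlongrightarrow> 0) (Fil T t)"
    using tendsto_ennrealI[OF tendsto_power[OF tendsto_ident_at[of 0 "{0<..<T-t}"], of 2]] by simp
  have fin': "2 * n2 (u' t) < top" using fin by (simp add: ennreal_mult_less_top)
  \<comment> \<open>The quotient error tends to 0 by itself, so its factor h^2 may be replaced by
    the constant T^2; the norm of \<open>u'\<close> keeps the factor h^2.\<close>
  show "((\<lambda>h. ennreal ((T)\<^sup>2) * (2 * ?Q h) + (2 * n2 (u' t)) * ennreal (h\<^sup>2)) \<longlongrightarrow> 0) (Fil T t)"
    by (intro tendsto0_ennreal_add tendsto0_ennreal_cmult Q h0 fin') auto
  show "\<forall>\<^sub>F h in Fil T t. n2 (\<lambda>x. sf e h u t x - u t x) \<le> ennreal (T\<^sup>2) * (2 * ?Q h) + (2 * n2 (u' t)) * ennreal (h\<^sup>2)"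
    using Fil_pos
  proof eventually_elim
    case (elim h)
    note [measurable] = sf_meas[OF assms(2) t elim] assms(2-3)[THEN reg_meas, OF t]
    have "n2 (\<lambda>x. sf e h u t x - u t x) = n2 (\<lambda>x. h * (((sf e h u t x - u t x) / h - u' t x) + u' t x))"
      using elim by simp
    also have "\<dots> = ennreal (h\<^sup>2) * n2 (\<lambda>x. ((sf e h u t x - u t x) / h - u' t x) + u' t x)"
      by (rule n2_cmult) simp
    also have "\<dots> \<le> ennreal (h\<^sup>2) * (2 * ?Q h + 2 * n2 (u' t))"
      by (intro mult_left_mono n2_add) auto
    also have "\<dots> = ennreal (h\<^sup>2) * (2 * ?Q h) + (2 * n2 (u' t)) * ennreal (h\<^sup>2)"
      by (simp add: distrib_left mult_ac)
    also have "\<dots> \<le> ennreal (T\<^sup>2) * (2 * ?Q h) + (2 * n2 (u' t)) * ennreal (h\<^sup>2)"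
      using elim t by (intro add_mono mult_right_mono ennreal_leI power_mono) auto
    finally show ?case .
  qed
qed

lemma n2_mult_le:
  assumes [measurable]: "w \<in> borel_measurable borel" and "\<And>x. \<bar>u x\<bar> \<le> B"
  shows "n2 (\<lambda>x. u x * w x) \<le> ennreal (B\<^sup>2) * n2 w"
proof -
  have B0: "B \<ge> 0" using assms(2)[of 0] by linarith
  have "n2 (\<lambda>x. u x * w x) \<le> n2 (\<lambda>x. B * w x)"
    using assms(2) B0 by (intro n2_mono) (auto simp: abs_mult intro!: mult_right_mono)
  also have "\<dots> = ennreal (B\<^sup>2) * n2 w" by (rule n2_cmult) simp
  finally show ?thesis .
qed

text \<open>The quotient error of u w is the shifted w times the error of u, plus \<open>u'\<close>
  times the increment of w, plus u times the error of w. The middle term is the delicate one, since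
  \<open>u'\<close> is only square integrable; \<open>n2_L2_times_bounded\<close> handles
  it.\<close>

lemma HD_mult:
  assumes hd: "HD T e u u'" "HD T e w w'" and rg: "reg T u" "reg T u'" "reg T w" "reg T w'"
    and bd: "\<And>t x. t \<in> {0..<T} \<Longrightarrow> \<bar>u t x\<bar> \<le> B" "\<And>t x. t \<in> {0..<T} \<Longrightarrow> \<bar>w t x\<bar> \<le> B"
    and fin: "\<And>t. t \<in> {0..<T} \<Longrightarrow> n2 (u' t) < \<infinity>" "\<And>t. t \<in> {0..<T} \<Longrightarrow> n2 (w' t) < \<infinity>"
  shows "HD T e (\<lambda>t x. u t x * w t x) (\<lambda>t x. u' t x * w t x + u t x * w' t x)"
  unfolding HD_def
proof
  fix t assume t: "t \<in> {0..<T}"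
  note [measurable] = rg[THEN reg_meas, OF t]
  let ?a = "\<lambda>h x. (sf e h u t x - u t x) / h - u' t x" and ?b = "\<lambda>h x. (sf e h w t x - w t x) / h - w' t x"
  have M: "\<forall>\<^sub>F h in Fil T t. sf e h u t \<in> borel_measurable borel \<and> sf e h w t \<in> borel_measurable borel"
    using Fil_pos by eventually_elim (auto intro: sf_meas rg t)
  have 1: "((\<lambda>h. n2 (\<lambda>x. sf e h w t x * ?a h x)) \<longlongrightarrow> 0) (Fil T t)"
  proof (rule tendsto0_ennreal_le)
    show "((\<lambda>h. ennreal (B\<^sup>2) * n2 (?a h)) \<longlongrightarrow> 0) (Fil T t)"
      using hd(1) t by (intro tendsto0_ennreal_cmult) (auto simp: HD_def)
    show "\<forall>\<^sub>F h in Fil T t. n2 (\<lambda>x. sf e h w t x * ?a h x) \<le> ennreal (B\<^sup>2) * n2 (?a h)"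
      using Fil_pos M
    proof eventually_elim
      case (elim h)
      then have [measurable]: "sf e h u t \<in> borel_measurable borel" by simp
      show ?case
        by (rule n2_mult_le) (use sf_bound[of T "\<lambda>y. \<bar>y\<bar> \<le> B" w, OF bd(2) t elim(1)] in auto)
    qed
  qed
  have 2: "((\<lambda>h. n2 (\<lambda>x. u' t x * (sf e h w t x - w t x))) \<longlongrightarrow> 0) (Fil T t)"
  proof (rule n2_L2_times_bounded)
    show "\<forall>\<^sub>F h in Fil T t. (\<lambda>x. sf e h w t x - w t x) \<in> borel_measurable borel \<and> (\<forall>x. \<bar>sf e h w t x - w t x\<bar> \<le> 2 * B)"
      using Fil_pos M
    proof eventually_elim
      case (elim h)
      then have [measurable]: "sf e h w t \<in> borel_measurable borel" by simp
      have "\<bar>sf e h w t x - w t x\<bar> \<le> 2 * B" for x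
        using sf_bound[of T "\<lambda>y. \<bar>y\<bar> \<le> B" w, OF bd(2) t elim(1), of e x] bd(2)[OF t, of x] by linarith
      then show ?case by simp
    qed
    show "((\<lambda>h. n2 (\<lambda>x. sf e h w t x - w t x)) \<longlongrightarrow> 0) (Fil T t)"
      by (rule HD_shift_tendsto[OF hd(2) rg(3,4) t fin(2)[OF t]])
  qed (use fin t in auto)
  have 3: "((\<lambda>h. n2 (\<lambda>x. u t x * ?b h x)) \<longlongrightarrow> 0) (Fil T t)"
  proof (rule tendsto0_ennreal_le)
    show "((\<lambda>h. ennreal (B\<^sup>2) * n2 (?b h)) \<longlongrightarrow> 0) (Fil T t)"
      using hd(2) t by (intro tendsto0_ennreal_cmult) (auto simp: HD_def)
    show "\<forall>\<^sub>F h in Fil T t. n2 (\<lambda>x. u t x * ?b h x) \<le> ennreal (B\<^sup>2) * n2 (?b h)"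
      using Fil_pos M
    proof eventually_elim
      case (elim h)
      then have [measurable]: "sf e h w t \<in> borel_measurable borel" by simp
      show ?case by (rule n2_mult_le) (use bd(1)[OF t] in auto)
    qed
  qed
  have 12: "((\<lambda>h. n2 (\<lambda>x. sf e h w t x * ?a h x + u' t x * (sf e h w t x - w t x))) \<longlongrightarrow> 0) (Fil T t)"
  proof (rule n2_add_tendsto0[OF _ 1 2], rule eventually_mono[OF M])
    fix h assume "sf e h u t \<in> borel_measurable borel \<and> sf e h w t \<in> borel_measurable borel"
    then have [measurable]: "sf e h u t \<in> borel_measurable borel" "sf e h w t \<in> borel_measurable borel" by auto
    show "(\<lambda>x. sf e h w t x * ?a h x) \<in> borel_measurable borel \<and> (\<lambda>x. u' t x * (sf e h w t x - w t x)) \<in> borel_measurable borel"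
      by simp
  qed
  have 123: "((\<lambda>h. n2 (\<lambda>x. (sf e h w t x * ?a h x + u' t x * (sf e h w t x - w t x)) + u t x * ?b h x)) \<longlongrightarrow> 0) (Fil T t)"
  proof (rule n2_add_tendsto0[OF _ 12 3], rule eventually_mono[OF M])
    fix h assume "sf e h u t \<in> borel_measurable borel \<and> sf e h w t \<in> borel_measurable borel"
    then have [measurable]: "sf e h u t \<in> borel_measurable borel" "sf e h w t \<in> borel_measurable borel" by auto
    show "(\<lambda>x. sf e h w t x * ?a h x + u' t x * (sf e h w t x - w t x)) \<in> borel_measurable borel \<and> (\<lambda>x. u t x * ?b h x) \<in> borel_measurable borel"
      by simp
  qed
  have eq: "(sf e h w t x * ?a h x + u' t x * (sf e h w t x - w t x)) + u t x * ?b h x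
     = (sf e h (\<lambda>t x. u t x * w t x) t x - u t x * w t x) / h - (u' t x * w t x + u t x * w' t x)" for h x
    unfolding sf_apply(2)[of e h "(*)" u w]
    by (cases "h = 0") (simp_all add: field_simps)
  show "((\<lambda>h. n2 (\<lambda>x. (sf e h (\<lambda>t x. u t x * w t x) t x - u t x * w t x) / h - (u' t x * w t x + u t x * w' t x))) \<longlongrightarrow> 0) (Fil T t)"
    using 123 unfolding eq .
qed

text \<open>The Taylor remainder is at most C (b - a)^2 / h. One factor (b - a) / h is the quotient
  error plus \<open>u'\<close>; the other factor is at most 1 in absolute value, because a and b lie
  in [1/2, 3/2], and tends to 0 in mean square. Square integrability of \<open>u'\<close> therefore
  suffices.\<close>

lemma HD_comp:
  assumes hd: "HD T e u u'" and rg: "reg T u" "reg T u'"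
    and I: "\<And>t x. t \<in> {0..<T} \<Longrightarrow> u t x \<in> {1/2..3/2}"
    and fin: "\<And>t. t \<in> {0..<T} \<Longrightarrow> n2 (u' t) < \<infinity>"
    and ph[measurable]: "\<phi> \<in> borel_measurable borel" "\<psi> \<in> borel_measurable borel"
    and C: "\<And>a b::real. a \<in> {1/2..3/2} \<Longrightarrow> b \<in> {1/2..3/2} \<Longrightarrow> \<bar>\<phi> b - \<phi> a - \<psi> a * (b - a)\<bar> \<le> C * (b - a)\<^sup>2"
      "\<And>a. a \<in> {1/2..3/2} \<Longrightarrow> \<bar>\<psi> a\<bar> \<le> C"
  shows "HD T e (\<lambda>t x. \<phi> (u t x)) (\<lambda>t x. \<psi> (u t x) * u' t x)"
  unfolding HD_def
proof
  fix t assume t: "t \<in> {0..<T}"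
  note [measurable] = rg[THEN reg_meas, OF t]
  have C0: "C \<ge> 0" using C(2)[of 1] by auto
  have M: "\<forall>\<^sub>F h in Fil T t. sf e h u t \<in> borel_measurable borel"
    using Fil_pos by eventually_elim (auto intro: sf_meas rg t)
  let ?q = "\<lambda>h x. (sf e h u t x - u t x) / h - u' t x"
  let ?r = "\<lambda>h x. u' t x * (sf e h u t x - u t x)"
  have q: "((\<lambda>h. n2 (?q h)) \<longlongrightarrow> 0) (Fil T t)" using hd t by (auto simp: HD_def)
  have 2: "((\<lambda>h. n2 (?r h)) \<longlongrightarrow> 0) (Fil T t)"
  proof (rule n2_L2_times_bounded)
    show "\<forall>\<^sub>F h in Fil T t. (\<lambda>x. sf e h u t x - u t x) \<in> borel_measurable borel \<and> (\<forall>x. \<bar>sf e h u t x - u t x\<bar> \<le> 1)"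
      using Fil_pos M
    proof eventually_elim
      case (elim h)
      then have [measurable]: "sf e h u t \<in> borel_measurable borel" by simp
      have "\<bar>sf e h u t x - u t x\<bar> \<le> 1" for x
        using sf_bound[of T "\<lambda>y. y \<in> {1/2..3/2}" u, OF I t elim(1), of e x] I[OF t, of x] by (auto simp: abs_le_iff)
      then show ?case by simp
    qed
    show "((\<lambda>h. n2 (\<lambda>x. sf e h u t x - u t x)) \<longlongrightarrow> 0) (Fil T t)"
      by (rule HD_shift_tendsto[OF hd rg t fin[OF t]])
  qed (use fin t in auto)
  have 3: "((\<lambda>h. ennreal ((2*C)\<^sup>2) * (2 * n2 (?q h) + 2 * n2 (?r h))) \<longlongrightarrow> 0) (Fil T t)"
    by (intro tendsto0_ennreal_cmult tendsto0_ennreal_add q 2) auto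
  show "((\<lambda>h. n2 (\<lambda>x. (sf e h (\<lambda>t x. \<phi> (u t x)) t x - \<phi> (u t x)) / h - \<psi> (u t x) * u' t x)) \<longlongrightarrow> 0) (Fil T t)"
  proof (rule tendsto0_ennreal_le[OF 3])
    show "\<forall>\<^sub>F h in Fil T t. n2 (\<lambda>x. (sf e h (\<lambda>t x. \<phi> (u t x)) t x - \<phi> (u t x)) / h - \<psi> (u t x) * u' t x)
        \<le> ennreal ((2*C)\<^sup>2) * (2 * n2 (?q h) + 2 * n2 (?r h))"
      using Fil_pos M
    proof eventually_elim
      case (elim h)
      then have [measurable]: "sf e h u t \<in> borel_measurable borel" and h: "h > 0" by auto
      have "n2 (\<lambda>x. (sf e h (\<lambda>t x. \<phi> (u t x)) t x - \<phi> (u t x)) / h - \<psi> (u t x) * u' t x)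
         \<le> n2 (\<lambda>x. (2 * C) * (\<bar>?q h x\<bar> + \<bar>?r h x\<bar>))"
      proof (rule n2_mono)
        fix x
        define a where "a = u t x"
        define b where "b = sf e h u t x"
        have ab: "a \<in> {1/2..3/2}" "b \<in> {1/2..3/2}"
          using sf_bound[of T "\<lambda>y. y \<in> {1/2..3/2}" u, OF I t elim(1), of e x] I[OF t, of x] by (auto simp: a_def b_def)
        define Q where "Q = (b - a) / h - u' t x"
        have e1: "(\<phi> b - \<phi> a) / h - \<psi> a * u' t x = \<psi> a * Q + (\<phi> b - \<phi> a - \<psi> a * (b - a)) / h"
          by (simp add: Q_def diff_divide_distrib right_diff_distrib)
        have "\<bar>(\<phi> b - \<phi> a - \<psi> a * (b - a)) / h\<bar> \<le> C * (b - a)\<^sup>2 / h"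
          using C(1)[OF ab] h by (simp add: divide_right_mono)
        also have "\<dots> = C * ((b - a) * (Q + u' t x))" using h by (simp add: Q_def power2_eq_square)
        also have "\<dots> \<le> C * (\<bar>Q\<bar> + \<bar>u' t x * (b - a)\<bar>)"
        proof (rule mult_left_mono[OF _ C0])
          have "(b - a) * Q \<le> \<bar>b - a\<bar> * \<bar>Q\<bar>" by (metis abs_ge_self abs_mult)
          also have "\<dots> \<le> 1 * \<bar>Q\<bar>" using ab by (intro mult_right_mono) (auto simp: abs_le_iff)
          finally have "(b - a) * Q \<le> \<bar>Q\<bar>" by simp
          moreover have "(b - a) * u' t x \<le> \<bar>u' t x * (b - a)\<bar>" by (metis abs_ge_self mult.commute)
          ultimately show "(b - a) * (Q + u' t x) \<le> \<bar>Q\<bar> + \<bar>u' t x * (b - a)\<bar>" by (simp add: distrib_left)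
        qed
        finally have r: "\<bar>(\<phi> b - \<phi> a - \<psi> a * (b - a)) / h\<bar> \<le> C * \<bar>Q\<bar> + C * \<bar>u' t x * (b - a)\<bar>" by (simp add: distrib_left)
        have p: "\<bar>\<psi> a * Q\<bar> \<le> C * \<bar>Q\<bar>" using C(2)[OF ab(1)] by (simp add: abs_mult mult_right_mono)
        have "\<bar>(\<phi> b - \<phi> a) / h - \<psi> a * u' t x\<bar> \<le> \<bar>\<psi> a * Q\<bar> + \<bar>(\<phi> b - \<phi> a - \<psi> a * (b - a)) / h\<bar>"
          unfolding e1 by (rule abs_triangle_ineq)
        also have "\<dots> \<le> C * \<bar>Q\<bar> + (C * \<bar>Q\<bar> + 2 * (C * \<bar>u' t x * (b - a)\<bar>))"
          using r p mult_nonneg_nonneg[OF C0 abs_ge_zero[of "u' t x * (b-a)"]] by linarith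
        also have "\<dots> = (2 * C) * (\<bar>Q\<bar> + \<bar>u' t x * (b - a)\<bar>)" by (simp add: distrib_left)
        also have "\<dots> \<le> \<bar>(2 * C) * (\<bar>Q\<bar> + \<bar>u' t x * (b - a)\<bar>)\<bar>" by (rule abs_ge_self)
        finally show "\<bar>(sf e h (\<lambda>t x. \<phi> (u t x)) t x - \<phi> (u t x)) / h - \<psi> (u t x) * u' t x\<bar>
           \<le> \<bar>(2 * C) * (\<bar>?q h x\<bar> + \<bar>?r h x\<bar>)\<bar>"
          unfolding sf_apply(1)[of e h \<phi> u] by (simp only: a_def b_def Q_def)
      qed
      also have "\<dots> = ennreal ((2*C)\<^sup>2) * n2 (\<lambda>x. \<bar>?q h x\<bar> + \<bar>?r h x\<bar>)"
        by (rule n2_cmult) simp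
      also have "\<dots> \<le> ennreal ((2*C)\<^sup>2) * (2 * n2 (\<lambda>x. \<bar>?q h x\<bar>) + 2 * n2 (\<lambda>x. \<bar>?r h x\<bar>))"
        by (intro mult_left_mono n2_add) auto
      finally show ?case by (simp add: n2_def)
    qed
  qed
qed

text \<open>If u and w agree almost everywhere at each time, so do their shifts: in time by
  assumption, in space by translation invariance. Hence their difference quotients agree. This
  allows an equation to be differentiated when its two sides are given by different
  formulas.\<close>

lemma HD_unique:
  assumes hd: "HD T e u u'" "HD T e w w'" and rg: "reg T u" "reg T u'" "reg T w" "reg T w'"
    and eq: "\<And>t. t \<in> {0..<T} \<Longrightarrow> n2 (\<lambda>x. u t x - w t x) = 0" and t: "t \<in> {0..<T}"
  shows "n2 (\<lambda>x. u' t x - w' t x) = 0"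
proof -
  note [measurable] = rg[THEN reg_meas, OF t]
  have "((\<lambda>h. n2 (\<lambda>x. u' t x - w' t x)) \<longlongrightarrow> 0) (Fil T t)"
  proof (rule tendsto0_ennreal_le)
    show "((\<lambda>h. 4 * n2 (\<lambda>x. (sf e h u t x - u t x) / h - u' t x) + 4 * n2 (\<lambda>x. (sf e h w t x - w t x) / h - w' t x)) \<longlongrightarrow> 0) (Fil T t)"
      using hd t by (intro tendsto0_ennreal_add tendsto0_ennreal_cmult) (auto simp: HD_def)
    show "\<forall>\<^sub>F h in Fil T t. n2 (\<lambda>x. u' t x - w' t x) \<le> 4 * n2 (\<lambda>x. (sf e h u t x - u t x) / h - u' t x) + 4 * n2 (\<lambda>x. (sf e h w t x - w t x) / h - w' t x)"
      using Fil_pos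
    proof eventually_elim
      case (elim h)
      note [measurable] = sf_meas[OF rg(1) t elim] sf_meas[OF rg(3) t elim]
      have sh: "n2 (\<lambda>x. sf e h u t x - sf e h w t x) = 0"
      proof (cases e)
        case None then show ?thesis using eq[of "t+h"] elim t by simp
      next
        case (Some i)
        have "n2 (sf (Some i) h (\<lambda>t x. u t x - w t x) t) = n2 (\<lambda>x. u t x - w t x)"
          by (rule n2_sf_Some) (use rg t elim in \<open>auto simp: reg_def per_def\<close>)
        moreover have "sf (Some i) h (\<lambda>t x. u t x - w t x) t = (\<lambda>x. sf e h u t x - sf e h w t x)"
          by (simp add: fun_eq_iff Some)
        ultimately show ?thesis using eq[OF t] by simp
      qed
      have z: "n2 (\<lambda>x. (sf e h u t x - sf e h w t x) - (u t x - w t x)) = 0"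
        using n2_diff[of "\<lambda>x. sf e h u t x - sf e h w t x" "\<lambda>x. u t x - w t x"] by (simp add: sh eq[OF t])
      let ?a = "\<lambda>x. (sf e h u t x - u t x) / h - u' t x" and ?b = "\<lambda>x. (sf e h w t x - w t x) / h - w' t x"
      let ?c = "\<lambda>x. (1/h) * ((sf e h u t x - sf e h w t x) - (u t x - w t x))"
      have z': "n2 ?c = 0"
        by (subst n2_cmult) (simp_all add: z)
      have "n2 (\<lambda>x. u' t x - w' t x) = n2 (\<lambda>x. ?c x - (?a x - ?b x))"
        by (rule arg_cong[where f=n2]) (simp add: fun_eq_iff diff_divide_distrib)
      also have "\<dots> \<le> 2 * n2 ?c + 2 * n2 (\<lambda>x. ?a x - ?b x)" by (rule n2_diff) auto
      also have "\<dots> \<le> 2 * n2 ?c + 2 * (2 * n2 ?a + 2 * n2 ?b)" by (intro add_mono mult_left_mono n2_diff) auto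
      also have "\<dots> = 4 * n2 ?a + 4 * n2 ?b" by (simp only: z') (simp add: distrib_left mult.assoc[symmetric])
      finally show ?case .
    qed
  qed
  from tendsto_unique[OF Fil_nontrivial tendsto_const this] t show ?thesis by auto
qed

text \<open>Real powers are smooth on [1/2, 3/2], which stays away from 0; the constants come from
  compactness and the mean value theorem.\<close>

lemma powr_Taylor:
  obtains C :: real where "\<And>a b. a \<in> {1/2..3/2} \<Longrightarrow> b \<in> {1/2..3/2} \<Longrightarrow> \<bar>b powr s - a powr s - (s * a powr (s-1)) * (b - a)\<bar> \<le> C * (b - a)\<^sup>2"
    "\<And>a. a \<in> {1/2..3/2} \<Longrightarrow> \<bar>s * a powr (s-1)\<bar> \<le> C" "\<And>a. a \<in> {1/2..3/2} \<Longrightarrow> \<bar>a powr s - 1\<bar> \<le> C * \<bar>a - 1\<bar>"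
proof -
  have bdd: "\<exists>K\<ge>0. \<forall>a\<in>{1/2..3/2}. \<bar>c * a powr r\<bar> \<le> K" for c r :: real
  proof -
    have "continuous_on {1/2..3/2::real} (\<lambda>a. c * a powr r)"
      by (intro continuous_on_mult continuous_on_const continuous_on_powr continuous_on_id) auto
    then have "compact ((\<lambda>a. c * a powr r) ` {1/2..3/2})"
      by (intro compact_continuous_image) auto
    then obtain K where "\<forall>y\<in>(\<lambda>a. c * a powr r) ` {1/2..3/2}. norm y \<le> K"
      using compact_imp_bounded bounded_iff by metis
    then show ?thesis by (intro exI[of _ "max K 0"]) (auto simp: le_max_iff_disj)
  qed
  obtain K1 where K1: "K1 \<ge> 0" "\<And>a. a \<in> {1/2..3/2} \<Longrightarrow> \<bar>s * a powr (s-1)\<bar> \<le> K1" using bdd by meson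
  obtain K2 where K2: "K2 \<ge> 0" "\<And>a. a \<in> {1/2..3/2} \<Longrightarrow> \<bar>(s * (s-1)) * a powr (s-1-1)\<bar> \<le> K2" using bdd by meson
  have d: "((\<lambda>x. x powr r) has_field_derivative r * a powr (r-1)) (at a within A)" if "a \<in> {1/2..3/2}" for a r :: real and A
  proof -
    have "((\<lambda>x. x powr r) has_field_derivative r * a powr (r-1)) (at a)"
      using that by (intro has_real_derivative_powr) auto
    then show ?thesis by (rule has_field_derivative_at_within)
  qed
  have L1: "\<bar>b powr s - a powr s\<bar> \<le> K1 * \<bar>b - a\<bar>" if ab: "a \<in> {1/2..3/2}" "b \<in> {1/2..3/2}" for a b
  proof -
    have "norm (b powr s - a powr s) \<le> K1 * norm (b - a)"
    proof (rule field_differentiable_bound[of "{1/2..3/2}" "\<lambda>x. x powr s" "\<lambda>a. s * a powr (s-1)"])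
      show "norm (s * z powr (s - 1)) \<le> K1" if "z \<in> {1/2..3/2}" for z
        unfolding real_norm_def by (rule K1(2)[OF that])
    qed (rule convex_real_interval d ab; assumption?)+
    then show ?thesis by (simp only: real_norm_def)
  qed
  have L2: "\<bar>s * b powr (s-1) - s * a powr (s-1)\<bar> \<le> K2 * \<bar>b - a\<bar>" if ab: "a \<in> {1/2..3/2}" "b \<in> {1/2..3/2}" for a b
  proof -
    have "norm (s * b powr (s-1) - s * a powr (s-1)) \<le> K2 * norm (b - a)"
    proof (rule field_differentiable_bound[of "{1/2..3/2}" "\<lambda>x. s * x powr (s-1)" "\<lambda>a. s * ((s-1) * a powr (s-1-1))"])
      show "norm (s * ((s - 1) * z powr (s - 1 - 1))) \<le> K2" if "z \<in> {1/2..3/2}" for z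
        unfolding real_norm_def using K2(2)[OF that] by (simp only: mult.assoc)
    qed (rule convex_real_interval DERIV_cmult d ab; assumption?)+
    then show ?thesis by (simp only: real_norm_def)
  qed
  \<comment> \<open>The mean value bound is applied to x^s minus its linear part at a, and only on
    the segment from a to b: there the derivative is at most K2 |b - a|, which supplies the second
    factor |b - a|.\<close>
  have L3: "\<bar>b powr s - a powr s - (s * a powr (s-1)) * (b - a)\<bar> \<le> K2 * (b - a)\<^sup>2" if ab: "a \<in> {1/2..3/2}" "b \<in> {1/2..3/2}" for a b
  proof -
    have seg: "closed_segment a b \<subseteq> {1/2..3/2}" using ab by (intro closed_segment_subset) auto
    let ?c = "s * a powr (s-1)"
    have h: "norm ((b powr s - ?c * b) - (a powr s - ?c * a)) \<le> (K2 * \<bar>b - a\<bar>) * norm (b - a)"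
    proof (rule field_differentiable_bound[of "closed_segment a b" "\<lambda>x. x powr s - ?c * x" "\<lambda>x. s * x powr (s-1) - ?c * 1"])
      fix z assume z: "z \<in> closed_segment a b"
      then have z': "z \<in> {1/2..3/2}" using seg by auto
      show "((\<lambda>x. x powr s - ?c * x) has_field_derivative s * z powr (s - 1) - ?c * 1) (at z within closed_segment a b)"
        by (intro DERIV_diff DERIV_cmult d z' DERIV_ident)
      have "\<bar>s * z powr (s-1) - s * a powr (s-1)\<bar> \<le> K2 * \<bar>z - a\<bar>" using L2 ab z' by blast
      also have "\<dots> \<le> K2 * \<bar>b - a\<bar>"
        using z K2(1) by (intro mult_left_mono) (auto simp: closed_segment_eq_real_ivl split: if_splits)
      finally show "norm (s * z powr (s - 1) - ?c * 1) \<le> K2 * \<bar>b - a\<bar>" by simp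
    qed auto
    have e1: "(b powr s - ?c * b) - (a powr s - ?c * a) = b powr s - a powr s - ?c * (b - a)"
      by (simp add: right_diff_distrib)
    have e2: "(K2 * \<bar>b - a\<bar>) * norm (b - a) = K2 * (b - a)\<^sup>2" by (simp add: power2_eq_square)
    have "\<bar>b powr s - a powr s - ?c * (b - a)\<bar> = norm ((b powr s - ?c * b) - (a powr s - ?c * a))"
      by (subst e1) (rule real_norm_def[symmetric])
    also note h
    also note e2
    finally show ?thesis .
  qed
  show thesis
  proof (rule that[of "max K1 K2"])
    show "\<bar>b powr s - a powr s - (s * a powr (s-1)) * (b - a)\<bar> \<le> max K1 K2 * (b - a)\<^sup>2" if "a \<in> {1/2..3/2}" "b \<in> {1/2..3/2}" for a b
      using L3[OF that] by (rule order_trans) (simp add: mult_right_mono)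
    show "\<bar>a powr s - 1\<bar> \<le> max K1 K2 * \<bar>a - 1\<bar>" if "a \<in> {1/2..3/2}" for a
    proof -
      have "\<bar>a powr s - 1 powr s\<bar> \<le> K1 * \<bar>a - 1\<bar>" by (rule L1) (use that in auto)
      also have "\<dots> \<le> max K1 K2 * \<bar>a - 1\<bar>" by (intro mult_right_mono) auto
      finally show ?thesis by (simp only: powr_one_eq_one)
    qed
    show "\<bar>s * a powr (s-1)\<bar> \<le> max K1 K2" if "a \<in> {1/2..3/2}" for a
      using K1(2)[OF that] by simp
  qed
qed

subsection \<open>An algebra of functions with iterated mean-square derivatives\<close>

text \<open>\<open>S\<close> indexes the solutions and \<open>Tm\<close> gives their lifetimes. The
  size predicates \<open>bnd\<close> and \<open>l2b\<close> choose the constant before the index and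
  the time, which is how the constants of the theorem become independent of the solution.\<close>

locale sols =
  fixes S :: "'i set" and Tm :: "'i \<Rightarrow> real"
begin

abbreviation Iv :: "'i \<Rightarrow> real set" where
  "Iv i \<equiv> {0..<Tm i}"

definition bnd :: "('i \<Rightarrow> real \<Rightarrow> real) \<Rightarrow> ('i \<Rightarrow> real \<Rightarrow> real^3 \<Rightarrow> real) \<Rightarrow> bool" where
  "bnd \<kappa> u \<longleftrightarrow> (\<exists>C\<ge>0. \<forall>i\<in>S. \<forall>t\<in>Iv i. \<forall>x. \<bar>u i t x\<bar> \<le> C * \<kappa> i t)"

definition rg :: "('i \<Rightarrow> real \<Rightarrow> real^3 \<Rightarrow> real) \<Rightarrow> bool" where
  "rg u \<longleftrightarrow> (\<forall>i\<in>S. reg (Tm i) (u i))"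

definition dd :: "3 option \<Rightarrow> ('i \<Rightarrow> real \<Rightarrow> real^3 \<Rightarrow> real) \<Rightarrow> ('i \<Rightarrow> real \<Rightarrow> real^3 \<Rightarrow> real) \<Rightarrow> bool" where
  "dd e u u' \<longleftrightarrow> (\<forall>i\<in>S. HD (Tm i) e (u i) (u' i))"

definition l2b :: "('i \<Rightarrow> real \<Rightarrow> real) \<Rightarrow> ('i \<Rightarrow> real \<Rightarrow> real^3 \<Rightarrow> real) \<Rightarrow> bool" where
  "l2b \<kappa> u \<longleftrightarrow> (\<exists>C\<ge>0. \<forall>i\<in>S. \<forall>t\<in>Iv i. n2 (u i t) \<le> ennreal ((C * \<kappa> i t)\<^sup>2))"

text \<open>Mean-square derivatives exist up to order k; those of order below k are bounded by a
  multiple of \<kappa>, those of order k only have L2 norm of that size. With k = N - 1 this fits a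
  solution with N derivatives, for which Sobolev's inequality bounds all orders up to N - 2.\<close>

primrec cls :: "nat \<Rightarrow> ('i \<Rightarrow> real \<Rightarrow> real) \<Rightarrow> ('i \<Rightarrow> real \<Rightarrow> real^3 \<Rightarrow> real) \<Rightarrow> bool" where
  "cls 0 \<kappa> u \<longleftrightarrow> rg u \<and> l2b \<kappa> u"
| "cls (Suc k) \<kappa> u \<longleftrightarrow> rg u \<and> bnd \<kappa> u \<and> (\<forall>e. \<exists>u'. dd e u u' \<and> cls k \<kappa> u')"

text \<open>Here the bound may depend on the index: it serves to apply \<open>HD_mult\<close> to one
  solution at a time and enters no constant.\<close>

definition adm :: "('i \<Rightarrow> real \<Rightarrow> real) \<Rightarrow> bool" where
  "adm \<kappa> \<longleftrightarrow> (\<forall>i\<in>S. \<exists>K. \<forall>t\<in>Iv i. 0 \<le> \<kappa> i t \<and> \<kappa> i t \<le> K)"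

lemma cls_rg: "cls k \<kappa> u \<Longrightarrow> rg u" by (cases k) auto

lemma bnd_l2b: "bnd \<kappa> u \<Longrightarrow> l2b \<kappa> u"
  unfolding bnd_def l2b_def by (meson n2_bound)

lemma cls_l2b: "cls k \<kappa> u \<Longrightarrow> l2b \<kappa> u"
  by (cases k) (auto intro: bnd_l2b)

lemma cls_mono: "cls (Suc k) \<kappa> u \<Longrightarrow> cls k \<kappa> u"
proof (induction k arbitrary: u)
  case 0 then show ?case by (auto intro: bnd_l2b)
next
  case (Suc k)
  then show ?case unfolding cls.simps(2)[of "Suc k"] cls.simps(2)[of k] by blast
qed

lemma rg_meas: "rg u \<Longrightarrow> i \<in> S \<Longrightarrow> t \<in> Iv i \<Longrightarrow> u i t \<in> borel_measurable borel"
  by (auto simp: rg_def reg_def)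

lemma rg_add: "rg u \<Longrightarrow> rg w \<Longrightarrow> rg (\<lambda>i t x. u i t x + w i t x)"
  by (simp add: rg_def reg_add)
lemma rg_mult: "rg u \<Longrightarrow> rg w \<Longrightarrow> rg (\<lambda>i t x. u i t x * w i t x)"
  by (simp add: rg_def reg_mult)
lemma rg_const: "rg (\<lambda>i t x. c)" by (simp add: rg_def reg_const)
lemma rg_comp1: "rg u \<Longrightarrow> F \<in> borel_measurable borel \<Longrightarrow> rg (\<lambda>i t x. F (u i t x))"
  by (simp add: rg_def reg_comp1)
lemma rg_cmult: "rg u \<Longrightarrow> rg (\<lambda>i t x. c * u i t x)"
  using rg_mult[OF rg_const] .

lemma l2b_fin: "l2b \<kappa> u \<Longrightarrow> i \<in> S \<Longrightarrow> t \<in> Iv i \<Longrightarrow> n2 (u i t) < \<infinity>"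
  unfolding l2b_def by (metis ennreal_less_top infinity_ennreal_def le_less_trans)

lemma l2b_add:
  assumes "l2b \<kappa> u" "l2b \<kappa> w" "rg u" "rg w"
  shows "l2b \<kappa> (\<lambda>i t x. u i t x + w i t x)"
proof -
  from assms obtain C D where C: "C \<ge> 0" "\<And>i t. i \<in> S \<Longrightarrow> t \<in> Iv i \<Longrightarrow> n2 (u i t) \<le> ennreal ((C * \<kappa> i t)\<^sup>2)"
    and D: "D \<ge> 0" "\<And>i t. i \<in> S \<Longrightarrow> t \<in> Iv i \<Longrightarrow> n2 (w i t) \<le> ennreal ((D * \<kappa> i t)\<^sup>2)"
    unfolding l2b_def by blast
  show ?thesis unfolding l2b_def
  proof (intro exI[of _ "2 * (C + D)"] conjI ballI)
    fix i t assume i: "i \<in> S" "t \<in> Iv i"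
    have "n2 (\<lambda>x. u i t x + w i t x) \<le> 2 * n2 (u i t) + 2 * n2 (w i t)"
      using assms i by (intro n2_add rg_meas)
    also have "\<dots> \<le> 2 * ennreal ((C * \<kappa> i t)\<^sup>2) + 2 * ennreal ((D * \<kappa> i t)\<^sup>2)"
      using C(2)[OF i] D(2)[OF i] by (intro add_mono mult_left_mono) auto
    also have "\<dots> = ennreal (2 * (C * \<kappa> i t)\<^sup>2 + 2 * (D * \<kappa> i t)\<^sup>2)"
      by (simp add: ennreal_plus ennreal_mult)
    also have "\<dots> \<le> ennreal ((2 * (C + D) * \<kappa> i t)\<^sup>2)"
    proof (rule ennreal_leI)
      have "2 * C\<^sup>2 + 2 * D\<^sup>2 \<le> (2 * (C + D))\<^sup>2"
        using C(1) D(1) by (simp add: power_mult_distrib power2_sum)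
      then have "(2 * C\<^sup>2 + 2 * D\<^sup>2) * (\<kappa> i t)\<^sup>2 \<le> (2 * (C + D))\<^sup>2 * (\<kappa> i t)\<^sup>2"
        by (rule mult_right_mono) simp
      moreover have "2 * (C * \<kappa> i t)\<^sup>2 + 2 * (D * \<kappa> i t)\<^sup>2 = (2 * C\<^sup>2 + 2 * D\<^sup>2) * (\<kappa> i t)\<^sup>2"
        by (simp add: power_mult_distrib distrib_right)
      ultimately show "2 * (C * \<kappa> i t)\<^sup>2 + 2 * (D * \<kappa> i t)\<^sup>2 \<le> (2 * (C + D) * \<kappa> i t)\<^sup>2"
        by (simp only: power_mult_distrib[of "2 * (C + D)" "\<kappa> i t"])
    qed
    finally show "n2 (\<lambda>x. u i t x + w i t x) \<le> ennreal ((2 * (C + D) * \<kappa> i t)\<^sup>2)" .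
  qed (use C D in auto)
qed

lemma bnd_add:
  assumes "bnd \<kappa> u" "bnd \<kappa> w"
  shows "bnd \<kappa> (\<lambda>i t x. u i t x + w i t x)"
proof -
  from assms obtain C D where C: "C \<ge> 0" "\<And>i t x. i \<in> S \<Longrightarrow> t \<in> Iv i \<Longrightarrow> \<bar>u i t x\<bar> \<le> C * \<kappa> i t"
    and D: "D \<ge> 0" "\<And>i t x. i \<in> S \<Longrightarrow> t \<in> Iv i \<Longrightarrow> \<bar>w i t x\<bar> \<le> D * \<kappa> i t"
    unfolding bnd_def by blast
  show ?thesis unfolding bnd_def
  proof (intro exI[of _ "C + D"] conjI ballI allI)
    fix i t x assume i: "i \<in> S" "t \<in> Iv i"
    show "\<bar>u i t x + w i t x\<bar> \<le> (C + D) * \<kappa> i t"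
      using C(2)[OF i, of x] D(2)[OF i, of x] by (simp add: distrib_right)
  qed (use C D in auto)
qed

lemma bnd_mult:
  assumes "bnd \<kappa> u" "bnd \<kappa>' w"
  shows "bnd (\<lambda>i t. \<kappa> i t * \<kappa>' i t) (\<lambda>i t x. u i t x * w i t x)"
proof -
  from assms obtain C D where C: "C \<ge> 0" "\<And>i t x. i \<in> S \<Longrightarrow> t \<in> Iv i \<Longrightarrow> \<bar>u i t x\<bar> \<le> C * \<kappa> i t"
    and D: "D \<ge> 0" "\<And>i t x. i \<in> S \<Longrightarrow> t \<in> Iv i \<Longrightarrow> \<bar>w i t x\<bar> \<le> D * \<kappa>' i t"
    unfolding bnd_def by blast
  show ?thesis unfolding bnd_def
  proof (intro exI[of _ "C * D"] conjI ballI allI)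
    fix i t x assume i: "i \<in> S" "t \<in> Iv i"
    have "\<bar>u i t x\<bar> * \<bar>w i t x\<bar> \<le> (C * \<kappa> i t) * (D * \<kappa>' i t)"
      using C(2)[OF i, of x] D(2)[OF i, of x] by (intro mult_mono) auto
    then show "\<bar>u i t x * w i t x\<bar> \<le> C * D * (\<kappa> i t * \<kappa>' i t)"
      by (simp add: abs_mult mult_ac)
  qed (use C D in auto)
qed

lemma bnd_const: "adm \<kappa> \<Longrightarrow> bnd \<kappa> (\<lambda>i t x. 0)"
  unfolding bnd_def by (auto intro!: exI[of _ 0])

lemma l2b_mult:
  assumes "l2b \<kappa> u" "bnd \<kappa>' w" "rg u"
  shows "l2b (\<lambda>i t. \<kappa> i t * \<kappa>' i t) (\<lambda>i t x. u i t x * w i t x)"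
proof -
  from assms obtain C D where C: "C \<ge> 0" "\<And>i t. i \<in> S \<Longrightarrow> t \<in> Iv i \<Longrightarrow> n2 (u i t) \<le> ennreal ((C * \<kappa> i t)\<^sup>2)"
    and D: "D \<ge> 0" "\<And>i t x. i \<in> S \<Longrightarrow> t \<in> Iv i \<Longrightarrow> \<bar>w i t x\<bar> \<le> D * \<kappa>' i t"
    unfolding bnd_def l2b_def by blast
  show ?thesis unfolding l2b_def
  proof (intro exI[of _ "C * D"] conjI ballI allI)
    fix i t assume i: "i \<in> S" "t \<in> Iv i"
    have "n2 (\<lambda>x. w i t x * u i t x) \<le> ennreal ((D * \<kappa>' i t)\<^sup>2) * n2 (u i t)"
      using D(2)[OF i] assms(3) i by (intro n2_mult_le rg_meas) auto
    also have "\<dots> \<le> ennreal ((D * \<kappa>' i t)\<^sup>2) * ennreal ((C * \<kappa> i t)\<^sup>2)"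
      using C(2)[OF i] by (intro mult_left_mono) auto
    also have "\<dots> = ennreal ((C * D * (\<kappa> i t * \<kappa>' i t))\<^sup>2)"
      by (subst ennreal_mult[symmetric]) (simp_all add: power_mult_distrib mult_ac)
    finally show "n2 (\<lambda>x. u i t x * w i t x) \<le> ennreal ((C * D * (\<kappa> i t * \<kappa>' i t))\<^sup>2)"
      by (simp add: mult.commute)
  qed (use C D in auto)
qed

lemma bnd_weaken:
  assumes "bnd \<kappa> u" "\<And>i t. i \<in> S \<Longrightarrow> t \<in> Iv i \<Longrightarrow> \<kappa> i t \<le> K * \<kappa>' i t" "K \<ge> 0"
  shows "bnd \<kappa>' u"
proof -
  from assms(1) obtain C where C: "C \<ge> 0" "\<And>i t x. i \<in> S \<Longrightarrow> t \<in> Iv i \<Longrightarrow> \<bar>u i t x\<bar> \<le> C * \<kappa> i t"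
    unfolding bnd_def by blast
  show ?thesis unfolding bnd_def
  proof (intro exI[of _ "C * K"] conjI ballI allI)
    fix i t x assume i: "i \<in> S" "t \<in> Iv i"
    have "\<bar>u i t x\<bar> \<le> C * \<kappa> i t" by (rule C(2)[OF i])
    also have "\<dots> \<le> C * (K * \<kappa>' i t)" by (intro mult_left_mono assms(2) i C)
    finally show "\<bar>u i t x\<bar> \<le> C * K * \<kappa>' i t" by simp
  qed (use C assms in auto)
qed

lemma l2b_weaken:
  assumes "l2b \<kappa> u" "\<And>i t. i \<in> S \<Longrightarrow> t \<in> Iv i \<Longrightarrow> 0 \<le> \<kappa> i t \<and> \<kappa> i t \<le> K * \<kappa>' i t" "K \<ge> 0"
  shows "l2b \<kappa>' u"
proof -
  from assms(1) obtain C where C: "C \<ge> 0" "\<And>i t. i \<in> S \<Longrightarrow> t \<in> Iv i \<Longrightarrow> n2 (u i t) \<le> ennreal ((C * \<kappa> i t)\<^sup>2)"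
    unfolding l2b_def by blast
  show ?thesis unfolding l2b_def
  proof (intro exI[of _ "C * K"] conjI ballI allI)
    fix i t assume i: "i \<in> S" "t \<in> Iv i"
    have "n2 (u i t) \<le> ennreal ((C * \<kappa> i t)\<^sup>2)" by (rule C(2)[OF i])
    also have "\<dots> \<le> ennreal ((C * (K * \<kappa>' i t))\<^sup>2)"
    proof (intro ennreal_leI power_mono mult_left_mono)
      show "\<kappa> i t \<le> K * \<kappa>' i t" "0 \<le> C * \<kappa> i t" using assms(2)[OF i] C(1) by simp_all
    qed (rule C(1))
    finally show "n2 (u i t) \<le> ennreal ((C * K * \<kappa>' i t)\<^sup>2)" by (simp add: mult.assoc)
  qed (use C assms in auto)
qed

lemma cls_weaken:
  assumes "cls k \<kappa> u" "\<And>i t. i \<in> S \<Longrightarrow> t \<in> Iv i \<Longrightarrow> 0 \<le> \<kappa> i t \<and> \<kappa> i t \<le> K * \<kappa>' i t" "K \<ge> 0"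
  shows "cls k \<kappa>' u"
  using assms(1)
proof (induction k arbitrary: u)
  case 0
  have "l2b \<kappa>' u" by (rule l2b_weaken[of \<kappa> u K]) (use 0 assms(2,3) in simp_all)
  then show ?case using 0 by simp
next
  case (Suc k)
  have "bnd \<kappa>' u" by (rule bnd_weaken[of \<kappa> u K]) (use Suc.prems assms(2,3) in simp_all)
  then show ?case using Suc.IH Suc.prems unfolding cls.simps by blast
qed

lemma dd_add: "dd e u u' \<Longrightarrow> dd e w w' \<Longrightarrow> rg u \<Longrightarrow> rg u' \<Longrightarrow> rg w \<Longrightarrow> rg w' \<Longrightarrow> dd e (\<lambda>i t x. u i t x + w i t x) (\<lambda>i t x. u' i t x + w' i t x)"
  by (simp add: dd_def rg_def HD_add)
lemma dd_cmult: "dd e u u' \<Longrightarrow> rg u \<Longrightarrow> rg u' \<Longrightarrow> dd e (\<lambda>i t x. c * u i t x) (\<lambda>i t x. c * u' i t x)"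
  by (simp add: dd_def rg_def HD_cmult)
lemma dd_const: "dd e (\<lambda>i t x. c) (\<lambda>i t x. 0)"
  by (simp add: dd_def HD_const)
lemma dd_add_const: "dd e u u' \<Longrightarrow> dd e (\<lambda>i t x. u i t x + c) u'"
  by (simp add: dd_def HD_add_const)

lemma cls_add: "cls k \<kappa> u \<Longrightarrow> cls k \<kappa> w \<Longrightarrow> cls k \<kappa> (\<lambda>i t x. u i t x + w i t x)"
proof (induction k arbitrary: u w)
  case 0 then show ?case by (auto intro: rg_add l2b_add)
next
  case (Suc k)
  show ?case unfolding cls.simps
  proof (intro conjI allI)
    show "rg (\<lambda>i t x. u i t x + w i t x)" using Suc.prems by (auto intro: rg_add)
    show "bnd \<kappa> (\<lambda>i t x. u i t x + w i t x)" using Suc.prems by (auto intro: bnd_add)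
    fix e
    obtain u' w' where "dd e u u'" "cls k \<kappa> u'" "dd e w w'" "cls k \<kappa> w'"
      using Suc.prems unfolding cls.simps by blast
    then show "\<exists>u'. dd e (\<lambda>i t x. u i t x + w i t x) u' \<and> cls k \<kappa> u'"
      using Suc by (intro exI[of _ "\<lambda>i t x. u' i t x + w' i t x"] conjI dd_add) (auto dest: cls_rg)
  qed
qed

lemma bnd_cmult: assumes "bnd \<kappa> u" shows "bnd \<kappa> (\<lambda>i t x. c * u i t x)"
proof -
  have "bnd (\<lambda>i t. 1) (\<lambda>i t x. c)" by (auto simp: bnd_def intro!: exI[of _ "\<bar>c\<bar>"])
  from bnd_mult[OF this assms] show ?thesis by simp
qed

lemma l2b_cmult: assumes "l2b \<kappa> u" "rg u" shows "l2b \<kappa> (\<lambda>i t x. c * u i t x)"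
proof -
  have "bnd (\<lambda>i t. 1) (\<lambda>i t x. c)" by (auto simp: bnd_def intro!: exI[of _ "\<bar>c\<bar>"])
  from l2b_mult[OF assms(1) this assms(2)] show ?thesis by (simp add: mult.commute)
qed

lemma cls_cmult: "cls k \<kappa> u \<Longrightarrow> cls k \<kappa> (\<lambda>i t x. c * u i t x)"
proof (induction k arbitrary: u)
  case 0 then show ?case by (auto intro: rg_cmult l2b_cmult)
next
  case (Suc k)
  show ?case unfolding cls.simps
  proof (intro conjI allI)
    show "rg (\<lambda>i t x. c * u i t x)" using Suc.prems by (auto intro: rg_cmult)
    show "bnd \<kappa> (\<lambda>i t x. c * u i t x)" using Suc.prems by (auto intro: bnd_cmult)
    fix e
    obtain u' where "dd e u u'" "cls k \<kappa> u'"
      using Suc.prems unfolding cls.simps by blast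
    then show "\<exists>u'. dd e (\<lambda>i t x. c * u i t x) u' \<and> cls k \<kappa> u'"
      using Suc by (intro exI[of _ "\<lambda>i t x. c * u' i t x"] conjI dd_cmult) (auto dest: cls_rg)
  qed
qed

lemma cls_zero: "adm \<kappa> \<Longrightarrow> cls k \<kappa> (\<lambda>i t x. 0)"
proof (induction k)
  case 0 then show ?case by (auto intro: rg_const bnd_l2b bnd_const)
next
  case (Suc k)
  then show ?case by (auto intro!: rg_const bnd_const exI[of _ "\<lambda>i t x. 0"] dd_const)
qed

lemma bnd_adm: "bnd \<kappa> u \<Longrightarrow> adm \<kappa> \<Longrightarrow> i \<in> S \<Longrightarrow> \<exists>B. \<forall>t\<in>Iv i. \<forall>x. \<bar>u i t x\<bar> \<le> B"
proof -
  assume "bnd \<kappa> u" and a: "adm \<kappa>" and i: "i \<in> S"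
  then obtain C where C: "C \<ge> 0" "\<And>i t x. i \<in> S \<Longrightarrow> t \<in> Iv i \<Longrightarrow> \<bar>u i t x\<bar> \<le> C * \<kappa> i t"
    unfolding bnd_def by blast
  obtain K where K: "\<And>t. t \<in> Iv i \<Longrightarrow> \<kappa> i t \<le> K" using a i unfolding adm_def by blast
  show ?thesis
    by (intro exI[of _ "C * K"] ballI allI order_trans[OF C(2)[OF i]] mult_left_mono K C(1))
qed

lemma dd_mult:
  assumes "dd e u u'" "dd e w w'" "rg u" "rg u'" "rg w" "rg w'" "bnd \<kappa> u" "bnd \<kappa>' w" "l2b \<kappa> u'" "l2b \<kappa>' w'"
    and a: "adm \<kappa>" "adm \<kappa>'"
  shows "dd e (\<lambda>i t x. u i t x * w i t x) (\<lambda>i t x. u' i t x * w i t x + u i t x * w' i t x)"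
  unfolding dd_def
proof
  fix i assume i: "i \<in> S"
  obtain B1 B2 where B: "\<And>t x. t\<in>Iv i \<Longrightarrow> \<bar>u i t x\<bar> \<le> B1" "\<And>t x. t\<in>Iv i \<Longrightarrow> \<bar>w i t x\<bar> \<le> B2"
    using bnd_adm[OF assms(7) a(1) i] bnd_adm[OF assms(8) a(2) i] by blast
  show "HD (Tm i) e (\<lambda>t x. u i t x * w i t x) (\<lambda>t x. u' i t x * w i t x + u i t x * w' i t x)"
  proof (rule HD_mult)
    show "\<bar>u i t x\<bar> \<le> max B1 B2" "\<bar>w i t x\<bar> \<le> max B1 B2" if "t \<in> Iv i" for t x
      using B[OF that, of x] by auto
    show "n2 (u' i t) < \<infinity>" "n2 (w' i t) < \<infinity>" if "t \<in> Iv i" for t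
      using l2b_fin assms(9,10) i that by blast+
  qed (use assms i in \<open>auto simp: dd_def rg_def\<close>)
qed

text \<open>Leibniz rule: among the factors of each term at most one lacks a pointwise bound, and
  that one is square integrable. At k = 0 the class gives no pointwise bound, hence the separate
  premise on w; in the induction step u and w exchange roles for the second term.\<close>

lemma cls_mult: "cls k \<kappa> u \<Longrightarrow> cls k \<kappa>' w \<Longrightarrow> bnd \<kappa>' w \<Longrightarrow> adm \<kappa> \<Longrightarrow> adm \<kappa>' \<Longrightarrow>
   cls k (\<lambda>i t. \<kappa> i t * \<kappa>' i t) (\<lambda>i t x. u i t x * w i t x)"
proof (induction k arbitrary: u w \<kappa> \<kappa>')
  case 0 then show ?case by (auto intro: rg_mult l2b_mult)
next
  case (Suc k)
  note a = Suc.prems(4,5)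
  show ?case unfolding cls.simps
  proof (intro conjI allI)
    show "rg (\<lambda>i t x. u i t x * w i t x)" using Suc.prems by (auto intro: rg_mult)
    show "bnd (\<lambda>i t. \<kappa> i t * \<kappa>' i t) (\<lambda>i t x. u i t x * w i t x)" using Suc.prems by (auto intro: bnd_mult)
    fix e
    obtain u' w' where 1: "dd e u u'" "cls k \<kappa> u'" and 2: "dd e w w'" "cls k \<kappa>' w'"
      using Suc.prems unfolding cls.simps by blast
    have 3: "dd e (\<lambda>i t x. u i t x * w i t x) (\<lambda>i t x. u' i t x * w i t x + u i t x * w' i t x)"
      using 1 2 Suc.prems by (intro dd_mult[of e u u' w w' \<kappa> \<kappa>']) (auto intro: cls_l2b cls_rg)
    have 4: "cls k (\<lambda>i t. \<kappa> i t * \<kappa>' i t) (\<lambda>i t x. u' i t x * w i t x)"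
      using 1 Suc.prems cls_mono by (intro Suc.IH) auto
    have "cls k (\<lambda>i t. \<kappa>' i t * \<kappa> i t) (\<lambda>i t x. w' i t x * u i t x)"
      using 2 Suc.prems cls_mono by (intro Suc.IH) auto
    then have 5: "cls k (\<lambda>i t. \<kappa> i t * \<kappa>' i t) (\<lambda>i t x. u i t x * w' i t x)"
      by (simp add: mult.commute)
    show "\<exists>u'. dd e (\<lambda>i t x. u i t x * w i t x) u' \<and> cls k (\<lambda>i t. \<kappa> i t * \<kappa>' i t) u'"
      using 3 cls_add[OF 4 5] by blast
  qed
qed

text \<open>Not u but its deviation from 1 has size \<kappa>. The derivative s u^(s-1) u' is written
  as s ((u^(s-1) - 1) u' + u'), which involves the same kind of deviation with another exponent; the
  induction therefore keeps s arbitrary.\<close>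

lemma cls_powr:
  assumes "cls k \<kappa> (\<lambda>i t x. u i t x - 1)" "bnd \<kappa> (\<lambda>i t x. u i t x - 1)"
    and I: "\<And>i t x. i \<in> S \<Longrightarrow> t \<in> Iv i \<Longrightarrow> u i t x \<in> {1/2..3/2}"
    and \<kappa>: "\<And>i t. i \<in> S \<Longrightarrow> t \<in> Iv i \<Longrightarrow> 0 \<le> \<kappa> i t \<and> \<kappa> i t \<le> 1"
  shows "cls k \<kappa> (\<lambda>i t x. u i t x powr s - 1)" and "bnd \<kappa> (\<lambda>i t x. u i t x powr s - 1)"
proof -
  have adm: "adm \<kappa>" using \<kappa> by (auto simp: adm_def intro!: exI[of _ 1])
  have adm1: "adm (\<lambda>i t. 1)" by (auto simp: adm_def intro!: exI[of _ 1])
  have b: "bnd \<kappa> (\<lambda>i t x. u i t x powr s - 1)" for s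
  proof -
    obtain C where C: "\<And>a. a \<in> {1/2..3/2} \<Longrightarrow> \<bar>a powr s - 1\<bar> \<le> C * \<bar>a - 1\<bar>" using powr_Taylor[of s] by metis
    obtain D where D: "D \<ge> 0" "\<And>i t x. i \<in> S \<Longrightarrow> t \<in> Iv i \<Longrightarrow> \<bar>u i t x - 1\<bar> \<le> D * \<kappa> i t"
      using assms(2) unfolding bnd_def by blast
    show ?thesis unfolding bnd_def
    proof (intro exI[of _ "\<bar>C\<bar> * D"] conjI ballI allI)
      fix i t x assume i: "i \<in> S" "t \<in> Iv i"
      have "\<bar>u i t x powr s - 1\<bar> \<le> C * \<bar>u i t x - 1\<bar>" by (rule C[OF I[OF i]])
      also have "\<dots> \<le> \<bar>C\<bar> * \<bar>u i t x - 1\<bar>" by (intro mult_right_mono) auto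
      also have "\<dots> \<le> \<bar>C\<bar> * (D * \<kappa> i t)" by (intro mult_left_mono D i) auto
      finally show "\<bar>u i t x powr s - 1\<bar> \<le> \<bar>C\<bar> * D * \<kappa> i t" by simp
    qed (use D in auto)
  qed
  show "bnd \<kappa> (\<lambda>i t x. u i t x powr s - 1)" by (rule b)
  have rgu: "rg u" using rg_add[OF cls_rg[OF assms(1)] rg_const[of 1]] by simp
  have pm: "(\<lambda>a. a powr s) \<in> borel_measurable borel" for s :: real by measurable
  have rgp: "rg (\<lambda>i t x. u i t x powr s - 1)" for s
    using rg_comp1[OF rgu, of "\<lambda>a. a powr s - 1"] by simp
  show "cls k \<kappa> (\<lambda>i t x. u i t x powr s - 1)"
    using assms(1)
  proof (induction k arbitrary: s)
    case 0
    show ?case using bnd_l2b[OF b] rgp by simp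
  next
    case (Suc k)
    show ?case unfolding cls.simps
    proof (intro conjI allI b rgp)
      fix e
      obtain u' where u': "dd e (\<lambda>i t x. u i t x - 1) u'" "cls k \<kappa> u'"
        using Suc.prems unfolding cls.simps by blast
      have ddu: "dd e u u'" using dd_add_const[OF u'(1), of 1] by simp
      have fin: "n2 (u' i t) < \<infinity>" if "i \<in> S" "t \<in> Iv i" for i t
        by (rule l2b_fin[OF cls_l2b[OF u'(2)] that])
      obtain C where C: "\<And>a b. a \<in> {1/2..3/2} \<Longrightarrow> b \<in> {1/2..3/2} \<Longrightarrow> \<bar>b powr s - a powr s - (s * a powr (s-1)) * (b - a)\<bar> \<le> C * (b - a)\<^sup>2"
        "\<And>a. a \<in> {1/2..3/2} \<Longrightarrow> \<bar>s * a powr (s-1)\<bar> \<le> C" using powr_Taylor[of s] by metis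
      have "dd e (\<lambda>i t x. u i t x powr s) (\<lambda>i t x. (s * u i t x powr (s-1)) * u' i t x)"
        unfolding dd_def
      proof
        fix i assume i: "i \<in> S"
        show "HD (Tm i) e (\<lambda>t x. u i t x powr s) (\<lambda>t x. (s * u i t x powr (s-1)) * u' i t x)"
          by (rule HD_comp[of "Tm i" e "u i" "u' i" "\<lambda>a. a powr s" "\<lambda>a. s * a powr (s-1)" C])
            (use ddu rgu cls_rg[OF u'(2)] i I fin C in \<open>auto simp: dd_def rg_def\<close>)
      qed
      then have 1: "dd e (\<lambda>i t x. u i t x powr s - 1) (\<lambda>i t x. (s * u i t x powr (s-1)) * u' i t x)"
        using dd_add_const[of e "\<lambda>i t x. u i t x powr s" _ "-1"] by simp
      have k1: "\<And>i t. i \<in> S \<Longrightarrow> t \<in> Iv i \<Longrightarrow> 0 \<le> \<kappa> i t \<and> \<kappa> i t \<le> 1 * 1" using \<kappa> by simp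
      \<comment> \<open>The factor u^(s-1) - 1 is used with weight 1 only, possible because \<kappa>
        \<le> 1, so that the product keeps weight \<kappa>.\<close>
      have "cls k (\<lambda>i t. \<kappa> i t * 1) (\<lambda>i t x. u' i t x * (u i t x powr (s-1) - 1))"
        by (intro cls_mult u'(2) cls_weaken[OF Suc.IH k1] bnd_weaken[OF b, of 1] adm adm1 cls_mono[OF Suc.prems]) (use \<kappa> in auto)
      from cls_cmult[OF cls_add[OF this[simplified] u'(2)], of s]
      have "cls k \<kappa> (\<lambda>i t x. (s * u i t x powr (s-1)) * u' i t x)"
        by (simp add: algebra_simps)
      with 1 show "\<exists>u'. dd e (\<lambda>i t x. u i t x powr s - 1) u' \<and> cls k \<kappa> u'" by blast
    qed
  qed
qed

text \<open>Adding boundedness makes the class closed under products for k = 0 as well.\<close>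

definition alg :: "nat \<Rightarrow> ('i \<Rightarrow> real \<Rightarrow> real) \<Rightarrow> ('i \<Rightarrow> real \<Rightarrow> real^3 \<Rightarrow> real) \<Rightarrow> bool" where
  "alg k \<kappa> u \<longleftrightarrow> cls k \<kappa> u \<and> bnd \<kappa> u"

lemma alg_add: "alg k \<kappa> u \<Longrightarrow> alg k \<kappa> w \<Longrightarrow> alg k \<kappa> (\<lambda>i t x. u i t x + w i t x)"
  by (auto simp: alg_def intro: cls_add bnd_add)
lemma alg_cmult: "alg k \<kappa> u \<Longrightarrow> alg k \<kappa> (\<lambda>i t x. c * u i t x)"
  by (auto simp: alg_def intro: cls_cmult bnd_cmult)
lemma alg_diff: "alg k \<kappa> u \<Longrightarrow> alg k \<kappa> w \<Longrightarrow> alg k \<kappa> (\<lambda>i t x. u i t x - w i t x)"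
  using alg_add[of k \<kappa> u "\<lambda>i t x. (-1) * w i t x"] alg_cmult[of k \<kappa> w "-1"] by simp
lemma alg_mult: "alg k \<kappa> u \<Longrightarrow> alg k \<kappa>' w \<Longrightarrow> adm \<kappa> \<Longrightarrow> adm \<kappa>' \<Longrightarrow> alg k (\<lambda>i t. \<kappa> i t * \<kappa>' i t) (\<lambda>i t x. u i t x * w i t x)"
  by (auto simp: alg_def intro: cls_mult bnd_mult)
lemma alg_zero: "adm \<kappa> \<Longrightarrow> alg k \<kappa> (\<lambda>i t x. 0)"
  by (auto simp: alg_def intro: cls_zero bnd_const)
lemma alg_weaken:
  assumes "alg k \<kappa> u" "\<And>i t. i \<in> S \<Longrightarrow> t \<in> Iv i \<Longrightarrow> 0 \<le> \<kappa> i t \<and> \<kappa> i t \<le> K * \<kappa>' i t" "K \<ge> 0"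
  shows "alg k \<kappa>' u"
  using assms cls_weaken[of k \<kappa> u K \<kappa>'] bnd_weaken[of \<kappa> u K \<kappa>'] by (auto simp: alg_def)
lemma alg_powr:
  assumes "alg k \<kappa> (\<lambda>i t x. u i t x - 1)"
    and "\<And>i t x. i \<in> S \<Longrightarrow> t \<in> Iv i \<Longrightarrow> u i t x \<in> {1/2..3/2}"
    and "\<And>i t. i \<in> S \<Longrightarrow> t \<in> Iv i \<Longrightarrow> 0 \<le> \<kappa> i t \<and> \<kappa> i t \<le> 1"
  shows "alg k \<kappa> (\<lambda>i t x. u i t x powr s - 1)"
  using cls_powr[of k \<kappa> u s] assms unfolding alg_def by blast
text \<open>The derivative-by-derivative form of an equation \<open>G \<gamma> = u\<close> in mean square: \<open>G\<close> need not be
  bounded, its derivatives being identified through uniqueness.\<close>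

lemma cls_transfer:
  assumes "cls k \<kappa> u" and rgG: "\<And>\<gamma>. P \<gamma> \<Longrightarrow> rg (G \<gamma>)"
    and D: "\<And>\<gamma> e. P \<gamma> \<Longrightarrow> P (nx e \<gamma>) \<Longrightarrow> dd e (G \<gamma>) (G (nx e \<gamma>))"
    and "P \<gamma>" and "\<And>i t. i \<in> S \<Longrightarrow> t \<in> Iv i \<Longrightarrow> n2 (\<lambda>x. G \<gamma> i t x - u i t x) = 0"
    and "length es \<le> k" and "\<And>es1 es2. es = es1 @ es2 \<Longrightarrow> P (fold nx es1 \<gamma>)"
  shows "l2b \<kappa> (G (fold nx es \<gamma>))"
  using assms(1,4-)
proof (induction es arbitrary: k u \<gamma>)
  case Nil
  obtain C where C: "C \<ge> 0" "\<And>i t. i \<in> S \<Longrightarrow> t \<in> Iv i \<Longrightarrow> n2 (u i t) \<le> ennreal ((C * \<kappa> i t)\<^sup>2)"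
    using cls_l2b[OF Nil(1)] unfolding l2b_def by blast
  have "l2b \<kappa> (G \<gamma>)" unfolding l2b_def
  proof (intro exI[of _ "2 * C"] conjI ballI)
    fix i t assume i: "i \<in> S" "t \<in> Iv i"
    note [measurable] = rg_meas[OF rgG[OF Nil(2)] i] rg_meas[OF cls_rg[OF Nil(1)] i]
    have "n2 (G \<gamma> i t) = n2 (\<lambda>x. u i t x + (G \<gamma> i t x - u i t x))" by simp
    also have "\<dots> \<le> 2 * n2 (u i t) + 2 * n2 (\<lambda>x. G \<gamma> i t x - u i t x)" by (rule n2_add) auto
    also have "\<dots> \<le> 2 * ennreal ((C * \<kappa> i t)\<^sup>2)" using C(2)[OF i] Nil(3)[OF i] by (simp add: mult_left_mono)
    also have "\<dots> = ennreal (2 * (C * \<kappa> i t)\<^sup>2)" by (simp add: ennreal_mult)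
    also have "\<dots> \<le> ennreal ((2 * C * \<kappa> i t)\<^sup>2)" by (rule ennreal_leI) (simp add: power_mult_distrib)
    finally show "n2 (G \<gamma> i t) \<le> ennreal ((2 * C * \<kappa> i t)\<^sup>2)" .
  qed (use C in auto)
  then show ?case by simp
next
  case (Cons e es)
  obtain k' where k: "k = Suc k'" using Cons.prems(4) by (cases k) auto
  obtain u' where u': "dd e u u'" "cls k' \<kappa> u'" using Cons.prems(1) unfolding k cls.simps by blast
  have P': "P (nx e \<gamma>)" using Cons.prems(5)[of "[e]" es] by simp
  have z: "n2 (\<lambda>x. G (nx e \<gamma>) i t x - u' i t x) = 0" if i: "i \<in> S" "t \<in> Iv i" for i t
  proof (rule HD_unique[of "Tm i" e "G \<gamma> i" "G (nx e \<gamma>) i" "u i" "u' i"])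
    show "HD (Tm i) e (G \<gamma> i) (G (nx e \<gamma>) i)" using D[OF Cons.prems(2) P'] i by (simp add: dd_def)
  qed (use u' Cons.prems(2,3) P' rgG cls_rg[OF Cons.prems(1)] cls_rg[OF u'(2)] i in \<open>auto simp: dd_def rg_def\<close>)
  have "l2b \<kappa> (G (fold nx es (nx e \<gamma>)))"
  proof (rule Cons.IH[OF u'(2) P' z])
    show "length es \<le> k'" using Cons.prems(4) k by simp
    show "P (fold nx es1 (nx e \<gamma>))" if "es = es1 @ es2" for es1 es2
      using Cons.prems(5)[of "e # es1" es2] that by simp
  qed
  then show ?case by simp
qed

end

subsection \<open>Velocity averages of locally bounded sequences\<close>

lemma phase_measurable:
  fixes f :: "(real^3) \<times> (real^3) \<Rightarrow> 'b::topological_space"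
  assumes "f \<in> borel_measurable (borel \<Otimes>\<^sub>M borel)"
  shows "f \<in> borel_measurable PM"
proof -
  have "(\<lambda>p::(real^3)\<times>(real^3). (fst p, snd p)) \<in> PM \<rightarrow>\<^sub>M borel \<Otimes>\<^sub>M borel"
  proof (rule measurable_Pair)
    show "fst \<in> PM \<rightarrow>\<^sub>M (borel :: (real^3) measure)"
      by (rule measurable_compose[OF measurable_fst]) (rule measurable_restrict_space1, simp)
    show "snd \<in> PM \<rightarrow>\<^sub>M (borel :: (real^3) measure)"
      by (rule measurable_compose[OF measurable_snd]) simp
  qed
  from measurable_compose[OF this assms] show ?thesis by simp
qed

lemma nn_integral_phase:
  fixes f :: "(real^3) \<times> (real^3) \<Rightarrow> ennreal"
  assumes "f \<in> borel_measurable (borel \<Otimes>\<^sub>M borel)"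
  shows "(\<integral>\<^sup>+p. f p \<partial>PM) = (\<integral>\<^sup>+x. \<integral>\<^sup>+v. f (x, v) \<partial>lborel \<partial>MQ)"
  by (rule lborel.nn_integral_fst[symmetric]) (rule phase_measurable[OF assms])

lemma n2_mom_le:
  assumes [measurable]: "(\<lambda>(x,v). D x v) \<in> borel_measurable (borel \<Otimes>\<^sub>M borel)"
  shows "n2 (\<lambda>x. mom (peval L) (D x)) \<le> ennreal (cw L) * (\<integral>\<^sup>+p. ennreal ((D (fst p) (snd p))\<^sup>2 / (1 + (norm (snd p))\<^sup>2)) \<partial>PM)"
proof -
  have "n2 (\<lambda>x. mom (peval L) (D x)) \<le> (\<integral>\<^sup>+x. ennreal (cw L) * (\<integral>\<^sup>+v. ennreal ((D x v)\<^sup>2 / (1 + (norm v)\<^sup>2)) \<partial>lborel) \<partial>MQ)"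
    unfolding n2_def by (intro nn_integral_mono mom_bound_weighted) simp
  also have "\<dots> = ennreal (cw L) * (\<integral>\<^sup>+x. \<integral>\<^sup>+v. ennreal ((D x v)\<^sup>2 / (1 + (norm v)\<^sup>2)) \<partial>lborel \<partial>MQ)"
    by (rule nn_integral_cmult) (rule measurable_MQ, measurable)
  also have "(\<integral>\<^sup>+x. \<integral>\<^sup>+v. ennreal ((D x v)\<^sup>2 / (1 + (norm v)\<^sup>2)) \<partial>lborel \<partial>MQ)
      = (\<integral>\<^sup>+p. ennreal ((D (fst p) (snd p))\<^sup>2 / (1 + (norm (snd p))\<^sup>2)) \<partial>PM)"
    by (subst nn_integral_phase) (simp_all, measurable)
  finally show ?thesis .
qed

lemma n2_mom_bound:
  assumes [measurable]: "(\<lambda>(x,v). D x v) \<in> borel_measurable (borel \<Otimes>\<^sub>M borel)"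
  shows "n2 (\<lambda>x. mom (peval L) (D x)) \<le> ennreal (cw L) * (\<integral>\<^sup>+p. ennreal ((D (fst p) (snd p))\<^sup>2) \<partial>PM)"
proof -
  have "(\<integral>\<^sup>+p. ennreal ((D (fst p) (snd p))\<^sup>2 / (1 + (norm (snd p))\<^sup>2)) \<partial>PM)
     \<le> (\<integral>\<^sup>+p. ennreal ((D (fst p) (snd p))\<^sup>2) \<partial>PM)"
  proof (intro nn_integral_mono ennreal_leI)
    fix p :: "(real^3) \<times> (real^3)"
    have "(D (fst p) (snd p))\<^sup>2 / (1 + (norm (snd p))\<^sup>2) \<le> (D (fst p) (snd p))\<^sup>2 / 1"
      by (intro divide_left_mono) auto
    then show "(D (fst p) (snd p))\<^sup>2 / (1 + (norm (snd p))\<^sup>2) \<le> (D (fst p) (snd p))\<^sup>2" by simp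
  qed
  from order_trans[OF n2_mom_le[OF assms] mult_left_mono[OF this]] show ?thesis by simp
qed

text \<open>Convergence of moments without an integrable majorant in v. For |v| \<le> R the
  integrands are uniformly bounded on a set of finite measure and dominated convergence applies; for
  |v| > R the weight 1 / (1 + |v|^2) leaves at most C / (1 + R^2).\<close>

lemma mom_averaging:
  fixes D :: "nat \<Rightarrow> real^3 \<Rightarrow> real^3 \<Rightarrow> real"
  assumes m: "\<And>n. (\<lambda>(x,v). D n x v) \<in> borel_measurable (borel \<Otimes>\<^sub>M borel)"
    and b: "\<And>n. (\<integral>\<^sup>+p. ennreal ((D n (fst p) (snd p))\<^sup>2) \<partial>PM) \<le> ennreal C"
    and p: "\<And>x v. (\<lambda>n. D n x v) \<longlonglongrightarrow> 0"
    and l: "\<And>R::real. \<exists>K. \<forall>n. \<forall>x\<in>cbox 0 One. \<forall>v. norm v \<le> R \<longrightarrow> \<bar>D n x v\<bar> \<le> K"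
  shows "(\<lambda>n. n2 (\<lambda>x. mom (peval L) (D n x))) \<longlonglongrightarrow> 0"
proof (rule tendsto0_ennreal_le)
  let ?P = "PM"
  let ?I = "\<lambda>n. (\<integral>\<^sup>+p. ennreal ((D n (fst p) (snd p))\<^sup>2 / (1 + (norm (snd p))\<^sup>2)) \<partial>?P)"
  note [measurable] = m
  have Dm[measurable]: "(\<lambda>p. D n (fst p) (snd p)) \<in> borel_measurable ?P" for n
    using phase_measurable[OF m[of n]] by (simp add: case_prod_beta')
  have sndm[measurable]: "(\<lambda>p::(real^3)\<times>(real^3). norm (snd p)) \<in> borel_measurable ?P"
    by (rule phase_measurable) measurable
  have "?I \<longlonglongrightarrow> 0"
  proof (rule tendsto0_ennrealI)
    fix \<epsilon> :: real assume e: "\<epsilon> > 0"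
    \<comment> \<open>Chosen so that |C| / (1 + R^2) is at most \<epsilon> / 2.\<close>
    define R where "R = sqrt (2 * \<bar>C\<bar> / \<epsilon>)"
    have R0: "R \<ge> 0" using e by (simp add: R_def)
    have R2: "R\<^sup>2 = 2 * \<bar>C\<bar> / \<epsilon>" using e by (simp add: R_def)
    obtain K where K: "\<And>n x v. x \<in> cbox 0 One \<Longrightarrow> norm v \<le> R \<Longrightarrow> \<bar>D n x v\<bar> \<le> K" using l[of R] by blast
    let ?J = "\<lambda>n. (\<integral>\<^sup>+p. ennreal ((D n (fst p) (snd p))\<^sup>2) * indicator {..R} (norm (snd p)) \<partial>?P)"
    have "?J \<longlonglongrightarrow> (\<integral>\<^sup>+p. 0 \<partial>?P)"
    proof (rule nn_integral_dominated_convergence[where w="\<lambda>p. ennreal (K\<^sup>2) * indicator {..R} (norm (snd p))"])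
      show "AE p in ?P. ennreal ((D j (fst p) (snd p))\<^sup>2) * indicator {..R} (norm (snd p)) \<le> ennreal (K\<^sup>2) * indicator {..R} (norm (snd p))" for j
      proof (rule AE_I2)
        fix p assume "p \<in> space ?P"
        then have "fst p \<in> cbox 0 One" by (auto simp: space_pair_measure)
        then show "ennreal ((D j (fst p) (snd p))\<^sup>2) * indicator {..R} (norm (snd p)) \<le> ennreal (K\<^sup>2) * indicator {..R} (norm (snd p))"
          using K[of "fst p" "snd p" j] by (auto simp: indicator_def abs_le_square_iff[symmetric] intro!: ennreal_leI)
      qed
      have "(\<integral>\<^sup>+p. ennreal (K\<^sup>2) * indicator {..R} (norm (snd p)) \<partial>?P) = (\<integral>\<^sup>+x. \<integral>\<^sup>+v. ennreal (K\<^sup>2) * indicator {..R} (norm (v::real^3)) \<partial>lborel \<partial>MQ)"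
        by (subst nn_integral_phase) (simp_all, measurable)
      also have "\<dots> = (\<integral>\<^sup>+v. ennreal (K\<^sup>2) * indicator {..R} (norm (v::real^3)) \<partial>lborel)"
        by (subst nn_integral_const) (simp_all only: MQ.emeasure_space_1 mult_1_right)
      also have "\<dots> = ennreal (K\<^sup>2) * emeasure lborel (cball (0::real^3) R)"
        by (subst nn_integral_cmult_indicator[symmetric]) (auto intro!: nn_integral_cong simp: indicator_def)
      also have "\<dots> < \<infinity>" by (simp add: ennreal_mult_less_top emeasure_lborel_cball_finite[unfolded infinity_ennreal_def])
      finally show "(\<integral>\<^sup>+p. ennreal (K\<^sup>2) * indicator {..R} (norm (snd p)) \<partial>?P) < \<infinity>" .
      show "AE q in ?P. (\<lambda>j. ennreal ((D j (fst q) (snd q))\<^sup>2) * indicator {..R} (norm (snd q))) \<longlonglongrightarrow> 0"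
      proof (rule AE_I2)
        fix q :: "(real^3) \<times> (real^3)"
        have "(\<lambda>j. (D j (fst q) (snd q))\<^sup>2 * indicator {..R} (norm (snd q))) \<longlonglongrightarrow> 0\<^sup>2 * indicator {..R} (norm (snd q))"
          by (intro tendsto_mult tendsto_power p tendsto_const)
        then have "(\<lambda>j. ennreal ((D j (fst q) (snd q))\<^sup>2 * indicator {..R} (norm (snd q)))) \<longlonglongrightarrow> ennreal 0"
          by (intro tendsto_ennrealI) simp
        moreover have "ennreal ((D j (fst q) (snd q))\<^sup>2 * indicator {..R} (norm (snd q))) = ennreal ((D j (fst q) (snd q))\<^sup>2) * indicator {..R} (norm (snd q))" for j
          by (auto simp: indicator_def)
        ultimately show "(\<lambda>j. ennreal ((D j (fst q) (snd q))\<^sup>2) * indicator {..R} (norm (snd q))) \<longlonglongrightarrow> 0"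
          by simp
      qed
    qed measurable
    then have J: "?J \<longlonglongrightarrow> 0" by simp
    have e2: "0 < ennreal (\<epsilon>/2)" using e by simp
    show "\<forall>\<^sub>F n in sequentially. ?I n \<le> ennreal \<epsilon>"
      using order_tendstoD(2)[OF J e2]
    proof eventually_elim
      case (elim n)
      have "?I n \<le> (\<integral>\<^sup>+p. ennreal ((D n (fst p) (snd p))\<^sup>2) * indicator {..R} (norm (snd p)) + ennreal (1 / (1 + R\<^sup>2)) * ennreal ((D n (fst p) (snd p))\<^sup>2) \<partial>?P)"
      proof (rule nn_integral_mono)
        fix q :: "(real^3) \<times> (real^3)"
        let ?d = "(D n (fst q) (snd q))\<^sup>2" and ?v = "norm (snd q)"
        have pos: "1 + R\<^sup>2 > 0" by (simp add: add_pos_nonneg)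
        show "ennreal (?d / (1 + ?v\<^sup>2)) \<le> ennreal ?d * indicator {..R} ?v + ennreal (1 / (1 + R\<^sup>2)) * ennreal ?d"
        proof (cases "?v \<le> R")
          case True
          have "?d / (1 + ?v\<^sup>2) \<le> ?d / 1" by (intro divide_left_mono) auto
          then have "ennreal (?d / (1 + ?v\<^sup>2)) \<le> ennreal ?d" by (intro ennreal_leI) simp
          then show ?thesis using True by (simp add: add_increasing2)
        next
          case False
          then have "R\<^sup>2 \<le> ?v\<^sup>2" using R0 by (intro power_mono) auto
          then have "?d / (1 + ?v\<^sup>2) \<le> ?d / (1 + R\<^sup>2)" using pos by (intro divide_left_mono) auto
          then have "ennreal (?d / (1 + ?v\<^sup>2)) \<le> ennreal (1 / (1 + R\<^sup>2) * ?d)" by (intro ennreal_leI) simp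
          also have "\<dots> = ennreal (1 / (1 + R\<^sup>2)) * ennreal ?d" using pos by (intro ennreal_mult) auto
          finally show ?thesis using False by simp
        qed
      qed
      also have "\<dots> = ?J n + ennreal (1 / (1 + R\<^sup>2)) * (\<integral>\<^sup>+p. ennreal ((D n (fst p) (snd p))\<^sup>2) \<partial>?P)"
        by (subst nn_integral_add) (auto simp: nn_integral_cmult)
      also have "\<dots> \<le> ennreal (\<epsilon>/2) + ennreal (1 / (1 + R\<^sup>2)) * ennreal C"
        using elim b[of n] by (intro add_mono mult_left_mono) auto
      also have "\<dots> \<le> ennreal (\<epsilon>/2) + ennreal (\<epsilon>/2)"
      proof (rule add_left_mono)
        have "1 / (1 + R\<^sup>2) * \<bar>C\<bar> \<le> \<epsilon> / 2"
        proof -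
          have pos: "1 + R\<^sup>2 > 0" by (simp add: add_pos_nonneg)
          have "\<bar>C\<bar> = \<epsilon> / 2 * R\<^sup>2" using e R2 by simp
          also have "\<dots> \<le> \<epsilon> / 2 * (1 + R\<^sup>2)" using e by (intro mult_left_mono) auto
          finally show ?thesis using pos by (simp add: pos_divide_le_eq)
        qed
        moreover have "ennreal (1 / (1 + R\<^sup>2)) * ennreal C \<le> ennreal (1 / (1 + R\<^sup>2)) * ennreal \<bar>C\<bar>"
          by (intro mult_left_mono ennreal_leI) auto
        moreover have "ennreal (1 / (1 + R\<^sup>2)) * ennreal \<bar>C\<bar> = ennreal (1 / (1 + R\<^sup>2) * \<bar>C\<bar>)"
          by (subst ennreal_mult) (simp_all add: add_nonneg_nonneg)
        ultimately show "ennreal (1 / (1 + R\<^sup>2)) * ennreal C \<le> ennreal (\<epsilon>/2)"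
          by (metis ennreal_leI order_trans)
      qed
      also have "\<dots> = ennreal \<epsilon>" using e by (simp add: ennreal_plus[symmetric] del: ennreal_plus)
      finally show ?case .
    qed
  qed
  then show "(\<lambda>n. ennreal (cw L) * ?I n) \<longlonglongrightarrow> 0" by (intro tendsto0_ennreal_cmult) auto
  show "\<forall>\<^sub>F n in sequentially. n2 (\<lambda>x. mom (peval L) (D n x)) \<le> ennreal (cw L) * ?I n"
    by (intro always_eventually allI n2_mom_le m)
qed

subsection \<open>Differentiability from continuous partial derivatives\<close>

text \<open>Walk from x to y along the three coordinate directions and apply the mean value theorem
  on each leg; continuity of the partial derivatives compares the intermediate values with those at
  x.\<close>

lemma has_derivative_partials_vec3:
  fixes u :: "real^3 \<Rightarrow> real"
  assumes d: "\<And>x j. ((\<lambda>s. u (x + s *\<^sub>R axis j 1)) has_real_derivative U j x) (at 0)"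
    and c: "\<And>j. continuous_on UNIV (U j)"
  shows "(u has_derivative (\<lambda>h. \<Sum>j\<in>UNIV. h$j * U j x)) (at x)"
  unfolding has_derivative_at_alt
proof (intro conjI allI impI)
  show "bounded_linear (\<lambda>h. \<Sum>j\<in>UNIV. h$j * U j x)"
    by (intro bounded_linear_sum bounded_linear_mult_left bounded_linear_compose[OF bounded_linear_mult_left] bounded_linear_vec_nth)
  fix e :: real assume e: "e > 0"
  have "\<exists>d>0. \<forall>y. dist y x < d \<longrightarrow> dist (U j y) (U j x) < e/3" for j
    using c[of j] e unfolding continuous_on_iff by (metis UNIV_I divide_pos_pos zero_less_numeral)
  then obtain dl where dl: "\<And>j. dl j > 0" "\<And>j y. dist y x < dl j \<Longrightarrow> \<bar>U j y - U j x\<bar> < e/3"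
    unfolding dist_real_def by metis
  define d0 where "d0 = Min (range dl)"
  have d0: "d0 > 0" "\<And>j. d0 \<le> dl j" using dl(1) by (auto simp: d0_def)
  have step: "\<exists>\<xi>. \<bar>\<xi>\<bar> \<le> \<bar>s\<bar> \<and> u (p + s *\<^sub>R axis j 1) - u p = s * U j (p + \<xi> *\<^sub>R axis j 1)" for p s j
  proof -
    have D: "((\<lambda>s. u (p + s *\<^sub>R axis j 1)) has_real_derivative U j (p + r *\<^sub>R axis j 1)) (at r)" for r
    proof -
      have "((\<lambda>s. u ((p + r *\<^sub>R axis j 1) + (s - r) *\<^sub>R axis j 1)) has_real_derivative U j (p + r *\<^sub>R axis j 1) * 1) (at r)"
        by (rule DERIV_chain2[where g="\<lambda>s. s - r"]) (use d[of "p + r *\<^sub>R axis j 1" j] in \<open>auto intro!: derivative_eq_intros\<close>)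
      moreover have "(p + r *\<^sub>R axis j 1) + (s - r) *\<^sub>R axis j 1 = p + s *\<^sub>R axis j 1" for s
        by (simp add: algebra_simps)
      ultimately show ?thesis by simp
    qed
    show ?thesis
    proof (cases s "0::real" rule: linorder_cases)
      case less
      obtain z where "s < z" "z < 0" "u (p + 0 *\<^sub>R axis j 1) - u (p + s *\<^sub>R axis j 1) = (0 - s) * U j (p + z *\<^sub>R axis j 1)"
        using MVT2[of s 0 "\<lambda>s. u (p + s *\<^sub>R axis j 1)" "\<lambda>z. U j (p + z *\<^sub>R axis j 1)"] less D by blast
      then show ?thesis by (intro exI[of _ z]) (auto simp: algebra_simps)
    next
      case equal then show ?thesis by (intro exI[of _ 0]) auto
    next
      case greater
      obtain z where "0 < z" "z < s" "u (p + s *\<^sub>R axis j 1) - u (p + 0 *\<^sub>R axis j 1) = (s - 0) * U j (p + z *\<^sub>R axis j 1)"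
        using MVT2[of 0 s "\<lambda>s. u (p + s *\<^sub>R axis j 1)" "\<lambda>z. U j (p + z *\<^sub>R axis j 1)"] greater D by blast
      then show ?thesis by (intro exI[of _ z]) auto
    qed
  qed
  show "\<exists>d>0. \<forall>y. norm (y - x) < d \<longrightarrow> norm (u y - u x - (\<Sum>j\<in>UNIV. (y - x)$j * U j x)) \<le> e * norm (y - x)"
  \<comment> \<open>Each leg is shorter than d0 / 3, so all intermediate points stay within d0 of
    x.\<close>
  proof (intro exI[of _ "d0 / 3"] conjI allI impI)
    show "d0 / 3 > 0" using d0 by simp
    fix y assume y: "norm (y - x) < d0 / 3"
    define h where "h = y - x"
    have hj: "\<bar>h$j\<bar> \<le> norm h" for j by (rule component_le_norm_cart)
    define p1 where "p1 = x + h$1 *\<^sub>R axis 1 1"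
    define p2 where "p2 = p1 + h$2 *\<^sub>R axis 2 1"
    have p3: "y = p2 + h$3 *\<^sub>R axis 3 1"
      by (simp add: p2_def p1_def h_def vec_eq_iff forall_3 axis_def)
    obtain a1 where a1: "\<bar>a1\<bar> \<le> \<bar>h$1\<bar>" "u p1 - u x = h$1 * U 1 (x + a1 *\<^sub>R axis 1 1)" using step[of "h$1" x 1] unfolding p1_def by blast
    obtain a2 where a2: "\<bar>a2\<bar> \<le> \<bar>h$2\<bar>" "u p2 - u p1 = h$2 * U 2 (p1 + a2 *\<^sub>R axis 2 1)" using step[of "h$2" p1 2] unfolding p2_def by blast
    obtain a3 where a3: "\<bar>a3\<bar> \<le> \<bar>h$3\<bar>" "u y - u p2 = h$3 * U 3 (p2 + a3 *\<^sub>R axis 3 1)" using step[of "h$3" p2 3] unfolding p3 by blast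
    have n: "norm (a *\<^sub>R axis j 1 :: real^3) = \<bar>a\<bar>" for a j by (simp add: norm_Basis axis_in_Basis_iff)
    have q1: "dist (x + a1 *\<^sub>R axis 1 1) x < d0"
      using a1(1) hj[of 1] y d0 by (simp add: dist_norm h_def n)
    have q2: "dist (p1 + a2 *\<^sub>R axis 2 1) x < d0"
    proof -
      have "dist (p1 + a2 *\<^sub>R axis 2 1) x = norm (h$1 *\<^sub>R axis 1 1 + a2 *\<^sub>R axis 2 1 :: real^3)" by (simp add: p1_def dist_norm algebra_simps)
      also have "\<dots> \<le> \<bar>h$1\<bar> + \<bar>a2\<bar>" using norm_triangle_ineq[of "h$1 *\<^sub>R axis 1 1 :: real^3" "a2 *\<^sub>R axis 2 1"] by (simp only: n)
      finally show ?thesis using a2(1) hj[of 1] hj[of 2] y d0 unfolding h_def by linarith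
    qed
    have q3: "dist (p2 + a3 *\<^sub>R axis 3 1) x < d0"
    proof -
      have "dist (p2 + a3 *\<^sub>R axis 3 1) x = norm ((h$1 *\<^sub>R axis 1 1 + h$2 *\<^sub>R axis 2 1) + a3 *\<^sub>R axis 3 1 :: real^3)" by (simp add: p1_def p2_def dist_norm algebra_simps)
      also have "\<dots> \<le> norm (h$1 *\<^sub>R axis 1 1 + h$2 *\<^sub>R axis 2 1 :: real^3) + \<bar>a3\<bar>" using norm_triangle_ineq[of _ "a3 *\<^sub>R axis 3 1 :: real^3"] by (simp only: n)
      also have "\<dots> \<le> (\<bar>h$1\<bar> + \<bar>h$2\<bar>) + \<bar>a3\<bar>" using norm_triangle_ineq[of "h$1 *\<^sub>R axis 1 1 :: real^3" "h$2 *\<^sub>R axis 2 1"] by (simp only: n add_right_mono)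
      finally show ?thesis using a3(1) hj[of 1] hj[of 2] hj[of 3] y d0 unfolding h_def by linarith
    qed
    have E: "\<bar>h$j * U j q - h$j * U j x\<bar> \<le> norm h * (e/3)" if "dist q x < d0" for j q
    proof -
      have "\<bar>U j q - U j x\<bar> \<le> e/3" using dl(2)[of q j] that d0(2)[of j] by simp
      then have "\<bar>h$j\<bar> * \<bar>U j q - U j x\<bar> \<le> norm h * (e/3)" using hj[of j] by (intro mult_mono) auto
      then show ?thesis by (simp add: abs_mult[symmetric] right_diff_distrib)
    qed
    have "u y - u x - (\<Sum>j\<in>UNIV. (y - x)$j * U j x) =
      (h$1 * U 1 (x + a1 *\<^sub>R axis 1 1) - h$1 * U 1 x) + (h$2 * U 2 (p1 + a2 *\<^sub>R axis 2 1) - h$2 * U 2 x) + (h$3 * U 3 (p2 + a3 *\<^sub>R axis 3 1) - h$3 * U 3 x)"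
      using a1(2) a2(2) a3(2) unfolding h_def[symmetric] sum_3 by linarith
    moreover have "e * norm h = norm h * (e/3) + norm h * (e/3) + norm h * (e/3)" by (simp add: field_simps)
    ultimately have "\<bar>u y - u x - (\<Sum>j\<in>UNIV. (y - x)$j * U j x)\<bar> \<le> e * norm h"
      using E[OF q1, of 1] E[OF q2, of 2] E[OF q3, of 3] by linarith
    then show "norm (u y - u x - (\<Sum>j\<in>UNIV. (y - x)$j * U j x)) \<le> e * norm (y - x)" by (simp add: h_def)
  qed
qed

subsection \<open>The Sobolev inequality on the unit cube\<close>

lemma Cauchy_Schwarz_interval:
  fixes \<psi> :: "real \<Rightarrow> real"
  assumes c: "continuous_on {0..h} \<psi>" and h: "h \<ge> 0"
  shows "ennreal ((LBINT r. indicator {0..h} r *\<^sub>R \<psi> r)\<^sup>2) \<le> ennreal h * (\<integral>\<^sup>+r. ennreal ((\<psi> r)\<^sup>2) * indicator {0..h} r \<partial>lborel)"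
proof -
  define f :: "real \<Rightarrow> real" where "f = indicator {0..h}"
  define g where "g r = indicator {0..h} r *\<^sub>R \<psi> r" for r
  have gm[measurable]: "g \<in> borel_measurable borel"
    unfolding g_def by (intro borel_measurable_continuous_on_indicator c) auto
  have [measurable]: "f \<in> borel_measurable borel" by (simp add: f_def)
  have f2: "(\<lambda>r. (f r)\<^sup>2) = indicator {0..h}" by (auto simp: f_def indicator_def fun_eq_iff)
  have f: "integrable lborel (\<lambda>r. (f r)\<^sup>2)" unfolding f2 by (simp add: h)
  have fi: "(LBINT r. (f r)\<^sup>2) = h" unfolding f2 using h by simp
  have g2: "(g r)\<^sup>2 = indicator {0..h} r *\<^sub>R (\<psi> r)\<^sup>2" for r by (auto simp: g_def indicator_def)
  have g: "integrable lborel (\<lambda>r. (g r)\<^sup>2)"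
    unfolding g2 using borel_integrable_compact[of "{0..h}" "\<lambda>r. (\<psi> r)\<^sup>2"] c
    by (auto intro: continuous_intros simp: indicator_def if_distrib cong: if_cong)
  have fg: "f r * g r = g r" for r by (auto simp: f_def g_def indicator_def)
  have "(LBINT r. g r)\<^sup>2 \<le> h * (LBINT r. (g r)\<^sup>2)"
    using Cauchy_Schwarz_integral(2)[OF _ _ f g] by (simp add: fg fi)
  then have "ennreal ((LBINT r. g r)\<^sup>2) \<le> ennreal (h * (LBINT r. (g r)\<^sup>2))" by (rule ennreal_leI)
  also have "\<dots> = ennreal h * ennreal (LBINT r. (g r)\<^sup>2)" using h by (simp add: ennreal_mult)
  also have "ennreal (LBINT r. (g r)\<^sup>2) = (\<integral>\<^sup>+r. ennreal ((g r)\<^sup>2) \<partial>lborel)"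
    by (rule nn_integral_eq_integral[symmetric]) (use g in auto)
  also have "\<dots> = (\<integral>\<^sup>+r. ennreal ((\<psi> r)\<^sup>2) * indicator {0..h} r \<partial>lborel)"
    by (intro nn_integral_cong) (auto simp: g_def indicator_def)
  finally show ?thesis by (simp add: g_def)
qed

lemma nn_integral_affine3:
  fixes f :: "real^3 \<Rightarrow> ennreal"
  assumes [measurable]: "f \<in> borel_measurable borel" and c: "c > 0"
  shows "(\<integral>\<^sup>+x. f x \<partial>lborel) = ennreal (c^3) * (\<integral>\<^sup>+x. f (t + c *\<^sub>R x) \<partial>lborel)"
proof -
  define D where "D = distr lborel borel (\<lambda>x::real^3. t + c *\<^sub>R x)"
  have 1: "(lborel :: (real^3) measure) = density D (\<lambda>_. ennreal (c^3))"
    using lborel_affine[of c t] c by (simp add: D_def)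
  have "(\<integral>\<^sup>+x. f x \<partial>lborel) = (\<integral>\<^sup>+x. f x \<partial>density D (\<lambda>_. ennreal (c^3)))" by (simp only: 1[symmetric])
  also have "\<dots> = ennreal (c^3) * (\<integral>\<^sup>+x. f x \<partial>D)"
    by (subst nn_integral_density) (auto simp: D_def nn_integral_cmult)
  also have "(\<integral>\<^sup>+x. f x \<partial>D) = (\<integral>\<^sup>+x. f (t + c *\<^sub>R x) \<partial>lborel)"
    unfolding D_def by (subst nn_integral_distr) auto
  finally show ?thesis .
qed

text \<open>The contraction towards x maps the cube into itself, by convexity, and has Jacobian
  c^3.\<close>

lemma nn_integral_MQ_contract:
  fixes f :: "real^3 \<Rightarrow> ennreal"
  assumes [measurable]: "f \<in> borel_measurable borel" and x: "x \<in> cbox 0 One" and r: "0 < c" "c \<le> 1"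
  shows "ennreal (c^3) * (\<integral>\<^sup>+y. f (x + c *\<^sub>R (y - x)) \<partial>MQ) \<le> (\<integral>\<^sup>+y. f y \<partial>MQ)"
proof -
  have M: "(\<integral>\<^sup>+y. k y \<partial>MQ) = (\<integral>\<^sup>+y. k y * indicator (cbox 0 One) y \<partial>lborel)" for k :: "real^3 \<Rightarrow> ennreal"
    by (subst nn_integral_restrict_space) auto
  let ?t = "(1 - c) *\<^sub>R x"
  have e: "x + c *\<^sub>R (y - x) = ?t + c *\<^sub>R y" for y by (simp add: algebra_simps)
  have "(\<integral>\<^sup>+y. f (x + c *\<^sub>R (y - x)) \<partial>MQ) \<le> (\<integral>\<^sup>+y. f (?t + c *\<^sub>R y) * indicator (cbox 0 One) (?t + c *\<^sub>R y) \<partial>lborel)"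
    unfolding M e
  proof (intro nn_integral_mono mult_left_mono)
    fix y
    have "y \<in> cbox 0 One \<Longrightarrow> ?t + c *\<^sub>R y \<in> cbox 0 One"
      by (rule convexD[OF convex_box(1)[of 0 One], OF x]) (use r in auto)
    then show "(indicator (cbox 0 One) y :: ennreal) \<le> indicator (cbox 0 One) (?t + c *\<^sub>R y)"
      by (auto simp: indicator_def)
  qed auto
  then have "ennreal (c^3) * (\<integral>\<^sup>+y. f (x + c *\<^sub>R (y - x)) \<partial>MQ) \<le> ennreal (c^3) * (\<integral>\<^sup>+y. f (?t + c *\<^sub>R y) * indicator (cbox 0 One) (?t + c *\<^sub>R y) \<partial>lborel)"
    by (rule mult_left_mono) simp
  also have "\<dots> = (\<integral>\<^sup>+y. f y * indicator (cbox 0 One) y \<partial>lborel)"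
    by (rule nn_integral_affine3[of "\<lambda>y. f y * indicator (cbox 0 One) y" c ?t, symmetric]) (use r in auto)
  finally show ?thesis unfolding M[of f] .
qed

lemma path_derivative:
  fixes u :: "real^3 \<Rightarrow> real"
  assumes "\<And>x. (u has_derivative (\<lambda>h. \<Sum>j\<in>UNIV. h$j * U j x)) (at x)"
  shows "((\<lambda>r. u (x + r\<^sup>2 *\<^sub>R z)) has_real_derivative (\<Sum>j\<in>UNIV. 2 * r * z$j * U j (x + r\<^sup>2 *\<^sub>R z))) (at r)"
proof -
  have p: "((\<lambda>r. x + r\<^sup>2 *\<^sub>R z) has_derivative (\<lambda>s. (2 * r * s) *\<^sub>R z)) (at r)"
    by (auto intro!: derivative_eq_intros)
  have "((\<lambda>r. u (x + r\<^sup>2 *\<^sub>R z)) has_derivative (\<lambda>s. \<Sum>j\<in>UNIV. ((2 * r * s) *\<^sub>R z)$j * U j (x + r\<^sup>2 *\<^sub>R z))) (at r)"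
    by (rule has_derivative_compose[OF p assms])
  moreover have "(\<Sum>j\<in>UNIV. ((2 * r * s) *\<^sub>R z)$j * U j (x + r\<^sup>2 *\<^sub>R z)) = (\<Sum>j\<in>UNIV. 2 * r * z$j * U j (x + r\<^sup>2 *\<^sub>R z)) * s" for s
    unfolding sum_distrib_right by (rule sum.cong) (simp_all add: mult_ac)
  ultimately show ?thesis by (simp add: has_field_derivative_def)
qed

text \<open>Taylor's formula with base point \<open>y\<close> and remainder along the ray \<open>x + r\<^sup>2 (y - x)\<close>; the quadratic
  parametrization turns the singular weight of the averaged remainder into a bounded one.\<close>

lemma Sobolev_pointwise:
  fixes u :: "real^3 \<Rightarrow> real"
  assumes d: "\<And>x. (u has_derivative (\<lambda>h. \<Sum>j\<in>UNIV. h$j * U j x)) (at x)"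
    and d2: "\<And>j x. (U j has_derivative (\<lambda>h. \<Sum>k\<in>UNIV. h$k * V j k x)) (at x)"
    and cV: "\<And>j k. continuous_on UNIV (V j k)"
    and z: "\<And>j. \<bar>z$j\<bar> \<le> 1"
  shows "ennreal ((u x)\<^sup>2) \<le> 3 * ennreal ((u (x+z))\<^sup>2) + (\<Sum>j\<in>UNIV. 9 * ennreal ((U j (x+z))\<^sup>2))
     + (\<Sum>j\<in>UNIV. \<Sum>k\<in>UNIV. 108 * (\<integral>\<^sup>+r. ennreal (r^6 * (V j k (x + r\<^sup>2 *\<^sub>R z))\<^sup>2) * indicator {0..1} r \<partial>lborel))"
proof -
  let ?p = "\<lambda>r. x + r\<^sup>2 *\<^sub>R z"
  \<comment> \<open>In the derivative of \<phi> the first-order terms cancel, leaving second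
    derivatives with the factor r^3; \<phi> runs from u x at r = 0 to the Taylor polynomial based at
    x + z at r = 1.\<close>
  define \<phi> where "\<phi> r = u (?p r) - r\<^sup>2 * (\<Sum>j\<in>UNIV. z$j * U j (?p r))" for r
  define \<psi> where "\<psi> r = 2 * r^3 * (\<Sum>j\<in>UNIV. \<Sum>k\<in>UNIV. z$j * z$k * V j k (?p r))" for r
  have der: "(\<phi> has_real_derivative - \<psi> r) (at r)" for r
  proof -
    have "(\<phi> has_real_derivative (\<Sum>j\<in>UNIV. 2 * r * z$j * U j (?p r)) - (2 * r * (\<Sum>j\<in>UNIV. z$j * U j (?p r))
        + (\<Sum>j\<in>UNIV. z$j * (\<Sum>k\<in>UNIV. 2 * r * z$k * V j k (?p r))) * r\<^sup>2)) (at r)"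
      unfolding \<phi>_def[abs_def]
      by (intro DERIV_diff DERIV_mult DERIV_sum DERIV_cmult path_derivative[OF d] path_derivative[OF d2])
         (auto intro!: derivative_eq_intros)
    moreover have "(\<Sum>j\<in>UNIV. 2 * r * z$j * U j (?p r)) - (2 * r * (\<Sum>j\<in>UNIV. z$j * U j (?p r))
        + (\<Sum>j\<in>UNIV. z$j * (\<Sum>k\<in>UNIV. 2 * r * z$k * V j k (?p r))) * r\<^sup>2) = - \<psi> r"
      unfolding \<psi>_def sum_3 by (simp add: power2_eq_square power3_eq_cube algebra_simps)
    ultimately show ?thesis by simp
  qed
  have cp: "continuous_on A ?p" for A by (intro continuous_intros)
  have cVp: "continuous_on A (\<lambda>r. V j k (?p r))" for A j k
    by (rule continuous_on_compose2[OF cV[of j k] cp]) auto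
  have c\<psi>: "continuous_on A \<psi>" for A
    unfolding \<psi>_def[abs_def] by (intro continuous_intros cVp)
  have "(LBINT r. indicator {0..1} r *\<^sub>R (- \<psi> r)) = \<phi> 1 - \<phi> 0"
  proof (rule integral_FTC_Icc)
    show "(\<phi> has_vector_derivative - \<psi> r) (at r within {0..1})" for r
      using der[of r] by (auto simp: has_real_derivative_iff_has_vector_derivative intro: has_vector_derivative_at_within)
  qed (auto intro!: continuous_intros c\<psi>)
  moreover have "(LBINT r. indicator {0..1} r *\<^sub>R (- \<psi> r)) = - (LBINT r. indicator {0..1} r *\<^sub>R \<psi> r)"
    by simp
  ultimately have eq: "u x = u (x+z) - (\<Sum>j\<in>UNIV. z$j * U j (x+z)) + (LBINT r. indicator {0..1} r *\<^sub>R \<psi> r)"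
    by (simp add: \<phi>_def)
  define a b c where "a = u (x+z)" and "b = (\<Sum>j\<in>UNIV. z$j * U j (x+z))" and "c = (LBINT r. indicator {0..1} r *\<^sub>R \<psi> r)"
  have "(a - b + c)\<^sup>2 \<le> 3 * a\<^sup>2 + 3 * b\<^sup>2 + 3 * c\<^sup>2"
    using sum_squares_bound[of a "-b"] sum_squares_bound[of a c] sum_squares_bound[of "-b" c]
    by (simp add: power2_eq_square algebra_simps)
  moreover have "b\<^sup>2 \<le> (\<Sum>j\<in>UNIV. 3 * (U j (x+z))\<^sup>2)"
  proof -
    have "b\<^sup>2 \<le> 3 * (\<Sum>j\<in>UNIV. (z$j * U j (x+z))\<^sup>2)"
      unfolding b_def using sum_squared_le_sum_of_squares[of "\<lambda>j. z$j * U j (x+z)" "UNIV::3 set"] by simp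
    also have "\<dots> \<le> 3 * (\<Sum>j\<in>UNIV. (U j (x+z))\<^sup>2)"
    proof (intro mult_left_mono sum_mono)
      fix j
      have "(z$j)\<^sup>2 \<le> 1" using z[of j] by (simp add: abs_square_le_1)
      then have "(z$j)\<^sup>2 * (U j (x+z))\<^sup>2 \<le> 1 * (U j (x+z))\<^sup>2" by (intro mult_right_mono) auto
      then show "(z$j * U j (x+z))\<^sup>2 \<le> (U j (x+z))\<^sup>2" by (simp add: power_mult_distrib)
    qed simp
    finally show ?thesis by (simp add: sum_distrib_left)
  qed
  ultimately have "(u x)\<^sup>2 \<le> (3 * a\<^sup>2 + (\<Sum>j\<in>UNIV. 9 * (U j (x+z))\<^sup>2)) + 3 * c\<^sup>2"
    unfolding eq a_def[symmetric] b_def[symmetric] c_def[symmetric] by (simp add: sum_distrib_left[symmetric])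
  then have "ennreal ((u x)\<^sup>2) \<le> ennreal ((3 * a\<^sup>2 + (\<Sum>j\<in>UNIV. 9 * (U j (x+z))\<^sup>2)) + 3 * c\<^sup>2)"
    by (rule ennreal_leI)
  also have "\<dots> = 3 * ennreal (a\<^sup>2) + (\<Sum>j\<in>UNIV. 9 * ennreal ((U j (x+z))\<^sup>2)) + 3 * ennreal (c\<^sup>2)"
    by (simp add: ennreal_plus sum_nonneg ennreal_mult sum_ennreal[symmetric] del: sum_ennreal)
  also have "\<dots> \<le> 3 * ennreal (a\<^sup>2) + (\<Sum>j\<in>UNIV. 9 * ennreal ((U j (x+z))\<^sup>2)) +
     3 * (\<Sum>j\<in>UNIV. \<Sum>k\<in>UNIV. 36 * (\<integral>\<^sup>+r. ennreal (r^6 * (V j k (?p r))\<^sup>2) * indicator {0..1} r \<partial>lborel))"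
  proof (intro add_left_mono mult_left_mono)
    \<comment> \<open>The constant 36 is 4 from (2 r^3)^2 times 9 from the sum of nine terms; the
      outer factor 3 turns it into the 108 of the statement.\<close>
    have "ennreal (c\<^sup>2) \<le> ennreal 1 * (\<integral>\<^sup>+r. ennreal ((\<psi> r)\<^sup>2) * indicator {0..1} r \<partial>lborel)"
      unfolding c_def by (rule Cauchy_Schwarz_interval[OF c\<psi>]) simp
    also have "\<dots> \<le> (\<integral>\<^sup>+r. (\<Sum>j\<in>UNIV. \<Sum>k\<in>UNIV. 36 * (ennreal (r^6 * (V j k (?p r))\<^sup>2) * indicator {0..1} r)) \<partial>lborel)"
      unfolding ennreal_1 mult_1_left
    proof (rule nn_integral_mono)
      fix r :: real
      have "(\<Sum>j\<in>UNIV. \<Sum>k\<in>UNIV. z$j * z$k * V j k (?p r))\<^sup>2 \<le> 3 * (\<Sum>j\<in>UNIV. (\<Sum>k\<in>UNIV. z$j * z$k * V j k (?p r))\<^sup>2)"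
        using sum_squared_le_sum_of_squares[of "\<lambda>j. \<Sum>k\<in>UNIV. z$j * z$k * V j k (?p r)" "UNIV::3 set"] by simp
      also have "\<dots> \<le> 3 * (\<Sum>j\<in>UNIV. 3 * (\<Sum>k\<in>UNIV. (V j k (?p r))\<^sup>2))"
      proof (intro mult_left_mono sum_mono)
        fix j :: 3
        have "(\<Sum>k\<in>UNIV. z$j * z$k * V j k (?p r))\<^sup>2 \<le> 3 * (\<Sum>k\<in>UNIV. (z$j * z$k * V j k (?p r))\<^sup>2)"
          using sum_squared_le_sum_of_squares[of "\<lambda>k. z$j * z$k * V j k (?p r)" "UNIV::3 set"] by simp
        also have "\<dots> \<le> 3 * (\<Sum>k\<in>UNIV. (V j k (?p r))\<^sup>2)"
        proof (intro mult_left_mono sum_mono)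
          fix k :: 3
          have "\<bar>z$j * z$k\<bar> \<le> 1" using z[of j] z[of k] by (simp add: abs_mult mult_le_one)
          then have "(z$j * z$k)\<^sup>2 \<le> 1" by (simp add: abs_square_le_1)
          then have "(z$j * z$k)\<^sup>2 * (V j k (?p r))\<^sup>2 \<le> 1 * (V j k (?p r))\<^sup>2" by (intro mult_right_mono) auto
          then show "(z$j * z$k * V j k (?p r))\<^sup>2 \<le> (V j k (?p r))\<^sup>2" by (simp add: power_mult_distrib)
        qed simp
        finally show "(\<Sum>k\<in>UNIV. z$j * z$k * V j k (?p r))\<^sup>2 \<le> 3 * (\<Sum>k\<in>UNIV. (V j k (?p r))\<^sup>2)" .
      qed simp
      finally have "(2 * r^3)\<^sup>2 * (\<Sum>j\<in>UNIV. \<Sum>k\<in>UNIV. z$j * z$k * V j k (?p r))\<^sup>2 \<le> (2 * r^3)\<^sup>2 * (3 * (\<Sum>j\<in>UNIV. 3 * (\<Sum>k\<in>UNIV. (V j k (?p r))\<^sup>2)))"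
        by (rule mult_left_mono) simp
      moreover have "(2 * r^3)\<^sup>2 = 4 * r^6" by (simp add: power_mult_distrib flip: power_mult)
      ultimately have "(\<psi> r)\<^sup>2 \<le> (\<Sum>j\<in>UNIV. \<Sum>k\<in>UNIV. 36 * (r^6 * (V j k (?p r))\<^sup>2))"
        unfolding \<psi>_def power_mult_distrib[of "2 * r^3"] by (simp add: sum_distrib_left mult_ac)
      then have "ennreal ((\<psi> r)\<^sup>2) \<le> ennreal (\<Sum>j\<in>UNIV. \<Sum>k\<in>UNIV. 36 * (r^6 * (V j k (?p r))\<^sup>2))"
        by (rule ennreal_leI)
      also have "\<dots> = (\<Sum>j\<in>UNIV. \<Sum>k\<in>UNIV. 36 * ennreal (r^6 * (V j k (?p r))\<^sup>2))"
        by (simp add: sum_nonneg ennreal_mult sum_ennreal[symmetric] del: sum_ennreal)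
      finally show "ennreal ((\<psi> r)\<^sup>2) * indicator {0..1} r \<le> (\<Sum>j\<in>UNIV. \<Sum>k\<in>UNIV. 36 * (ennreal (r^6 * (V j k (?p r))\<^sup>2) * indicator {0..1} r))"
        by (auto simp: indicator_def)
    qed
    also have "\<dots> = (\<Sum>j\<in>UNIV. \<Sum>k\<in>UNIV. 36 * (\<integral>\<^sup>+r. ennreal (r^6 * (V j k (?p r))\<^sup>2) * indicator {0..1} r \<partial>lborel))"
    proof -
      have [measurable]: "(\<lambda>r. V j k (?p r)) \<in> borel_measurable borel" for j k
        by (rule borel_measurable_continuous_onI[OF cVp])
      show ?thesis by (simp add: nn_integral_sum nn_integral_cmult)
    qed
    finally show "ennreal (c\<^sup>2) \<le> (\<Sum>j\<in>UNIV. \<Sum>k\<in>UNIV. 36 * (\<integral>\<^sup>+r. ennreal (r^6 * (V j k (?p r))\<^sup>2) * indicator {0..1} r \<partial>lborel))" .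
  qed simp
  finally show ?thesis
    unfolding a_def by (simp add: sum_distrib_left mult.assoc[symmetric])
qed

text \<open>\<open>Sobolev_pointwise\<close> is averaged over the end point y = x + z in the cube.
  Contracting y towards x by r^2 has Jacobian r^6, exactly the weight in the remainder, so each
  second derivative is controlled by its L2 norm with no singularity left in r. This is where two
  derivatives suffice in dimension three.\<close>

lemma Sobolev_cube:
  fixes u :: "real^3 \<Rightarrow> real"
  assumes d: "\<And>x. (u has_derivative (\<lambda>h. \<Sum>j\<in>UNIV. h$j * U j x)) (at x)"
    and d2: "\<And>j x. (U j has_derivative (\<lambda>h. \<Sum>k\<in>UNIV. h$k * V j k x)) (at x)"
    and cV: "\<And>j k. continuous_on UNIV (V j k)"
    and x: "x \<in> cbox 0 One"
  shows "ennreal ((u x)\<^sup>2) \<le> 108 * (n2 u + (\<Sum>j\<in>UNIV. n2 (U j)) + (\<Sum>j\<in>UNIV. \<Sum>k\<in>UNIV. n2 (V j k)))"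
proof -
  have cu: "continuous_on UNIV u"
    using d by (meson continuous_at_imp_continuous_on has_derivative_continuous)
  have cU: "continuous_on UNIV (U j)" for j
    using d2 by (meson continuous_at_imp_continuous_on has_derivative_continuous)
  have [measurable]: "u \<in> borel_measurable borel" "U j \<in> borel_measurable borel" "V j k \<in> borel_measurable borel" for j k
    using cu cU cV by (auto intro: borel_measurable_continuous_onI)
  define W where "W j k y = (\<integral>\<^sup>+r. ennreal (r^6 * (V j k (x + r\<^sup>2 *\<^sub>R (y - x)))\<^sup>2) * indicator {0..1} r \<partial>lborel)" for j k y
  have Wm[measurable]: "W j k \<in> borel_measurable borel" for j k
    unfolding W_def[abs_def] by measurable
  have WQ: "(\<integral>\<^sup>+y. W j k y \<partial>MQ) \<le> n2 (V j k)" for j k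
  proof -
    interpret P: pair_sigma_finite MQ "lborel :: real measure" ..
    have "(\<integral>\<^sup>+y. W j k y \<partial>MQ) = (\<integral>\<^sup>+r. \<integral>\<^sup>+y. ennreal (r^6 * (V j k (x + r\<^sup>2 *\<^sub>R (y - x)))\<^sup>2) * indicator {0..1} r \<partial>MQ \<partial>lborel)"
      unfolding W_def
    proof (rule P.Fubini'[symmetric])
      have 1: "(\<lambda>p::(real^3) \<times> real. (fst p, snd p)) \<in> MQ \<Otimes>\<^sub>M lborel \<rightarrow>\<^sub>M borel \<Otimes>\<^sub>M borel"
      proof (rule measurable_Pair)
        show "fst \<in> MQ \<Otimes>\<^sub>M (lborel :: real measure) \<rightarrow>\<^sub>M (borel :: (real^3) measure)"
          by (rule measurable_compose[OF measurable_fst]) (rule measurable_restrict_space1, simp)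
        show "snd \<in> MQ \<Otimes>\<^sub>M lborel \<rightarrow>\<^sub>M (borel :: real measure)"
          by (rule measurable_compose[OF measurable_snd]) simp
      qed
      have 2: "(\<lambda>p::(real^3) \<times> real. ennreal ((snd p)^6 * (V j k (x + (snd p)\<^sup>2 *\<^sub>R (fst p - x)))\<^sup>2) * indicator {0..1} (snd p)) \<in> borel_measurable (borel \<Otimes>\<^sub>M borel)"
        by measurable
      show "(\<lambda>(y, r). ennreal (r^6 * (V j k (x + r\<^sup>2 *\<^sub>R (y - x)))\<^sup>2) * indicator {0..1} r) \<in> borel_measurable (MQ \<Otimes>\<^sub>M lborel)"
        using measurable_compose[OF 1 2] by (simp add: case_prod_beta')
    qed
    also have "\<dots> \<le> (\<integral>\<^sup>+r. n2 (V j k) * indicator {0..1::real} r \<partial>lborel)"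
    proof (rule nn_integral_mono)
      fix r :: real
      show "(\<integral>\<^sup>+y. ennreal (r^6 * (V j k (x + r\<^sup>2 *\<^sub>R (y - x)))\<^sup>2) * indicator {0..1} r \<partial>MQ) \<le> n2 (V j k) * indicator {0..1} r"
      proof (cases "r \<in> {0..1} \<and> r \<noteq> 0")
        case True
        then have r: "0 < r\<^sup>2" "r\<^sup>2 \<le> 1" by (auto simp: power_le_one)
        have r6: "(r\<^sup>2)^3 = r^6" by (simp flip: power_mult)
        have "(\<integral>\<^sup>+y. ennreal (r^6 * (V j k (x + r\<^sup>2 *\<^sub>R (y - x)))\<^sup>2) * indicator {0..1} r \<partial>MQ)
           = (\<integral>\<^sup>+y. ennreal ((r\<^sup>2)^3) * ennreal ((V j k (x + r\<^sup>2 *\<^sub>R (y - x)))\<^sup>2) \<partial>MQ)"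
          using True unfolding r6 by (intro nn_integral_cong) (simp add: ennreal_mult)
        also have "\<dots> = ennreal ((r\<^sup>2)^3) * (\<integral>\<^sup>+y. ennreal ((V j k (x + r\<^sup>2 *\<^sub>R (y - x)))\<^sup>2) \<partial>MQ)"
          by (rule nn_integral_cmult) (rule measurable_MQ, measurable)
        also have "\<dots> \<le> n2 (V j k)"
          unfolding n2_def by (rule nn_integral_MQ_contract[of "\<lambda>y. ennreal ((V j k y)\<^sup>2)", OF _ x r]) measurable
        finally show ?thesis using True by simp
      next
        \<comment> \<open>At r = 0 the contraction degenerates, but the weight r^6 vanishes
          there.\<close>
        case False
        then have "r = 0 \<or> r \<notin> {0..1}" by auto
        then show ?thesis by (auto simp: indicator_def)
      qed
    qed
    also have "\<dots> = n2 (V j k)"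
      by (subst nn_integral_cmult_indicator) auto
    finally show ?thesis .
  qed
  have "ennreal ((u x)\<^sup>2) = (\<integral>\<^sup>+y. ennreal ((u x)\<^sup>2) \<partial>MQ)"
    by (subst nn_integral_const) (simp_all only: MQ.emeasure_space_1 mult_1_right)
  also have "\<dots> \<le> (\<integral>\<^sup>+y. 3 * ennreal ((u y)\<^sup>2) + (\<Sum>j\<in>UNIV. 9 * ennreal ((U j y)\<^sup>2)) + (\<Sum>j\<in>UNIV. \<Sum>k\<in>UNIV. 108 * W j k y) \<partial>MQ)"
  proof (rule nn_integral_mono)
    fix y assume "y \<in> space MQ"
    then have y: "y \<in> cbox 0 One" by simp
    have "\<bar>(y - x)$j\<bar> \<le> 1" for j using x y by (auto simp: mem_box_cart abs_le_iff) (smt (verit))+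
    from Sobolev_pointwise[OF d d2 cV this, of x]
    show "ennreal ((u x)\<^sup>2) \<le> 3 * ennreal ((u y)\<^sup>2) + (\<Sum>j\<in>UNIV. 9 * ennreal ((U j y)\<^sup>2)) + (\<Sum>j\<in>UNIV. \<Sum>k\<in>UNIV. 108 * W j k y)"
      by (simp add: W_def)
  qed
  also have "\<dots> = 3 * n2 u + (\<Sum>j\<in>UNIV. 9 * n2 (U j)) + (\<Sum>j\<in>UNIV. \<Sum>k\<in>UNIV. 108 * (\<integral>\<^sup>+y. W j k y \<partial>MQ))"
    unfolding n2_def by (simp add: nn_integral_add nn_integral_sum nn_integral_cmult)
  also have "\<dots> \<le> 108 * n2 u + (\<Sum>j\<in>UNIV. 108 * n2 (U j)) + (\<Sum>j\<in>UNIV. \<Sum>k\<in>UNIV. 108 * n2 (V j k))"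
    by (intro add_mono sum_mono mult_mono WQ) auto
  also have "\<dots> = 108 * (n2 u + (\<Sum>j\<in>UNIV. n2 (U j)) + (\<Sum>j\<in>UNIV. \<Sum>k\<in>UNIV. n2 (V j k)))"
    by (simp add: distrib_left sum_distrib_left)
  finally show ?thesis .
qed

subsection \<open>Families of derivatives with finite energy\<close>

definition ax :: "3 option \<Rightarrow> 4" where
  "ax e = (case e of None \<Rightarrow> 0 | Some j \<Rightarrow> if j = 1 then 1 else if j = 2 then 2 else 3)"

definition inc :: "3 option \<Rightarrow> nat^4 \<Rightarrow> nat^4" where
  "inc e \<alpha> = \<alpha> + axis (ax e) 1"

lemma mi_length_inc[simp]: "mi_length (inc e \<alpha>) = Suc (mi_length \<alpha>)"
proof -
  have "(\<Sum>i\<in>UNIV. (axis (ax e) 1 :: nat^4) $ i) = 1"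
    by (simp add: axis_def)
  then show ?thesis by (simp add: mi_length_def inc_def sum.distrib)
qed

lemma mi_length_zero[simp]: "mi_length 0 = 0" by (simp add: mi_length_def)

lemma inc_commute: "inc e (inc e' \<alpha>) = inc e' (inc e \<alpha>)" by (simp add: inc_def add_ac)

lemma finite_mi_length: "finite {\<alpha>::nat^'n. mi_length \<alpha> \<le> N}"
proof -
  have "{\<alpha>::nat^'n. mi_length \<alpha> \<le> N} \<subseteq> vec_lambda ` (PiE UNIV (\<lambda>_. {..N}))"
  proof
    fix \<alpha> :: "nat^'n" assume "\<alpha> \<in> {\<alpha>. mi_length \<alpha> \<le> N}"
    then have "\<alpha> $ i \<le> N" for i
      using member_le_sum[of i UNIV "\<lambda>i. \<alpha> $ i"] by (simp add: mi_length_def)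
    then have "(\<lambda>i. \<alpha> $ i) \<in> PiE UNIV (\<lambda>_. {..N})" by auto
    then show "\<alpha> \<in> vec_lambda ` (PiE UNIV (\<lambda>_. {..N}))" by (rule rev_image_eqI) simp
  qed
  then show ?thesis by (rule finite_subset) (intro finite_imageI finite_PiE, auto)
qed

lemma per_int: assumes "per f" shows "f (x + of_int n *\<^sub>R axis i 1) = f x"
proof (cases "n \<ge> 0")
  case True then show ?thesis using per_int_shift[OF assms, of x "nat n" i] by simp
next
  case False
  have "f ((x + of_int n *\<^sub>R axis i 1) + real (nat (-n)) *\<^sub>R axis i 1) = f (x + of_int n *\<^sub>R axis i 1)"
    by (rule per_int_shift[OF assms])
  then show ?thesis using False by (simp add: scaleR_add_left[symmetric])
qed

text \<open>Carries bounds proved on the closed cube over to all of space.\<close>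

lemma per_wrap:
  assumes "per f"
  shows "\<exists>y\<in>cbox 0 (One::real^3). f y = f x"
proof -
  define n where "n j = - \<lfloor>x$j\<rfloor>" for j
  define y where "y = x + of_int (n 1) *\<^sub>R axis 1 1 + of_int (n 2) *\<^sub>R axis 2 1 + of_int (n 3) *\<^sub>R axis 3 1"
  have "f y = f x" unfolding y_def by (simp only: per_int[OF assms])
  moreover have "y $ j = frac (x $ j)" for j
    using exhaust_3[of j] by (auto simp: y_def n_def frac_def axis_def)
  then have "y \<in> cbox 0 One" by (simp add: mem_box_cart less_imp_le[OF frac_lt_1])
  ultimately show ?thesis by blast
qed

lemma L2_norm_sq_iter:
  assumes "(\<lambda>(x,v). D x v) \<in> borel_measurable (borel \<Otimes>\<^sub>M borel)"
  shows "L2_norm_sq D = (\<integral>\<^sup>+p. ennreal ((D (fst p) (snd p))\<^sup>2) \<partial>PM)"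
    and "L2_norm_sq D = (\<integral>\<^sup>+x. \<integral>\<^sup>+v. ennreal ((D x v)\<^sup>2) \<partial>lborel \<partial>MQ)"
    and "L2_norm_sq D = (\<integral>\<^sup>+v. n2 (\<lambda>x. D x v) \<partial>lborel)"
proof -
  note [measurable] = assms
  show 1: "L2_norm_sq D = (\<integral>\<^sup>+p. ennreal ((D (fst p) (snd p))\<^sup>2) \<partial>PM)"
    by (simp add: L2_norm_sq_def phase_space_def case_prod_beta')
  have m: "(\<lambda>p. ennreal ((D (fst p) (snd p))\<^sup>2)) \<in> borel_measurable (borel \<Otimes>\<^sub>M borel)" by measurable
  show "L2_norm_sq D = (\<integral>\<^sup>+x. \<integral>\<^sup>+v. ennreal ((D x v)\<^sup>2) \<partial>lborel \<partial>MQ)"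
    unfolding 1 by (subst nn_integral_phase[OF m]) simp
  interpret P: pair_sigma_finite MQ "lborel :: (real^3) measure" ..
  show "L2_norm_sq D = (\<integral>\<^sup>+v. n2 (\<lambda>x. D x v) \<partial>lborel)"
    unfolding 1 n2_def using P.nn_integral_snd[OF phase_measurable[OF m]] by simp
qed

lemma L2_norm_sq_diff:
  assumes [measurable]: "(\<lambda>(x,v). D x v) \<in> borel_measurable (borel \<Otimes>\<^sub>M borel)" "(\<lambda>(x,v). E x v) \<in> borel_measurable (borel \<Otimes>\<^sub>M borel)"
  shows "L2_norm_sq (\<lambda>x v. D x v - E x v) \<le> 2 * L2_norm_sq D + 2 * L2_norm_sq E"
proof -
  have [measurable]: "(\<lambda>p. D (fst p) (snd p)) \<in> borel_measurable PM" "(\<lambda>p. E (fst p) (snd p)) \<in> borel_measurable PM"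
    using phase_measurable[OF assms(1)] phase_measurable[OF assms(2)] by (simp_all add: case_prod_beta')
  have "L2_norm_sq (\<lambda>x v. D x v - E x v) \<le> (\<integral>\<^sup>+p. 2 * ennreal ((D (fst p) (snd p))\<^sup>2) + 2 * ennreal ((E (fst p) (snd p))\<^sup>2) \<partial>PM)"
  proof (subst L2_norm_sq_iter(1), measurable, rule nn_integral_mono)
    fix p :: "(real^3) \<times> (real^3)"
    let ?a = "D (fst p) (snd p)" and ?b = "E (fst p) (snd p)"
    have "(?a - ?b)\<^sup>2 \<le> 2 * ?a\<^sup>2 + 2 * ?b\<^sup>2"
      using sum_squares_bound[of ?a "- ?b"] by (simp add: power2_diff)
    then have "ennreal ((?a - ?b)\<^sup>2) \<le> ennreal (2 * ?a\<^sup>2 + 2 * ?b\<^sup>2)" by (rule ennreal_leI)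
    then show "ennreal ((?a - ?b)\<^sup>2) \<le> 2 * ennreal (?a\<^sup>2) + 2 * ennreal (?b\<^sup>2)" by (simp add: ennreal_plus ennreal_mult)
  qed
  also have "\<dots> = 2 * L2_norm_sq D + 2 * L2_norm_sq E"
    unfolding L2_norm_sq_iter(1)[OF assms(1)] L2_norm_sq_iter(1)[OF assms(2)]
    by (subst nn_integral_add) (auto simp: nn_integral_cmult)
  finally show ?thesis .
qed

lemma n2_cong_AE: "AE x in MQ. u x = w x \<Longrightarrow> n2 u = n2 w"
  unfolding n2_def by (rule nn_integral_cong_AE) auto

text \<open>A positive null sequence attains its maximum. The resulting h < c confines all step
  sizes of a difference quotient to a compact interval inside the lifetime, where continuity gives
  uniform local bounds.\<close>

lemma seq_bounded_below:
  fixes X :: "nat \<Rightarrow> real"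
  assumes "X \<longlonglongrightarrow> 0" "\<And>n. 0 < X n \<and> X n < c"
  shows "\<exists>h. 0 < h \<and> h < c \<and> (\<forall>n. X n \<le> h)"
proof -
  have "\<forall>\<^sub>F n in sequentially. X n < X 0" using order_tendstoD(2)[OF assms(1), of "X 0"] assms(2)[of 0] by auto
  then obtain n0 where n0: "\<And>n. n \<ge> n0 \<Longrightarrow> X n < X 0" by (auto simp: eventually_sequentially)
  define h where "h = Max (X ` {..n0})"
  have "X n \<le> h" for n
  proof (cases "n \<le> n0")
    case True then show ?thesis by (auto simp: h_def)
  next
    case False
    then have "X n \<le> X 0" using n0[of n] by simp
    also have "\<dots> \<le> h" by (auto simp: h_def)
    finally show ?thesis .
  qed
  moreover have "h \<in> X ` {..n0}" unfolding h_def by (rule Max_in) auto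
  ultimately show ?thesis using assms(2) by blast
qed

text \<open>All derivatives in t and x are given as one family over multi-indices, and
  \<open>inc e\<close> adds a derivative in direction e. That the order of differentiation does not
  matter is built into this encoding; for solutions it is justified by
  \<open>mult_deriv_inc\<close>. The bound \<open>B\<close> is used qualitatively, for finiteness
  and convergence, whereas sizes are measured by \<open>en\<close>.\<close>

locale kinetic = sols S Tm for S :: "'i set" and Tm :: "'i \<Rightarrow> real" +
  fixes g :: "'i \<Rightarrow> nat^4 \<Rightarrow> real \<Rightarrow> real^3 \<Rightarrow> real^3 \<Rightarrow> real" and N :: nat and B :: real
  assumes N3: "N \<ge> 3" and B0: "B \<ge> 0"
    and g_cont: "i \<in> S \<Longrightarrow> mi_length \<alpha> \<le> N \<Longrightarrow> continuous_on ({0..<Tm i} \<times> UNIV \<times> UNIV) (\<lambda>(t,x,v). g i \<alpha> t x v)"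
    and g_per: "i \<in> S \<Longrightarrow> mi_length \<alpha> \<le> N \<Longrightarrow> t \<in> Iv i \<Longrightarrow> per (g i \<alpha> t)"
    and g_dt: "i \<in> S \<Longrightarrow> mi_length \<alpha> < N \<Longrightarrow> t \<in> Iv i \<Longrightarrow> ((\<lambda>s. g i \<alpha> s x v) has_real_derivative g i (inc None \<alpha>) t x v) (at t within {0..})"
    and g_dx: "i \<in> S \<Longrightarrow> mi_length \<alpha> < N \<Longrightarrow> t \<in> Iv i \<Longrightarrow> ((\<lambda>s. g i \<alpha> t (x + s *\<^sub>R axis j 1) v) has_real_derivative g i (inc (Some j) \<alpha>) t x v) (at 0)"
    and g_L2: "i \<in> S \<Longrightarrow> mi_length \<alpha> \<le> N \<Longrightarrow> t \<in> Iv i \<Longrightarrow> L2_norm_sq (g i \<alpha> t) \<le> ennreal B"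
begin

text \<open>Only derivatives in t and x are summed, as in the quadratic form to be
  estimated.\<close>

definition en :: "'i \<Rightarrow> real \<Rightarrow> real" where
  "en i t = (\<Sum>\<alpha> | mi_length \<alpha> \<le> N. enn2real (L2_norm_sq (g i \<alpha> t)))"

definition Y :: "poly3 \<Rightarrow> nat^4 \<Rightarrow> 'i \<Rightarrow> real \<Rightarrow> real^3 \<Rightarrow> real" where
  "Y L \<alpha> i t x = mom (peval L) (g i \<alpha> t x)"

lemma en_nonneg: "en i t \<ge> 0" by (simp add: en_def sum_nonneg)

lemma L2_fin: "i \<in> S \<Longrightarrow> mi_length \<alpha> \<le> N \<Longrightarrow> t \<in> Iv i \<Longrightarrow> L2_norm_sq (g i \<alpha> t) < top"
  using g_L2 le_less_trans ennreal_less_top by blast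

lemma L2_le_en:
  assumes "i \<in> S" "mi_length \<alpha> \<le> N" "t \<in> Iv i"
  shows "L2_norm_sq (g i \<alpha> t) \<le> ennreal (en i t)"
proof -
  have "enn2real (L2_norm_sq (g i \<alpha> t)) \<le> en i t"
    unfolding en_def by (rule member_le_sum) (use assms finite_mi_length in auto)
  then have "ennreal (enn2real (L2_norm_sq (g i \<alpha> t))) \<le> ennreal (en i t)" by (rule ennreal_leI)
  then show ?thesis using L2_fin[OF assms] by (simp add: ennreal_enn2real)
qed

lemma g_cont_xv:
  assumes "i \<in> S" "mi_length \<alpha> \<le> N" "t \<in> Iv i"
  shows "continuous_on UNIV (\<lambda>(x,v). g i \<alpha> t x v)"
proof -
  have "continuous_on UNIV (\<lambda>p::(real^3)\<times>(real^3). (\<lambda>(t,x,v). g i \<alpha> t x v) (t, fst p, snd p))"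
    by (rule continuous_on_compose2[OF g_cont[OF assms(1,2)]]) (use assms in \<open>auto intro!: continuous_intros\<close>)
  then show ?thesis by (simp add: case_prod_beta')
qed

lemma g_cont_v:
  assumes "i \<in> S" "mi_length \<alpha> \<le> N" "t \<in> Iv i"
  shows "continuous_on UNIV (\<lambda>v. g i \<alpha> t x v)"
proof -
  have "continuous_on UNIV (\<lambda>v. (\<lambda>(x,v). g i \<alpha> t x v) (x, v))"
    by (rule continuous_on_compose2[OF g_cont_xv[OF assms]]) (auto intro!: continuous_intros)
  then show ?thesis by simp
qed

lemma g_cont_x:
  assumes "i \<in> S" "mi_length \<alpha> \<le> N" "t \<in> Iv i"
  shows "continuous_on UNIV (\<lambda>x. g i \<alpha> t x v)"
proof -
  have "continuous_on UNIV (\<lambda>x. (\<lambda>(x,v). g i \<alpha> t x v) (x, v))"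
    by (rule continuous_on_compose2[OF g_cont_xv[OF assms]]) (auto intro!: continuous_intros)
  then show ?thesis by simp
qed

lemma g_meas:
  assumes "i \<in> S" "mi_length \<alpha> \<le> N" "t \<in> Iv i"
  shows "(\<lambda>(x,v). g i \<alpha> t x v) \<in> borel_measurable (borel \<Otimes>\<^sub>M borel)"
  unfolding borel_prod by (rule borel_measurable_continuous_onI[OF g_cont_xv[OF assms]])

lemma g_meas_v: "i \<in> S \<Longrightarrow> mi_length \<alpha> \<le> N \<Longrightarrow> t \<in> Iv i \<Longrightarrow> g i \<alpha> t x \<in> borel_measurable borel"
  by (rule borel_measurable_continuous_onI[OF g_cont_v])

lemma rg_Y: assumes "mi_length \<alpha> \<le> N" shows "rg (Y L \<alpha>)"
  unfolding rg_def reg_def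
proof (intro ballI conjI)
  fix i t assume i: "i \<in> S" "t \<in> Iv i"
  note [measurable] = g_meas[OF i(1) assms i(2)]
  show "Y L \<alpha> i t \<in> borel_measurable borel"
    unfolding Y_def[abs_def] mom_def by measurable
  show "per (Y L \<alpha> i t)"
    using g_per[OF i(1) assms i(2)] by (simp add: per_def Y_def)
qed

lemma n2_Y_le:
  assumes "i \<in> S" "mi_length \<alpha> \<le> N" "t \<in> Iv i"
  shows "n2 (Y L \<alpha> i t) \<le> ennreal (cw L) * L2_norm_sq (g i \<alpha> t)"
  unfolding Y_def L2_norm_sq_iter(1)[OF g_meas[OF assms]] by (rule n2_mom_bound[OF g_meas[OF assms]])

lemma l2b_Y: assumes "mi_length \<alpha> \<le> N" shows "l2b (\<lambda>i t. sqrt (en i t)) (Y L \<alpha>)"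
  unfolding l2b_def
proof (intro exI[of _ "sqrt (cw L)"] conjI ballI)
  fix i t assume i: "i \<in> S" "t \<in> Iv i"
  have "n2 (Y L \<alpha> i t) \<le> ennreal (cw L) * ennreal (en i t)"
    by (rule order_trans[OF n2_Y_le[OF i(1) assms i(2)] mult_left_mono[OF L2_le_en[OF i(1) assms i(2)]]]) simp
  also have "\<dots> = ennreal ((sqrt (cw L) * sqrt (en i t))\<^sup>2)"
    using cw_ge1[of L] en_nonneg[of i t] by (simp add: ennreal_mult power_mult_distrib)
  finally show "n2 (Y L \<alpha> i t) \<le> ennreal ((sqrt (cw L) * sqrt (en i t))\<^sup>2)" .
qed (use cw_ge1[of L] in auto)

lemma sf_g_deriv:
  assumes i: "i \<in> S" "t \<in> Iv i" and a: "mi_length \<alpha> < N" and h: "t + h < Tm i" and r: "r \<in> {0..h}"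
  shows "((\<lambda>r. sf e r (\<lambda>t x. g i \<alpha> t x v) t x) has_real_derivative sf e r (\<lambda>t x. g i (inc e \<alpha>) t x v) t x) (at r within {0..h})"
proof (cases e)
  case None
  have "((\<lambda>s. g i \<alpha> s x v) has_real_derivative g i (inc None \<alpha>) (t+r) x v) (at (t + r) within (\<lambda>r. t + r) ` {0..h})"
    by (rule DERIV_subset[OF g_dt[OF i(1) a]]) (use i h r in auto)
  moreover have "((\<lambda>r. t + r) has_real_derivative 1) (at r within {0..h})"
    by (auto intro!: derivative_eq_intros)
  ultimately have "((\<lambda>s. g i \<alpha> s x v) \<circ> (\<lambda>r. t + r) has_real_derivative g i (inc None \<alpha>) (t+r) x v * 1) (at r within {0..h})"
    by (rule DERIV_image_chain)
  then show ?thesis using None by (simp add: o_def)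
next
  case (Some j)
  have "((\<lambda>s. g i \<alpha> t ((x + r *\<^sub>R axis j 1) + (s - r) *\<^sub>R axis j 1) v) has_real_derivative g i (inc (Some j) \<alpha>) t (x + r *\<^sub>R axis j 1) v * 1) (at r)"
    by (rule DERIV_chain2[where g="\<lambda>s. s - r"]) (use g_dx[OF i(1) a i(2), of "x + r *\<^sub>R axis j 1" j v] in \<open>auto intro!: derivative_eq_intros\<close>)
  moreover have "(x + r *\<^sub>R axis j 1) + (s - r) *\<^sub>R axis j 1 = x + s *\<^sub>R axis j 1" for s
    by (simp add: algebra_simps)
  ultimately show ?thesis using Some by (auto intro: has_field_derivative_at_within)
qed

lemma sf_g_cont:
  assumes i: "i \<in> S" "t \<in> Iv i" and a: "mi_length \<beta> \<le> N" and h: "t + h < Tm i"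
  shows "continuous_on ({0..h} \<times> UNIV \<times> UNIV) (\<lambda>(r,x,v). sf e r (\<lambda>t x. g i \<beta> t x v) t x)"
proof (cases e)
  case None
  have "continuous_on ({0..h} \<times> UNIV \<times> UNIV) (\<lambda>q. (\<lambda>(t,x,v). g i \<beta> t x v) (t + fst q, fst (snd q), snd (snd q)))"
    by (rule continuous_on_compose2[OF g_cont[OF i(1) a]]) (use i h in \<open>auto intro!: continuous_intros\<close>)
  then show ?thesis using None by (simp add: case_prod_beta')
next
  case (Some j)
  have "continuous_on ({0..h} \<times> UNIV \<times> UNIV) (\<lambda>q. (\<lambda>(t,x,v). g i \<beta> t x v) (t, fst (snd q) + fst q *\<^sub>R axis j 1, snd (snd q)))"
    by (rule continuous_on_compose2[OF g_cont[OF i(1) a]]) (use i in \<open>auto intro!: continuous_intros\<close>)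
  then show ?thesis using Some by (simp add: case_prod_beta')
qed

lemma L2_sf_g:
  assumes i: "i \<in> S" "t \<in> Iv i" and a: "mi_length \<beta> \<le> N" and h: "0 \<le> h" "t + h < Tm i"
  shows "L2_norm_sq (\<lambda>x v. sf e h (\<lambda>t x. g i \<beta> t x v) t x) \<le> ennreal B"
proof (cases e)
  case None
  have "t + h \<in> Iv i" using i h by auto
  from g_L2[OF i(1) a this] show ?thesis using None by simp
next
  case (Some j)
  note [measurable] = g_meas[OF i(1) a i(2)]
  let ?f = "\<lambda>x. \<integral>\<^sup>+v. ennreal ((g i \<beta> t x v)\<^sup>2) \<partial>lborel"
  have m: "(\<lambda>(x,v). g i \<beta> t (x + h *\<^sub>R axis j 1) v) \<in> borel_measurable (borel \<Otimes>\<^sub>M borel)" by measurable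
  have "L2_norm_sq (\<lambda>x v. sf e h (\<lambda>t x. g i \<beta> t x v) t x) = (\<integral>\<^sup>+x. ?f (x + h *\<^sub>R axis j 1) \<partial>MQ)"
    using Some by (simp add: L2_norm_sq_iter(2)[OF m])
  also have "\<dots> = (\<integral>\<^sup>+x. ?f x \<partial>MQ)"
    by (rule nn_integral_MQ_translate) (use g_per[OF i(1) a i(2)] h in \<open>auto simp: per_def\<close>)
  also have "\<dots> = L2_norm_sq (g i \<beta> t)" by (rule L2_norm_sq_iter(2)[OF g_meas[OF i(1) a i(2)], symmetric])
  finally show ?thesis using g_L2[OF i(1) a i(2)] by simp
qed

lemma sf_g_meas:
  assumes i: "i \<in> S" "t \<in> Iv i" and a: "mi_length \<beta> \<le> N" and h: "0 \<le> h" "t + h < Tm i"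
  shows "(\<lambda>(x,v). sf e h (\<lambda>t x. g i \<beta> t x v) t x) \<in> borel_measurable (borel \<Otimes>\<^sub>M borel)"
proof -
  have "continuous_on UNIV (\<lambda>q::(real^3)\<times>(real^3). (\<lambda>(r,x,v). sf e r (\<lambda>t x. g i \<beta> t x v) t x) (h, fst q, snd q))"
    by (rule continuous_on_compose2[OF sf_g_cont[OF i a h(2)]]) (use h in \<open>auto intro!: continuous_intros\<close>)
  then show ?thesis
    unfolding borel_prod by (intro borel_measurable_continuous_onI) (simp add: case_prod_beta')
qed

lemma AE_fin_v:
  assumes i: "i \<in> S" "t \<in> Iv i" and a: "mi_length \<beta> \<le> N" and h: "0 \<le> h" "t + h < Tm i"
  shows "AE x in MQ. (\<integral>\<^sup>+v. ennreal ((sf e h (\<lambda>t x. g i \<beta> t x v) t x)\<^sup>2) \<partial>lborel) < \<infinity>"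
proof -
  note m[measurable] = sf_g_meas[OF i a h, of e]
  have "(\<integral>\<^sup>+x. \<integral>\<^sup>+v. ennreal ((sf e h (\<lambda>t x. g i \<beta> t x v) t x)\<^sup>2) \<partial>lborel \<partial>MQ) \<noteq> \<infinity>"
    using L2_sf_g[OF i a h, of e] unfolding L2_norm_sq_iter(2)[OF m] by (auto simp: top_unique)
  moreover have "(\<lambda>x. \<integral>\<^sup>+v. ennreal ((sf e h (\<lambda>t x. g i \<beta> t x v) t x)\<^sup>2) \<partial>lborel) \<in> borel_measurable MQ"
    by (rule measurable_MQ) measurable
  ultimately have "AE x in MQ. (\<integral>\<^sup>+v. ennreal ((sf e h (\<lambda>t x. g i \<beta> t x v) t x)\<^sup>2) \<partial>lborel) \<noteq> \<infinity>"
    by (intro nn_integral_noteq_infinite)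
  then show ?thesis by (simp add: less_top)
qed

lemma AE_fin_v0:
  assumes i: "i \<in> S" "t \<in> Iv i" and a: "mi_length \<beta> \<le> N"
  shows "AE x in MQ. (sqn (g i \<beta> t x)) < \<infinity>"
  using AE_fin_v[OF i a, of 0 None] i by simp

text \<open>The quotient is the average of the derivative over [0, h]. By Cauchy-Schwarz and Fubini
  its squared norm is at most the average of the squared norms of the shifted derivatives, each
  bounded by \<open>B\<close>.\<close>

lemma L2_quotient:
  assumes i: "i \<in> S" "t \<in> Iv i" and a: "mi_length \<alpha> < N" and h: "0 < h" "t + h < Tm i"
  shows "L2_norm_sq (\<lambda>x v. (sf e h (\<lambda>t x. g i \<alpha> t x v) t x - g i \<alpha> t x v) / h) \<le> ennreal B"
proof -
  have a': "mi_length (inc e \<alpha>) \<le> N" using a by simp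
  let ?F = "\<lambda>r x v. sf e r (\<lambda>t x. g i (inc e \<alpha>) t x v) t x"
  have m1: "(\<lambda>(x,v). sf e h (\<lambda>t x. g i \<alpha> t x v) t x) \<in> borel_measurable (borel \<Otimes>\<^sub>M borel)"
    by (rule sf_g_meas) (use i a h in auto)
  have m2: "(\<lambda>(x,v). g i \<alpha> t x v) \<in> borel_measurable (borel \<Otimes>\<^sub>M borel)"
    by (rule g_meas) (use i a in auto)
  have m: "(\<lambda>(x,v). (sf e h (\<lambda>t x. g i \<alpha> t x v) t x - g i \<alpha> t x v) / h) \<in> borel_measurable (borel \<Otimes>\<^sub>M borel)"
    using m1 m2 by measurable
  have cF: "continuous_on {0..h} (\<lambda>r. ?F r x v)" for x v
  proof -
    have "continuous_on {0..h} (\<lambda>r. (\<lambda>(r,x,v). ?F r x v) (r, x, v))"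
      by (rule continuous_on_compose2[OF sf_g_cont[OF i a' h(2)]]) (auto intro!: continuous_intros)
    then show ?thesis by simp
  qed
  have pw: "ennreal (((sf e h (\<lambda>t x. g i \<alpha> t x v) t x - g i \<alpha> t x v) / h)\<^sup>2) \<le> ennreal (1/h) * (\<integral>\<^sup>+r. ennreal ((?F r x v)\<^sup>2) * indicator {0..h} r \<partial>lborel)" for x v
  proof -
    have "(LBINT r. indicator {0..h} r *\<^sub>R ?F r x v) = sf e h (\<lambda>t x. g i \<alpha> t x v) t x - sf e 0 (\<lambda>t x. g i \<alpha> t x v) t x"
    proof (rule integral_FTC_Icc)
      show "((\<lambda>r. sf e r (\<lambda>t x. g i \<alpha> t x v) t x) has_vector_derivative ?F r x v) (at r within {0..h})" if "0 \<le> r" "r \<le> h" for r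
        using sf_g_deriv[OF i a h(2), of r e v x] that by (simp add: has_real_derivative_iff_has_vector_derivative)
    qed (use h cF in auto)
    moreover have "sf e 0 (\<lambda>t x. g i \<alpha> t x v) t x = g i \<alpha> t x v" by (cases e) auto
    ultimately have "ennreal ((sf e h (\<lambda>t x. g i \<alpha> t x v) t x - g i \<alpha> t x v)\<^sup>2) \<le> ennreal h * (\<integral>\<^sup>+r. ennreal ((?F r x v)\<^sup>2) * indicator {0..h} r \<partial>lborel)"
      using Cauchy_Schwarz_interval[OF cF[where x=x and v=v]] h by simp
    then have "ennreal (1/h\<^sup>2) * ennreal ((sf e h (\<lambda>t x. g i \<alpha> t x v) t x - g i \<alpha> t x v)\<^sup>2) \<le> ennreal (1/h\<^sup>2) * (ennreal h * (\<integral>\<^sup>+r. ennreal ((?F r x v)\<^sup>2) * indicator {0..h} r \<partial>lborel))"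
      by (rule mult_left_mono) simp
    moreover have "ennreal (1/h\<^sup>2) * ennreal ((sf e h (\<lambda>t x. g i \<alpha> t x v) t x - g i \<alpha> t x v)\<^sup>2) = ennreal (((sf e h (\<lambda>t x. g i \<alpha> t x v) t x - g i \<alpha> t x v) / h)\<^sup>2)"
      by (subst ennreal_mult[symmetric]) (auto simp: power_divide)
    moreover have "ennreal (1/h\<^sup>2) * ennreal h = ennreal (1/h)"
      using h by (subst ennreal_mult[symmetric]) (auto simp: power2_eq_square)
    ultimately show ?thesis by (simp add: mult.assoc[symmetric])
  qed
  let ?P = "PM"
  interpret MP: pair_sigma_finite MQ "lborel :: (real^3) measure" ..
  interpret P: pair_sigma_finite ?P "lborel :: real measure" ..
  have Fm: "(\<lambda>(p, r). ennreal ((?F r (fst p) (snd p))\<^sup>2) * indicator {0..h} r) \<in> borel_measurable (?P \<Otimes>\<^sub>M lborel)"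
  proof -
    have "(\<lambda>q::real\<times>(real^3)\<times>(real^3). indicator ({0..h} \<times> UNIV \<times> UNIV) q *\<^sub>R (\<lambda>(r,x,v). ?F r x v) q) \<in> borel_measurable borel"
      by (rule borel_measurable_continuous_on_indicator[OF _ sf_g_cont[OF i a' h(2)]]) (intro borel_closed closed_Times closed_UNIV closed_atLeastAtMost)
    then have b: "(\<lambda>q::real\<times>(real^3)\<times>(real^3). indicator {0..h} (fst q) * ?F (fst q) (fst (snd q)) (snd (snd q))) \<in> borel_measurable (borel \<Otimes>\<^sub>M (borel \<Otimes>\<^sub>M borel))"
      by (simp add: borel_prod case_prod_beta' indicator_times)
    have s: "(\<lambda>p::((real^3)\<times>(real^3))\<times>real. (snd p, (fst (fst p), snd (fst p)))) \<in> ?P \<Otimes>\<^sub>M lborel \<rightarrow>\<^sub>M borel \<Otimes>\<^sub>M (borel \<Otimes>\<^sub>M borel)"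
    proof (intro measurable_Pair)
      show "(\<lambda>x. snd x) \<in> ?P \<Otimes>\<^sub>M lborel \<rightarrow>\<^sub>M (borel::real measure)"
        by (rule measurable_compose[OF measurable_snd]) simp
      show "(\<lambda>x. fst (fst x)) \<in> ?P \<Otimes>\<^sub>M (lborel::real measure) \<rightarrow>\<^sub>M (borel::(real^3) measure)"
        by (rule measurable_compose[OF measurable_fst measurable_compose[OF measurable_fst]]) (rule measurable_restrict_space1, simp)
      show "(\<lambda>x. snd (fst x)) \<in> ?P \<Otimes>\<^sub>M (lborel::real measure) \<rightarrow>\<^sub>M (borel::(real^3) measure)"
        by (rule measurable_compose[OF measurable_fst measurable_compose[OF measurable_snd]]) simp
    qed
    have "(\<lambda>p. ennreal ((indicator {0..h} (snd p) * ?F (snd p) (fst (fst p)) (snd (fst p)))\<^sup>2)) \<in> borel_measurable (?P \<Otimes>\<^sub>M lborel)"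
      using measurable_compose[OF s b] by simp
    moreover have "ennreal ((indicator {0..h} r * ?F r x v)\<^sup>2) = ennreal ((?F r x v)\<^sup>2) * indicator {0..h} r" for r x v
      by (auto simp: indicator_def)
    ultimately show ?thesis by (simp add: case_prod_beta')
  qed
  have "L2_norm_sq (\<lambda>x v. (sf e h (\<lambda>t x. g i \<alpha> t x v) t x - g i \<alpha> t x v) / h)
     \<le> (\<integral>\<^sup>+p. ennreal (1/h) * (\<integral>\<^sup>+r. ennreal ((?F r (fst p) (snd p))\<^sup>2) * indicator {0..h} r \<partial>lborel) \<partial>?P)"
    unfolding L2_norm_sq_iter(1)[OF m] by (intro nn_integral_mono pw)
  also have "\<dots> = ennreal (1/h) * (\<integral>\<^sup>+p. (\<integral>\<^sup>+r. ennreal ((?F r (fst p) (snd p))\<^sup>2) * indicator {0..h} r \<partial>lborel) \<partial>?P)"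
    by (rule nn_integral_cmult) (use lborel.borel_measurable_nn_integral[OF Fm] in simp)
  also have "(\<integral>\<^sup>+p. (\<integral>\<^sup>+r. ennreal ((?F r (fst p) (snd p))\<^sup>2) * indicator {0..h} r \<partial>lborel) \<partial>?P)
     = (\<integral>\<^sup>+r. (\<integral>\<^sup>+p. ennreal ((?F r (fst p) (snd p))\<^sup>2) * indicator {0..h} r \<partial>?P) \<partial>lborel)"
    by (rule P.Fubini'[OF Fm, symmetric])
  also have "\<dots> \<le> (\<integral>\<^sup>+r. ennreal B * indicator {0..h} r \<partial>lborel)"
  proof (rule nn_integral_mono)
    fix r :: real
    show "(\<integral>\<^sup>+p. ennreal ((?F r (fst p) (snd p))\<^sup>2) * indicator {0..h} r \<partial>?P) \<le> ennreal B * indicator {0..h} r"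
    proof (cases "r \<in> {0..h}")
      case True
      have "L2_norm_sq (?F r) \<le> ennreal B" by (rule L2_sf_g[OF i a']) (use True h in auto)
      moreover have "L2_norm_sq (?F r) = (\<integral>\<^sup>+p. ennreal ((?F r (fst p) (snd p))\<^sup>2) \<partial>?P)"
        by (rule L2_norm_sq_iter(1)[OF sf_g_meas[OF i a']]) (use True h in auto)
      ultimately show ?thesis using True by simp
    qed simp
  qed
  also have "\<dots> = ennreal B * ennreal h" using h by (subst nn_integral_cmult_indicator) auto
  also have "ennreal (1/h) * (ennreal B * ennreal h) = ennreal B"
    using h B0 by (simp add: ennreal_mult[symmetric])
  finally show ?thesis by (simp add: mult_left_mono)
qed

end

lemma mom_diff:
  assumes [measurable]: "a \<in> borel_measurable borel" "b \<in> borel_measurable borel"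
    and "sqn a < \<infinity>" "sqn b < \<infinity>"
  shows "mom (peval L) (\<lambda>v. a v - b v) = mom (peval L) a - mom (peval L) b"
  unfolding mom_def left_diff_distrib
  by (rule Bochner_Integration.integral_diff) (use assms in \<open>auto intro: mom_integrable\<close>)

lemma mom_cmult: "mom p (\<lambda>v. c * a v) = c * mom p a"
  unfolding mom_def mult.assoc by simp

lemma mom_divide: "mom p (\<lambda>v. a v / c) = mom p a / c"
  using mom_cmult[of p "1/c" a] by simp

lemma sf_zero: "sf e 0 u t x = u t x" by (cases e) auto

lemma L2_finite_sum_fin:
  fixes a :: "real^3 \<Rightarrow> real"
  assumes [measurable]: "a \<in> borel_measurable borel" "b \<in> borel_measurable borel"
    and "sqn a < \<infinity>" "sqn b < \<infinity>"
  shows "(\<integral>\<^sup>+v. ennreal ((a v - b v)\<^sup>2) \<partial>lborel) < \<infinity>"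
proof -
  have "(\<integral>\<^sup>+v. ennreal ((a v - b v)\<^sup>2) \<partial>lborel) \<le> (\<integral>\<^sup>+v. 2 * ennreal ((a v)\<^sup>2) + 2 * ennreal ((b v)\<^sup>2) \<partial>lborel)"
  proof (rule nn_integral_mono)
    fix v
    have "(a v - b v)\<^sup>2 \<le> 2 * (a v)\<^sup>2 + 2 * (b v)\<^sup>2"
      using sum_squares_bound[of "a v" "- b v"] by (simp add: power2_diff)
    then have "ennreal ((a v - b v)\<^sup>2) \<le> ennreal (2 * (a v)\<^sup>2 + 2 * (b v)\<^sup>2)" by (rule ennreal_leI)
    then show "ennreal ((a v - b v)\<^sup>2) \<le> 2 * ennreal ((a v)\<^sup>2) + 2 * ennreal ((b v)\<^sup>2)" by (simp add: ennreal_plus ennreal_mult)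
  qed
  also have "\<dots> = 2 * (sqn a) + 2 * (sqn b)"
    by (subst nn_integral_add) (auto simp: nn_integral_cmult)
  also have "\<dots> < \<infinity>" using assms(3,4) by (simp add: ennreal_mult_less_top)
  finally show ?thesis .
qed

section \<open>Mean-square differentiability and boundedness of the moments\<close>

context kinetic
begin

lemma sf_Y: "sf e h (Y L \<alpha> i) t x = mom (peval L) (\<lambda>v. sf e h (\<lambda>t x. g i \<alpha> t x v) t x)"
  by (cases e) (simp_all add: Y_def)

lemma sf_g_meas_v:
  assumes i: "i \<in> S" "t \<in> Iv i" and a: "mi_length \<beta> \<le> N" and h: "0 \<le> h" "t + h < Tm i"
  shows "(\<lambda>v. sf e h (\<lambda>t x. g i \<beta> t x v) t x) \<in> borel_measurable borel"
  using measurable_compose[OF measurable_Pair1' sf_g_meas[OF i a h, of e], of x] by simp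

lemma sf_g_loc_bounded:
  assumes i: "i \<in> S" "t \<in> Iv i" and a: "mi_length \<beta> \<le> N" and h: "t + h < Tm i"
  shows "\<exists>K. \<forall>r\<in>{0..h}. \<forall>x\<in>cbox 0 One. \<forall>v. norm v \<le> R \<longrightarrow> \<bar>sf e r (\<lambda>t x. g i \<beta> t x v) t x\<bar> \<le> K"
proof -
  let ?F = "\<lambda>(r,x,v). sf e r (\<lambda>t x. g i \<beta> t x v) t x"
  have "compact (?F ` ({0..h} \<times> cbox 0 One \<times> cball 0 R))"
    by (intro compact_continuous_image continuous_on_subset[OF sf_g_cont[OF i a h]] compact_Times) auto
  then obtain K where "\<forall>y\<in>?F ` ({0..h} \<times> cbox 0 One \<times> cball 0 R). norm y \<le> K"
    using compact_imp_bounded bounded_iff by metis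
  then have "\<forall>r\<in>{0..h}. \<forall>x\<in>cbox 0 One. \<forall>v. norm v \<le> R \<longrightarrow> \<bar>sf e r (\<lambda>t x. g i \<beta> t x v) t x\<bar> \<le> K"
    by force
  then show ?thesis by blast
qed

text \<open>Differentiation under the velocity integral. The error of the difference quotient is
  bounded in L2 by \<open>L2_quotient\<close>, locally bounded by the mean value theorem, and tends
  to 0 pointwise, so \<open>mom_averaging\<close> applies to it.\<close>

lemma dd_Y:
  assumes a: "mi_length \<alpha> < N"
  shows "dd e (Y L \<alpha>) (Y L (inc e \<alpha>))"
  unfolding dd_def HD_def tendsto_at_iff_sequentially
proof (intro ballI allI impI)
  fix i t X assume i: "i \<in> S" "t \<in> Iv i" and "\<forall>n. X n \<in> {0<..<Tm i - t} - {0}" and X0: "X \<longlonglongrightarrow> (0::real)"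
  then have X: "\<And>n. 0 < X n \<and> X n < Tm i - t" by auto
  obtain h where h: "0 < h" "h < Tm i - t" "\<And>n. X n \<le> h" using seq_bounded_below[OF X0 X] by blast
  have th: "t + h < Tm i" and tX: "\<And>n. 0 \<le> X n" "\<And>n. t + X n < Tm i" using h X by (auto simp: algebra_simps less_imp_le)
  have t0: "t + 0 < Tm i" using i by simp
  have a1: "mi_length \<alpha> \<le> N" and a2: "mi_length (inc e \<alpha>) \<le> N" using a by auto
  define F where "F r x v = sf e r (\<lambda>t x. g i \<alpha> t x v) t x" for r x v
  define F' where "F' r x v = sf e r (\<lambda>t x. g i (inc e \<alpha>) t x v) t x" for r x v
  have F0: "F 0 x v = g i \<alpha> t x v" "F' 0 x v = g i (inc e \<alpha>) t x v" for x v by (simp_all add: F_def F'_def sf_zero)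
  have der: "((\<lambda>r. F r x v) has_real_derivative F' r x v) (at r within {0..h})" if "r \<in> {0..h}" for r x v
    unfolding F_def F'_def by (rule sf_g_deriv[OF i a th that])
  define D where "D n x v = (F (X n) x v - F 0 x v) / X n - F' 0 x v" for n x v
  have mF: "(\<lambda>(x,v). F r x v) \<in> borel_measurable (borel \<Otimes>\<^sub>M borel)" "(\<lambda>(x,v). F' r x v) \<in> borel_measurable (borel \<Otimes>\<^sub>M borel)" if "0 \<le> r" "t + r < Tm i" for r
    unfolding F_def F'_def using sf_g_meas[OF i a1 that] sf_g_meas[OF i a2 that] by auto
  have "(\<lambda>n. n2 (\<lambda>x. mom (peval L) (D n x))) \<longlonglongrightarrow> 0"
  proof (rule mom_averaging[where C="4 * B"])
    fix n
    note m[measurable] = mF[OF tX(1) tX(2), of n] mF[of 0]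
    have t0: "t + 0 < Tm i" using i by simp
    have q[measurable]: "(\<lambda>(x,v). (F (X n) x v - F 0 x v) / X n) \<in> borel_measurable (borel \<Otimes>\<^sub>M borel)"
      using m(3)[OF _ t0] m(1) by measurable
    have F'm: "(\<lambda>(x,v). F' 0 x v) \<in> borel_measurable (borel \<Otimes>\<^sub>M borel)" using m(4)[OF _ t0] by simp
    show Dm: "(\<lambda>(x,v). D n x v) \<in> borel_measurable (borel \<Otimes>\<^sub>M borel)"
      unfolding D_def using q F'm by measurable
    have "L2_norm_sq (D n) \<le> 2 * L2_norm_sq (\<lambda>x v. (F (X n) x v - F 0 x v) / X n) + 2 * L2_norm_sq (F' 0)"
      unfolding D_def by (rule L2_norm_sq_diff[OF q F'm])
    also have "\<dots> \<le> 2 * ennreal B + 2 * ennreal B"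
    proof (intro add_mono mult_left_mono)
      show "L2_norm_sq (\<lambda>x v. (F (X n) x v - F 0 x v) / X n) \<le> ennreal B"
        using L2_quotient[OF i a, of "X n" e] X[of n] tX(2)[of n] unfolding F0 by (simp add: F_def)
      show "L2_norm_sq (F' 0) \<le> ennreal B"
        unfolding F0 using g_L2[OF i(1) a2 i(2)] by simp
    qed auto
    also have "\<dots> = ennreal (4 * B)" using B0 by (simp add: ennreal_mult ennreal_plus[symmetric] mult.assoc[symmetric] del: ennreal_plus flip: distrib_right)
    finally show "(\<integral>\<^sup>+p. ennreal ((D n (fst p) (snd p))\<^sup>2) \<partial>PM) \<le> ennreal (4 * B)"
      unfolding L2_norm_sq_iter(1)[OF Dm] .
  next
    fix x v
    have "((\<lambda>r. (F r x v - F 0 x v) / (r - 0)) \<longlongrightarrow> F' 0 x v) (at 0 within {0..h})"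
      using der[of 0 x v] h(1) by (simp add: has_field_derivative_iff)
    then have "(\<lambda>n. (F (X n) x v - F 0 x v) / (X n - 0)) \<longlonglongrightarrow> F' 0 x v"
      unfolding tendsto_at_iff_sequentially using X0 X h(3) by (auto simp: o_def less_imp_le less_imp_neq[THEN not_sym])
    then show "(\<lambda>n. D n x v) \<longlonglongrightarrow> 0"
      unfolding D_def by (simp add: LIM_zero)
  next
    fix R :: real
    obtain K where K: "\<And>r x v. r \<in> {0..h} \<Longrightarrow> x \<in> cbox 0 One \<Longrightarrow> norm v \<le> R \<Longrightarrow> \<bar>F' r x v\<bar> \<le> K"
      using sf_g_loc_bounded[OF i a2 th, of R e] unfolding F'_def by blast
    show "\<exists>K. \<forall>n. \<forall>x\<in>cbox 0 One. \<forall>v. norm v \<le> R \<longrightarrow> \<bar>D n x v\<bar> \<le> K"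
    proof (intro exI[of _ "2 * K"] allI ballI impI)
      fix n and x v :: "real^3" assume x: "x \<in> cbox 0 One" and v: "norm v \<le> R"
      have "norm (F (X n) x v - F 0 x v) \<le> K * norm (X n - 0)"
        by (rule field_differentiable_bound[of "{0..h}" "\<lambda>r. F r x v" "\<lambda>r. F' r x v"])
          (use der K[OF _ x v] X h in \<open>auto simp: less_imp_le\<close>)
      then have "\<bar>(F (X n) x v - F 0 x v) / X n\<bar> \<le> K"
        using X[of n] by (simp add: abs_divide pos_divide_le_eq)
      moreover have "\<bar>F' 0 x v\<bar> \<le> K" using K[OF _ x v, of 0] h by simp
      ultimately show "\<bar>D n x v\<bar> \<le> 2 * K" unfolding D_def by linarith
    qed
  qed
  \<comment> \<open>Splitting the moment of a difference requires integrability, which is available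
    where the velocity norms are finite, that is for almost every x.\<close>
  moreover have "n2 (\<lambda>x. mom (peval L) (D n x)) = n2 (\<lambda>x. (sf e (X n) (Y L \<alpha> i) t x - Y L \<alpha> i t x) / X n - Y L (inc e \<alpha>) i t x)" for n
  proof (rule n2_cong_AE)
    show "AE x in MQ. mom (peval L) (D n x) = (sf e (X n) (Y L \<alpha> i) t x - Y L \<alpha> i t x) / X n - Y L (inc e \<alpha>) i t x"
    proof -
      have key: "mom (peval L) (D n x) = (sf e (X n) (Y L \<alpha> i) t x - Y L \<alpha> i t x) / X n - Y L (inc e \<alpha>) i t x"
        if elim: "(\<integral>\<^sup>+v. ennreal ((sf e (X n) (\<lambda>t x. g i \<alpha> t x v) t x)\<^sup>2) \<partial>lborel) < \<infinity>"
          "sqn (g i \<alpha> t x) < \<infinity>" "(\<integral>\<^sup>+v. ennreal ((g i (inc e \<alpha>) t x v)\<^sup>2) \<partial>lborel) < \<infinity>" for x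
      proof -
      have [measurable]: "F (X n) x \<in> borel_measurable borel" "F 0 x \<in> borel_measurable borel" "F' 0 x \<in> borel_measurable borel"
        using sf_g_meas_v[OF i a1 tX(1)[of n] tX(2)[of n], of e x] sf_g_meas_v[OF i a1 order_refl t0, of e x] sf_g_meas_v[OF i a2 order_refl t0, of e x]
        unfolding F_def F'_def by simp_all
      note [measurable] = g_meas_v[OF i(1) a1 i(2), of x] g_meas_v[OF i(1) a2 i(2), of x]
      have f1: "(\<integral>\<^sup>+v. ennreal ((F (X n) x v - F 0 x v)\<^sup>2) \<partial>lborel) < \<infinity>"
        by (rule L2_finite_sum_fin) (use elim in \<open>simp_all add: F0\<close>, simp_all add: F_def)
      have f2: "(\<integral>\<^sup>+v. ennreal (((F (X n) x v - F 0 x v) / X n)\<^sup>2) \<partial>lborel) < \<infinity>"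
      proof -
        have "ennreal (((F (X n) x v - F 0 x v) / X n)\<^sup>2) = ennreal (1 / (X n)\<^sup>2) * ennreal ((F (X n) x v - F 0 x v)\<^sup>2)" for v
          by (subst ennreal_mult[symmetric]) (auto simp: power_divide)
        then have "(\<integral>\<^sup>+v. ennreal (((F (X n) x v - F 0 x v) / X n)\<^sup>2) \<partial>lborel) = ennreal (1 / (X n)\<^sup>2) * (\<integral>\<^sup>+v. ennreal ((F (X n) x v - F 0 x v)\<^sup>2) \<partial>lborel)"
          by (simp add: nn_integral_cmult)
        then show ?thesis using f1 by (simp add: ennreal_mult_less_top)
      qed
      have "mom (peval L) (D n x) = mom (peval L) (\<lambda>v. (F (X n) x v - F 0 x v) / X n) - mom (peval L) (F' 0 x)"
        unfolding D_def by (rule mom_diff) (use f2 elim in \<open>simp_all add: F0\<close>)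
      also have "mom (peval L) (\<lambda>v. (F (X n) x v - F 0 x v) / X n) = (mom (peval L) (F (X n) x) - mom (peval L) (F 0 x)) / X n"
        unfolding mom_divide by (subst mom_diff) (use elim in \<open>simp_all add: F0\<close>, simp_all add: F_def)
      moreover have "F (X n) x = (\<lambda>v. sf e (X n) (\<lambda>t x. g i \<alpha> t x v) t x)" "F 0 x = g i \<alpha> t x" "F' 0 x = g i (inc e \<alpha>) t x"
        by (simp_all add: fun_eq_iff F0) (simp add: F_def)
      ultimately show ?thesis by (simp only: sf_Y Y_def)
      qed
      show ?thesis
        using AE_fin_v[OF i a1 tX(1)[of n] tX(2)[of n], of e] AE_fin_v0[OF i a1] AE_fin_v0[OF i a2] by eventually_elim (rule key)
    qed
  qed
  ultimately show "((\<lambda>h. n2 (\<lambda>x. (sf e h (Y L \<alpha> i) t x - Y L \<alpha> i t x) / h - Y L (inc e \<alpha>) i t x)) \<circ> X) \<longlonglongrightarrow> 0"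
    by (simp add: o_def)
qed

text \<open>Covers the top order |\<alpha>| = N, where \<open>dd_Y\<close> does not apply;
  \<open>IBP_Y\<close> needs translations of these moments to be continuous in mean square.\<close>

lemma shift_Y:
  assumes a: "mi_length \<alpha> \<le> N" and i: "i \<in> S" "t \<in> Iv i"
  shows "((\<lambda>h. n2 (\<lambda>x. sf e h (Y L \<alpha> i) t x - Y L \<alpha> i t x)) \<longlongrightarrow> 0) (Fil (Tm i) t)"
  unfolding tendsto_at_iff_sequentially
proof (intro ballI allI impI)
  fix X assume "\<forall>n. X n \<in> {0<..<Tm i - t} - {0}" and X0: "X \<longlonglongrightarrow> (0::real)"
  then have X: "\<And>n. 0 < X n \<and> X n < Tm i - t" by auto
  obtain h where h: "0 < h" "h < Tm i - t" "\<And>n. X n \<le> h" using seq_bounded_below[OF X0 X] by blast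
  have th: "t + h < Tm i" and tX: "\<And>n. 0 \<le> X n" "\<And>n. t + X n < Tm i" using h X by (auto simp: algebra_simps less_imp_le)
  define F where "F r x v = sf e r (\<lambda>t x. g i \<alpha> t x v) t x" for r x v
  have F0: "F 0 x v = g i \<alpha> t x v" for x v by (simp add: F_def sf_zero)
  define D where "D n x v = F (X n) x v - F 0 x v" for n x v
  have mF: "(\<lambda>(x,v). F r x v) \<in> borel_measurable (borel \<Otimes>\<^sub>M borel)" if "0 \<le> r" "t + r < Tm i" for r
    unfolding F_def using sf_g_meas[OF i a that] by auto
  have t0: "t + 0 < Tm i" using i by simp
  have "(\<lambda>n. n2 (\<lambda>x. mom (peval L) (D n x))) \<longlonglongrightarrow> 0"
  proof (rule mom_averaging[where C="4 * B"])
    fix n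
    note m = mF[OF tX(1) tX(2), of n] mF[OF order_refl t0]
    show Dm: "(\<lambda>(x,v). D n x v) \<in> borel_measurable (borel \<Otimes>\<^sub>M borel)"
      unfolding D_def using m by measurable
    have "L2_norm_sq (D n) \<le> 2 * L2_norm_sq (F (X n)) + 2 * L2_norm_sq (F 0)"
      unfolding D_def by (rule L2_norm_sq_diff[OF m])
    also have "\<dots> \<le> 2 * ennreal B + 2 * ennreal B"
    proof (intro add_mono mult_left_mono)
      show "L2_norm_sq (F (X n)) \<le> ennreal B"
        unfolding F_def by (rule L2_sf_g[OF i a tX])
      show "L2_norm_sq (F 0) \<le> ennreal B"
        unfolding F0 using g_L2[OF i(1) a i(2)] by simp
    qed auto
    also have "\<dots> = ennreal (4 * B)" using B0 by (simp add: ennreal_mult ennreal_plus[symmetric] mult.assoc[symmetric] del: ennreal_plus flip: distrib_right)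
    finally show "(\<integral>\<^sup>+p. ennreal ((D n (fst p) (snd p))\<^sup>2) \<partial>PM) \<le> ennreal (4 * B)"
      unfolding L2_norm_sq_iter(1)[OF Dm] .
  next
    fix x v
    have "continuous_on {0..h} (\<lambda>r. (\<lambda>(r,x,v). sf e r (\<lambda>t x. g i \<alpha> t x v) t x) (r, x, v))"
      by (rule continuous_on_compose2[OF sf_g_cont[OF i a th]]) (auto intro!: continuous_intros)
    then have "continuous_on {0..h} (\<lambda>r. F r x v)" by (simp add: F_def)
    then have "(\<lambda>n. F (X n) x v) \<longlonglongrightarrow> F 0 x v"
      by (rule continuous_on_tendsto_compose[OF _ X0]) (use h X in \<open>auto simp: less_imp_le\<close>)
    then show "(\<lambda>n. D n x v) \<longlonglongrightarrow> 0"
      unfolding D_def by (simp add: LIM_zero)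
  next
    fix R :: real
    obtain K where K: "\<And>r x v. r \<in> {0..h} \<Longrightarrow> x \<in> cbox 0 One \<Longrightarrow> norm v \<le> R \<Longrightarrow> \<bar>F r x v\<bar> \<le> K"
      using sf_g_loc_bounded[OF i a th, of R e] unfolding F_def by blast
    show "\<exists>K. \<forall>n. \<forall>x\<in>cbox 0 One. \<forall>v. norm v \<le> R \<longrightarrow> \<bar>D n x v\<bar> \<le> K"
    proof (intro exI[of _ "2 * K"] allI ballI impI)
      fix n and x v :: "real^3" assume x: "x \<in> cbox 0 One" and v: "norm v \<le> R"
      have "\<bar>F (X n) x v\<bar> \<le> K" "\<bar>F 0 x v\<bar> \<le> K" using K[OF _ x v, of 0] K[OF _ x v, of "X n"] h X[of n] by auto
      then show "\<bar>D n x v\<bar> \<le> 2 * K" unfolding D_def by linarith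
    qed
  qed
  moreover have "n2 (\<lambda>x. mom (peval L) (D n x)) = n2 (\<lambda>x. sf e (X n) (Y L \<alpha> i) t x - Y L \<alpha> i t x)" for n
  proof (rule n2_cong_AE)
    show "AE x in MQ. mom (peval L) (D n x) = sf e (X n) (Y L \<alpha> i) t x - Y L \<alpha> i t x"
    proof -
      have key: "mom (peval L) (D n x) = sf e (X n) (Y L \<alpha> i) t x - Y L \<alpha> i t x"
        if elim: "(\<integral>\<^sup>+v. ennreal ((sf e (X n) (\<lambda>t x. g i \<alpha> t x v) t x)\<^sup>2) \<partial>lborel) < \<infinity>"
          "sqn (g i \<alpha> t x) < \<infinity>" for x
      proof -
      have [measurable]: "F (X n) x \<in> borel_measurable borel" "F 0 x \<in> borel_measurable borel"
        using sf_g_meas_v[OF i a tX(1)[of n] tX(2)[of n], of e x] sf_g_meas_v[OF i a order_refl t0, of e x]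
        unfolding F_def by simp_all
      note [measurable] = g_meas_v[OF i(1) a i(2), of x]
      have "mom (peval L) (D n x) = mom (peval L) (F (X n) x) - mom (peval L) (F 0 x)"
        unfolding D_def by (rule mom_diff) (use elim in \<open>simp_all add: F0\<close>, simp_all add: F_def)
      moreover have "F (X n) x = (\<lambda>v. sf e (X n) (\<lambda>t x. g i \<alpha> t x v) t x)" "F 0 x = g i \<alpha> t x"
        by (simp_all add: fun_eq_iff F0) (simp add: F_def)
      ultimately show ?thesis by (simp only: sf_Y Y_def)
      qed
      show ?thesis
        using AE_fin_v[OF i a tX(1)[of n] tX(2)[of n], of e] AE_fin_v0[OF i a] by eventually_elim (rule key)
    qed
  qed
  ultimately show "((\<lambda>h. n2 (\<lambda>x. sf e h (Y L \<alpha> i) t x - Y L \<alpha> i t x)) \<circ> X) \<longlonglongrightarrow> 0"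
    by (simp add: o_def)
qed

lemma g_has_derivative:
  assumes i: "i \<in> S" "t \<in> Iv i" and a: "mi_length \<alpha> < N"
  shows "((\<lambda>x. g i \<alpha> t x v) has_derivative (\<lambda>h. \<Sum>j\<in>UNIV. h$j * g i (inc (Some j) \<alpha>) t x v)) (at x)"
  by (rule has_derivative_partials_vec3[OF g_dx[OF i(1) a i(2)] g_cont_x[OF i(1) _ i(2)]]) (use a in simp)

text \<open>Sobolev's inequality in x for each fixed v, integrated over v. The constant is 108 times
  13: one term of order 0, three of order 1 and nine of order 2.\<close>

lemma sup_L2:
  assumes i: "i \<in> S" "t \<in> Iv i" and a: "mi_length \<alpha> + 2 \<le> N"
  shows "sqn (g i \<alpha> t x) \<le> ennreal (1404 * en i t)"
proof -
  have "per (\<lambda>x. g i \<alpha> t x)" using g_per[OF i(1) _ i(2), of \<alpha>] a by simp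
  from per_wrap[OF this, of x] obtain y where y: "y \<in> cbox 0 One" "g i \<alpha> t y = g i \<alpha> t x" by blast
  let ?n = "\<lambda>\<beta> v. n2 (\<lambda>x. g i \<beta> t x v)"
  have m: "?n \<beta> \<in> borel_measurable borel" if "mi_length \<beta> \<le> N" for \<beta>
  proof -
    have "(\<lambda>(x,v). g i \<beta> t x v) \<in> borel_measurable (borel \<Otimes>\<^sub>M borel)" by (rule g_meas[OF i(1) that i(2)])
    note this[THEN phase_measurable, measurable]
    interpret P: pair_sigma_finite MQ "lborel :: (real^3) measure" ..
    have "(\<lambda>(v,x). ennreal ((g i \<beta> t x v)\<^sup>2)) \<in> borel_measurable (lborel \<Otimes>\<^sub>M MQ)" by measurable
    from MQ.borel_measurable_nn_integral[OF this] show ?thesis by (simp add: n2_def)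
  qed
  have I: "(\<integral>\<^sup>+v. ?n \<beta> v \<partial>lborel) \<le> ennreal (en i t)" if "mi_length \<beta> \<le> N" for \<beta>
    using L2_le_en[OF i(1) that i(2)] L2_norm_sq_iter(3)[OF g_meas[OF i(1) that i(2)]] by simp
  have a0: "mi_length \<alpha> \<le> N" "mi_length (inc (Some j) \<alpha>) \<le> N" "mi_length (inc (Some k) (inc (Some j) \<alpha>)) \<le> N" for j k
    using a by auto
  note m0[measurable] = m[OF a0(1)] m[OF a0(2)] m[OF a0(3)]
  have "sqn (g i \<alpha> t x) = (sqn (g i \<alpha> t y))" using y by simp
  also have "\<dots> \<le> (\<integral>\<^sup>+v. 108 * (?n \<alpha> v + (\<Sum>j\<in>UNIV. ?n (inc (Some j) \<alpha>) v) + (\<Sum>j\<in>UNIV. \<Sum>k\<in>UNIV. ?n (inc (Some k) (inc (Some j) \<alpha>)) v)) \<partial>lborel)"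
    by (intro nn_integral_mono Sobolev_cube g_has_derivative i y g_cont_x) (use a in auto)
  also have "\<dots> = 108 * ((\<integral>\<^sup>+v. ?n \<alpha> v \<partial>lborel) + (\<Sum>j\<in>UNIV. (\<integral>\<^sup>+v. ?n (inc (Some j) \<alpha>) v \<partial>lborel)) + (\<Sum>j\<in>UNIV. \<Sum>k\<in>UNIV. (\<integral>\<^sup>+v. ?n (inc (Some k) (inc (Some j) \<alpha>)) v \<partial>lborel)))"
    by (simp add: nn_integral_cmult nn_integral_add nn_integral_sum)
  also have "\<dots> \<le> 108 * (ennreal (en i t) + (\<Sum>j\<in>(UNIV::3 set). ennreal (en i t)) + (\<Sum>j\<in>(UNIV::3 set). \<Sum>k\<in>(UNIV::3 set). ennreal (en i t)))"
    by (intro mult_left_mono add_mono sum_mono I a0) auto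
  also have "\<dots> = 108 * (ennreal (en i t) + ennreal (3 * en i t) + ennreal (9 * en i t))"
    using en_nonneg[of i t] by (simp add: ennreal_mult mult.assoc[symmetric])
  also have "\<dots> = ennreal 108 * ennreal (13 * en i t)"
  proof -
    have "ennreal a + ennreal b + ennreal c = ennreal (a + b + c)" if "0 \<le> a" "0 \<le> b" "0 \<le> c" for a b c
      using that by simp
    from this[of "en i t" "3 * en i t" "9 * en i t"] show ?thesis using en_nonneg[of i t] by simp
  qed
  also have "\<dots> = ennreal (1404 * en i t)"
    using en_nonneg[of i t] by (subst ennreal_mult[symmetric]) auto
  finally show ?thesis .
qed

lemma Y_sup:
  assumes i: "i \<in> S" "t \<in> Iv i" and a: "mi_length \<alpha> + 2 \<le> N"
  shows "\<bar>Y L \<alpha> i t x\<bar> \<le> sqrt (1404 * cw L) * sqrt (en i t)"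
proof -
  have "ennreal ((Y L \<alpha> i t x)\<^sup>2) \<le> ennreal (cw L) * ennreal (1404 * en i t)"
    unfolding Y_def by (rule order_trans[OF mom_bound mult_left_mono[OF sup_L2[OF i a]]]) (use g_meas_v i a in auto)
  also have "\<dots> = ennreal (1404 * cw L * en i t)"
    using cw_ge1[of L] en_nonneg[of i t] by (simp add: ennreal_mult[symmetric] mult_ac)
  finally have "(Y L \<alpha> i t x)\<^sup>2 \<le> 1404 * cw L * en i t"
    using cw_ge1[of L] en_nonneg[of i t] by (subst (asm) ennreal_le_iff) auto
  then have "sqrt ((Y L \<alpha> i t x)\<^sup>2) \<le> sqrt (1404 * cw L * en i t)" by (rule real_sqrt_le_mono)
  then show ?thesis by (simp add: real_sqrt_mult)
qed

lemma bnd_Y: "mi_length \<alpha> + 2 \<le> N \<Longrightarrow> bnd (\<lambda>i t. sqrt (en i t)) (Y L \<alpha>)"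
  unfolding bnd_def using cw_ge1[of L] by (intro exI[of _ "sqrt (1404 * cw L)"]) (auto intro: Y_sup)

text \<open>The strict inequality leaves two spare derivatives for \<open>bnd_Y\<close> at every
  level where boundedness is demanded.\<close>

lemma cls_Y: "mi_length \<alpha> + k < N \<Longrightarrow> cls k (\<lambda>i t. sqrt (en i t)) (Y L \<alpha>)"
proof (induction k arbitrary: \<alpha>)
  case 0 then show ?case by (auto intro: rg_Y l2b_Y)
next
  case (Suc k)
  then show ?case by (auto intro!: rg_Y bnd_Y exI[of _ "Y L (inc _ \<alpha>)"] dd_Y)
qed

lemma alg_Y: "mi_length \<alpha> + k < N \<Longrightarrow> mi_length \<alpha> + 2 \<le> N \<Longrightarrow> alg k (\<lambda>i t. sqrt (en i t)) (Y L \<alpha>)"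
  by (simp add: alg_def cls_Y bnd_Y)

end

subsection \<open>Velocity moments of the Shakhov distribution\<close>

lemma neq3[simp]: "(1::3) \<noteq> 2" "(2::3) \<noteq> 1" "(1::3) \<noteq> 3" "(3::3) \<noteq> 1" "(2::3) \<noteq> 3" "(3::3) \<noteq> 2"
  by simp_all

definition V :: "3 \<Rightarrow> poly3" where
  "V i = (if i = 1 then [(1,1,0,0)] else if i = 2 then [(1,0,1,0)] else [(1,0,0,1)])"

definition pc :: "real \<Rightarrow> poly3" where "pc c = [(c,0,0,0)]"

definition N2 :: poly3 where "N2 = [(1,2,0,0),(1,0,2,0),(1,0,0,2)]"

lemma V_simps: "V 1 = [(1,1,0,0)]" "V 2 = [(1,0,1,0)]" "V 3 = [(1,0,0,1)]"
  by (simp_all add: V_def)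

lemma peval_V[simp]: "peval (V i) v = v$i"
  using exhaust_3[of i] by (auto simp: V_simps peval_Cons mono3_def)
lemma peval_pc[simp]: "peval (pc c) v = c" by (simp add: pc_def peval_Cons mono3_def)
lemma peval_N2[simp]: "peval N2 v = (norm v)\<^sup>2" by (simp add: N2_def peval_Cons mono3_def norm_sq3)

text \<open>Components and squared length of v = U + s y as polynomials in the normalized velocity
  y; with s^2 = T the Gaussian factor becomes the standard one.\<close>

definition lin :: "real^3 \<Rightarrow> real \<Rightarrow> 3 \<Rightarrow> poly3" where
  "lin U s i = pc (U$i) @ pscale s (V i)"
definition lsq :: "real^3 \<Rightarrow> real \<Rightarrow> poly3" where
  "lsq U s = pmul (lin U s 1) (lin U s 1) @ pmul (lin U s 2) (lin U s 2) @ pmul (lin U s 3) (lin U s 3)"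

lemma peval_lin[simp]: "peval (lin U s i) y = (U + s *\<^sub>R y)$i" by (simp add: lin_def)
lemma peval_lsq[simp]: "peval (lsq U s) y = (norm (U + s *\<^sub>R y))\<^sup>2"
  unfolding norm_sq3 by (simp add: lsq_def power2_eq_square)

text \<open>The polynomial factor of the Shakhov distribution in the normalized velocity;
  \<open>Sh_moment\<close> uses it with \<kappa> = sqrt T / (10 \<rho> T^2).\<close>

definition shp :: "real \<Rightarrow> real \<Rightarrow> real^3 \<Rightarrow> poly3" where
  "shp \<rho> \<kappa> q = pc \<rho> @ pscale (\<rho> * \<kappa>) (pmul (pscale (q$1) (V 1) @ pscale (q$2) (V 2) @ pscale (q$3) (V 3)) (N2 @ pc (-5)))"

lemma peval_shp: "peval (shp \<rho> \<kappa> q) y = \<rho> * (1 + \<kappa> * (q \<bullet> y) * ((norm y)\<^sup>2 - 5))"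
  by (simp add: shp_def inner_vec_def sum_3 algebra_simps)

text \<open>\<open>shakhov\<close> at Pr = 0 with the macroscopic fields as free parameters, so that
  its moments can be computed independently of how the fields arise from F.\<close>

definition Sh :: "real \<Rightarrow> real^3 \<Rightarrow> real \<Rightarrow> real^3 \<Rightarrow> velocity_fn" where
  "Sh \<rho> U T q v = \<rho> / sqrt (2 * pi * T) ^ 3 * exp (- (norm (v - U))\<^sup>2 / (2 * T)) *
     (1 + 1 / 5 * ((q \<bullet> (v - U)) / (\<rho> * T\<^sup>2)) * ((norm (v - U))\<^sup>2 / (2 * T) - 5 / 2))"

lemma has_bochner_integral_affine3:
  fixes h :: "real^3 \<Rightarrow> real"
  assumes s: "s > 0" and [measurable]: "h \<in> borel_measurable borel"
    and I: "has_bochner_integral lborel (\<lambda>y. s^3 * h (U + s *\<^sub>R y)) r"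
  shows "has_bochner_integral lborel h r"
proof -
  define D where "D = distr lborel borel (\<lambda>x::real^3. U + s *\<^sub>R x)"
  have 1: "(lborel :: (real^3) measure) = density D (\<lambda>_. ennreal (s^3))"
    using lborel_affine[of s U] s by (simp add: D_def)
  have 2: "integrable D h \<longleftrightarrow> integrable lborel (\<lambda>y. h (U + s *\<^sub>R y))" "integral\<^sup>L D h = (LINT y|lborel. h (U + s *\<^sub>R y))"
    unfolding D_def by (subst integrable_distr_eq integral_distr; simp)+
  have s3: "s^3 \<noteq> 0" "s^3 \<ge> 0" using s by auto
  have Dm[measurable]: "h \<in> borel_measurable D" by (simp add: D_def)
  have i1: "integrable lborel (\<lambda>y. h (U + s *\<^sub>R y))" and i2: "s^3 * (LINT y|lborel. h (U + s *\<^sub>R y)) = r"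
    using I s3 by (auto simp: has_bochner_integral_iff)
  have "integrable (density D (\<lambda>_. ennreal (s^3))) h"
    by (subst integrable_density) (use i1 2 s3 in auto)
  moreover have "integral\<^sup>L (density D (\<lambda>_. ennreal (s^3))) h = r"
    by (subst integral_density) (use i2 2 s3 in auto)
  ultimately show ?thesis by (simp add: has_bochner_integral_iff flip: 1)
qed

lemma Sh_measurable[measurable]: "Sh \<rho> U T q \<in> borel_measurable borel"
  unfolding Sh_def by measurable

text \<open>Under v = U + sqrt T y the distribution becomes the standard Gaussian times a
  polynomial, so every moment is a finite Gaussian expectation.\<close>

lemma Sh_moment:
  assumes \<rho>: "\<rho> > 0" and T: "T > 0" and L: "\<And>y. peval L (U + sqrt T *\<^sub>R y) = peval L' y"
  shows "has_bochner_integral lborel (\<lambda>v. Sh \<rho> U T q v * peval L v) (pE (pmul (shp \<rho> (sqrt T / (10 * \<rho> * T\<^sup>2)) q) L'))"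
proof (rule has_bochner_integral_affine3[of "sqrt T" _ U])
  let ?s = "sqrt T" and ?k = "sqrt T / (10 * \<rho> * T\<^sup>2)"
  have e: "?s^3 * (Sh \<rho> U T q (U + ?s *\<^sub>R y) * peval L (U + ?s *\<^sub>R y)) = maxwellian y * peval (pmul (shp \<rho> ?k q) L') y" for y
  proof -
    have n: "(norm (?s *\<^sub>R y))\<^sup>2 = T * (norm y)\<^sup>2" using T by (simp add: power_mult_distrib)
    have m: "maxwellian y = exp (- (norm y)\<^sup>2 / 2) / sqrt (2 * pi) ^ 3"
    proof -
      have "(2*pi) powr (-3/2) = ((2*pi) powr (-(1/2))) powr 3" by (simp only: powr_powr) simp
      also have "\<dots> = ((2*pi) powr (-(1/2)))^3" by (subst powr_numeral) auto
      also have "(2*pi) powr (-(1/2)) = 1 / sqrt (2*pi)" by (simp add: powr_minus_divide powr_half_sqrt)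
      finally show ?thesis by (simp add: maxwellian_def power_divide)
    qed
    have c: "?s^3 * (\<rho> / sqrt (2 * pi * T) ^ 3) = \<rho> / sqrt (2 * pi) ^ 3"
      using T by (simp add: real_sqrt_mult power_mult_distrib)
    have "?s^3 * Sh \<rho> U T q (U + ?s *\<^sub>R y) = (?s^3 * (\<rho> / sqrt (2 * pi * T) ^ 3)) * exp (- (T * (norm y)\<^sup>2) / (2 * T)) *
       (1 + 1 / 5 * ((q \<bullet> (?s *\<^sub>R y)) / (\<rho> * T\<^sup>2)) * (T * (norm y)\<^sup>2 / (2 * T) - 5 / 2))"
      unfolding Sh_def by (simp only: add_diff_cancel_left' n mult.assoc)
    also have "- (T * (norm y)\<^sup>2) / (2 * T) = - (norm y)\<^sup>2 / 2" using T by simp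
    also have "T * (norm y)\<^sup>2 / (2 * T) = (norm y)\<^sup>2 / 2" using T by simp
    also have "1 / 5 * ((q \<bullet> (?s *\<^sub>R y)) / (\<rho> * T\<^sup>2)) * ((norm y)\<^sup>2 / 2 - 5 / 2) = ?k * (q \<bullet> y) * ((norm y)\<^sup>2 - 5)"
      by (simp add: inner_scaleR_right diff_divide_distrib[symmetric])
    finally have "?s^3 * Sh \<rho> U T q (U + ?s *\<^sub>R y) = maxwellian y * (\<rho> * (1 + ?k * (q \<bullet> y) * ((norm y)\<^sup>2 - 5)))"
      unfolding c m by simp
    then show ?thesis by (simp only: L peval_pmul peval_shp mult.assoc[symmetric])
  qed
  show "has_bochner_integral lborel (\<lambda>y. ?s^3 * (Sh \<rho> U T q (U + ?s *\<^sub>R y) * peval L (U + ?s *\<^sub>R y))) (pE (pmul (shp \<rho> ?k q) L'))"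
    unfolding e by (rule pE_integral)
qed (use T in auto)

lemma gmom_numeral: "gmom 1 = 0" "gmom 2 = 1" "gmom 3 = 0" "gmom 4 = 3" "gmom 5 = 0" "gmom 6 = 15" "gmom 7 = 0" "gmom 8 = 105" "gmom 9 = 0" "gmom 10 = 945"
  by (simp_all add: numeral_eq_Suc)

lemmas pE_simps = pmul_def pE_def pscale_def pc_def lin_def lsq_def V_simps N2_def mmul_def gmono_def shp_def

lemma shp_1: "pE (pmul (shp \<rho> \<kappa> q) (pc 1)) = \<rho>"
  by (simp add: pE_simps gmom_numeral)
lemma shp_v: "pE (pmul (shp \<rho> \<kappa> q) (lin U s 1)) = \<rho> * U$1"
   "pE (pmul (shp \<rho> \<kappa> q) (lin U s 2)) = \<rho> * U$2"
   "pE (pmul (shp \<rho> \<kappa> q) (lin U s 3)) = \<rho> * U$3"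
  by (simp_all add: pE_simps gmom_numeral algebra_simps)
lemma shp_vsq: "pE (pmul (shp \<rho> \<kappa> q) (lsq U s)) = \<rho> * ((U$1)\<^sup>2 + (U$2)\<^sup>2 + (U$3)\<^sup>2) + 3 * \<rho> * s\<^sup>2"
  by (simp add: pE_simps gmom_numeral algebra_simps power2_eq_square)
text \<open>The factor 10 is the expectation of y_1^2 |y|^2 (|y|^2 - 5), namely 35 - 25.\<close>

lemma shp_vvsq1:
  "pE (pmul (shp \<rho> \<kappa> q) (pmul (lin U s 1) (lsq U s))) = 10 * (\<rho> * \<kappa> * s^3) * q$1 + 5 * \<rho> * s\<^sup>2 * U$1 + \<rho> * U$1 * ((U$1)\<^sup>2 + (U$2)\<^sup>2 + (U$3)\<^sup>2)"
  by (simp_all add: pE_simps gmom_numeral algebra_simps power2_eq_square power3_eq_cube)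

lemma shp_vvsq2:
  "pE (pmul (shp \<rho> \<kappa> q) (pmul (lin U s 2) (lsq U s))) = 10 * (\<rho> * \<kappa> * s^3) * q$2 + 5 * \<rho> * s\<^sup>2 * U$2 + \<rho> * U$2 * ((U$1)\<^sup>2 + (U$2)\<^sup>2 + (U$3)\<^sup>2)"
  by (simp_all add: pE_simps gmom_numeral algebra_simps power2_eq_square power3_eq_cube)

lemma shp_vvsq3:
  "pE (pmul (shp \<rho> \<kappa> q) (pmul (lin U s 3) (lsq U s))) = 10 * (\<rho> * \<kappa> * s^3) * q$3 + 5 * \<rho> * s\<^sup>2 * U$3 + \<rho> * U$3 * ((U$1)\<^sup>2 + (U$2)\<^sup>2 + (U$3)\<^sup>2)"
  by (simp_all add: pE_simps gmom_numeral algebra_simps power2_eq_square power3_eq_cube)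

text \<open>The correction y (|y|^2 - 5) is orthogonal to all polynomials of degree at most 2, so
  the heat flux drops out of these moments; the isotropic part drops out because they are
  traceless.\<close>

lemma shp_off12:
  "pE (pmul (shp \<rho> \<kappa> q) (pmul (lin U s 1) (lin U s 2))) = \<rho> * U$1 * U$2"
  "pE (pmul (shp \<rho> \<kappa> q) (pmul (lin U s 1) (lin U s 1) @ pscale (-1) (pmul (lin U s 2) (lin U s 2)))) = \<rho> * ((U$1)\<^sup>2 - (U$2)\<^sup>2)"
  by (simp_all add: pE_simps gmom_numeral algebra_simps power2_eq_square power3_eq_cube)

lemma shp_off13:
  "pE (pmul (shp \<rho> \<kappa> q) (pmul (lin U s 1) (lin U s 3))) = \<rho> * U$1 * U$3"
  "pE (pmul (shp \<rho> \<kappa> q) (pmul (lin U s 1) (lin U s 1) @ pscale (-1) (pmul (lin U s 3) (lin U s 3)))) = \<rho> * ((U$1)\<^sup>2 - (U$3)\<^sup>2)"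
  by (simp_all add: pE_simps gmom_numeral algebra_simps power2_eq_square power3_eq_cube)

lemma shp_off23:
  "pE (pmul (shp \<rho> \<kappa> q) (pmul (lin U s 2) (lin U s 3))) = \<rho> * U$2 * U$3"
  "pE (pmul (shp \<rho> \<kappa> q) (pmul (lin U s 2) (lin U s 2) @ pscale (-1) (pmul (lin U s 3) (lin U s 3)))) = \<rho> * ((U$2)\<^sup>2 - (U$3)\<^sup>2)"
  by (simp_all add: pE_simps gmom_numeral algebra_simps power2_eq_square power3_eq_cube)

text \<open>At this degree the heat flux survives, but only multiplied by the mean velocity; since
  s^2 will be a temperature close to 1, everything is at least quadratic in the deviation from
  equilibrium.\<close>

lemma shp_thoff12:
  "pE (pmul (shp \<rho> \<kappa> q) (pmul (pmul (lin U s 1) (lin U s 2)) (lsq U s @ pc (-7)))) = \<rho> * U$1 * U$2 * (((U$1)\<^sup>2 + (U$2)\<^sup>2 + (U$3)\<^sup>2) + 7 * s\<^sup>2 - 7) + 14 * (\<rho> * \<kappa> * s^3) * (U$1 * q$2 + U$2 * q$1)"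
  by (simp_all add: pE_simps gmom_numeral algebra_simps power2_eq_square power3_eq_cube)

lemma shp_thdif12:
  "pE (pmul (shp \<rho> \<kappa> q) (pmul (pmul (lin U s 1) (lin U s 1) @ pscale (-1) (pmul (lin U s 2) (lin U s 2))) (lsq U s @ pc (-7)))) = \<rho> * ((U$1)\<^sup>2 - (U$2)\<^sup>2) * (((U$1)\<^sup>2 + (U$2)\<^sup>2 + (U$3)\<^sup>2) + 7 * s\<^sup>2 - 7) + 28 * (\<rho> * \<kappa> * s^3) * (U$1 * q$1 - U$2 * q$2)"
  by (simp_all add: pE_simps gmom_numeral algebra_simps power2_eq_square power3_eq_cube)

lemma shp_thoff13:
  "pE (pmul (shp \<rho> \<kappa> q) (pmul (pmul (lin U s 1) (lin U s 3)) (lsq U s @ pc (-7)))) = \<rho> * U$1 * U$3 * (((U$1)\<^sup>2 + (U$2)\<^sup>2 + (U$3)\<^sup>2) + 7 * s\<^sup>2 - 7) + 14 * (\<rho> * \<kappa> * s^3) * (U$1 * q$3 + U$3 * q$1)"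
  by (simp_all add: pE_simps gmom_numeral algebra_simps power2_eq_square power3_eq_cube)

lemma shp_thdif13:
  "pE (pmul (shp \<rho> \<kappa> q) (pmul (pmul (lin U s 1) (lin U s 1) @ pscale (-1) (pmul (lin U s 3) (lin U s 3))) (lsq U s @ pc (-7)))) = \<rho> * ((U$1)\<^sup>2 - (U$3)\<^sup>2) * (((U$1)\<^sup>2 + (U$2)\<^sup>2 + (U$3)\<^sup>2) + 7 * s\<^sup>2 - 7) + 28 * (\<rho> * \<kappa> * s^3) * (U$1 * q$1 - U$3 * q$3)"
  by (simp_all add: pE_simps gmom_numeral algebra_simps power2_eq_square power3_eq_cube)

lemma shp_thoff23:
  "pE (pmul (shp \<rho> \<kappa> q) (pmul (pmul (lin U s 2) (lin U s 3)) (lsq U s @ pc (-7)))) = \<rho> * U$2 * U$3 * (((U$1)\<^sup>2 + (U$2)\<^sup>2 + (U$3)\<^sup>2) + 7 * s\<^sup>2 - 7) + 14 * (\<rho> * \<kappa> * s^3) * (U$2 * q$3 + U$3 * q$2)"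
  by (simp_all add: pE_simps gmom_numeral algebra_simps power2_eq_square power3_eq_cube)

lemma shp_thdif23:
  "pE (pmul (shp \<rho> \<kappa> q) (pmul (pmul (lin U s 2) (lin U s 2) @ pscale (-1) (pmul (lin U s 3) (lin U s 3))) (lsq U s @ pc (-7)))) = \<rho> * ((U$2)\<^sup>2 - (U$3)\<^sup>2) * (((U$1)\<^sup>2 + (U$2)\<^sup>2 + (U$3)\<^sup>2) + 7 * s\<^sup>2 - 7) + 28 * (\<rho> * \<kappa> * s^3) * (U$2 * q$2 - U$3 * q$3)"
  by (simp_all add: pE_simps gmom_numeral algebra_simps power2_eq_square power3_eq_cube)

text \<open>\<open>pE\<close> is an integral of the polynomial function, so it depends on the values
  of a list and not on its shape.\<close>

lemma pE_cong: "(\<And>v. peval L v = peval L' v) \<Longrightarrow> pE L = pE L'"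
  by (simp add: integral_maxwellian_peval[symmetric])

lemma mom_cong: "(\<And>v. peval L v = peval L' v) \<Longrightarrow> mom (peval L) h = mom (peval L') h"
  by (simp add: mom_def)

lemma mom_append:
  assumes "h \<in> borel_measurable borel" "sqn h < \<infinity>"
  shows "mom (peval (L @ L')) h = mom (peval L) h + mom (peval L') h"
  unfolding mom_def peval_append distrib_right distrib_left
  by (rule Bochner_Integration.integral_add) (use assms mom_integrable in auto)

lemma mom_pscale: "mom (peval (pscale a L)) h = a * mom (peval L) h"
proof -
  have "(\<lambda>v. h v * (wt (pscale a L) v)) = (\<lambda>v. a * (h v * (wt L v)))"
    by (simp add: mult_ac)
  then show ?thesis by (simp add: mom_def)
qed

lemma perturbed_moment:
  assumes h: "h \<in> borel_measurable borel" "sqn h < \<infinity>"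
  shows "has_bochner_integral lborel (\<lambda>v. perturbed h v * peval L v) (pE L + mom (peval L) h)"
proof -
  have "has_bochner_integral lborel (\<lambda>v. maxwellian v * peval L v + h v * (wt L v)) (pE L + mom (peval L) h)"
    by (intro has_bochner_integral_add pE_integral) (simp add: has_bochner_integral_iff mom_def mom_integrable[OF h])
  then show ?thesis by (simp add: perturbed_def algebra_simps)
qed

lemma perturbed_measurable[measurable]: "h \<in> borel_measurable borel \<Longrightarrow> perturbed h \<in> borel_measurable borel"
  unfolding perturbed_def[abs_def] by measurable

lemma perturbed_vec_moment:
  fixes w :: "real^3 \<Rightarrow> real^3"
  assumes h: "h \<in> borel_measurable borel" "sqn h < \<infinity>"
    and w: "w \<in> borel_measurable borel" "\<And>v. norm (w v) \<le> peval L v" "\<And>v. w v $ j = peval (Lj) v"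
  shows "(LINT v|lborel. perturbed h v *\<^sub>R w v) $ j = pE Lj + mom (peval Lj) h"
proof -
  note [measurable] = h(1) w(1)
  have "integrable lborel (\<lambda>v. perturbed h v * peval L v)"
    using perturbed_moment[OF h] by (auto simp: has_bochner_integral_iff)
  then have I: "integrable lborel (\<lambda>v. perturbed h v *\<^sub>R w v)"
  proof (rule Bochner_Integration.integrable_bound)
    show "AE v in lborel. norm (perturbed h v *\<^sub>R w v) \<le> norm (perturbed h v * peval L v)"
      using order_trans[OF norm_ge_zero w(2)] w(2) by (auto simp: abs_mult intro!: mult_left_mono)
  qed measurable
  have "(LINT v|lborel. perturbed h v *\<^sub>R w v) $ j = (LINT v|lborel. (perturbed h v *\<^sub>R w v) $ j)"
    by (rule integral_bounded_linear[OF bounded_linear_vec_nth I, symmetric])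
  also have "\<dots> = (LINT v|lborel. perturbed h v * peval Lj v)" by (simp add: w(3))
  also have "\<dots> = pE Lj + mom (peval Lj) h" using perturbed_moment[OF h] by (simp add: has_bochner_integral_iff)
  finally show ?thesis .
qed

lemma pE_basic: "pE (pc c) = c" "pE N2 = 3" "pE (V j) = 0" "pE (pmul (V k) (V j)) = (if k = j then 1 else 0)"
  "pE (pmul (V j) N2) = 0"
  using exhaust_3[of j] exhaust_3[of k] by (auto simp: pE_simps gmom_numeral)

lemma cw_basic: "cw (pc 1) = 5" "cw (V j) = 7" "cw N2 = 121"
  using exhaust_3[of j] by (auto simp: cw_def wsq_def pE_simps gmom_numeral)

lemma norm_le_poly: "norm (a :: real^3) \<le> 1 + (norm a)\<^sup>2"
proof -
  have "2 * norm a \<le> 1 + (norm a)\<^sup>2" using sum_squares_bound[of 1 "norm a"] by simp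
  then show ?thesis using norm_ge_zero[of a] by linarith
qed

definition LT :: "real^3 \<Rightarrow> poly3" where
  "LT U = N2 @ pscale (-2 * U$1) (V 1) @ pscale (-2 * U$2) (V 2) @ pscale (-2 * U$3) (V 3) @ pc ((U$1)\<^sup>2 + (U$2)\<^sup>2 + (U$3)\<^sup>2)"

lemma peval_LT: "peval (LT U) v = (norm (v - U))\<^sup>2"
  unfolding LT_def peval_append peval_pscale peval_V peval_pc peval_N2 norm_sq3
  by (simp add: power2_eq_square algebra_simps)

definition LQ :: "real^3 \<Rightarrow> 3 \<Rightarrow> poly3" where
  "LQ U j = (let u2 = (U$1)\<^sup>2 + (U$2)\<^sup>2 + (U$3)\<^sup>2 in pmul (V j) N2 @ pscale (- (U$j)) N2
     @ pscale (-2 * U$1) (pmul (V 1) (V j)) @ pscale (-2 * U$2) (pmul (V 2) (V j)) @ pscale (-2 * U$3) (pmul (V 3) (V j))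
     @ pscale (2 * U$j * U$1) (V 1) @ pscale (2 * U$j * U$2) (V 2) @ pscale (2 * U$j * U$3) (V 3)
     @ pscale u2 (V j) @ pc (- u2 * U$j))"

lemma peval_LQ: "peval (LQ U j) v = (norm (v - U))\<^sup>2 * (v - U)$j"
  unfolding LQ_def Let_def peval_append peval_pscale peval_pmul peval_V peval_pc peval_N2 norm_sq3
  by (simp add: power2_eq_square algebra_simps)

subsection \<open>Macroscopic fields in terms of moments of the perturbation\<close>

context
  fixes h :: velocity_fn
  assumes h: "h \<in> borel_measurable borel" "sqn h < \<infinity>"
begin

private abbreviation (input) "F \<equiv> perturbed h"
private abbreviation (input) "M L \<equiv> mom (peval L) h"

lemma mass_density_perturbed: "mass_density F = 1 + M (pc 1)"
  using perturbed_moment[OF h, of "pc 1"] by (simp add: mass_density_def has_bochner_integral_iff pE_basic)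

lemma bulk_velocity_perturbed: "bulk_velocity F $ j = M (V j) / mass_density F"
proof -
  have "(LINT v|lborel. F v *\<^sub>R v) $ j = pE (V j) + M (V j)"
    by (rule perturbed_vec_moment[OF h, where L="wsq"]) (auto simp: peval_wsq norm_le_poly)
  then show ?thesis by (simp add: bulk_velocity_def pE_basic)
qed

lemma temperature_perturbed:
  assumes \<rho>: "mass_density F > 0"
  shows "3 * mass_density F * temperature F = 3 + M N2 - mass_density F * ((bulk_velocity F$1)\<^sup>2 + (bulk_velocity F$2)\<^sup>2 + (bulk_velocity F$3)\<^sup>2)"
proof -
  define U where "U = bulk_velocity F"
  have n: "M (V j) = mass_density F * U $ j" for j using \<rho> by (simp add: U_def bulk_velocity_perturbed)
  have r: "M (pc c) = c * (mass_density F - 1)" for c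
  proof -
    have "M (pc c) = M (pscale c (pc 1))" by (rule mom_cong) simp
    then show ?thesis by (simp add: mom_pscale mass_density_perturbed)
  qed
  have "(LINT v|lborel. F v * (norm (v - U))\<^sup>2) = pE (LT U) + M (LT U)"
    using perturbed_moment[OF h, of "LT U"] by (simp add: has_bochner_integral_iff peval_LT)
  also have "\<dots> = 3 + M N2 - mass_density F * ((U$1)\<^sup>2 + (U$2)\<^sup>2 + (U$3)\<^sup>2)"
    unfolding LT_def mom_append[OF h] mom_pscale pE_append pE_pscale pE_basic n r
    by (simp add: power2_eq_square algebra_simps)
  finally show ?thesis using \<rho> by (simp add: temperature_def U_def)
qed

lemma heat_flux_perturbed:
  assumes \<rho>: "mass_density F > 0"
  defines "U \<equiv> bulk_velocity F"
  shows "heat_flux F $ j = M (pmul (V j) N2) - U$j * (3 + M N2) - 2 * U$j - 2 * (U$1 * M (pmul (V 1) (V j)) + U$2 * M (pmul (V 2) (V j)) + U$3 * M (pmul (V 3) (V j)))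
     + 2 * mass_density F * ((U$1)\<^sup>2 + (U$2)\<^sup>2 + (U$3)\<^sup>2) * U$j"
proof -
  have n: "M (V j) = mass_density F * U $ j" for j using \<rho> by (simp add: U_def bulk_velocity_perturbed)
  have r: "M (pc c) = c * (mass_density F - 1)" for c
  proof -
    have "M (pc c) = M (pscale c (pc 1))" by (rule mom_cong) simp
    then show ?thesis by (simp add: mom_pscale mass_density_perturbed)
  qed
  have w: "norm ((norm (v - U))\<^sup>2 *\<^sub>R (v - U)) \<le> peval (pmul (pc 1 @ LT U) (pc 1 @ LT U)) v" for v
  proof -
    have "(norm (v - U))\<^sup>2 * norm (v - U) \<le> (1 + (norm (v - U))\<^sup>2) * (1 + (norm (v - U))\<^sup>2)"
      by (intro mult_mono norm_le_poly) auto
    then show ?thesis by (simp add: peval_LT)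
  qed
  have "(LINT v|lborel. F v *\<^sub>R ((norm (v - U))\<^sup>2 *\<^sub>R (v - U))) $ j = pE (LQ U j) + M (LQ U j)"
    by (rule perturbed_vec_moment[OF h _ w]) (simp_all add: peval_LQ)
  moreover have "heat_flux F = (LINT v|lborel. F v *\<^sub>R ((norm (v - U))\<^sup>2 *\<^sub>R (v - U)))"
    by (simp add: heat_flux_def U_def)
  ultimately have "heat_flux F $ j = pE (LQ U j) + M (LQ U j)" by simp
  also have "pE (LQ U j) = - 5 * U$j - ((U$1)\<^sup>2 + (U$2)\<^sup>2 + (U$3)\<^sup>2) * U$j"
  proof -
    have "pE (LQ U j) = - (U$j * 3) - 2 * U$1 * (if 1 = j then 1 else 0) - 2 * U$2 * (if 2 = j then 1 else 0) - 2 * U$3 * (if 3 = j then 1 else 0)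
       - ((U$1)\<^sup>2 + (U$2)\<^sup>2 + (U$3)\<^sup>2) * U$j"
      unfolding LQ_def Let_def by (simp add: pE_basic) (simp add: algebra_simps)
    also have "2 * U$1 * (if 1 = j then 1 else 0) = (if 1 = j then 2 * U$j else 0)" by auto
    also have "2 * U$2 * (if 2 = j then 1 else 0) = (if 2 = j then 2 * U$j else 0)" by auto
    also have "2 * U$3 * (if 3 = j then 1 else 0) = (if 3 = j then 2 * U$j else 0)" by auto
    finally show ?thesis using exhaust_3[of j] by (elim disjE) simp_all
  qed
  also have "M (LQ U j) = M (pmul (V j) N2) - U$j * M N2 - 2 * (U$1 * M (pmul (V 1) (V j)) + U$2 * M (pmul (V 2) (V j)) + U$3 * M (pmul (V 3) (V j)))
     + (2 * mass_density F + 1) * ((U$1)\<^sup>2 + (U$2)\<^sup>2 + (U$3)\<^sup>2) * U$j"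
    unfolding LQ_def Let_def mom_append[OF h] mom_pscale n r
    by (simp add: power2_eq_square algebra_simps)
  finally show ?thesis by (simp add: algebra_simps)
qed

lemma shakhov_moment:
  assumes \<rho>: "mass_density F > 0" and T: "temperature F > 0"
    and L: "\<And>y. peval L (bulk_velocity F + sqrt (temperature F) *\<^sub>R y) = peval L' y"
  shows "has_bochner_integral lborel (\<lambda>v. shakhov 0 F v * peval L v)
     (pE (pmul (shp (mass_density F) (sqrt (temperature F) / (10 * mass_density F * (temperature F)\<^sup>2)) (heat_flux F)) L'))"
proof -
  have "shakhov 0 F = Sh (mass_density F) (bulk_velocity F) (temperature F) (heat_flux F)"
    by (simp add: fun_eq_iff shakhov_def Sh_def local_maxwellian_def)
  then show ?thesis using Sh_moment[OF \<rho> T L] by simp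
qed

end

section \<open>The transport operator in moment form\<close>

context kinetic
begin

text \<open>The moment against L of (d/dt + v . grad_x) applied to the \<gamma>-th derivative of the
  solution; the factor \<open>V j\<close> produces the flux.\<close>

definition W :: "poly3 \<Rightarrow> nat^4 \<Rightarrow> 'i \<Rightarrow> real \<Rightarrow> real^3 \<Rightarrow> real" where
  "W L \<gamma> i t x = Y L (inc None \<gamma>) i t x + (\<Sum>j\<in>UNIV. Y (pmul (V j) L) (inc (Some j) \<gamma>) i t x)"

lemma rg_sum: "(\<And>j. j \<in> J \<Longrightarrow> rg (u j)) \<Longrightarrow> rg (\<lambda>i t x. \<Sum>j\<in>J. u j i t x)"
  by (induction J rule: infinite_finite_induct) (auto intro: rg_const rg_add)

lemma dd_sum: "(\<And>j. j \<in> J \<Longrightarrow> dd e (u j) (u' j)) \<Longrightarrow> (\<And>j. j \<in> J \<Longrightarrow> rg (u j) \<and> rg (u' j)) \<Longrightarrow> dd e (\<lambda>i t x. \<Sum>j\<in>J. u j i t x) (\<lambda>i t x. \<Sum>j\<in>J. u' j i t x)"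
proof (induction J rule: infinite_finite_induct)
  case (insert x J)
  then show ?case by (simp, intro dd_add rg_sum) auto
qed (auto intro: dd_const)

lemma rg_W: "mi_length \<gamma> < N \<Longrightarrow> rg (W L \<gamma>)"
  unfolding W_def[abs_def] by (intro rg_add rg_sum rg_Y) auto

lemma dd_W: "Suc (mi_length \<gamma>) < N \<Longrightarrow> dd e (W L \<gamma>) (W L (inc e \<gamma>))"
  unfolding W_def[abs_def] inc_commute[of _ e \<gamma>]
  by (intro dd_add dd_sum dd_Y rg_sum rg_Y conjI) auto

lemma finite_v0: "i \<in> S \<Longrightarrow> t \<in> Iv i \<Longrightarrow> mi_length \<alpha> + 2 \<le> N \<Longrightarrow> (sqn (g i \<alpha> t x)) < \<infinity>"
  using sup_L2[of i t \<alpha> x] le_less_trans ennreal_less_top unfolding infinity_ennreal_def by blast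

lemma fold_inc_length: "mi_length (fold inc es \<gamma>) = length es + mi_length \<gamma>"
  by (induction es arbitrary: \<gamma>) auto

lemma ex_fold_inc: "\<exists>es. \<gamma> = fold inc es 0 \<and> length es = mi_length \<gamma>"
proof (induction "mi_length \<gamma>" arbitrary: \<gamma>)
  case 0
  then have "\<gamma> = 0" by (auto simp: mi_length_def vec_eq_iff)
  then show ?case by (intro exI[of _ "[]"]) auto
next
  case (Suc n)
  have "\<not> (\<forall>k. \<gamma>$k = 0)"
  proof
    assume "\<forall>k. \<gamma>$k = 0"
    then have "mi_length \<gamma> = 0" by (simp add: mi_length_def)
    then show False using Suc(2) by simp
  qed
  then obtain k where k: "\<gamma>$k > 0" by blast
  have "\<exists>e. ax e = k"
    using exhaust_4[of k] by (auto simp: ax_def intro: exI[of _ None] exI[of _ "Some 1"] exI[of _ "Some 2"] exI[of _ "Some 3"])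
  then obtain e where e: "ax e = k" by blast
  define \<gamma>' where "\<gamma>' = \<gamma> - axis k 1"
  have g: "\<gamma> = inc e \<gamma>'" using k by (auto simp: inc_def \<gamma>'_def e vec_eq_iff axis_def)
  then have "n = mi_length \<gamma>'" using Suc(2) by simp
  from Suc(1)[OF this] obtain es where es: "\<gamma>' = fold inc es 0" "length es = mi_length \<gamma>'" by blast
  then show ?case using g by (intro exI[of _ "es @ [e]"]) auto
qed

text \<open>A moment equation is known pointwise for the undifferentiated solution only. Its
  nonlinear side has N - 1 derivatives in the algebra, and uniqueness of mean-square derivatives
  carries the size bound to every \<gamma> of order below N, hence to moments of derivatives of
  order up to N.\<close>

lemma transfer_W:
  assumes "alg (N-1) \<kappa> u" "\<And>i t x. i \<in> S \<Longrightarrow> t \<in> Iv i \<Longrightarrow> W L 0 i t x + c * Y L 0 i t x = u i t x"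
    and "mi_length \<gamma> < N"
  shows "l2b \<kappa> (\<lambda>i t x. W L \<gamma> i t x + c * Y L \<gamma> i t x)"
proof -
  obtain es where es: "\<gamma> = fold inc es 0" "length es = mi_length \<gamma>" using ex_fold_inc by blast
  have "l2b \<kappa> ((\<lambda>\<gamma> i t x. W L \<gamma> i t x + c * Y L \<gamma> i t x) (fold inc es 0))"
  proof (rule cls_transfer[where P="\<lambda>\<gamma>. mi_length \<gamma> < N"])
    show "cls (N-1) \<kappa> u" using assms(1) by (simp add: alg_def)
    show "dd e (\<lambda>i t x. W L \<gamma> i t x + c * Y L \<gamma> i t x) (\<lambda>i t x. W L (inc e \<gamma>) i t x + c * Y L (inc e \<gamma>) i t x)"
      if "mi_length \<gamma> < N" "mi_length (inc e \<gamma>) < N" for \<gamma> e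
      using that by (intro dd_add dd_W dd_cmult dd_Y rg_W rg_cmult rg_Y) auto
    show "mi_length (fold inc es1 0) < N" if "es = es1 @ es2" for es1 es2
      using that es assms(3) by (simp add: fold_inc_length)
    show "rg (\<lambda>i t x. W L \<gamma> i t x + c * Y L \<gamma> i t x)" if "mi_length \<gamma> < N" for \<gamma>
      using that by (intro rg_add rg_W rg_cmult rg_Y) auto
  qed (use assms es N3 in \<open>auto intro: rg_add rg_W rg_cmult rg_Y\<close>)
  then show ?thesis by (simp add: es(1))
qed

end

subsection \<open>The moment equations\<close>

text \<open>\<open>DP\<close> and \<open>CP\<close> are the velocity polynomials in
  \<open>P_nc\<close> and in the energy part of \<open>P_c\<close>.\<close>

definition DP :: "3 \<Rightarrow> poly3" where
  "DP j = pscale (1 / sqrt 10) (pmul (V j) (N2 @ pc (-5)))"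
definition CP :: poly3 where
  "CP = pscale (1 / sqrt 6) (N2 @ pc (-3))"
text \<open>Off-diagonal entries and differences of diagonal entries together span the traceless
  symmetric second moments.\<close>

definition off :: "3 \<Rightarrow> 3 \<Rightarrow> poly3" where
  "off i j = pmul (V i) (V j)"
definition dif :: "3 \<Rightarrow> 3 \<Rightarrow> poly3" where
  "dif i j = pmul (V i) (V i) @ pscale (-1) (pmul (V j) (V j))"
text \<open>The shift 7 is the expectation of v_1^2 v_2^2 |v|^2. It makes v_i v_j (|v|^2 - 7)
  orthogonal to v_i v_j, so the flux of these moments contains the heat flux but no
  velocity.\<close>

definition th :: "poly3 \<Rightarrow> poly3" where
  "th L = pmul L (N2 @ pc (-7))"

lemma pE_pmul_append: "pE (pmul S (L @ L')) = pE (pmul S L) + pE (pmul S L')"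
proof -
  have "pE (pmul S (L @ L')) = pE (pmul S L @ pmul S L')" by (rule pE_cong) (simp add: algebra_simps)
  then show ?thesis by simp
qed

lemma pE_pmul_pscale: "pE (pmul S (pscale a L)) = a * pE (pmul S L)"
proof -
  have "pE (pmul S (pscale a L)) = pE (pscale a (pmul S L))" by (rule pE_cong) (simp add: algebra_simps)
  then show ?thesis by simp
qed

text \<open>The threshold serves \<open>Y_small\<close>: 1404 * 121 / 10^9 is below (1/20)^2, which
  keeps density and temperature inside [1/2, 3/2].\<close>

locale shakhov_kinetic = kinetic S Tm g N B for S :: "'i set" and Tm g N B +
  fixes \<tau>\<^sub>0 \<eta> w :: real
  assumes tau: "\<tau>\<^sub>0 > 0"
    and en_small: "i \<in> S \<Longrightarrow> t \<in> Iv i \<Longrightarrow> en i t \<le> 1 / 10^9"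
    and pde: "i \<in> S \<Longrightarrow> t \<in> Iv i \<Longrightarrow> g i (inc None 0) t x v + (\<Sum>j\<in>UNIV. v$j * g i (inc (Some j) 0) t x v)
       = 1 / sqrt (maxwellian v) * (inv_tau \<tau>\<^sub>0 \<eta> w (perturbed (g i 0 t x)) * (shakhov 0 (perturbed (g i 0 t x)) v - perturbed (g i 0 t x) v))"
begin

text \<open>Density, velocity, temperature, heat flux and collision frequency are written through
  moments of the perturbation alone, with \<open>powr (-1)\<close> for division, so that the closure
  lemmas of \<open>alg\<close> apply to them.\<close>

definition R :: "'i \<Rightarrow> real \<Rightarrow> real^3 \<Rightarrow> real" where "R i t x = 1 + Y (pc 1) 0 i t x"
definition Uf :: "3 \<Rightarrow> 'i \<Rightarrow> real \<Rightarrow> real^3 \<Rightarrow> real" where "Uf j i t x = R i t x powr (-1) * Y (V j) 0 i t x"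
definition U2 :: "'i \<Rightarrow> real \<Rightarrow> real^3 \<Rightarrow> real" where
  "U2 i t x = Uf 1 i t x * Uf 1 i t x + Uf 2 i t x * Uf 2 i t x + Uf 3 i t x * Uf 3 i t x"
definition Th :: "'i \<Rightarrow> real \<Rightarrow> real^3 \<Rightarrow> real" where
  "Th i t x = (1 + Y N2 0 i t x / 3) * R i t x powr (-1) - 1/3 * U2 i t x"
definition Qf :: "3 \<Rightarrow> 'i \<Rightarrow> real \<Rightarrow> real^3 \<Rightarrow> real" where
  "Qf j i t x = Y (pmul (V j) N2) 0 i t x - Uf j i t x * (3 + Y N2 0 i t x) - 2 * Uf j i t x
     - 2 * (Uf 1 i t x * Y (pmul (V 1) (V j)) 0 i t x + Uf 2 i t x * Y (pmul (V 2) (V j)) 0 i t x + Uf 3 i t x * Y (pmul (V 3) (V j)) 0 i t x)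
     + 2 * R i t x * U2 i t x * Uf j i t x"
definition Af :: "'i \<Rightarrow> real \<Rightarrow> real^3 \<Rightarrow> real" where
  "Af i t x = 1 / \<tau>\<^sub>0 * R i t x powr \<eta> * Th i t x powr w"

lemma Y_small:
  assumes i: "i \<in> S" "t \<in> Iv i" and L: "cw L \<le> 121"
  shows "\<bar>Y L 0 i t x\<bar> \<le> 1/20"
proof -
  have "\<bar>Y L 0 i t x\<bar> \<le> sqrt (1404 * cw L) * sqrt (en i t)" by (rule Y_sup[OF i]) (use N3 in simp)
  also have "\<dots> = sqrt (1404 * cw L * en i t)" by (simp add: real_sqrt_mult)
  also have "\<dots> \<le> sqrt ((1/20)\<^sup>2)"
  proof (rule real_sqrt_le_mono)
    have "1404 * cw L * en i t \<le> 1404 * 121 * (1 / 10^9)"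
      using L cw_ge1[of L] en_small[OF i] en_nonneg[of i t] by (intro mult_mono) auto
    also have "\<dots> \<le> (1/20)\<^sup>2" by (simp add: power2_eq_square)
    finally show "1404 * cw L * en i t \<le> (1/20)\<^sup>2" .
  qed
  finally show ?thesis by simp
qed

lemma R_range: assumes i: "i \<in> S" "t \<in> Iv i" shows "R i t x \<in> {19/20..21/20}"
proof -
  have "\<bar>Y (pc 1) 0 i t x\<bar> \<le> 1/20" by (rule Y_small[OF i]) (simp add: cw_basic)
  then show ?thesis unfolding R_def atLeastAtMost_iff by linarith
qed

lemma R_inv: "i \<in> S \<Longrightarrow> t \<in> Iv i \<Longrightarrow> R i t x powr (-1) = 1 / R i t x"
  using R_range[of i t x] by (simp add: powr_minus_divide)

lemma Uf_bound: assumes i: "i \<in> S" "t \<in> Iv i" shows "\<bar>Uf j i t x\<bar> \<le> 1/19"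
proof -
  have r: "R i t x \<ge> 19/20" using R_range[OF i, of x] by simp
  then have "\<bar>Uf j i t x\<bar> = \<bar>Y (V j) 0 i t x\<bar> / R i t x" by (simp add: Uf_def R_inv[OF i] abs_mult)
  also have "\<dots> \<le> (1/20) / (19/20)"
    using r Y_small[OF i, of "V j" x] by (intro frac_le) (auto simp: cw_basic)
  finally show ?thesis by simp
qed

lemma Th_range: assumes i: "i \<in> S" "t \<in> Iv i" shows "Th i t x \<in> {1/2..3/2}"
proof -
  have r: "19/20 \<le> R i t x" "R i t x \<le> 21/20" using R_range[OF i, of x] by auto
  have y: "59/60 \<le> 1 + Y N2 0 i t x / 3" "1 + Y N2 0 i t x / 3 \<le> 61/60"
  proof -
    have "\<bar>Y N2 0 i t x\<bar> \<le> 1/20" by (rule Y_small[OF i]) (simp add: cw_basic)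
    then show "59/60 \<le> 1 + Y N2 0 i t x / 3" "1 + Y N2 0 i t x / 3 \<le> 61/60" by linarith+
  qed
  have q1: "(1 + Y N2 0 i t x / 3) / R i t x \<le> (61/60) / (19/20)" using r y by (intro frac_le) auto
  have q2: "(59/60) / (21/20) \<le> (1 + Y N2 0 i t x / 3) / R i t x" using r y by (intro frac_le) auto
  have u: "Uf j i t x * Uf j i t x \<le> 1/361" "0 \<le> Uf j i t x * Uf j i t x" for j
  proof -
    have "\<bar>Uf j i t x\<bar> * \<bar>Uf j i t x\<bar> \<le> (1/19) * (1/19)" using Uf_bound[OF i] by (intro mult_mono) auto
    then show "Uf j i t x * Uf j i t x \<le> 1/361" by simp
  qed simp
  have e: "Th i t x = (1 + Y N2 0 i t x / 3) / R i t x - 1/3 * (Uf 1 i t x * Uf 1 i t x + Uf 2 i t x * Uf 2 i t x + Uf 3 i t x * Uf 3 i t x)"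
    unfolding Th_def R_inv[OF i] U2_def by simp
  have q: "1/2 \<le> X - 1/3 * (a + b + c)" "X - 1/3 * (a + b + c) \<le> 3/2"
    if "X \<le> 61/57" "59/63 \<le> X" "0 \<le> a" "a \<le> 1/361" "0 \<le> b" "b \<le> 1/361" "0 \<le> c" "c \<le> 1/361" for X a b c :: real
    using that by (simp_all add: field_simps)
  show ?thesis unfolding e atLeastAtMost_iff
    by (intro conjI q u) (use q1 q2 in simp_all)
qed

context
  fixes i and t :: real and x :: "real^3"
  assumes i: "i \<in> S" "t \<in> Iv i"
begin

private abbreviation (input) "F \<equiv> perturbed (g i 0 t x)"

lemma h0: "g i 0 t x \<in> borel_measurable borel" "sqn (g i 0 t x) < \<infinity>"
  using g_meas_v[OF i(1) _ i(2), of 0 x] finite_v0[OF i, of 0 x] N3 by auto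

lemma rho_eq: "mass_density F = R i t x"
  using mass_density_perturbed[OF h0] by (simp add: R_def Y_def)
lemma rho_pos: "mass_density F > 0" using R_range[OF i, of x] by (simp add: rho_eq)
lemma U_eq: "bulk_velocity F $ j = Uf j i t x"
  unfolding bulk_velocity_perturbed[OF h0] rho_eq Uf_def R_inv[OF i] Y_def by simp
lemma T_eq: "temperature F = Th i t x"
proof -
  have r: "R i t x > 0" using R_range[OF i, of x] by simp
  have "3 * R i t x * temperature F = 3 + Y N2 0 i t x - R i t x * U2 i t x"
    using temperature_perturbed[OF h0 rho_pos] by (simp add: rho_eq U_eq U2_def Y_def power2_eq_square)
  also have "\<dots> = 3 * R i t x * Th i t x" using r by (simp add: Th_def R_inv[OF i] field_simps)
  finally show ?thesis using r by simp
qed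
lemma q_eq: "heat_flux F $ j = Qf j i t x"
  using heat_flux_perturbed[OF h0 rho_pos, of j] by (simp add: rho_eq U_eq U2_def Qf_def Y_def power2_eq_square)
lemma A_eq: "inv_tau \<tau>\<^sub>0 \<eta> w F = Af i t x"
  by (simp add: inv_tau_def Af_def rho_eq T_eq)

text \<open>The kinetic equation integrated against L sqrt m: this weight cancels the factor 1 /
  sqrt m of the collision term and leaves moments of the Shakhov distribution and of F.\<close>

lemma W_eq:
  assumes L: "\<And>y. peval L (bulk_velocity F + sqrt (Th i t x) *\<^sub>R y) = peval L' y"
  shows "W L 0 i t x = Af i t x * (pE (pmul (shp (R i t x) (sqrt (Th i t x) / (10 * R i t x * (Th i t x)\<^sup>2)) (heat_flux F)) L') - (pE L + Y L 0 i t x))"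
proof -
  have T0: "Th i t x > 0" using Th_range[OF i, of x] by auto
  have m1: "g i (inc e 0) t x \<in> borel_measurable borel" "(\<integral>\<^sup>+v. ennreal ((g i (inc e 0) t x v)\<^sup>2) \<partial>lborel) < \<infinity>" for e
    using g_meas_v[OF i(1) _ i(2), of "inc e 0" x] finite_v0[OF i, of "inc e 0" x] N3 by auto
  have 1: "integrable lborel (\<lambda>v. g i (inc None 0) t x v * (wt L v))"
    by (rule mom_integrable[OF m1])
  have 2: "integrable lborel (\<lambda>v. g i (inc (Some j) 0) t x v * (peval (pmul (V j) L) v * sqrt (maxwellian v)))" for j
    by (rule mom_integrable[OF m1])
  have 3: "has_bochner_integral lborel (\<lambda>v. shakhov 0 F v * peval L v) (pE (pmul (shp (R i t x) (sqrt (Th i t x) / (10 * R i t x * (Th i t x)\<^sup>2)) (heat_flux F)) L'))"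
    using shakhov_moment[OF h0 rho_pos, of L L'] T0 L by (simp add: T_eq rho_eq)
  have 4: "has_bochner_integral lborel (\<lambda>v. F v * peval L v) (pE L + Y L 0 i t x)"
    using perturbed_moment[OF h0, of L] by (simp add: Y_def)
  have "W L 0 i t x = (LINT v|lborel. g i (inc None 0) t x v * (wt L v) + (\<Sum>j\<in>UNIV. g i (inc (Some j) 0) t x v * (peval (pmul (V j) L) v * sqrt (maxwellian v))))"
    unfolding W_def Y_def mom_def
    by (subst Bochner_Integration.integral_add[OF 1 Bochner_Integration.integrable_sum[OF 2]], subst Bochner_Integration.integral_sum[OF 2]) simp
  also have "\<dots> = (LINT v|lborel. Af i t x * (shakhov 0 F v * peval L v - F v * peval L v))"
  proof (rule Bochner_Integration.integral_cong)
    fix v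
    have "g i (inc None 0) t x v * (wt L v) + (\<Sum>j\<in>UNIV. g i (inc (Some j) 0) t x v * (peval (pmul (V j) L) v * sqrt (maxwellian v)))
      = (g i (inc None 0) t x v + (\<Sum>j\<in>UNIV. v$j * g i (inc (Some j) 0) t x v)) * (wt L v)"
      unfolding distrib_right sum_distrib_right by (simp only: peval_pmul peval_V mult_ac)
    also have "\<dots> = Af i t x * (shakhov 0 F v * peval L v - F v * peval L v)"
      unfolding pde[OF i] A_eq using maxwellian_pos[of v] by (simp add: algebra_simps)
    finally show "g i (inc None 0) t x v * (wt L v) + (\<Sum>j\<in>UNIV. g i (inc (Some j) 0) t x v * (peval (pmul (V j) L) v * sqrt (maxwellian v))) = Af i t x * (shakhov 0 F v * peval L v - F v * peval L v)" .
  qed simp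
  also have "\<dots> = Af i t x * (pE (pmul (shp (R i t x) (sqrt (Th i t x) / (10 * R i t x * (Th i t x)\<^sup>2)) (heat_flux F)) L') - (pE L + Y L 0 i t x))"
    using 3 4 by (simp add: has_bochner_integral_iff)
  finally show ?thesis .
qed

text \<open>Together with the factor 10 in \<open>shp_vvsq1\<close> this says that at Pr = 0 the
  Shakhov distribution has exactly the heat flux q of F.\<close>

lemma coef: "R i t x * (sqrt (Th i t x) / (10 * R i t x * (Th i t x)\<^sup>2)) * (sqrt (Th i t x))^3 = 1/10"
proof -
  have T0: "Th i t x > 0" using Th_range[OF i, of x] by auto
  have r: "R i t x \<noteq> 0" using R_range[OF i, of x] by auto
  have "(sqrt (Th i t x))^4 = (Th i t x)\<^sup>2"
  proof -
    have "(sqrt (Th i t x))^4 = ((sqrt (Th i t x))\<^sup>2)\<^sup>2" by simp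
    then show ?thesis using T0 by simp
  qed
  then have "sqrt (Th i t x) * (sqrt (Th i t x))^3 = (Th i t x)\<^sup>2" by (simp add: numeral_eq_Suc)
  then show ?thesis using T0 r by (simp add: field_simps)
qed

lemma sq_Th: "(sqrt (Th i t x))\<^sup>2 = Th i t x" using Th_range[OF i, of x] by auto

lemma U2_eq: "(bulk_velocity F$1)\<^sup>2 + (bulk_velocity F$2)\<^sup>2 + (bulk_velocity F$3)\<^sup>2 = U2 i t x"
  by (simp add: U_eq U2_def power2_eq_square)

lemma U2_sq: "(Uf 1 i t x)\<^sup>2 + (Uf 2 i t x)\<^sup>2 + (Uf 3 i t x)\<^sup>2 = U2 i t x"
  by (simp add: U2_def power2_eq_square)

lemma RU: "R i t x * Uf j i t x = Y (V j) 0 i t x"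
  using R_range[OF i, of x] by (simp add: Uf_def R_inv[OF i])

lemma RT: "3 * R i t x * Th i t x = 3 + Y N2 0 i t x - R i t x * U2 i t x"
  using R_range[OF i, of x] by (simp add: Th_def R_inv[OF i] field_simps)

lemma W_mass: "W (pc 1) 0 i t x = 0"
  by (subst W_eq[where L'="pc 1"]) (simp_all add: shp_1 pE_basic R_def)

lemma W_momentum: "W (V j) 0 i t x = 0"
proof -
  have "pE (pmul (shp \<rho> \<kappa> q) (lin U s j)) = \<rho> * U$j" for \<rho> \<kappa> q U s
    using exhaust_3[of j] by (elim disjE) (simp_all add: shp_v)
  then show ?thesis
    by (subst W_eq[where L'="lin (bulk_velocity F) (sqrt (Th i t x)) j"]) (simp_all add: pE_basic U_eq RU)
qed

lemma W_CP: "W CP 0 i t x = 0"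
proof -
  let ?L' = "pscale (1 / sqrt 6) (lsq (bulk_velocity F) (sqrt (Th i t x)) @ pc (-3))"
  have "pE (pmul S (pc c)) = c * pE (pmul S (pc 1))" for S c
  proof -
    have "pE (pmul S (pc c)) = pE (pscale c (pmul S (pc 1)))" by (rule pE_cong) simp
    then show ?thesis by simp
  qed
  note c = this[of _ "-3"]
  have Yc: "Y CP 0 i t x = 1 / sqrt 6 * (Y N2 0 i t x - 3 * Y (pc 1) 0 i t x)"
  proof -
    have "mom (peval (pc (-3))) (g i 0 t x) = mom (peval (pscale (-3) (pc 1))) (g i 0 t x)" by (rule mom_cong) simp
    then show ?thesis by (simp add: Y_def CP_def mom_pscale mom_append[OF h0])
  qed
  have p: "pE CP = 0" by (simp add: CP_def pE_basic)
  have "W CP 0 i t x = Af i t x * (pE (pmul (shp (R i t x) (sqrt (Th i t x) / (10 * R i t x * (Th i t x)\<^sup>2)) (heat_flux F)) ?L') - (pE CP + Y CP 0 i t x))"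
    by (rule W_eq) (simp add: CP_def)
  also have "\<dots> = Af i t x * (1 / sqrt 6 * (R i t x * U2 i t x + 3 * R i t x * Th i t x - 3 * R i t x) - Y CP 0 i t x)"
    unfolding pE_pmul_pscale pE_pmul_append c shp_1 shp_vsq U2_eq sq_Th p by simp
  also have "1 / sqrt 6 * (R i t x * U2 i t x + 3 * R i t x * Th i t x - 3 * R i t x) - Y CP 0 i t x = 0"
  proof -
    have "R i t x * U2 i t x + 3 * R i t x * Th i t x - 3 * R i t x = Y N2 0 i t x - 3 * Y (pc 1) 0 i t x"
      using RT R_def[of i t x] by linarith
    then show ?thesis unfolding Yc by simp
  qed
  finally show ?thesis by simp
qed

text \<open>Since the Shakhov distribution reproduces the heat flux at Pr = 0, the linear terms
  cancel; every remaining term is a component of the mean velocity times another small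
  quantity.\<close>

lemma W_DP: "W (DP j) 0 i t x = Af i t x * (1 / sqrt 10 * (4/3 * (R i t x * (U2 i t x * Uf j i t x))
   - 2 * (Uf 1 i t x * Y (pmul (V 1) (V j)) 0 i t x + Uf 2 i t x * Y (pmul (V 2) (V j)) 0 i t x + Uf 3 i t x * Y (pmul (V 3) (V j)) 0 i t x)
   + 2/3 * (Uf j i t x * Y N2 0 i t x)))"
proof -
  let ?U = "bulk_velocity F" and ?s = "sqrt (Th i t x)" and ?k = "sqrt (Th i t x) / (10 * R i t x * (Th i t x)\<^sup>2)"
  let ?S = "shp (R i t x) ?k (heat_flux F)"
  let ?L' = "pscale (1 / sqrt 10) (pmul (lin ?U ?s j) (lsq ?U ?s) @ pscale (-5) (lin ?U ?s j))"
  have e1: "pE (pmul (shp \<rho> \<kappa> q) (lin U s j)) = \<rho> * U$j" for \<rho> \<kappa> q U s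
    using exhaust_3[of j] by (elim disjE) (simp_all add: shp_v)
  have e2: "pE (pmul (shp \<rho> \<kappa> q) (pmul (lin U s j) (lsq U s))) = 10 * (\<rho> * \<kappa> * s^3) * q$j + 5 * \<rho> * s\<^sup>2 * U$j + \<rho> * U$j * ((U$1)\<^sup>2 + (U$2)\<^sup>2 + (U$3)\<^sup>2)" for \<rho> \<kappa> q U s
    using exhaust_3[of j] by (elim disjE) (simp_all only: shp_vvsq1 shp_vvsq2 shp_vvsq3)
  have Yd: "Y (DP j) 0 i t x = 1 / sqrt 10 * (Y (pmul (V j) N2) 0 i t x - 5 * Y (V j) 0 i t x)"
  proof -
    have "mom (peval (pmul (V j) (N2 @ pc (-5)))) (g i 0 t x) = mom (peval (pmul (V j) N2 @ pscale (-5) (V j))) (g i 0 t x)" by (rule mom_cong) (simp add: algebra_simps)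
    then show ?thesis by (simp add: Y_def DP_def mom_pscale mom_append[OF h0])
  qed
  have p: "pE (DP j) = 0"
  proof -
    have "pE (DP j) = pE (pscale (1 / sqrt 10) (pmul (V j) N2 @ pscale (-5) (V j)))" unfolding DP_def by (rule pE_cong) (simp add: algebra_simps)
    then show ?thesis by (simp add: pE_basic)
  qed
  have "W (DP j) 0 i t x = Af i t x * (pE (pmul ?S ?L') - (pE (DP j) + Y (DP j) 0 i t x))"
    by (rule W_eq) (simp add: DP_def algebra_simps)
  also have "pE (pmul ?S ?L') = 1 / sqrt 10 * (Qf j i t x + 5 * (R i t x * Th i t x) * Uf j i t x + R i t x * Uf j i t x * U2 i t x - 5 * (R i t x * Uf j i t x))"
    unfolding pE_pmul_pscale pE_pmul_append e1 e2 coef sq_Th U_eq U2_sq q_eq by (simp add: mult_ac)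
  also have "1 / sqrt 10 * (Qf j i t x + 5 * (R i t x * Th i t x) * Uf j i t x + R i t x * Uf j i t x * U2 i t x - 5 * (R i t x * Uf j i t x)) - (pE (DP j) + Y (DP j) 0 i t x)
     = 1 / sqrt 10 * (Qf j i t x + 5 * (R i t x * Th i t x) * Uf j i t x + R i t x * Uf j i t x * U2 i t x - Y (pmul (V j) N2) 0 i t x)"
    unfolding p Yd RU by (simp add: algebra_simps)
  also have "R i t x * Th i t x = (3 + Y N2 0 i t x - R i t x * U2 i t x) / 3" using RT by simp
  also have "Qf j i t x + 5 * ((3 + Y N2 0 i t x - R i t x * U2 i t x) / 3) * Uf j i t x + R i t x * Uf j i t x * U2 i t x - Y (pmul (V j) N2) 0 i t x
    = 4/3 * (R i t x * (U2 i t x * Uf j i t x))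
   - 2 * (Uf 1 i t x * Y (pmul (V 1) (V j)) 0 i t x + Uf 2 i t x * Y (pmul (V 2) (V j)) 0 i t x + Uf 3 i t x * Y (pmul (V 3) (V j)) 0 i t x)
   + 2/3 * (Uf j i t x * Y N2 0 i t x)"
    unfolding Qf_def by (simp add: field_simps)
  finally show ?thesis .
qed

text \<open>Here the linear term does not cancel: the subtracted moment \<open>Y\<close> remains. It
  is microscopic, however, and so is controlled by the dissipation, while all other terms are
  quadratic.\<close>

lemma W_dev:
  assumes "p \<in> {(1,2),(1,3),(2,3)}"
  shows "W (off (fst p) (snd p)) 0 i t x = Af i t x * (R i t x * (Uf (fst p) i t x * Uf (snd p) i t x) - Y (off (fst p) (snd p)) 0 i t x)"
    and "W (dif (fst p) (snd p)) 0 i t x = Af i t x * (R i t x * (Uf (fst p) i t x * Uf (fst p) i t x - Uf (snd p) i t x * Uf (snd p) i t x) - Y (dif (fst p) (snd p)) 0 i t x)"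
    and "W (th (off (fst p) (snd p))) 0 i t x = Af i t x * (R i t x * (Uf (fst p) i t x * Uf (snd p) i t x * (U2 i t x + 7 * (Th i t x - 1)))
       + 7/5 * (Uf (fst p) i t x * Qf (snd p) i t x + Uf (snd p) i t x * Qf (fst p) i t x) - Y (th (off (fst p) (snd p))) 0 i t x)"
    and "W (th (dif (fst p) (snd p))) 0 i t x = Af i t x * (R i t x * ((Uf (fst p) i t x * Uf (fst p) i t x - Uf (snd p) i t x * Uf (snd p) i t x) * (U2 i t x + 7 * (Th i t x - 1)))
       + 14/5 * (Uf (fst p) i t x * Qf (fst p) i t x - Uf (snd p) i t x * Qf (snd p) i t x) - Y (th (dif (fst p) (snd p))) 0 i t x)"
proof -
  let ?U = "bulk_velocity F" and ?s = "sqrt (Th i t x)" and ?k = "sqrt (Th i t x) / (10 * R i t x * (Th i t x)\<^sup>2)"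
  let ?S = "shp (R i t x) ?k (heat_flux F)"
  let ?l = "lin ?U ?s"
  obtain a b where ab: "p = (a,b)" "a = 1 \<and> b = 2 \<or> a = 1 \<and> b = 3 \<or> a = 2 \<and> b = 3" using assms by auto
  have p0: "pE (off a b) = 0" "pE (dif a b) = 0" "pE (th (off a b)) = 0" "pE (th (dif a b)) = 0"
    using ab(2) by (auto simp: off_def dif_def th_def pE_simps gmom_numeral)
  have 1: "pE (pmul (shp \<rho> \<kappa> q) (pmul (lin U s a) (lin U s b))) = \<rho> * U$a * U$b" for \<rho> \<kappa> q U s
    using ab(2) by (elim disjE conjE) (simp_all only: shp_off12 shp_off13 shp_off23)
  have 2: "pE (pmul (shp \<rho> \<kappa> q) (pmul (lin U s a) (lin U s a) @ pscale (-1) (pmul (lin U s b) (lin U s b)))) = \<rho> * ((U$a)\<^sup>2 - (U$b)\<^sup>2)" for \<rho> \<kappa> q U s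
    using ab(2) by (elim disjE conjE) (simp_all only: shp_off12 shp_off13 shp_off23)
  have 3: "pE (pmul (shp \<rho> \<kappa> q) (pmul (pmul (lin U s a) (lin U s b)) (lsq U s @ pc (-7)))) = \<rho> * U$a * U$b * (((U$1)\<^sup>2 + (U$2)\<^sup>2 + (U$3)\<^sup>2) + 7 * s\<^sup>2 - 7) + 14 * (\<rho> * \<kappa> * s^3) * (U$a * q$b + U$b * q$a)" for \<rho> \<kappa> q U s
    using ab(2) by (elim disjE conjE) (simp_all only: shp_thoff12 shp_thoff13 shp_thoff23)
  have 4: "pE (pmul (shp \<rho> \<kappa> q) (pmul (pmul (lin U s a) (lin U s a) @ pscale (-1) (pmul (lin U s b) (lin U s b))) (lsq U s @ pc (-7)))) = \<rho> * ((U$a)\<^sup>2 - (U$b)\<^sup>2) * (((U$1)\<^sup>2 + (U$2)\<^sup>2 + (U$3)\<^sup>2) + 7 * s\<^sup>2 - 7) + 28 * (\<rho> * \<kappa> * s^3) * (U$a * q$a - U$b * q$b)" for \<rho> \<kappa> q U s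
    using ab(2) by (elim disjE conjE) (simp_all only: shp_thdif12 shp_thdif13 shp_thdif23)
  have "W (off a b) 0 i t x = Af i t x * (pE (pmul ?S (pmul (?l a) (?l b))) - (pE (off a b) + Y (off a b) 0 i t x))"
    by (rule W_eq) (simp add: off_def)
  then show "W (off (fst p) (snd p)) 0 i t x = Af i t x * (R i t x * (Uf (fst p) i t x * Uf (snd p) i t x) - Y (off (fst p) (snd p)) 0 i t x)"
    unfolding 1 U_eq p0 by (simp add: ab(1) mult.assoc)
  have "W (dif a b) 0 i t x = Af i t x * (pE (pmul ?S (pmul (?l a) (?l a) @ pscale (-1) (pmul (?l b) (?l b)))) - (pE (dif a b) + Y (dif a b) 0 i t x))"
    by (rule W_eq) (simp add: dif_def)
  then show "W (dif (fst p) (snd p)) 0 i t x = Af i t x * (R i t x * (Uf (fst p) i t x * Uf (fst p) i t x - Uf (snd p) i t x * Uf (snd p) i t x) - Y (dif (fst p) (snd p)) 0 i t x)"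
    unfolding 2 U_eq p0 by (simp add: ab(1) power2_eq_square)
  have "W (th (off a b)) 0 i t x = Af i t x * (pE (pmul ?S (pmul (pmul (?l a) (?l b)) (lsq ?U ?s @ pc (-7)))) - (pE (th (off a b)) + Y (th (off a b)) 0 i t x))"
    by (rule W_eq) (simp add: off_def th_def)
  then show "W (th (off (fst p) (snd p))) 0 i t x = Af i t x * (R i t x * (Uf (fst p) i t x * Uf (snd p) i t x * (U2 i t x + 7 * (Th i t x - 1)))
       + 7/5 * (Uf (fst p) i t x * Qf (snd p) i t x + Uf (snd p) i t x * Qf (fst p) i t x) - Y (th (off (fst p) (snd p))) 0 i t x)"
    unfolding 3 coef sq_Th U_eq U2_sq q_eq p0 by (simp add: ab(1) mult.assoc add_diff_eq)
  have "W (th (dif a b)) 0 i t x = Af i t x * (pE (pmul ?S (pmul (pmul (?l a) (?l a) @ pscale (-1) (pmul (?l b) (?l b))) (lsq ?U ?s @ pc (-7)))) - (pE (th (dif a b)) + Y (th (dif a b)) 0 i t x))"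
    by (rule W_eq) (simp add: dif_def th_def)
  then show "W (th (dif (fst p) (snd p))) 0 i t x = Af i t x * (R i t x * ((Uf (fst p) i t x * Uf (fst p) i t x - Uf (snd p) i t x * Uf (snd p) i t x) * (U2 i t x + 7 * (Th i t x - 1)))
       + 14/5 * (Uf (fst p) i t x * Qf (fst p) i t x - Uf (snd p) i t x * Qf (snd p) i t x) - Y (th (dif (fst p) (snd p))) 0 i t x)"
    unfolding 4 coef sq_Th U_eq U2_sq q_eq p0 by (simp add: ab(1) power2_eq_square mult.assoc add_diff_eq)
qed

end

subsection \<open>The nonlinear terms are quadratic\<close>

text \<open>First and second order in the deviation from equilibrium, uniformly over all solutions
  and with N - 1 derivatives.\<close>

abbreviation A1 where "A1 \<equiv> alg (N-1) (\<lambda>i t. sqrt (en i t))"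
abbreviation A2 where "A2 \<equiv> alg (N-1) (\<lambda>i t. en i t)"

lemma en_le1: "i \<in> S \<Longrightarrow> t \<in> Iv i \<Longrightarrow> en i t \<le> 1"
  using en_small[of i t] by simp

lemma en_sqrt: "i \<in> S \<Longrightarrow> t \<in> Iv i \<Longrightarrow> sqrt (en i t) \<le> 1 \<and> en i t \<le> sqrt (en i t)"
proof -
  assume a: "i \<in> S" "t \<in> Iv i"
  have s: "sqrt (en i t) \<le> 1" using en_le1[OF a] by simp
  have "sqrt (en i t) * sqrt (en i t) \<le> sqrt (en i t) * 1" using s en_nonneg[of i t] by (intro mult_left_mono) auto
  then show ?thesis using s en_nonneg[of i t] by simp
qed

lemma adm1: "adm (\<lambda>i t. sqrt (en i t))" and adm2: "adm (\<lambda>i t. en i t)"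
  using en_nonneg en_sqrt en_le1 by (auto simp: adm_def intro!: exI[of _ 1])

lemma A1_Y: "A1 (Y L 0)" by (rule alg_Y) (use N3 in auto)
lemma A11: "A1 u \<Longrightarrow> A1 w' \<Longrightarrow> A2 (\<lambda>i t x. u i t x * w' i t x)"
  using alg_mult[OF _ _ adm1 adm1] en_nonneg by fastforce
lemma A21: "A2 u \<Longrightarrow> A1 u"
  by (rule alg_weaken[of _ _ _ 1]) (use en_nonneg en_sqrt in auto)
lemma A111: "A1 u \<Longrightarrow> A1 w' \<Longrightarrow> A1 (\<lambda>i t x. u i t x * w' i t x)"
  by (rule A21[OF A11])
lemma A12: "A1 u \<Longrightarrow> A2 w' \<Longrightarrow> A2 (\<lambda>i t x. u i t x * w' i t x)"
  by (rule A11[OF _ A21])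

lemmas A1_intros = alg_add alg_diff alg_cmult A111 A1_Y

lemma A1_ir: "A1 (\<lambda>i t x. R i t x powr s - 1)"
proof (rule alg_powr)
  show "A1 (\<lambda>i t x. R i t x - 1)" using A1_Y[of "pc 1"] by (simp add: R_def)
  show "R i t x \<in> {1/2..3/2}" if "i \<in> S" "t \<in> Iv i" for i t x using R_range[OF that, of x] by auto
qed (use en_sqrt en_nonneg in auto)

lemma A1_Uf: "A1 (Uf j)"
proof -
  have "A1 (\<lambda>i t x. (R i t x powr (-1) - 1) * Y (V j) 0 i t x + Y (V j) 0 i t x)" by (intro A1_intros A1_ir)
  then show ?thesis unfolding Uf_def[abs_def] by (simp add: algebra_simps)
qed

lemma A2_U2: "A2 U2"
  unfolding U2_def[abs_def] by (intro alg_add A11 A1_Uf)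

lemma A1_Th: "A1 (\<lambda>i t x. Th i t x - 1)"
proof -
  have "A1 (\<lambda>i t x. (R i t x powr (-1) - 1) + 1/3 * (Y N2 0 i t x * (R i t x powr (-1) - 1) + Y N2 0 i t x) - 1/3 * U2 i t x)"
    by (intro A1_intros A1_ir A21[OF A2_U2])
  then show ?thesis unfolding Th_def[abs_def] by (simp add: algebra_simps)
qed

lemma A1_Qf: "A1 (Qf j)"
proof -
  have "A1 (\<lambda>i t x. Y (pmul (V j) N2) 0 i t x - (3 * Uf j i t x + Uf j i t x * Y N2 0 i t x) - 2 * Uf j i t x
     - 2 * (Uf 1 i t x * Y (pmul (V 1) (V j)) 0 i t x + Uf 2 i t x * Y (pmul (V 2) (V j)) 0 i t x + Uf 3 i t x * Y (pmul (V 3) (V j)) 0 i t x)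
     + (2 * (U2 i t x * Uf j i t x) + 2 * (Y (pc 1) 0 i t x * (U2 i t x * Uf j i t x))))"
    by (intro A1_intros A1_Uf A21[OF A2_U2])
  then show ?thesis unfolding Qf_def[abs_def] R_def by (simp add: algebra_simps)
qed

lemma A1_Af: "A1 (\<lambda>i t x. Af i t x - 1/\<tau>\<^sub>0)"
proof -
  have T: "A1 (\<lambda>i t x. Th i t x powr w - 1)"
    by (rule alg_powr[OF A1_Th Th_range]) (use en_sqrt en_nonneg in auto)
  have "A1 (\<lambda>i t x. 1/\<tau>\<^sub>0 * ((R i t x powr \<eta> - 1) * (Th i t x powr w - 1) + (R i t x powr \<eta> - 1) + (Th i t x powr w - 1)))"
    by (intro A1_intros A1_ir T)
  then show ?thesis unfolding Af_def[abs_def] using tau by (simp add: algebra_simps)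
qed

lemma A2_Af: assumes "A2 u" shows "A2 (\<lambda>i t x. Af i t x * u i t x)"
proof -
  have "A2 (\<lambda>i t x. (Af i t x - 1/\<tau>\<^sub>0) * u i t x + 1/\<tau>\<^sub>0 * u i t x)" by (intro alg_add alg_cmult A12 A1_Af assms)
  then show ?thesis by (simp add: left_diff_distrib)
qed

lemma A2_R: assumes "A2 u" shows "A2 (\<lambda>i t x. R i t x * u i t x)"
proof -
  have "A2 (\<lambda>i t x. Y (pc 1) 0 i t x * u i t x + u i t x)" by (intro alg_add A12 A1_Y assms)
  then show ?thesis by (simp add: R_def distrib_right add.commute)
qed

text \<open>The weight 0 in \<open>transfer_W\<close> turns a size bound into an exact statement:
  the differentiated conservation laws hold almost everywhere.\<close>

lemma l2b_W_cons:
  assumes "\<gamma> \<in> {\<gamma>. mi_length \<gamma> < N}" and i: "i \<in> S" "t \<in> Iv i"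
  shows "n2 (W (pc 1) \<gamma> i t) = 0" "n2 (W (V j) \<gamma> i t) = 0" "n2 (W CP \<gamma> i t) = 0"
proof -
  have adm0: "adm (\<lambda>i t. 0)" by (auto simp: adm_def intro: exI[of _ 0])
  have "n2 (W L \<gamma> i t) = 0" if L: "\<And>i t x. i \<in> S \<Longrightarrow> t \<in> Iv i \<Longrightarrow> W L 0 i t x = 0" for L
  proof -
    have "l2b (\<lambda>i t. 0) (\<lambda>i t x. W L \<gamma> i t x + 0 * Y L \<gamma> i t x)"
      by (rule transfer_W[where u="\<lambda>i t x. 0", OF alg_zero[OF adm0]]) (use L assms in auto)
    then show ?thesis using i by (auto simp: l2b_def)
  qed
  then show "n2 (W (pc 1) \<gamma> i t) = 0" "n2 (W (V j) \<gamma> i t) = 0" "n2 (W CP \<gamma> i t) = 0"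
    using W_mass W_momentum W_CP by blast+
qed

lemma l2b_W_DP: assumes "mi_length \<gamma> < N" shows "l2b (\<lambda>i t. en i t) (W (DP j) \<gamma>)"
proof -
  let ?u = "\<lambda>i t x. Af i t x * (1 / sqrt 10 * (4/3 * (R i t x * (U2 i t x * Uf j i t x))
   - 2 * (Uf 1 i t x * Y (pmul (V 1) (V j)) 0 i t x + Uf 2 i t x * Y (pmul (V 2) (V j)) 0 i t x + Uf 3 i t x * Y (pmul (V 3) (V j)) 0 i t x)
   + 2/3 * (Uf j i t x * Y N2 0 i t x)))"
  have "A2 ?u"
    by (intro A2_Af alg_cmult alg_add alg_diff A2_R A11 A1_Uf A1_Y A21[OF A2_U2])
  from transfer_W[OF this _ assms, of "DP j" 0] show ?thesis by (simp add: W_DP)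
qed

text \<open>The collision frequency is frozen at its equilibrium value; its deviation times
  \<open>Y\<close> is quadratic and joins the right-hand side.\<close>

lemma l2b_W_dev:
  assumes g: "mi_length \<gamma> < N" and p: "p \<in> {(1,2),(1,3),(2,3)}" and L: "L \<in> {off (fst p) (snd p), dif (fst p) (snd p), th (off (fst p) (snd p)), th (dif (fst p) (snd p))}"
  shows "l2b (\<lambda>i t. en i t) (\<lambda>i t x. W L \<gamma> i t x + 1/\<tau>\<^sub>0 * Y L \<gamma> i t x)"
proof -
  have key: "l2b (\<lambda>i t. en i t) (\<lambda>i t x. W L \<gamma> i t x + 1/\<tau>\<^sub>0 * Y L \<gamma> i t x)"
    if u: "A2 u" and e: "\<And>i t x. i \<in> S \<Longrightarrow> t \<in> Iv i \<Longrightarrow> W L 0 i t x = Af i t x * (u i t x - Y L 0 i t x)" for u L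
  proof (rule transfer_W[OF _ _ g])
    show "A2 (\<lambda>i t x. Af i t x * u i t x - (Af i t x - 1/\<tau>\<^sub>0) * Y L 0 i t x)"
      by (intro alg_diff A2_Af u A11 A1_Af A1_Y)
    show "W L 0 i t x + 1/\<tau>\<^sub>0 * Y L 0 i t x = Af i t x * u i t x - (Af i t x - 1/\<tau>\<^sub>0) * Y L 0 i t x" if "i \<in> S" "t \<in> Iv i" for i t x
      unfolding e[OF that] by (simp add: algebra_simps)
  qed
  have UU: "A2 (\<lambda>i t x. Uf a i t x * Uf b i t x)" for a b by (intro A11 A1_Uf)
  have z: "A1 (\<lambda>i t x. U2 i t x + 7 * (Th i t x - 1))" by (intro A1_intros A1_Th A21[OF A2_U2])
  have s: "A2 (\<lambda>i t x. u i t x * z' i t x)" if "A2 u" "A1 z'" for u z' using A12[OF that(2,1)] by (simp add: mult.commute)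
  show ?thesis
    using L
  proof (elim insertE emptyE)
    assume L: "L = off (fst p) (snd p)"
    show ?thesis unfolding L by (rule key[OF _ W_dev(1)[OF _ _ p]]) (intro A2_R UU, assumption+)
  next
    assume L: "L = dif (fst p) (snd p)"
    show ?thesis unfolding L by (rule key[OF _ W_dev(2)[OF _ _ p]]) (intro A2_R alg_diff UU, assumption+)
  next
    assume L: "L = th (off (fst p) (snd p))"
    show ?thesis unfolding L by (rule key[OF _ W_dev(3)[OF _ _ p]]) (intro A2_R alg_add alg_cmult s UU z A11 A1_Uf A1_Qf, assumption+)
  next
    assume L: "L = th (dif (fst p) (snd p))"
    show ?thesis unfolding L by (rule key[OF _ W_dev(4)[OF _ _ p]]) (intro A2_R alg_add alg_diff alg_cmult s UU z A11 A1_Uf A1_Qf, assumption+)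
  qed
qed

end

subsection \<open>Inner products, Korn's inequality and Poincare's inequality on the torus\<close>

definition ip :: "(real^3 \<Rightarrow> real) \<Rightarrow> (real^3 \<Rightarrow> real) \<Rightarrow> real" where
  "ip a b = (\<integral>x. a x * b x \<partial>MQ)"
definition mn :: "(real^3 \<Rightarrow> real) \<Rightarrow> real" where
  "mn a = (\<integral>x. a x \<partial>MQ)"
definition nr :: "(real^3 \<Rightarrow> real) \<Rightarrow> real" where
  "nr a = sqrt (enn2real (n2 a))"
definition sq :: "(real^3 \<Rightarrow> real) \<Rightarrow> bool" where
  "sq a \<longleftrightarrow> a \<in> borel_measurable borel \<and> n2 a < \<infinity>"

lemma sq_meas: "sq a \<Longrightarrow> a \<in> borel_measurable borel" by (simp add: sq_def)

lemma sq_add: "sq a \<Longrightarrow> sq b \<Longrightarrow> sq (\<lambda>x. a x + b x)"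
  unfolding sq_def using n2_add[of a b] by (auto simp: ennreal_mult_less_top elim!: order.strict_trans1 intro!: ennreal_add_less_top[THEN iffD2])
lemma sq_cmult: "sq a \<Longrightarrow> sq (\<lambda>x. c * a x)"
  unfolding sq_def by (auto simp: n2_cmult ennreal_mult_less_top)
lemma sq_diff: "sq a \<Longrightarrow> sq b \<Longrightarrow> sq (\<lambda>x. a x - b x)"
  using sq_add[of a "\<lambda>x. (-1) * b x"] sq_cmult[of b "-1"] by simp
lemma sq_const: "sq (\<lambda>x. c)"
  unfolding sq_def using n2_bound[of "\<lambda>x. c" "\<bar>c\<bar>"] by (auto elim!: order.strict_trans1)

lemma sq_integrable_sq: "sq a \<Longrightarrow> integrable MQ (\<lambda>x. (a x)\<^sup>2)"
  by (subst integrable_sq_iff) (auto simp: sq_def n2_def)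
lemma sq_integrable: "sq a \<Longrightarrow> sq b \<Longrightarrow> integrable MQ (\<lambda>x. a x * b x)"
  by (rule Cauchy_Schwarz_integral(1)) (auto intro: sq_integrable_sq sq_meas measurable_MQ)
lemma sq_integrable1: "sq a \<Longrightarrow> integrable MQ a"
  using sq_integrable[of a "\<lambda>x. 1"] sq_const by simp
lemma n2_ip: "sq a \<Longrightarrow> n2 a = ennreal (ip a a)"
  unfolding n2_def ip_def using nn_integral_eq_integral[OF sq_integrable_sq[of a]] by (simp add: power2_eq_square)
lemma nr_sq: "sq a \<Longrightarrow> (nr a)\<^sup>2 = ip a a"
  by (simp add: nr_def n2_ip ip_def)
lemma ip_le_nr: assumes "sq a" "sq b" shows "\<bar>ip a b\<bar> \<le> nr a * nr b"
proof -
  have "(ip a b)\<^sup>2 \<le> ip a a * ip b b"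
    using Cauchy_Schwarz_integral(2)[of a MQ b] sq_integrable_sq[OF assms(1)] sq_integrable_sq[OF assms(2)] sq_meas[OF assms(1)] sq_meas[OF assms(2)]
    by (simp add: ip_def power2_eq_square measurable_MQ)
  then have "(ip a b)\<^sup>2 \<le> (nr a * nr b)\<^sup>2" using nr_sq assms by (simp add: power_mult_distrib)
  then show ?thesis by (rule abs_le_square_iff[THEN iffD2, THEN order_trans]) (simp add: nr_def)
qed
lemma ip_add: "sq a \<Longrightarrow> sq b \<Longrightarrow> sq c \<Longrightarrow> ip (\<lambda>x. a x + b x) c = ip a c + ip b c"
  unfolding ip_def distrib_right by (rule Bochner_Integration.integral_add) (auto intro: sq_integrable)
lemma ip_diff: "sq a \<Longrightarrow> sq b \<Longrightarrow> sq c \<Longrightarrow> ip (\<lambda>x. a x - b x) c = ip a c - ip b c"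
  unfolding ip_def left_diff_distrib by (rule Bochner_Integration.integral_diff) (auto intro: sq_integrable)
lemma ip_commute: "ip a b = ip b a" by (simp add: ip_def mult.commute)
lemma mn_le_nr: "sq a \<Longrightarrow> \<bar>mn a\<bar> \<le> nr a"
proof -
  assume a: "sq a"
  have "nr (\<lambda>x. 1) = 1" unfolding nr_def n2_def by (simp add: MQ.emeasure_space_1 del: space_restrict_space space_restrict_space2)
  then show ?thesis using ip_le_nr[OF a sq_const[of 1]] by (simp add: ip_def mn_def)
qed

lemma nr_tendsto0: "((\<lambda>h. n2 (a h)) \<longlongrightarrow> 0) F \<Longrightarrow> ((\<lambda>h. nr (a h)) \<longlongrightarrow> 0) F"
proof -
  assume "((\<lambda>h. n2 (a h)) \<longlongrightarrow> 0) F"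
  then have "((\<lambda>h. enn2real (n2 (a h))) \<longlongrightarrow> enn2real 0) F" by (intro tendsto_enn2real) auto
  then have "((\<lambda>h. sqrt (enn2real (n2 (a h)))) \<longlongrightarrow> sqrt 0) F" by (intro tendsto_real_sqrt) simp
  then show ?thesis by (simp add: nr_def)
qed

lemma ip_tendsto:
  assumes a: "((\<lambda>h. n2 (\<lambda>x. a h x - a0 x)) \<longlongrightarrow> 0) F" and b: "((\<lambda>h. n2 (\<lambda>x. b h x - b0 x)) \<longlongrightarrow> 0) F"
    and s: "\<forall>\<^sub>F h in F. sq (a h) \<and> sq (b h)" "sq a0" "sq b0"
  shows "((\<lambda>h. ip (a h) (b h)) \<longlongrightarrow> ip a0 b0) F"
proof (rule Lim_transform2[OF tendsto_const], rule Lim_null_comparison)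
  note na = nr_tendsto0[OF a] and nb = nr_tendsto0[OF b]
  show "((\<lambda>h. nr (\<lambda>x. a h x - a0 x) * nr (\<lambda>x. b h x - b0 x) + nr (\<lambda>x. a h x - a0 x) * nr b0 + nr a0 * nr (\<lambda>x. b h x - b0 x)) \<longlongrightarrow> 0) F"
    using tendsto_add[OF tendsto_add[OF tendsto_mult[OF na nb] tendsto_mult[OF na tendsto_const[of "nr b0"]]] tendsto_mult[OF tendsto_const[of "nr a0"] nb]] by simp
  show "\<forall>\<^sub>F h in F. norm (ip a0 b0 - ip (a h) (b h)) \<le> nr (\<lambda>x. a h x - a0 x) * nr (\<lambda>x. b h x - b0 x) + nr (\<lambda>x. a h x - a0 x) * nr b0 + nr a0 * nr (\<lambda>x. b h x - b0 x)"
    using s(1)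
  proof eventually_elim
    case (elim h)
    let ?a = "\<lambda>x. a h x - a0 x" and ?b = "\<lambda>x. b h x - b0 x"
    have q: "sq ?a" "sq ?b" using elim s by (auto intro: sq_diff)
    have "ip (a h) (b h) = ip (\<lambda>x. ?a x + a0 x) (\<lambda>x. ?b x + b0 x)" by simp
    also have "\<dots> = ip ?a (\<lambda>x. ?b x + b0 x) + ip a0 (\<lambda>x. ?b x + b0 x)" by (rule ip_add) (use q s elim in simp_all)
    also have "ip ?a (\<lambda>x. ?b x + b0 x) = ip ?a ?b + ip ?a b0" using ip_add[of ?b b0 ?a] q s by (simp add: ip_commute)
    also have "ip a0 (\<lambda>x. ?b x + b0 x) = ip a0 ?b + ip a0 b0" using ip_add[of ?b b0 a0] q s by (simp add: ip_commute)
    finally have "ip (a h) (b h) = ip ?a ?b + ip ?a b0 + (ip a0 ?b + ip a0 b0)" .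
    then show ?case using ip_le_nr[OF q] ip_le_nr[OF q(1) s(3)] ip_le_nr[OF s(2) q(2)] by simp
  qed
qed

lemma n2_translate:
  assumes "u \<in> borel_measurable borel" "per u" "h \<ge> 0"
  shows "n2 (\<lambda>x. u (x + h *\<^sub>R axis i 1)) = n2 u"
  unfolding n2_def by (rule nn_integral_MQ_translate[of "\<lambda>x. ennreal ((u x)\<^sup>2)"]) (use assms in \<open>auto simp: per_def\<close>)

lemma integral_MQ_translate:
  fixes u :: "real^3 \<Rightarrow> real"
  assumes [measurable]: "u \<in> borel_measurable borel" and p: "per u" and h: "h \<ge> 0" and i: "integrable MQ u"
  shows "(\<integral>x. u (x + h *\<^sub>R axis j 1) \<partial>MQ) = (\<integral>x. u x \<partial>MQ)"
proof -
  have 1: "(\<integral>\<^sup>+x. ennreal (u (x + h *\<^sub>R axis j 1)) \<partial>MQ) = (\<integral>\<^sup>+x. ennreal (u x) \<partial>MQ)"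
    by (rule nn_integral_MQ_translate[of "\<lambda>x. ennreal (u x)"]) (use p h in \<open>auto simp: per_def\<close>)
  have 2: "(\<integral>\<^sup>+x. ennreal (- u (x + h *\<^sub>R axis j 1)) \<partial>MQ) = (\<integral>\<^sup>+x. ennreal (- u x) \<partial>MQ)"
    by (rule nn_integral_MQ_translate[of "\<lambda>x. ennreal (- u x)"]) (use p h in \<open>auto simp: per_def\<close>)
  have 3: "(\<integral>\<^sup>+x. ennreal \<bar>u (x + h *\<^sub>R axis j 1)\<bar> \<partial>MQ) = (\<integral>\<^sup>+x. ennreal \<bar>u x\<bar> \<partial>MQ)"
    by (rule nn_integral_MQ_translate[of "\<lambda>x. ennreal \<bar>u x\<bar>"]) (use p h in \<open>auto simp: per_def\<close>)
  have m: "(\<lambda>x. u (x + h *\<^sub>R axis j 1)) \<in> borel_measurable MQ" by (rule measurable_MQ) measurable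
  have "integrable MQ (\<lambda>x. u (x + h *\<^sub>R axis j 1))"
    using i m 3 by (simp add: integrable_iff_bounded)
  then show ?thesis using i 1 2 by (simp add: real_lebesgue_integral_def)
qed

lemma sq_translate: "sq u \<Longrightarrow> per u \<Longrightarrow> h \<ge> 0 \<Longrightarrow> sq (\<lambda>x. u (x + h *\<^sub>R axis i 1))"
  unfolding sq_def by (auto simp: n2_translate)

lemma per_translate: "per u \<Longrightarrow> per (\<lambda>x. u (x + z))"
  unfolding per_def by (metis add.assoc add.commute)

lemma per_diff: "per u \<Longrightarrow> per w \<Longrightarrow> per (\<lambda>x. u x - w x)" for u :: "_ \<Rightarrow> real"
  by (simp add: per_def)

lemma ip_translate: "sq u \<Longrightarrow> per u \<Longrightarrow> sq w \<Longrightarrow> per w \<Longrightarrow> h \<ge> 0 \<Longrightarrow> ip (\<lambda>x. u (x + h *\<^sub>R axis i 1)) (\<lambda>x. w (x + h *\<^sub>R axis i 1)) = ip u w"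
  unfolding ip_def by (rule integral_MQ_translate[of "\<lambda>x. u x * w x"]) (auto simp: per_def sq_def intro: sq_integrable)

text \<open>Discrete form of the symmetry of the inner product of d_j u with d_i w in i and j. By
  translation invariance both sides expand into the same four inner products. After division by h^2
  only first difference quotients occur, so the limit is possible where second derivatives are
  missing.\<close>

lemma discrete_IBP:
  assumes u: "sq u" "per u" and w: "sq w" "per w" and h: "h \<ge> 0"
  shows "ip (\<lambda>x. u (x + h *\<^sub>R axis j 1) - u x) (\<lambda>x. w (x + h *\<^sub>R axis i 1) - w x)
    = ip (\<lambda>x. u ((x + h *\<^sub>R axis j 1) + h *\<^sub>R axis i 1) - u (x + h *\<^sub>R axis j 1)) (\<lambda>x. w ((x + h *\<^sub>R axis i 1) + h *\<^sub>R axis j 1) - w (x + h *\<^sub>R axis i 1))"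
proof -
  let ?t = "\<lambda>k f x. f (x + h *\<^sub>R axis k 1) :: real"
  have s: "sq (?t k f)" "per (?t k f)" if "sq f" "per f" for k f
    using that h by (auto intro: sq_translate per_translate)
  note s1 = s[OF u] s[OF w] and s2 = s[OF s[OF u]] s[OF s[OF w]]
  have sw: "(\<lambda>x. w ((x + h *\<^sub>R axis i 1) + h *\<^sub>R axis j 1)) = (\<lambda>x. w ((x + h *\<^sub>R axis j 1) + h *\<^sub>R axis i 1))"
    by (simp add: add_ac)
  have e: "ip (\<lambda>x. a x - b x) (\<lambda>x. c x - d x) = ip a c - ip a d - ip b c + ip b d" if "sq a" "sq b" "sq c" "sq d" for a b c d
  proof -
    have "ip (\<lambda>x. a x - b x) (\<lambda>x. c x - d x) = ip a (\<lambda>x. c x - d x) - ip b (\<lambda>x. c x - d x)"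
      by (rule ip_diff) (use that in \<open>auto intro: sq_diff\<close>)
    moreover have "ip f (\<lambda>x. c x - d x) = ip f c - ip f d" if "sq f" for f
      using ip_diff[of c d f] that \<open>sq c\<close> \<open>sq d\<close> by (simp add: ip_commute)
    ultimately show ?thesis using that by simp
  qed
  have 1: "ip (\<lambda>x. u ((x + h *\<^sub>R axis j 1) + h *\<^sub>R axis i 1)) (\<lambda>x. w ((x + h *\<^sub>R axis i 1) + h *\<^sub>R axis j 1)) = ip u w"
    unfolding sw by (rule trans[OF ip_translate[OF s(1)[OF u] s(2)[OF u] s(1)[OF w] s(2)[OF w] h] ip_translate[OF u w h]])
  have 2: "ip (\<lambda>x. u ((x + h *\<^sub>R axis j 1) + h *\<^sub>R axis i 1)) (\<lambda>x. w (x + h *\<^sub>R axis i 1)) = ip (?t j u) w"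
  proof -
    have c: "(\<lambda>x. u ((x + h *\<^sub>R axis j 1) + h *\<^sub>R axis i 1)) = (\<lambda>x. ?t j u (x + h *\<^sub>R axis i 1))" by (simp add: add_ac)
    show ?thesis unfolding c by (rule ip_translate[OF s(1)[OF u] s(2)[OF u] w h])
  qed
  have 3: "ip (\<lambda>x. u (x + h *\<^sub>R axis j 1)) (\<lambda>x. w ((x + h *\<^sub>R axis i 1) + h *\<^sub>R axis j 1)) = ip u (?t i w)"
  proof -
    have c: "(\<lambda>x. w ((x + h *\<^sub>R axis i 1) + h *\<^sub>R axis j 1)) = (\<lambda>x. ?t i w (x + h *\<^sub>R axis j 1))" by (simp add: add_ac)
    show ?thesis unfolding c by (rule ip_translate[OF u s(1)[OF w] s(2)[OF w] h])
  qed
  show ?thesis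
    by (subst e, use s1 u w in simp_all, subst e) (use s1 s2 1 2 3 in simp_all)
qed

lemma nn_integral_MQ_translate_vec:
  fixes f :: "real^3 \<Rightarrow> ennreal"
  assumes f: "f \<in> borel_measurable borel" "per f" and z: "\<And>j. 0 \<le> z$j"
  shows "(\<integral>\<^sup>+x. f (x + z) \<partial>MQ) = (\<integral>\<^sup>+x. f x \<partial>MQ)"
proof -
  have zz: "z = z$1 *\<^sub>R axis 1 1 + z$2 *\<^sub>R axis 2 1 + z$3 *\<^sub>R axis 3 1"
    by (simp add: vec_eq_iff forall_3 axis_def)
  have T: "(\<integral>\<^sup>+x. f (x + a + z$j *\<^sub>R axis j 1) \<partial>MQ) = (\<integral>\<^sup>+x. f (x + a) \<partial>MQ)" for a j
  proof -
    have "(\<integral>\<^sup>+x. f (x + z$j *\<^sub>R axis j 1 + a) \<partial>MQ) = (\<integral>\<^sup>+x. f (x + a) \<partial>MQ)"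
      by (rule nn_integral_MQ_translate[of "\<lambda>x. f (x + a)"]) (use f z in \<open>auto intro: per_translate\<close>)
    then show ?thesis by (simp add: add_ac)
  qed
  have "(\<integral>\<^sup>+x. f (x + z) \<partial>MQ) = (\<integral>\<^sup>+x. f (x + (z$1 *\<^sub>R axis 1 1 + z$2 *\<^sub>R axis 2 1) + z$3 *\<^sub>R axis 3 1) \<partial>MQ)"
    by (subst zz) (simp add: add_ac)
  also have "\<dots> = (\<integral>\<^sup>+x. f (x + (z$1 *\<^sub>R axis 1 1 + z$2 *\<^sub>R axis 2 1)) \<partial>MQ)" by (rule T)
  also have "\<dots> = (\<integral>\<^sup>+x. f (x + z$1 *\<^sub>R axis 1 1 + z$2 *\<^sub>R axis 2 1) \<partial>MQ)" by (simp add: add_ac)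
  also have "\<dots> = (\<integral>\<^sup>+x. f (x + z$1 *\<^sub>R axis 1 1) \<partial>MQ)" by (rule T)
  also have "\<dots> = (\<integral>\<^sup>+x. f (x + 0 + z$1 *\<^sub>R axis 1 1) \<partial>MQ)" by simp
  also have "\<dots> = (\<integral>\<^sup>+x. f (x + 0) \<partial>MQ)" by (rule T)
  finally show ?thesis by simp
qed

lemma n2_three:
  assumes "a \<in> borel_measurable borel" "b \<in> borel_measurable borel" "c \<in> borel_measurable borel"
  shows "n2 (\<lambda>x. a x + b x + c x) \<le> 4 * n2 a + 4 * n2 b + 4 * n2 c"
proof -
  have "n2 (\<lambda>x. (a x + b x) + c x) \<le> 2 * n2 (\<lambda>x. a x + b x) + 2 * n2 c" by (rule n2_add) (use assms in auto)
  also have "\<dots> \<le> 2 * (2 * n2 a + 2 * n2 b) + 4 * n2 c" by (intro add_mono mult_left_mono n2_add mult_right_mono assms) auto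
  finally show ?thesis by (simp add: distrib_left mult.assoc[symmetric])
qed

text \<open>Telescoping along a coordinate direction turns the infinitesimal bound into one for a finite shift.\<close>

lemma n2_finite_shift:
  assumes u: "sq u" "per u" and d: "((\<lambda>h. n2 (\<lambda>x. (u (x + h *\<^sub>R axis j 1) - u x) / h - u' x)) \<longlongrightarrow> 0) (at 0 within {0<..<c})"
    and u': "u' \<in> borel_measurable borel" and c: "c > 0" and h: "h \<ge> 0"
  shows "n2 (\<lambda>x. u (x + h *\<^sub>R axis j 1) - u x) \<le> ennreal (h\<^sup>2) * (2 * n2 u')"
proof (cases "h = 0")
  case True then show ?thesis by simp
next
  case False
  then have h: "h > 0" using h by simp
  note [measurable] = sq_meas[OF u(1)] u'
  let ?d = "\<lambda>e x. u (x + e *\<^sub>R axis j 1) - u x"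
  have tele: "n2 (?d (real n * e)) \<le> ennreal ((real n)\<^sup>2) * n2 (?d e)" if e: "e \<ge> 0" for n e
  proof -
    have s: "?d (real n * e) x = (\<Sum>k<n. ?d e (x + (real k * e) *\<^sub>R axis j 1))" for x
    proof (induction n)
      case (Suc n)
      have "(x + (real n * e) *\<^sub>R axis j 1) + e *\<^sub>R axis j 1 = x + (real (Suc n) * e) *\<^sub>R axis j 1"
        by (simp add: distrib_right scaleR_add_left)
      then have "?d (real (Suc n) * e) x = ?d (real n * e) x + ?d e (x + (real n * e) *\<^sub>R axis j 1)"
        by (simp only:)
      then show ?case by (simp only: Suc sum.lessThan_Suc)
    qed simp
    have "n2 (?d (real n * e)) \<le> (\<integral>\<^sup>+x. (\<Sum>k<n. ennreal (real n) * ennreal ((?d e (x + (real k * e) *\<^sub>R axis j 1))\<^sup>2)) \<partial>MQ)"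
      unfolding n2_def
    proof (rule nn_integral_mono)
      fix x
      have "(?d (real n * e) x)\<^sup>2 \<le> (\<Sum>k<n. real n * (?d e (x + (real k * e) *\<^sub>R axis j 1))\<^sup>2)"
        unfolding s using sum_squared_le_sum_of_squares[of "\<lambda>k. ?d e (x + (real k * e) *\<^sub>R axis j 1)" "{..<n}"]
        by (simp add: sum_distrib_left[symmetric] mult.commute)
      then have "ennreal ((?d (real n * e) x)\<^sup>2) \<le> ennreal (\<Sum>k<n. real n * (?d e (x + (real k * e) *\<^sub>R axis j 1))\<^sup>2)" by (rule ennreal_leI)
      also have "\<dots> = (\<Sum>k<n. ennreal (real n * (?d e (x + (real k * e) *\<^sub>R axis j 1))\<^sup>2))"
        by (rule sum_ennreal[symmetric]) simp
      finally show "ennreal ((?d (real n * e) x)\<^sup>2) \<le> (\<Sum>k<n. ennreal (real n) * ennreal ((?d e (x + (real k * e) *\<^sub>R axis j 1))\<^sup>2))"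
        by (simp add: ennreal_mult)
    qed
    also have "\<dots> = (\<Sum>k<n. ennreal (real n) * (\<integral>\<^sup>+x. ennreal ((?d e (x + (real k * e) *\<^sub>R axis j 1))\<^sup>2) \<partial>MQ))"
      by (simp add: nn_integral_sum nn_integral_cmult)
    also have "\<dots> = (\<Sum>k<n. ennreal (real n) * n2 (?d e))"
    proof (intro sum.cong refl arg_cong2[where f="(*)"])
      fix k
      have "(\<integral>\<^sup>+x. ennreal ((?d e (x + (real k * e) *\<^sub>R axis j 1))\<^sup>2) \<partial>MQ) = n2 (\<lambda>x. ?d e (x + (real k * e) *\<^sub>R axis j 1))"
        by (simp add: n2_def)
      also have "\<dots> = n2 (?d e)"
        by (rule n2_translate[of "?d e"]) (use u e in \<open>auto intro: per_diff per_translate\<close>)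
      finally show "(\<integral>\<^sup>+x. ennreal ((?d e (x + (real k * e) *\<^sub>R axis j 1))\<^sup>2) \<partial>MQ) = n2 (?d e)" .
    qed
    also have "\<dots> = ennreal ((real n)\<^sup>2) * n2 (?d e)"
      by (simp add: power2_eq_square ennreal_mult ennreal_of_nat_eq_real_of_nat mult.assoc)
    finally show ?thesis .
  qed
  let ?q = "\<lambda>e. n2 (\<lambda>x. ?d e x / e - u' x)"
  have lim: "((\<lambda>e. ennreal (h\<^sup>2) * (2 * ?q e + 2 * n2 u')) \<longlongrightarrow> ennreal (h\<^sup>2) * (2 * 0 + 2 * n2 u')) (at 0 within {0<..<c})"
    by (intro ennreal_tendsto_cmult tendsto_add d tendsto_const) auto
  \<comment> \<open>These step sizes divide h exactly, so that n + 1 of them telescope to h.\<close>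
  define X where "X n = h / real (Suc n)" for n
  have X0: "X \<longlonglongrightarrow> 0" unfolding X_def by (rule LIMSEQ_Suc[OF lim_const_over_n])
  have ev: "\<forall>\<^sub>F n in sequentially. X n \<in> {0<..<c} - {0}"
    using order_tendstoD(2)[OF X0 c] by eventually_elim (use h in \<open>auto simp: X_def\<close>)
  then have "filterlim X (at 0 within {0<..<c}) sequentially"
    using X0 by (auto simp: filterlim_at elim!: eventually_mono)
  then have "(\<lambda>n. ennreal (h\<^sup>2) * (2 * ?q (X n) + 2 * n2 u')) \<longlonglongrightarrow> ennreal (h\<^sup>2) * (2 * 0 + 2 * n2 u')"
    by (rule filterlim_compose[OF lim])
  moreover have "n2 (?d h) \<le> ennreal (h\<^sup>2) * (2 * ?q (X n) + 2 * n2 u')" for n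
  proof -
    have Xp: "X n > 0" using h by (simp add: X_def)
    have hX: "h = real (Suc n) * X n" by (simp add: X_def)
    have "n2 (?d h) \<le> ennreal ((real (Suc n))\<^sup>2) * n2 (?d (X n))"
      using tele[of "X n" "Suc n"] Xp hX by simp
    also have "n2 (?d (X n)) = n2 (\<lambda>x. X n * ((?d (X n) x / X n - u' x) + u' x))" using Xp by simp
    also have "\<dots> = ennreal ((X n)\<^sup>2) * n2 (\<lambda>x. (?d (X n) x / X n - u' x) + u' x)" by (rule n2_cmult) measurable
    also have "ennreal ((real (Suc n))\<^sup>2) * (ennreal ((X n)\<^sup>2) * n2 (\<lambda>x. (?d (X n) x / X n - u' x) + u' x)) = ennreal (h\<^sup>2) * n2 (\<lambda>x. (?d (X n) x / X n - u' x) + u' x)"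
      by (simp only: mult.assoc[symmetric] ennreal_mult[symmetric, OF zero_le_power2 zero_le_power2] power_mult_distrib[symmetric] hX[symmetric])
    also have "\<dots> \<le> ennreal (h\<^sup>2) * (2 * ?q (X n) + 2 * n2 u')"
      by (intro mult_left_mono n2_add) auto
    finally show ?thesis .
  qed
  ultimately have "n2 (?d h) \<le> ennreal (h\<^sup>2) * (2 * 0 + 2 * n2 u')"
    by (intro LIMSEQ_le_const) auto
  then show ?thesis by simp
qed

text \<open>By Cauchy-Schwarz the variance is at most the double integral of (u y - u x)^2.
  Periodicity allows y = x + z with z in the cube, and for fixed z the shift is taken along the
  three axes in turn, each bounded by \<open>n2_finite_shift\<close>. The constant 8 is 4 from the
  three-term sum times 2 from that lemma.\<close>

lemma Poincare:
  assumes u: "sq u" "per u" and d: "\<And>j. ((\<lambda>h. n2 (\<lambda>x. (u (x + h *\<^sub>R axis j 1) - u x) / h - u' j x)) \<longlongrightarrow> 0) (at 0 within {0<..<c})"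
    and u': "\<And>j. u' j \<in> borel_measurable borel" and c: "c > 0"
  shows "n2 (\<lambda>x. u x - mn u) \<le> 8 * (n2 (u' 1) + n2 (u' 2) + n2 (u' 3))"
proof -
  note [measurable] = sq_meas[OF u(1)]
  have cm: "(\<integral>\<^sup>+x. k \<partial>MQ) = k" for k :: ennreal
    by (subst nn_integral_const) (simp_all only: MQ.emeasure_space_1 mult_1_right)
  have "n2 (\<lambda>x. u x - mn u) \<le> (\<integral>\<^sup>+x. \<integral>\<^sup>+y. ennreal ((u y - u x)\<^sup>2) \<partial>MQ \<partial>MQ)"
    unfolding n2_def
  proof (rule nn_integral_mono)
    fix x
    let ?w = "\<lambda>y. u x - u y"
    have s: "sq ?w" using sq_diff[OF sq_const u(1)] .
    have "u x - mn u = mn ?w"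
      using sq_integrable1[OF u(1)] MQ.prob_space unfolding mn_def by (subst Bochner_Integration.integral_diff) auto
    then have "(u x - mn u)\<^sup>2 \<le> (nr ?w)\<^sup>2" using mn_le_nr[OF s] by (metis abs_ge_zero power2_abs power_mono)
    also have "\<dots> = ip ?w ?w" by (rule nr_sq[OF s])
    finally have "ennreal ((u x - mn u)\<^sup>2) \<le> ennreal (ip ?w ?w)" by (rule ennreal_leI)
    also have "\<dots> = n2 ?w" by (rule n2_ip[OF s, symmetric])
    finally show "ennreal ((u x - mn u)\<^sup>2) \<le> (\<integral>\<^sup>+y. ennreal ((u y - u x)\<^sup>2) \<partial>MQ)"
      by (simp add: n2_def power2_commute)
  qed
  also have "\<dots> = (\<integral>\<^sup>+x. \<integral>\<^sup>+z. ennreal ((u (z + x) - u x)\<^sup>2) \<partial>MQ \<partial>MQ)"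
  proof (rule nn_integral_cong)
    fix x assume "x \<in> space MQ"
    then have "\<And>j. 0 \<le> x$j" by (simp add: mem_box_cart)
    then show "(\<integral>\<^sup>+y. ennreal ((u y - u x)\<^sup>2) \<partial>MQ) = (\<integral>\<^sup>+z. ennreal ((u (z + x) - u x)\<^sup>2) \<partial>MQ)"
      by (intro nn_integral_MQ_translate_vec[of "\<lambda>y. ennreal ((u y - u x)\<^sup>2)", symmetric]) (use u in \<open>auto simp: per_def\<close>)
  qed
  also have "\<dots> = (\<integral>\<^sup>+z. \<integral>\<^sup>+x. ennreal ((u (z + x) - u x)\<^sup>2) \<partial>MQ \<partial>MQ)"
  proof -
    interpret P: pair_sigma_finite MQ MQ ..
    have 1: "(\<lambda>p::(real^3) \<times> (real^3). (fst p, snd p)) \<in> MQ \<Otimes>\<^sub>M MQ \<rightarrow>\<^sub>M borel \<Otimes>\<^sub>M borel"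
    proof (rule measurable_Pair)
      show "fst \<in> MQ \<Otimes>\<^sub>M MQ \<rightarrow>\<^sub>M (borel :: (real^3) measure)"
        by (rule measurable_compose[OF measurable_fst]) (rule measurable_restrict_space1, simp)
      show "snd \<in> MQ \<Otimes>\<^sub>M MQ \<rightarrow>\<^sub>M (borel :: (real^3) measure)"
        by (rule measurable_compose[OF measurable_snd]) (rule measurable_restrict_space1, simp)
    qed
    have 2: "(\<lambda>p::(real^3) \<times> (real^3). ennreal ((u (fst p + snd p) - u (snd p))\<^sup>2)) \<in> borel_measurable (borel \<Otimes>\<^sub>M borel)"
      by measurable
    show ?thesis
      by (rule P.Fubini') (use measurable_compose[OF 1 2] in \<open>simp add: case_prod_beta'\<close>)
  qed
  also have "\<dots> \<le> (\<integral>\<^sup>+z. 8 * (n2 (u' 1) + n2 (u' 2) + n2 (u' 3)) \<partial>MQ)"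
  proof (rule nn_integral_mono)
    fix z assume "z \<in> space MQ"
    then have z: "0 \<le> z$j" "z$j \<le> 1" for j by (simp_all add: mem_box_cart)
    let ?a1 = "z$1 *\<^sub>R axis 1 1 :: real^3" and ?a2 = "z$2 *\<^sub>R axis 2 1 :: real^3" and ?a3 = "z$3 *\<^sub>R axis 3 1 :: real^3"
    have zz: "z = ?a1 + ?a2 + ?a3"
      by (simp add: vec_eq_iff forall_3 axis_def)
    have sh: "n2 (\<lambda>x. u (x + z$j *\<^sub>R axis j 1) - u x) \<le> 2 * n2 (u' j)" for j
    proof -
      have "n2 (\<lambda>x. u (x + z$j *\<^sub>R axis j 1) - u x) \<le> ennreal ((z$j)\<^sup>2) * (2 * n2 (u' j))"
        by (rule n2_finite_shift[OF u d u' c z(1)])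
      also have "\<dots> \<le> ennreal 1 * (2 * n2 (u' j))"
        using z by (intro mult_right_mono ennreal_leI) (auto simp: power_le_one)
      finally show ?thesis by simp
    qed
    have pd: "per (\<lambda>x. u (x + b) - u x)" for b using u(2) by (intro per_diff per_translate)
    have t2: "n2 (\<lambda>x. u ((x + ?a1) + ?a2) - u (x + ?a1)) = n2 (\<lambda>x. u (x + ?a2) - u x)"
      by (rule n2_translate[of "\<lambda>x. u (x + ?a2) - u x"]) (use pd z in auto)
    have t3: "n2 (\<lambda>x. u (((x + ?a1) + ?a2) + ?a3) - u ((x + ?a1) + ?a2)) = n2 (\<lambda>x. u (x + ?a3) - u x)"
    proof -
      have "n2 (\<lambda>x. u (((x + ?a1) + ?a2) + ?a3) - u ((x + ?a1) + ?a2)) = n2 (\<lambda>x. u ((x + ?a2) + ?a3) - u (x + ?a2))"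
        by (rule n2_translate[of "\<lambda>x. u ((x + ?a2) + ?a3) - u (x + ?a2)"]) (use z pd[THEN per_translate] in auto)
      also have "\<dots> = n2 (\<lambda>x. u (x + ?a3) - u x)"
        by (rule n2_translate[of "\<lambda>x. u (x + ?a3) - u x"]) (use pd z in auto)
      finally show ?thesis .
    qed
    have "(\<integral>\<^sup>+x. ennreal ((u (z + x) - u x)\<^sup>2) \<partial>MQ)
       = n2 (\<lambda>x. (u (x + ?a1) - u x) + (u ((x + ?a1) + ?a2) - u (x + ?a1)) + (u (((x + ?a1) + ?a2) + ?a3) - u ((x + ?a1) + ?a2)))"
      unfolding n2_def by (subst zz) (simp add: add_ac)
    also have "\<dots> \<le> 4 * n2 (\<lambda>x. u (x + ?a1) - u x) + 4 * n2 (\<lambda>x. u ((x + ?a1) + ?a2) - u (x + ?a1)) + 4 * n2 (\<lambda>x. u (((x + ?a1) + ?a2) + ?a3) - u ((x + ?a1) + ?a2))"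
      by (rule n2_three) measurable
    also have "\<dots> \<le> 4 * (2 * n2 (u' 1)) + 4 * (2 * n2 (u' 2)) + 4 * (2 * n2 (u' 3))"
      unfolding t2 t3 by (intro add_mono mult_left_mono sh) auto
    also have "\<dots> = 8 * (n2 (u' 1) + n2 (u' 2) + n2 (u' 3))" by (simp add: distrib_left mult.assoc[symmetric])
    finally show "(\<integral>\<^sup>+x. ennreal ((u (z + x) - u x)\<^sup>2) \<partial>MQ) \<le> 8 * (n2 (u' 1) + n2 (u' 2) + n2 (u' 3))" .
  qed
  also have "\<dots> = 8 * (n2 (u' 1) + n2 (u' 2) + n2 (u' 3))" by (rule cm)
  finally show ?thesis .
qed

subsection \<open>The hydrodynamic moments and the microscopic remainder\<close>

text \<open>\<open>CP\<close> and \<open>DP\<close> without their normalizing square roots, so that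
  Gaussian expectations involve rational numbers only.\<close>

definition CC :: poly3 where "CC = N2 @ pc (-3)"
definition DD :: "3 \<Rightarrow> poly3" where "DD j = pmul (V j) (N2 @ pc (-5))"

lemma CP_CC: "CP = pscale (1 / sqrt 6) CC" by (simp add: CP_def CC_def)
lemma DP_DD: "DP j = pscale (1 / sqrt 10) (DD j)" by (simp add: DP_def DD_def)

text \<open>The directions onto which \<open>P_c\<close> and \<open>P_nc\<close> project, with the normalizing factors \<open>chn\<close>.\<close>

definition chi :: "nat \<Rightarrow> poly3" where
  "chi k = [pc 1, V 1, V 2, V 3, CC, DD 1, DD 2, DD 3] ! k"
definition chn :: "nat \<Rightarrow> real" where
  "chn k = [1, 1, 1, 1, 1 / sqrt 6, 1 / sqrt 10, 1 / sqrt 10, 1 / sqrt 10] ! k"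

lemma chi_simps: "chi 0 = pc 1" "chi 1 = V 1" "chi 2 = V 2" "chi 3 = V 3" "chi 4 = CC" "chi 5 = DD 1" "chi 6 = DD 2" "chi 7 = DD 3"
  by (simp_all add: chi_def)
lemma chn_simps: "chn 0 = 1" "chn 1 = 1" "chn 2 = 1" "chn 3 = 1" "chn 4 = 1 / sqrt 6" "chn 5 = 1 / sqrt 10" "chn 6 = 1 / sqrt 10" "chn 7 = 1 / sqrt 10"
  by (simp_all add: chn_def)

lemma less_8: "k < 8 \<longleftrightarrow> k \<in> {0,1,2,3,4,5,6,7::nat}" by auto

lemma chi_orth: "k < 8 \<Longrightarrow> l < 8 \<Longrightarrow> pE (pmul (chi k) (chi l)) = (if k = l then 1 / (chn k)\<^sup>2 else 0)"
  unfolding less_8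
  by (elim insertE emptyE; hypsubst; simp only: chi_simps chn_simps CC_def DD_def; simp add: pE_simps gmom_numeral power_divide)

lemma chn_pos: "k < 8 \<Longrightarrow> chn k > 0"
  unfolding less_8 by (elim insertE emptyE; hypsubst; simp only: chn_simps; simp)

text \<open>By \<open>chi_orth\<close> the squared norm of \<open>chi k\<close> is 1 / (chn k)^2;
  with y the moments of h, this is the polynomial of the orthogonal projection of h.\<close>

definition prj :: "(nat \<Rightarrow> real) \<Rightarrow> poly3" where
  "prj y = concat (map (\<lambda>k. pscale (y k * (chn k)\<^sup>2) (chi k)) [0..<8])"

lemma peval_concat: "peval (concat Ls) v = (\<Sum>L\<leftarrow>Ls. peval L v)"
  by (induction Ls) auto

lemma peval_prj: "peval (prj y) v = (\<Sum>k<8. y k * (chn k)\<^sup>2 * peval (chi k) v)"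
  unfolding prj_def peval_concat by (simp add: o_def sum_list_sum_nth atLeast0LessThan)

lemma pE_concat: "pE (concat Ls) = (\<Sum>L\<leftarrow>Ls. pE L)"
  by (induction Ls) (auto simp: pE_def)

lemma pE_pmul_prj: "pE (pmul L (prj y)) = (\<Sum>k<8. y k * (chn k)\<^sup>2 * pE (pmul L (chi k)))"
proof -
  have "pE (pmul L (prj y)) = pE (concat (map (\<lambda>k. pscale (y k * (chn k)\<^sup>2) (pmul L (chi k))) [0..<8]))"
    by (rule pE_cong) (simp add: peval_concat peval_prj o_def sum_list_sum_nth atLeast0LessThan sum_distrib_left mult_ac)
  then show ?thesis by (simp add: pE_concat o_def sum_list_sum_nth atLeast0LessThan)
qed

lemma pE_pmul_commute: "pE (pmul L L') = pE (pmul L' L)"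
  by (rule pE_cong) simp

lemma mom_prj:
  assumes h: "h \<in> borel_measurable borel" "sqn h < \<infinity>"
  shows "mom (peval (prj y)) h = (\<Sum>k<8. y k * (chn k)\<^sup>2 * mom (peval (chi k)) h)"
proof -
  have "mom (peval (concat Ls)) h = (\<Sum>L\<leftarrow>Ls. mom (peval L) h)" for Ls
  proof (induction Ls)
    case Nil then show ?case by (simp add: mom_def)
  next
    case (Cons L Ls) then show ?case using mom_append[OF h, of L "concat Ls"] by (simp only: concat.simps list.map sum_list.Cons)
  qed
  then show ?thesis unfolding prj_def by (simp add: o_def sum_list_sum_nth atLeast0LessThan mom_pscale)
qed

text \<open>Subtracting from h its projection onto the eight directions leaves a remainder r whose
  squared norm is that of h minus the sum of (chn k * y k)^2; the squared term on the left is the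
  moment of r. The identity is stated additively because subtraction in \<open>ennreal\<close> is
  truncated.\<close>

lemma micro_bound:
  assumes h: "h \<in> borel_measurable borel" "sqn h < \<infinity>"
  defines "y \<equiv> \<lambda>k. mom (peval (chi k)) h"
  shows "ennreal ((mom (peval L) h - (\<Sum>k<8. (chn k)\<^sup>2 * pE (pmul L (chi k)) * y k))\<^sup>2) + ennreal (cw L) * (\<Sum>k<8. ennreal ((chn k * y k)\<^sup>2))
    \<le> ennreal (cw L) * (sqn h)"
proof -
  note [measurable] = h(1)
  define P where "P = prj y"
  define r where "r v = h v - peval P v * sqrt (maxwellian v)" for v
  have [measurable]: "r \<in> borel_measurable borel" unfolding r_def[abs_def] by measurable
  have ih: "integrable lborel (\<lambda>v. (h v)\<^sup>2)" using h by (simp add: integrable_sq_iff)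
  define s where "s = (\<Sum>k<8. (chn k * y k)\<^sup>2)"
  have mP: "mom (peval P) h = s"
    unfolding P_def mom_prj[OF h] s_def by (simp add: y_def power2_eq_square mult_ac)
  have PP: "pE (pmul P P) = s"
  proof -
    have "pE (pmul P P) = (\<Sum>k<8. y k * (chn k)\<^sup>2 * pE (pmul (chi k) P))"
      unfolding P_def pE_pmul_prj[of "prj y" y] by (simp only: pE_pmul_commute[of "prj y"])
    also have "\<dots> = (\<Sum>k<8. y k * (chn k)\<^sup>2 * y k)"
    proof (rule sum.cong[OF refl])
      fix k :: nat assume k: "k \<in> {..<8}"
      have "pE (pmul (chi k) P) = (\<Sum>l<8. if l = k then y k else 0)"
        unfolding P_def pE_pmul_prj
        by (rule sum.cong[OF refl]) (use k chn_pos[of k] in \<open>auto simp: chi_orth\<close>)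
      then show "y k * (chn k)\<^sup>2 * pE (pmul (chi k) P) = y k * (chn k)\<^sup>2 * y k" using k by simp
    qed
    finally show ?thesis by (simp add: s_def power2_eq_square mult_ac)
  qed
  have er: "(r v)\<^sup>2 = ((h v)\<^sup>2 - 2 * (h v * (wt P v))) + maxwellian v * peval (pmul P P) v" for v
    by (simp add: r_def power2_diff power_mult_distrib) (simp add: power2_eq_square mult_ac)
  have ip: "integrable lborel (\<lambda>v. h v * (wt P v))" by (rule mom_integrable[OF h])
  have ir: "integrable lborel (\<lambda>v. (r v)\<^sup>2)"
    unfolding er by (intro Bochner_Integration.integrable_add Bochner_Integration.integrable_diff ih integrable_maxwellian_peval Bochner_Integration.integrable_mult_right ip)
  have "(LINT v|lborel. (r v)\<^sup>2) = (LINT v|lborel. (h v)\<^sup>2) - 2 * s + s"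
    unfolding er using ih ip integrable_maxwellian_peval[of "pmul P P"] mP PP integral_maxwellian_peval[of "pmul P P"]
    by (simp add: mom_def del: peval_pmul)
  then have vr: "(LINT v|lborel. (r v)\<^sup>2) = (LINT v|lborel. (h v)\<^sup>2) - s" by simp
  have fr: "sqn r = ennreal ((LINT v|lborel. (h v)\<^sup>2) - s)"
    unfolding vr[symmetric] by (rule nn_integral_eq_integral[OF ir]) simp
  have mr: "mom (peval L) r = mom (peval L) h - (\<Sum>k<8. (chn k)\<^sup>2 * pE (pmul L (chi k)) * y k)"
  proof -
    have "mom (peval L) r = (LINT v|lborel. h v * (wt L v) - maxwellian v * peval (pmul L P) v)"
      unfolding mom_def by (rule Bochner_Integration.integral_cong) (simp_all add: r_def left_diff_distrib)
    also have "\<dots> = mom (peval L) h - pE (pmul L P)"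
      using mom_integrable[OF h] integrable_maxwellian_peval[of "pmul L P"] integral_maxwellian_peval[of "pmul L P"]
      by (simp add: mom_def del: peval_pmul)
    finally show ?thesis by (simp add: P_def pE_pmul_prj mult_ac)
  qed
  have s0: "s \<ge> 0" by (simp add: s_def sum_nonneg)
  have le: "s \<le> (LINT v|lborel. (h v)\<^sup>2)" using vr Bochner_Integration.integral_nonneg[of lborel "\<lambda>v. (r v)\<^sup>2"] by simp
  have es: "(\<Sum>k<8. ennreal ((chn k * y k)\<^sup>2)) = ennreal s" unfolding s_def by (rule sum_ennreal) simp
  have "ennreal ((mom (peval L) r)\<^sup>2) \<le> ennreal (cw L) * (sqn r)"
    by (rule mom_bound) (use fr in auto)
  then have "ennreal ((mom (peval L) r)\<^sup>2) + ennreal (cw L) * ennreal s \<le> ennreal (cw L) * ennreal ((LINT v|lborel. (h v)\<^sup>2) - s) + ennreal (cw L) * ennreal s"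
    unfolding fr by (rule add_right_mono)
  also have "\<dots> = ennreal (cw L) * (ennreal ((LINT v|lborel. (h v)\<^sup>2) - s) + ennreal s)" by (simp add: distrib_left)
  also have "ennreal ((LINT v|lborel. (h v)\<^sup>2) - s) + ennreal s = ennreal (LINT v|lborel. (h v)\<^sup>2)"
    using le s0 by (subst ennreal_plus[symmetric]) auto
  also have "\<dots> = (sqn h)" by (rule nn_integral_eq_integral[OF ih, symmetric]) simp
  finally show ?thesis unfolding mr es .
qed

lemma phase_weight:
  "(\<integral>\<^sup>+p. ennreal (((\<lambda>(x, v). peval L v * sqrt (maxwellian v)) p)\<^sup>2) \<partial>PM) = ennreal (pE (pmul L L))"
proof -
  let ?w = "\<lambda>(x::real^3, v). peval L v * sqrt (maxwellian v)"
  have "sqn (wt L) = (\<integral>\<^sup>+v. ennreal (maxwellian v * peval (pmul L L) v) \<partial>lborel)"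
  proof (rule nn_integral_cong)
    fix v
    have "(wt L v)\<^sup>2 = maxwellian v * peval (pmul L L) v"
      by (simp add: power_mult_distrib) (simp add: power2_eq_square)
    then show "ennreal ((wt L v)\<^sup>2) = ennreal (maxwellian v * peval (pmul L L) v)" by simp
  qed
  also have "\<dots> = ennreal (pE (pmul L L))"
    unfolding integral_maxwellian_peval[symmetric] by (rule nn_integral_eq_integral[OF integrable_maxwellian_peval]) simp
  finally have e: "sqn (wt L) = ennreal (pE (pmul L L))" .
  have "(\<integral>\<^sup>+p. ennreal ((?w p)\<^sup>2) \<partial>PM) = (\<integral>\<^sup>+x. \<integral>\<^sup>+v. ennreal ((?w (x, v))\<^sup>2) \<partial>lborel \<partial>MQ)"
    by (rule nn_integral_phase) measurable
  also have "\<dots> = ennreal (pE (pmul L L))" by (simp add: e MQ.emeasure_space_1 del: space_restrict_space space_restrict_space2)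
  finally show ?thesis .
qed

section \<open>Microscopic remainders and integration by parts for moments\<close>

context kinetic
begin

text \<open>The moment against L of the microscopic part of the \<alpha>-th derivative.\<close>

definition res :: "poly3 \<Rightarrow> nat^4 \<Rightarrow> 'i \<Rightarrow> real \<Rightarrow> real^3 \<Rightarrow> real" where
  "res L \<alpha> i t x = Y L \<alpha> i t x - (\<Sum>k<8. (chn k)\<^sup>2 * pE (pmul L (chi k)) * Y (chi k) \<alpha> i t x)"

lemma n2_res:
  assumes i: "i \<in> S" "t \<in> Iv i" and a: "mi_length \<alpha> \<le> N"
  shows "n2 (res L \<alpha> i t) + ennreal (cw L) * (\<Sum>k<8. n2 (\<lambda>x. chn k * Y (chi k) \<alpha> i t x)) \<le> ennreal (cw L) * L2_norm_sq (g i \<alpha> t)"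
proof -
  have [measurable]: "Y L \<alpha> i t \<in> borel_measurable borel" for L by (rule rg_meas[OF rg_Y[OF a] i])
  note gm[measurable] = g_meas[OF i(1) a i(2)]
  have [measurable]: "res L \<alpha> i t \<in> borel_measurable borel" unfolding res_def[abs_def] by measurable
  have "n2 (res L \<alpha> i t) + ennreal (cw L) * (\<Sum>k<8. n2 (\<lambda>x. chn k * Y (chi k) \<alpha> i t x))
    = (\<integral>\<^sup>+x. ennreal ((res L \<alpha> i t x)\<^sup>2) + ennreal (cw L) * (\<Sum>k<8. ennreal ((chn k * Y (chi k) \<alpha> i t x)\<^sup>2)) \<partial>MQ)"
    unfolding n2_def
    by (subst nn_integral_add) (auto simp: nn_integral_cmult nn_integral_sum simp del: sum_ennreal intro!: measurable_MQ)
  also have "\<dots> \<le> (\<integral>\<^sup>+x. ennreal (cw L) * (sqn (g i \<alpha> t x)) \<partial>MQ)"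
  proof (rule nn_integral_mono_AE, rule AE_mp[OF AE_fin_v0[OF i a]], rule AE_I2, rule impI)
    fix x assume "sqn (g i \<alpha> t x) < \<infinity>"
    from micro_bound[OF g_meas_v[OF i(1) a i(2)] this, of L]
    show "ennreal ((res L \<alpha> i t x)\<^sup>2) + ennreal (cw L) * (\<Sum>k<8. ennreal ((chn k * Y (chi k) \<alpha> i t x)\<^sup>2)) \<le> ennreal (cw L) * (sqn (g i \<alpha> t x))"
      by (simp add: res_def Y_def)
  qed
  also have "\<dots> = ennreal (cw L) * L2_norm_sq (g i \<alpha> t)"
    unfolding L2_norm_sq_iter(2)[OF gm]
    by (rule nn_integral_cmult) (measurable)
  finally show ?thesis .
qed

lemma sq_Y: "i \<in> S \<Longrightarrow> t \<in> Iv i \<Longrightarrow> mi_length \<alpha> \<le> N \<Longrightarrow> sq (Y L \<alpha> i t)"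
  unfolding sq_def using rg_meas[OF rg_Y] l2b_fin[OF l2b_Y] by blast

lemma per_Y: "i \<in> S \<Longrightarrow> t \<in> Iv i \<Longrightarrow> mi_length \<alpha> \<le> N \<Longrightarrow> per (Y L \<alpha> i t)"
  using rg_Y[of \<alpha> L] by (auto simp: rg_def reg_def)

lemma dq_Y:
  assumes i: "i \<in> S" "t \<in> Iv i" and a: "mi_length \<gamma> < N"
  shows "((\<lambda>h. n2 (\<lambda>x. (Y L \<gamma> i t (x + h *\<^sub>R axis j 1) - Y L \<gamma> i t x) / h - Y L (inc (Some j) \<gamma>) i t x)) \<longlongrightarrow> 0) (Fil (Tm i) t)"
  using dd_Y[OF a, of "Some j" L] i by (auto simp: dd_def HD_def)

text \<open>By periodicity the mean of every difference quotient vanishes, and means are continuous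
  in mean square.\<close>

lemma mean_derivative:
  assumes i: "i \<in> S" "t \<in> Iv i" and a: "mi_length \<gamma> < N"
  shows "mn (Y L (inc (Some j) \<gamma>) i t) = 0"
proof -
  let ?F = "Fil (Tm i) t" and ?u = "Y L \<gamma> i t" and ?w = "Y L (inc (Some j) \<gamma>) i t"
  have u: "sq ?u" "per ?u" and w: "sq ?w" using sq_Y per_Y i a by auto
  have "\<forall>\<^sub>F h in ?F. norm (mn ?w) \<le> nr (\<lambda>x. (?u (x + h *\<^sub>R axis j 1) - ?u x) / h - ?w x)"
    using Fil_pos[of "Tm i" t]
  proof eventually_elim
    case (elim h)
    then have h: "h \<ge> 0" by simp
    have s: "sq (\<lambda>x. ?u (x + h *\<^sub>R axis j 1))" by (rule sq_translate[OF u h])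
    have d: "sq (\<lambda>x. (?u (x + h *\<^sub>R axis j 1) - ?u x) / h)"
      using sq_cmult[OF sq_diff[OF s u(1)], of "1/h"] by simp
    have "mn (\<lambda>x. (?u (x + h *\<^sub>R axis j 1) - ?u x) / h) = 0"
      unfolding mn_def using sq_integrable1[OF s] sq_integrable1[OF u(1)] integral_MQ_translate[OF sq_meas[OF u(1)] u(2) h sq_integrable1[OF u(1)], of j]
      by simp
    then have "mn (\<lambda>x. (?u (x + h *\<^sub>R axis j 1) - ?u x) / h - ?w x) = - mn ?w"
      unfolding mn_def using sq_integrable1[OF d] sq_integrable1[OF w] by (subst Bochner_Integration.integral_diff) auto
    then show ?case using mn_le_nr[OF sq_diff[OF d w]] by simp
  qed
  from tendsto_le[OF Fil_nontrivial nr_tendsto0[OF dq_Y[OF i a, of L j]] tendsto_const this]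
  show ?thesis using i by simp
qed

text \<open>The limit of \<open>discrete_IBP\<close> divided by h^2. Its right side is evaluated at
  shifted points, and \<open>shift_Y\<close> removes the shift, since the derivatives involved may
  be of top order.\<close>

lemma IBP_Y:
  assumes i: "i \<in> S" "t \<in> Iv i" and a: "mi_length \<gamma> < N"
  shows "ip (Y L (inc (Some j) \<gamma>) i t) (Y L' (inc (Some k) \<gamma>) i t) = ip (Y L (inc (Some k) \<gamma>) i t) (Y L' (inc (Some j) \<gamma>) i t)"
proof -
  let ?F = "Fil (Tm i) t"
  define u where "u = Y L \<gamma> i t"
  define w where "w = Y L' \<gamma> i t"
  define u' where "u' j = Y L (inc (Some j) \<gamma>) i t" for j
  define w' where "w' j = Y L' (inc (Some j) \<gamma>) i t" for j
  have u: "sq u" "per u" and w: "sq w" "per w" and u': "\<And>j. sq (u' j)" "\<And>j. per (u' j)" and w': "\<And>j. sq (w' j)" "\<And>j. per (w' j)"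
    unfolding u_def w_def u'_def w'_def using sq_Y per_Y i a by auto
  define dq where "dq f j h x = (f (x + h *\<^sub>R axis j 1) - f x) / h" for f :: "real^3 \<Rightarrow> real" and j h x
  have sdq: "sq (dq f j h)" "per (dq f j h)" if "sq f" "per f" "h \<ge> 0" for f j h
  proof -
    show "sq (dq f j h)" using sq_cmult[OF sq_diff[OF sq_translate[OF that] that(1)], of "1/h" j] by (simp add: dq_def[abs_def])
    show "per (dq f j h)" using per_diff[OF per_translate[OF that(2)] that(2)] by (simp add: dq_def[abs_def] per_def)
  qed
  have lu: "((\<lambda>h. n2 (\<lambda>x. dq u j h x - u' j x)) \<longlongrightarrow> 0) ?F" for j
    unfolding u_def u'_def dq_def by (rule dq_Y[OF i a])
  have lw: "((\<lambda>h. n2 (\<lambda>x. dq w j h x - w' j x)) \<longlongrightarrow> 0) ?F" for j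
    unfolding w_def w'_def dq_def by (rule dq_Y[OF i a])
  have tr: "((\<lambda>h. n2 (\<lambda>x. dq f k h (x + h *\<^sub>R axis j 1) - f' x)) \<longlongrightarrow> 0) ?F"
    if f: "sq f" "per f" "sq f'" "per f'" and l: "((\<lambda>h. n2 (\<lambda>x. dq f k h x - f' x)) \<longlongrightarrow> 0) ?F"
      and sh: "((\<lambda>h. n2 (\<lambda>x. f' (x + h *\<^sub>R axis j 1) - f' x)) \<longlongrightarrow> 0) ?F" for f f' k j
  proof -
    have "((\<lambda>h. 2 * n2 (\<lambda>x. dq f k h x - f' x) + 2 * n2 (\<lambda>x. f' (x + h *\<^sub>R axis j 1) - f' x)) \<longlongrightarrow> 0) ?F"
      by (intro tendsto0_ennreal_add tendsto0_ennreal_cmult l sh) auto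
    then show ?thesis
    proof (rule tendsto0_ennreal_le)
      show "\<forall>\<^sub>F h in ?F. n2 (\<lambda>x. dq f k h (x + h *\<^sub>R axis j 1) - f' x) \<le> 2 * n2 (\<lambda>x. dq f k h x - f' x) + 2 * n2 (\<lambda>x. f' (x + h *\<^sub>R axis j 1) - f' x)"
        using Fil_pos[of "Tm i" t]
      proof eventually_elim
        case (elim h)
        then have h: "h \<ge> 0" by simp
        note s = sdq[OF f(1,2) h, of k]
        have [measurable]: "f' \<in> borel_measurable borel" "dq f k h \<in> borel_measurable borel" using f s by (auto simp: sq_def)
        have "n2 (\<lambda>x. dq f k h (x + h *\<^sub>R axis j 1) - f' x) = n2 (\<lambda>x. (dq f k h (x + h *\<^sub>R axis j 1) - f' (x + h *\<^sub>R axis j 1)) + (f' (x + h *\<^sub>R axis j 1) - f' x))" by simp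
        also have "\<dots> \<le> 2 * n2 (\<lambda>x. dq f k h (x + h *\<^sub>R axis j 1) - f' (x + h *\<^sub>R axis j 1)) + 2 * n2 (\<lambda>x. f' (x + h *\<^sub>R axis j 1) - f' x)"
          by (rule n2_add) measurable
        also have "n2 (\<lambda>x. dq f k h (x + h *\<^sub>R axis j 1) - f' (x + h *\<^sub>R axis j 1)) = n2 (\<lambda>x. dq f k h x - f' x)"
          by (rule n2_translate[of "\<lambda>x. dq f k h x - f' x"]) (use h per_diff[OF s(2) f(4)] in auto)
        finally show ?case .
      qed
    qed
  qed
  have shu: "((\<lambda>h. n2 (\<lambda>x. u' k (x + h *\<^sub>R axis j 1) - u' k x)) \<longlongrightarrow> 0) ?F" for j k
    unfolding u'_def using shift_Y[of "inc (Some k) \<gamma>" i t "Some j" L] i a by simp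
  have shw: "((\<lambda>h. n2 (\<lambda>x. w' k (x + h *\<^sub>R axis j 1) - w' k x)) \<longlongrightarrow> 0) ?F" for j k
    unfolding w'_def using shift_Y[of "inc (Some k) \<gamma>" i t "Some j" L'] i a by simp
  have ev: "\<forall>\<^sub>F h in ?F. sq (dq u j h) \<and> sq (dq w k h)" for j k
    using Fil_pos[of "Tm i" t] by eventually_elim (use sdq u w in auto)
  have ev': "\<forall>\<^sub>F h in ?F. sq (\<lambda>x. dq u k h (x + h *\<^sub>R axis j 1)) \<and> sq (\<lambda>x. dq w j h (x + h *\<^sub>R axis k 1))" for j k
    using Fil_pos[of "Tm i" t] by eventually_elim (use sdq u w sq_translate in auto)
  have A: "((\<lambda>h. ip (dq u j h) (dq w k h)) \<longlongrightarrow> ip (u' j) (w' k)) ?F"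
    by (rule ip_tendsto) (rule lu lw ev u'(1) w'(1))+
  have Bt: "((\<lambda>h. ip (\<lambda>x. dq u k h (x + h *\<^sub>R axis j 1)) (\<lambda>x. dq w j h (x + h *\<^sub>R axis k 1))) \<longlongrightarrow> ip (u' k) (w' j)) ?F"
  proof (rule ip_tendsto)
    show "((\<lambda>h. n2 (\<lambda>x. dq u k h (x + h *\<^sub>R axis j 1) - u' k x)) \<longlongrightarrow> 0) ?F"
      by (rule tr) (rule u u' lu shu)+
    show "((\<lambda>h. n2 (\<lambda>x. dq w j h (x + h *\<^sub>R axis k 1) - w' j x)) \<longlongrightarrow> 0) ?F"
      by (rule tr) (rule w w' lw shw)+
  qed (rule ev' u'(1) w'(1))+
  have ev_eq: "\<forall>\<^sub>F h in ?F. ip (\<lambda>x. dq u k h (x + h *\<^sub>R axis j 1)) (\<lambda>x. dq w j h (x + h *\<^sub>R axis k 1)) = ip (dq u j h) (dq w k h)"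
    using Fil_pos[of "Tm i" t]
  proof eventually_elim
    case (elim h)
    have sc: "ip (\<lambda>x. a x / h) (\<lambda>x. b x / h) = ip a b / (h * h)" for a b by (simp add: ip_def)
    show ?case unfolding dq_def sc using discrete_IBP[OF u w, of h j k] elim by simp
  qed
  have "((\<lambda>h. ip (dq u j h) (dq w k h)) \<longlongrightarrow> ip (u' k) (w' j)) ?F"
    by (rule Lim_transform_eventually[OF Bt ev_eq])
  moreover have "?F \<noteq> bot" by (rule Fil_nontrivial) (use i in simp)
  ultimately have "ip (u' j) (w' k) = ip (u' k) (w' j)" using tendsto_unique A by blast
  then show ?thesis unfolding u'_def w'_def .
qed

text \<open>Korn's inequality in one coordinate plane, even as an identity: the cross terms of the
  two squares cancel by \<open>IBP_Y\<close>. In each plane the off-diagonal entry and the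
  difference of the two diagonal entries therefore control all four derivatives.\<close>

lemma Korn_Y:
  assumes i: "i \<in> S" "t \<in> Iv i" and a: "mi_length \<gamma> < N"
  shows "n2 (Y L (inc (Some x) \<gamma>) i t) + n2 (Y L (inc (Some y) \<gamma>) i t) + n2 (Y L' (inc (Some x) \<gamma>) i t) + n2 (Y L' (inc (Some y) \<gamma>) i t)
    = n2 (\<lambda>z. Y L' (inc (Some x) \<gamma>) i t z + Y L (inc (Some y) \<gamma>) i t z) + n2 (\<lambda>z. Y L (inc (Some x) \<gamma>) i t z - Y L' (inc (Some y) \<gamma>) i t z)"
proof -
  define u where "u j = Y L (inc (Some j) \<gamma>) i t" for j
  define w where "w j = Y L' (inc (Some j) \<gamma>) i t" for j
  have u: "sq (u j)" and w: "sq (w j)" for j unfolding u_def w_def using sq_Y i a by auto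
  have e1: "ip (\<lambda>z. w x z + u y z) (\<lambda>z. w x z + u y z) = ip (w x) (w x) + ip (u y) (u y) + 2 * ip (u y) (w x)"
    using ip_add[OF w u sq_add[OF w u], of x y x y] ip_add[OF w u w, of x y x] ip_add[OF w u u, of x y y]
    by (simp add: ip_commute)
  have e2: "ip (\<lambda>z. u x z - w y z) (\<lambda>z. u x z - w y z) = ip (u x) (u x) + ip (w y) (w y) - 2 * ip (u x) (w y)"
    using ip_diff[OF u w sq_diff[OF u w], of x y x y] ip_diff[OF u w w, of x y y] ip_diff[OF u w u, of x y x]
    by (simp add: ip_commute)
  have c: "ip (u x) (w y) = ip (u y) (w x)" unfolding u_def w_def by (rule IBP_Y[OF i a])
  have nn: "ip f f \<ge> 0" for f by (simp add: ip_def)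
  have "n2 (u x) + n2 (u y) + n2 (w x) + n2 (w y) = n2 (\<lambda>z. w x z + u y z) + n2 (\<lambda>z. u x z - w y z)"
    unfolding n2_ip[OF u] n2_ip[OF w] n2_ip[OF sq_add[OF w u]] n2_ip[OF sq_diff[OF u w]]
    using nn[of "\<lambda>z. w x z + u y z"] nn[of "\<lambda>z. u x z - w y z"]
    by (simp add: ennreal_plus[symmetric] nn del: ennreal_plus) (simp add: e1 e2 c)
  then show ?thesis unfolding u_def w_def .
qed

lemma phase_Y:
  assumes i: "i \<in> S" "t \<in> Iv i" and a: "mi_length \<alpha> \<le> N"
  shows "integrable PM (\<lambda>(x,v). g i \<alpha> t x v * (wt L v))"
    and "(LINT (x,v)|PM. g i \<alpha> t x v * (wt L v)) = mn (Y L \<alpha> i t)"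
proof -
  interpret L: sigma_finite_measure "lborel :: (real^3) measure" by (rule sigma_finite_lborel)
  interpret P: pair_sigma_finite MQ "lborel :: (real^3) measure" ..
  note gm = phase_measurable[OF g_meas[OF i(1) a i(2)]]
  let ?w = "\<lambda>(x::real^3, v). peval L v * sqrt (maxwellian v)"
  have wm: "?w \<in> borel_measurable PM" by measurable
  have g2: "integrable PM (\<lambda>p. ((\<lambda>(x,v). g i \<alpha> t x v) p)\<^sup>2)"
    using L2_fin[OF i(1) a i(2)] unfolding L2_norm_sq_iter(1)[OF g_meas[OF i(1) a i(2)]]
    by (subst integrable_sq_iff[OF gm]) (simp add: case_prod_beta')
  have w2: "integrable PM (\<lambda>p. (?w p)\<^sup>2)"
  proof -
    show ?thesis using phase_weight[of L] by (subst integrable_sq_iff[OF wm]) simp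
  qed
  show I: "integrable PM (\<lambda>(x,v). g i \<alpha> t x v * (wt L v))"
    using Cauchy_Schwarz_integral(1)[OF gm wm g2 w2] by (simp add: case_prod_beta')
  show "(LINT (x,v)|PM. g i \<alpha> t x v * (wt L v)) = mn (Y L \<alpha> i t)"
    unfolding P.integral_fst[OF I, symmetric] mn_def Y_def mom_def ..
qed

end

section \<open>Evolution of spatial means in time\<close>

context kinetic
begin

lemma g_joint_measurable:
  assumes i: "i \<in> S" "t \<in> Iv i" and a: "mi_length \<alpha> \<le> N"
  shows "(\<lambda>p. indicator {0..t} (snd p) * g i \<alpha> (snd p) (fst (fst p)) (snd (fst p))) \<in> borel_measurable (PM \<Otimes>\<^sub>M lborel)"
proof -
  have cont: "continuous_on ({0..t} \<times> UNIV \<times> UNIV) (\<lambda>(r,x,v). g i \<alpha> r x v)"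
    by (rule continuous_on_subset[OF g_cont[OF i(1) a]]) (use i in auto)
  have "(\<lambda>q::real\<times>(real^3)\<times>(real^3). indicator ({0..t} \<times> UNIV \<times> UNIV) q *\<^sub>R (\<lambda>(r,x,v). g i \<alpha> r x v) q) \<in> borel_measurable borel"
    by (rule borel_measurable_continuous_on_indicator[OF _ cont]) (intro borel_closed closed_Times closed_UNIV closed_atLeastAtMost)
  then have b: "(\<lambda>q::real\<times>(real^3)\<times>(real^3). indicator {0..t} (fst q) * g i \<alpha> (fst q) (fst (snd q)) (snd (snd q))) \<in> borel_measurable (borel \<Otimes>\<^sub>M (borel \<Otimes>\<^sub>M borel))"
    by (simp add: borel_prod case_prod_beta' indicator_times)
  have s: "(\<lambda>p::((real^3)\<times>(real^3))\<times>real. (snd p, (fst (fst p), snd (fst p)))) \<in> PM \<Otimes>\<^sub>M lborel \<rightarrow>\<^sub>M borel \<Otimes>\<^sub>M (borel \<Otimes>\<^sub>M borel)"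
  proof (intro measurable_Pair)
    show "(\<lambda>x. snd x) \<in> PM \<Otimes>\<^sub>M lborel \<rightarrow>\<^sub>M (borel::real measure)"
      by (rule measurable_compose[OF measurable_snd]) simp
    show "(\<lambda>x. fst (fst x)) \<in> PM \<Otimes>\<^sub>M (lborel::real measure) \<rightarrow>\<^sub>M (borel::(real^3) measure)"
      by (rule measurable_compose[OF measurable_fst measurable_compose[OF measurable_fst]]) (rule measurable_restrict_space1, simp)
    show "(\<lambda>x. snd (fst x)) \<in> PM \<Otimes>\<^sub>M (lborel::real measure) \<rightarrow>\<^sub>M (borel::(real^3) measure)"
      by (rule measurable_compose[OF measurable_fst measurable_compose[OF measurable_snd]]) simp
  qed
  show ?thesis using measurable_compose[OF s b] by simp
qed

text \<open>The energy is a sum of time integrals, whereas the drift of the mean heat flux is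
  bounded by the integral of the sum. The exchange requires measurability in time, obtained from
  joint continuity.\<close>

lemma integral_en:
  assumes i: "i \<in> S" "t \<in> Iv i"
  shows "(\<integral>\<^sup>+s\<in>{0..t}. ennreal (en i s) \<partial>lborel) = (\<Sum>\<alpha> | mi_length \<alpha> \<le> N. \<integral>\<^sup>+s\<in>{0..t}. L2_norm_sq (g i \<alpha> s) \<partial>lborel)"
proof -
  let ?P = "PM"
  interpret MP: pair_sigma_finite MQ "lborel :: (real^3) measure" ..
  interpret P: pair_sigma_finite ?P "lborel :: real measure" ..
  have m: "(\<lambda>s. L2_norm_sq (g i \<alpha> s) * indicator {0..t} s) \<in> borel_measurable lborel" if a: "mi_length \<alpha> \<le> N" for \<alpha>
  proof -
    let ?h = "\<lambda>p. ennreal ((indicator {0..t} (snd p) * g i \<alpha> (snd p) (fst (fst p)) (snd (fst p)))\<^sup>2)"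
    have "?h \<in> borel_measurable (?P \<Otimes>\<^sub>M lborel)" using g_joint_measurable[OF i a] by measurable
    from measurable_compose[OF measurable_pair_swap' this]
    have "(\<lambda>(s, q). ?h (q, s)) \<in> borel_measurable (lborel \<Otimes>\<^sub>M ?P)" by (simp add: case_prod_beta')
    from MP.borel_measurable_nn_integral[OF this]
    have "(\<lambda>s. \<integral>\<^sup>+q. ?h (q, s) \<partial>?P) \<in> borel_measurable lborel" .
    moreover have "(\<integral>\<^sup>+q. ?h (q, s) \<partial>?P) = L2_norm_sq (g i \<alpha> s) * indicator {0..t} s" for s
    proof (cases "s \<in> {0..t}")
      case True
      then have "s \<in> Iv i" using i by auto
      from L2_norm_sq_iter(1)[OF g_meas[OF i(1) a this]] show ?thesis using True by simp
    qed simp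
    ultimately show ?thesis by simp
  qed
  have "(\<integral>\<^sup>+s\<in>{0..t}. ennreal (en i s) \<partial>lborel) = (\<integral>\<^sup>+s. (\<Sum>\<alpha> | mi_length \<alpha> \<le> N. L2_norm_sq (g i \<alpha> s) * indicator {0..t} s) \<partial>lborel)"
  proof (rule nn_integral_cong)
    fix s :: real
    show "ennreal (en i s) * indicator {0..t} s = (\<Sum>\<alpha> | mi_length \<alpha> \<le> N. L2_norm_sq (g i \<alpha> s) * indicator {0..t} s)"
    proof (cases "s \<in> {0..t}")
      case True
      then have s: "s \<in> Iv i" using i by auto
      have "ennreal (en i s) = (\<Sum>\<alpha> | mi_length \<alpha> \<le> N. ennreal (enn2real (L2_norm_sq (g i \<alpha> s))))"
        unfolding en_def by (rule sum_ennreal[symmetric]) simp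
      also have "\<dots> = (\<Sum>\<alpha> | mi_length \<alpha> \<le> N. L2_norm_sq (g i \<alpha> s))"
        by (rule sum.cong) (use L2_fin[OF i(1) _ s] in auto)
      finally show ?thesis using True by simp
    qed simp
  qed
  also have "\<dots> = (\<Sum>\<alpha> | mi_length \<alpha> \<le> N. \<integral>\<^sup>+s\<in>{0..t}. L2_norm_sq (g i \<alpha> s) \<partial>lborel)"
    by (rule nn_integral_sum) (use m in auto)
  finally show ?thesis .
qed

text \<open>Only right derivatives of the moments are available, so the growth of their means is
  bounded by Fubini's theorem instead of the mean value theorem.\<close>

lemma mean_time:
  assumes i: "i \<in> S" "t \<in> Iv i" and a: "mi_length \<gamma> < N" and K: "K > 0"
    and bound: "\<And>s. s \<in> {0..t} \<Longrightarrow> \<bar>mn (Y L (inc None \<gamma>) i s)\<bar> \<le> K * e s"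
    and int: "(\<integral>\<^sup>+s\<in>{0..t}. ennreal (e s) \<partial>lborel) \<le> ennreal k" and k: "k \<ge> 0"
  shows "\<bar>mn (Y L \<gamma> i t) - mn (Y L \<gamma> i 0)\<bar> \<le> K * k"
proof -
  have a': "mi_length (inc None \<gamma>) \<le> N" and a'': "mi_length \<gamma> \<le> N" using a by auto
  have t0: "0 \<in> Iv i" "0 \<le> t" using i by auto
  have st: "s \<in> Iv i" if "s \<in> {0..t}" for s using that i by auto
  let ?P = "PM"
  let ?g = "\<lambda>r x v. g i (inc None \<gamma>) r x v" and ?p = "\<lambda>v. peval L v * sqrt (maxwellian v)"
  interpret MP: pair_sigma_finite MQ "lborel :: (real^3) measure" ..
  interpret P: pair_sigma_finite ?P "lborel :: real measure" ..
  define G where "G q r = (indicator {0..t} r * ?g r (fst q) (snd q)) * ?p (snd q)" for q :: "(real^3) \<times> (real^3)" and r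
  have cont: "continuous_on ({0..t} \<times> UNIV \<times> UNIV) (\<lambda>(r,x,v). ?g r x v)"
    by (rule continuous_on_subset[OF g_cont[OF i(1) a']]) (use st in auto)
  have Gm: "(\<lambda>(q, r). G q r) \<in> borel_measurable (?P \<Otimes>\<^sub>M lborel)"
  proof -
    note m1 = g_joint_measurable[OF i a']
    have "(\<lambda>x. snd (fst x)) \<in> ?P \<Otimes>\<^sub>M (lborel::real measure) \<rightarrow>\<^sub>M (borel::(real^3) measure)"
      by (rule measurable_compose[OF measurable_fst measurable_compose[OF measurable_snd]]) simp
    then have m2: "(\<lambda>p. ?p (snd (fst p))) \<in> borel_measurable (?P \<Otimes>\<^sub>M (lborel::real measure))"
      by (rule measurable_compose) measurable
    show ?thesis using borel_measurable_times[OF m1 m2] by (simp add: G_def case_prod_beta')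
  qed
  \<comment> \<open>Absolute integrability over phase space and time, from |a b| \<le> a^2 + b^2 and
    the uniform bound \<open>B\<close>; it licenses the exchange of the integrals.\<close>
  have I: "integrable (?P \<Otimes>\<^sub>M lborel) (\<lambda>(q, r). G q r)"
    unfolding integrable_iff_bounded
  proof (rule conjI[OF Gm])
    have m: "(\<lambda>p. ennreal (norm (case_prod G p))) \<in> borel_measurable (?P \<Otimes>\<^sub>M lborel)" using Gm by measurable
    have "(\<integral>\<^sup>+p. ennreal (norm (case_prod G p)) \<partial>(?P \<Otimes>\<^sub>M lborel)) = (\<integral>\<^sup>+r. \<integral>\<^sup>+q. ennreal (norm (G q r)) \<partial>?P \<partial>lborel)"
      using P.nn_integral_snd[OF m] by simp
    also have "\<dots> \<le> (\<integral>\<^sup>+r. ennreal (B + pE (pmul L L)) * indicator {0..t} r \<partial>lborel)"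
    proof (rule nn_integral_mono)
      fix r :: real
      show "(\<integral>\<^sup>+q. ennreal (norm (G q r)) \<partial>?P) \<le> ennreal (B + pE (pmul L L)) * indicator {0..t} r"
      proof (cases "r \<in> {0..t}")
        case True
        note gm = phase_measurable[OF g_meas[OF i(1) a' st[OF True]]]
        have wm: "(\<lambda>(x::real^3, v). ?p v) \<in> borel_measurable ?P" by measurable
        have pp: "pE (pmul L L) \<ge> 0"
          unfolding integral_maxwellian_peval[symmetric] by (rule Bochner_Integration.integral_nonneg) simp
        have "(\<integral>\<^sup>+q. ennreal (norm (G q r)) \<partial>?P) \<le> (\<integral>\<^sup>+q. ennreal (((\<lambda>(x,v). ?g r x v) q)\<^sup>2) + ennreal (((\<lambda>(x::real^3, v). ?p v) q)\<^sup>2) \<partial>?P)"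
        proof (rule nn_integral_mono)
          fix q
          have "\<bar>a * b\<bar> \<le> a\<^sup>2 + b\<^sup>2" for a b :: real
          proof -
            have "2 * (\<bar>a\<bar> * \<bar>b\<bar>) \<le> a\<^sup>2 + b\<^sup>2" using sum_squares_bound[of "\<bar>a\<bar>" "\<bar>b\<bar>"] by simp
            moreover have "0 \<le> \<bar>a\<bar> * \<bar>b\<bar>" by simp
            ultimately show ?thesis unfolding abs_mult by linarith
          qed
          then show "ennreal (norm (G q r)) \<le> ennreal (((\<lambda>(x,v). ?g r x v) q)\<^sup>2) + ennreal (((\<lambda>(x::real^3, v). ?p v) q)\<^sup>2)"
            using True by (subst ennreal_plus[symmetric]) (auto simp: G_def case_prod_beta' intro!: ennreal_leI simp del: ennreal_plus)
        qed
        also have "\<dots> = L2_norm_sq (?g r) + ennreal (pE (pmul L L))"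
          unfolding L2_norm_sq_iter(1)[OF g_meas[OF i(1) a' st[OF True]]] phase_weight[symmetric]
          by (subst nn_integral_add) (use gm wm in \<open>auto simp: case_prod_beta'\<close>)
        also have "\<dots> \<le> ennreal B + ennreal (pE (pmul L L))" by (rule add_right_mono) (rule g_L2[OF i(1) a' st[OF True]])
        also have "\<dots> = ennreal (B + pE (pmul L L))" using B0 pp by simp
        finally show ?thesis using True by simp
      qed (simp add: G_def)
    qed
    also have "\<dots> < \<infinity>" using t0 by (subst nn_integral_cmult_indicator) (auto simp: ennreal_mult_less_top)
    finally show "(\<integral>\<^sup>+p. ennreal (norm (case_prod G p)) \<partial>(?P \<Otimes>\<^sub>M lborel)) < \<infinity>" .
  qed
  define \<mu> where "\<mu> r = indicator {0..t} r * mn (Y L (inc None \<gamma>) i r)" for r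
  have q: "(\<integral>q. G q r \<partial>?P) = \<mu> r" for r
  proof (cases "r \<in> {0..t}")
    case True
    then show ?thesis using phase_Y(2)[OF i(1) st[OF True] a', of L] by (simp add: G_def \<mu>_def case_prod_beta')
  qed (simp add: G_def \<mu>_def)
  have r: "(\<integral>r. G q r \<partial>lborel) = g i \<gamma> t (fst q) (snd q) * ?p (snd q) - g i \<gamma> 0 (fst q) (snd q) * ?p (snd q)" for q
  proof -
    have "(LBINT r. indicator {0..t} r *\<^sub>R ?g r (fst q) (snd q)) = g i \<gamma> t (fst q) (snd q) - g i \<gamma> 0 (fst q) (snd q)"
    proof (rule integral_FTC_Icc)
      show "((\<lambda>r. g i \<gamma> r (fst q) (snd q)) has_vector_derivative ?g r (fst q) (snd q)) (at r within {0..t})" if "0 \<le> r" "r \<le> t" for r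
      proof -
        have "((\<lambda>s. g i \<gamma> s (fst q) (snd q)) has_real_derivative ?g r (fst q) (snd q)) (at r within {0..t})"
          by (rule DERIV_subset[OF g_dt[OF i(1) a]]) (use st that in auto)
        then show ?thesis by (simp add: has_real_derivative_iff_has_vector_derivative)
      qed
      have "continuous_on {0..t} (\<lambda>r. (\<lambda>(r,x,v). ?g r x v) (r, fst q, snd q))"
        by (rule continuous_on_compose2[OF cont]) (auto intro!: continuous_intros)
      then show "continuous_on {0..t} (\<lambda>r. ?g r (fst q) (snd q))" by (simp add: split_beta)
    qed (use t0 in auto)
    then show ?thesis unfolding G_def integral_mult_left_zero by (simp add: left_diff_distrib)
  qed
  have "(\<integral>r. \<mu> r \<partial>lborel) = (\<integral>q. g i \<gamma> t (fst q) (snd q) * ?p (snd q) - g i \<gamma> 0 (fst q) (snd q) * ?p (snd q) \<partial>?P)"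
    using P.Fubini_integral[OF I] unfolding q r .
  also have "\<dots> = mn (Y L \<gamma> i t) - mn (Y L \<gamma> i 0)"
    using phase_Y[OF i a'', of L] phase_Y[OF i(1) t0(1) a'', of L] by (simp add: case_prod_beta')
  finally have e: "(\<integral>r. \<mu> r \<partial>lborel) = mn (Y L \<gamma> i t) - mn (Y L \<gamma> i 0)" .
  have im: "integrable lborel \<mu>" using P.integrable_snd[OF I] unfolding q .
  then have [measurable]: "\<mu> \<in> borel_measurable borel" by auto
  have "ennreal \<bar>mn (Y L \<gamma> i t) - mn (Y L \<gamma> i 0)\<bar> \<le> (\<integral>\<^sup>+r. ennreal (norm (\<mu> r)) \<partial>lborel)"
    using integral_norm_bound_ennreal[OF im] by (simp add: e)
  also have "\<dots> = (\<integral>\<^sup>+r. ennreal K * ennreal (\<bar>\<mu> r\<bar> / K) \<partial>lborel)"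
    using K by (intro nn_integral_cong) (simp add: ennreal_mult[symmetric])
  also have "\<dots> = ennreal K * (\<integral>\<^sup>+r. ennreal (\<bar>\<mu> r\<bar> / K) \<partial>lborel)"
    by (rule nn_integral_cmult) measurable
  also have "\<dots> \<le> ennreal K * (\<integral>\<^sup>+s\<in>{0..t}. ennreal (e s) \<partial>lborel)"
  proof (intro mult_left_mono nn_integral_mono)
    fix r show "ennreal (\<bar>\<mu> r\<bar> / K) \<le> ennreal (e r) * indicator {0..t} r"
      using bound[of r] K by (auto simp: \<mu>_def indicator_def pos_divide_le_eq mult.commute intro!: ennreal_leI)
  qed simp
  also have "\<dots> \<le> ennreal K * ennreal k" by (rule mult_left_mono[OF int]) simp
  also have "\<dots> = ennreal (K * k)" using K k by (simp add: ennreal_mult)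
  finally show ?thesis using K k by simp
qed

lemma Y_cong: "(\<And>v. peval L v = peval L' v) \<Longrightarrow> Y L \<alpha> i t x = Y L' \<alpha> i t x"
  unfolding Y_def by (rule mom_cong)

lemma Y_pscale: "Y (pscale c L) \<alpha> i t x = c * Y L \<alpha> i t x"
  by (simp only: Y_def mom_pscale)

lemma mn_Y_append:
  assumes "i \<in> S" "t \<in> Iv i" "mi_length \<alpha> \<le> N"
  shows "mn (Y (L @ L') \<alpha> i t) = mn (Y L \<alpha> i t) + mn (Y L' \<alpha> i t)"
proof -
  have "mn (Y (L @ L') \<alpha> i t) = (LINT p|PM. (case p of (x,v) \<Rightarrow> g i \<alpha> t x v * (wt L v)) + (case p of (x,v) \<Rightarrow> g i \<alpha> t x v * (wt L' v)))"
    unfolding phase_Y(2)[OF assms, symmetric] by (rule Bochner_Integration.integral_cong) (auto simp: algebra_simps)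
  also have "\<dots> = mn (Y L \<alpha> i t) + mn (Y L' \<alpha> i t)"
    unfolding Bochner_Integration.integral_add[OF phase_Y(1)[OF assms, of L] phase_Y(1)[OF assms, of L']] phase_Y(2)[OF assms] ..
  finally show ?thesis .
qed

lemma mn_Y_pscale: "mn (Y (pscale c L) \<alpha> i t) = c * mn (Y L \<alpha> i t)"
  by (simp add: mn_def Y_pscale)

lemma mn_Y_cong: "(\<And>v. peval L v = peval L' v) \<Longrightarrow> mn (Y L \<alpha> i t) = mn (Y L' \<alpha> i t)"
  by (simp add: mn_def Y_cong[of L L'])

lemma W_pscale: "W (pscale c L) \<gamma> i t x = c * W L \<gamma> i t x"
proof -
  have "Y (pmul (V j) (pscale c L)) \<alpha> i t x = c * Y (pmul (V j) L) \<alpha> i t x" for j \<alpha>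
    unfolding Y_pscale[symmetric] by (rule Y_cong) simp
  then show ?thesis by (simp add: W_def Y_pscale sum_distrib_left distrib_left)
qed

lemma multi_index_cases: obtains "\<gamma> = 0" | e \<gamma>' where "\<gamma> = inc e \<gamma>'"
proof -
  obtain es where es: "\<gamma> = fold inc es 0" using ex_fold_inc by blast
  show thesis
  proof (cases es rule: rev_cases)
    case Nil then show thesis using es that(1) by simp
  next
    case (snoc ys e) then show thesis using es that(2)[of e "fold inc ys 0"] by simp
  qed
qed

end

subsection \<open>The macroscopic estimate\<close>

text \<open>\<kappa> is the target size. It dominates the energy norms and their time integral, so
  quadratic terms and the drift of the mean heat flux are admissible, and its square dominates the
  dissipation. The quantity to be bounded is the sum subtracted in \<open>kap_diss\<close>.\<close>

locale macro_estimate = shakhov_kinetic S Tm g N B \<tau>\<^sub>0 \<eta> w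
  for S :: "'i set" and Tm g N B \<tau>\<^sub>0 \<eta> w +
  fixes \<kappa> :: "'i \<Rightarrow> real \<Rightarrow> real"
  assumes kap_en: "i \<in> S \<Longrightarrow> t \<in> Iv i \<Longrightarrow> en i t \<le> \<kappa> i t"
    and kap_int: "i \<in> S \<Longrightarrow> t \<in> Iv i \<Longrightarrow> (\<integral>\<^sup>+s\<in>{0..t}. ennreal (en i s) \<partial>lborel) \<le> ennreal (\<kappa> i t)"
    and kap_diss: "i \<in> S \<Longrightarrow> t \<in> Iv i \<Longrightarrow>
      en i t - (\<Sum>\<alpha> | mi_length \<alpha> \<le> N. \<Sum>k<8. enn2real (n2 (\<lambda>x. chn k * Y (chi k) \<alpha> i t x))) \<le> (\<kappa> i t)\<^sup>2"
    and mean_cons: "i \<in> S \<Longrightarrow> t \<in> Iv i \<Longrightarrow> mn (Y (pc 1) 0 i t) = 0"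
      "i \<in> S \<Longrightarrow> t \<in> Iv i \<Longrightarrow> mn (Y (V j) 0 i t) = 0"
      "i \<in> S \<Longrightarrow> t \<in> Iv i \<Longrightarrow> mn (Y N2 0 i t) = 0"
    and mean_third: "i \<in> S \<Longrightarrow> 0 < Tm i \<Longrightarrow> mn (Y (pmul (V j) N2) 0 i 0) = 0"
begin

lemma kap_nonneg: "i \<in> S \<Longrightarrow> t \<in> Iv i \<Longrightarrow> 0 \<le> \<kappa> i t"
  using kap_en en_nonneg order_trans by blast

definition ok :: "('i \<Rightarrow> real \<Rightarrow> real^3 \<Rightarrow> real) \<Rightarrow> bool" where
  "ok u \<longleftrightarrow> rg u \<and> l2b \<kappa> u"

lemma ok_add: "ok u \<Longrightarrow> ok w' \<Longrightarrow> ok (\<lambda>i t x. u i t x + w' i t x)"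
  by (simp add: ok_def rg_add l2b_add)
lemma ok_cmult: "ok u \<Longrightarrow> ok (\<lambda>i t x. c * u i t x)"
  by (simp add: ok_def rg_cmult l2b_cmult)
lemma ok_diff: "ok u \<Longrightarrow> ok w' \<Longrightarrow> ok (\<lambda>i t x. u i t x - w' i t x)"
  using ok_add[OF _ ok_cmult[of w' "-1"], of u] by simp
lemma ok_cong: "ok u \<Longrightarrow> (\<And>i t x. u i t x = w' i t x) \<Longrightarrow> ok w'"
proof -
  assume u: "ok u" and "\<And>i t x. u i t x = w' i t x"
  then have "u = w'" by blast
  with u show ?thesis by simp
qed
lemma ok_null: "rg u \<Longrightarrow> (\<And>i t. i \<in> S \<Longrightarrow> t \<in> Iv i \<Longrightarrow> n2 (u i t) = 0) \<Longrightarrow> ok u"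
  unfolding ok_def l2b_def by auto

lemma ok_en: "rg u \<Longrightarrow> l2b (\<lambda>i t. en i t) u \<Longrightarrow> ok u"
  unfolding ok_def using l2b_weaken[of "\<lambda>i t. en i t" u 1 \<kappa>] kap_en en_nonneg by auto

lemma ok_const_in_space:
  assumes "C \<ge> 0" "\<And>i t. i \<in> S \<Longrightarrow> t \<in> Iv i \<Longrightarrow> \<bar>m i t\<bar> \<le> C * \<kappa> i t"
  shows "ok (\<lambda>i t x. m i t)"
  unfolding ok_def
proof (rule conjI)
  show "rg (\<lambda>i t x. m i t)" by (simp add: rg_def reg_def per_def)
  show "l2b \<kappa> (\<lambda>i t x. m i t)" using assms by (intro bnd_l2b) (auto simp: bnd_def)
qed

lemma ok_n2: "ok u \<Longrightarrow> \<exists>C\<ge>0. \<forall>i\<in>S. \<forall>t\<in>Iv i. n2 (u i t) \<le> ennreal ((C * \<kappa> i t)\<^sup>2)"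
  by (simp add: ok_def l2b_def)

lemma ok_dominated:
  assumes "rg u" "ok a" "ok b" "\<And>i t. i \<in> S \<Longrightarrow> t \<in> Iv i \<Longrightarrow> n2 (u i t) \<le> n2 (a i t) + n2 (b i t)"
  shows "ok u"
proof -
  obtain C D where C: "C \<ge> 0" "\<And>i t. i \<in> S \<Longrightarrow> t \<in> Iv i \<Longrightarrow> n2 (a i t) \<le> ennreal ((C * \<kappa> i t)\<^sup>2)"
    and D: "D \<ge> 0" "\<And>i t. i \<in> S \<Longrightarrow> t \<in> Iv i \<Longrightarrow> n2 (b i t) \<le> ennreal ((D * \<kappa> i t)\<^sup>2)"
    using ok_n2[OF assms(2)] ok_n2[OF assms(3)] by blast
  have "l2b \<kappa> u" unfolding l2b_def
  proof (intro exI[of _ "C + D"] conjI ballI)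
    fix i t assume i: "i \<in> S" "t \<in> Iv i"
    have "n2 (u i t) \<le> ennreal ((C * \<kappa> i t)\<^sup>2) + ennreal ((D * \<kappa> i t)\<^sup>2)"
      by (rule order_trans[OF assms(4)[OF i] add_mono[OF C(2)[OF i] D(2)[OF i]]])
    also have "\<dots> = ennreal ((C * \<kappa> i t)\<^sup>2 + (D * \<kappa> i t)\<^sup>2)" by simp
    also have "\<dots> \<le> ennreal (((C + D) * \<kappa> i t)\<^sup>2)"
      using C(1) D(1) kap_nonneg[OF i] by (intro ennreal_leI) (simp add: distrib_right power2_sum)
    finally show "n2 (u i t) \<le> ennreal (((C + D) * \<kappa> i t)\<^sup>2)" .
  qed (use C D in simp)
  then show ?thesis using assms(1) by (simp add: ok_def)
qed

lemma rg_res: "mi_length \<alpha> \<le> N \<Longrightarrow> rg (res L \<alpha>)"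
proof -
  assume a: "mi_length \<alpha> \<le> N"
  have "rg (\<lambda>i t x. Y L \<alpha> i t x + (-1) * (\<Sum>k<8. ((chn k)\<^sup>2 * pE (pmul L (chi k))) * Y (chi k) \<alpha> i t x))"
    by (intro rg_add rg_cmult rg_sum rg_Y a)
  then show ?thesis by (simp add: res_def[abs_def])
qed

text \<open>By Bessel's inequality every multi-index contributes a nonnegative amount to the
  dissipation, so a single contribution is at most the whole sum and hence at most
  \<kappa>^2.\<close>

lemma ok_res: assumes a: "mi_length \<alpha> \<le> N" shows "ok (res L \<alpha>)"
  unfolding ok_def l2b_def
proof (intro conjI exI[of _ "sqrt (cw L)"] ballI rg_res[OF a])
  fix i t assume i: "i \<in> S" "t \<in> Iv i"
  define A where "A \<beta> = enn2real (L2_norm_sq (g i \<beta> t))" for \<beta>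
  define M where "M \<beta> = (\<Sum>k<8. enn2real (n2 (\<lambda>x. chn k * Y (chi k) \<beta> i t x)))" for \<beta>
  have L: "n2 (res L \<beta> i t) \<le> ennreal (cw L * (A \<beta> - M \<beta>))" "M \<beta> \<le> A \<beta>" if b: "mi_length \<beta> \<le> N" for \<beta> L
  proof -
    have f: "n2 (\<lambda>x. chn k * Y (chi k) \<beta> i t x) < top" for k
      using sq_cmult[OF sq_Y[OF i b]] by (simp add: sq_def)
    have M: "(\<Sum>k<8. n2 (\<lambda>x. chn k * Y (chi k) \<beta> i t x)) = ennreal (M \<beta>)"
      unfolding M_def using f by (simp add: sum_ennreal[symmetric] del: sum_ennreal)
    have M0: "M \<beta> \<ge> 0" by (simp add: M_def sum_nonneg)
    have A: "L2_norm_sq (g i \<beta> t) = ennreal (A \<beta>)" unfolding A_def using L2_fin[OF i(1) b i(2)] by simp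
    have A0: "A \<beta> \<ge> 0" by (simp add: A_def)
    have c: "cw L > 0" using cw_ge1[of L] by simp
    have le: "n2 (res L \<beta> i t) + ennreal (cw L * M \<beta>) \<le> ennreal (cw L * A \<beta>)"
      using n2_res[OF i b, of L] unfolding M A using c M0 A0 by (simp add: ennreal_mult)
    have "ennreal (cw L * M \<beta>) \<le> ennreal (cw L * A \<beta>)"
      by (rule order_trans[OF _ le]) simp
    then have "cw L * M \<beta> \<le> cw L * A \<beta>" using c A0 by (subst (asm) ennreal_le_iff) auto
    then show "M \<beta> \<le> A \<beta>" using c by simp
    have "n2 (res L \<beta> i t) = n2 (res L \<beta> i t) + ennreal (cw L * M \<beta>) - ennreal (cw L * M \<beta>)" by simp
    also have "\<dots> \<le> ennreal (cw L * A \<beta>) - ennreal (cw L * M \<beta>)" by (rule ennreal_minus_mono[OF le order_refl])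
    also have "\<dots> = ennreal (cw L * A \<beta> - cw L * M \<beta>)" using c M0 by (intro ennreal_minus) auto
    finally show "n2 (res L \<beta> i t) \<le> ennreal (cw L * (A \<beta> - M \<beta>))" by (simp add: right_diff_distrib)
  qed
  have "A \<alpha> - M \<alpha> \<le> (\<Sum>\<beta> | mi_length \<beta> \<le> N. A \<beta> - M \<beta>)"
    by (rule member_le_sum) (use a L(2) finite_mi_length in auto)
  also have "\<dots> \<le> (\<kappa> i t)\<^sup>2" using kap_diss[OF i] by (simp add: sum_subtractf A_def M_def en_def)
  finally have "cw L * (A \<alpha> - M \<alpha>) \<le> cw L * (\<kappa> i t)\<^sup>2" using cw_ge1[of L] by (intro mult_left_mono) auto
  also have "\<dots> = (sqrt (cw L) * \<kappa> i t)\<^sup>2" using cw_ge1[of L] by (simp add: power_mult_distrib)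
  finally show "n2 (res L \<alpha> i t) \<le> ennreal ((sqrt (cw L) * \<kappa> i t)\<^sup>2)"
    using L(1)[OF a, of L] order_trans ennreal_leI by blast
qed (use cw_ge1[of L] in simp)

text \<open>L agrees with a L1 + b L2 up to a microscopic moment, which is tested on the eight
  directions.\<close>

definition lcomb :: "poly3 \<Rightarrow> real \<Rightarrow> poly3 \<Rightarrow> real \<Rightarrow> poly3 \<Rightarrow> bool" where
  "lcomb L a L1 b L2 \<longleftrightarrow> (\<forall>k<8. pE (pmul L (chi k)) = a * pE (pmul L1 (chi k)) + b * pE (pmul L2 (chi k)))"

lemma lcombI:
  assumes "\<forall>M\<in>{pc 1, V 1, V 2, V 3, CC, DD 1, DD 2, DD 3}. pE (pmul L M) = a * pE (pmul L1 M) + b * pE (pmul L2 M)"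
  shows "lcomb L a L1 b L2"
  unfolding lcomb_def
proof (intro allI impI)
  fix k :: nat assume "k < 8"
  then have "chi k \<in> {pc 1, V 1, V 2, V 3, CC, DD 1, DD 2, DD 3}"
    unfolding less_8 by (elim insertE emptyE; hypsubst; simp only: chi_simps; simp)
  then show "pE (pmul L (chi k)) = a * pE (pmul L1 (chi k)) + b * pE (pmul L2 (chi k))" using assms by blast
qed

lemma ok_lcomb:
  assumes "lcomb L a L1 b L2" "mi_length \<alpha> \<le> N"
  shows "ok (\<lambda>i t x. Y L \<alpha> i t x - (a * Y L1 \<alpha> i t x + b * Y L2 \<alpha> i t x))"
proof -
  have "ok (\<lambda>i t x. res L \<alpha> i t x - (a * res L1 \<alpha> i t x + b * res L2 \<alpha> i t x))"
    using assms by (intro ok_diff ok_add ok_cmult ok_res)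
  moreover have "res L \<alpha> i t x - (a * res L1 \<alpha> i t x + b * res L2 \<alpha> i t x) = Y L \<alpha> i t x - (a * Y L1 \<alpha> i t x + b * Y L2 \<alpha> i t x)" for i t x
  proof -
    have "(\<Sum>k<8. (chn k)\<^sup>2 * pE (pmul L (chi k)) * Y (chi k) \<alpha> i t x)
      = a * (\<Sum>k<8. (chn k)\<^sup>2 * pE (pmul L1 (chi k)) * Y (chi k) \<alpha> i t x) + b * (\<Sum>k<8. (chn k)\<^sup>2 * pE (pmul L2 (chi k)) * Y (chi k) \<alpha> i t x)"
      unfolding sum_distrib_left sum.distrib[symmetric]
      by (rule sum.cong[OF refl]) (use assms(1) in \<open>simp add: lcomb_def algebra_simps\<close>)
    then show ?thesis by (simp add: res_def algebra_simps)
  qed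
  ultimately show ?thesis by (rule ok_cong)
qed

text \<open>The moment equation for T modulo admissible terms, each flux being replaced by its
  hydrodynamic part; it is used with e = 1 when T is one of the eight directions and with e = 0 when
  T is microscopic.\<close>

lemma ok_flux:
  assumes W: "ok (W T \<gamma>)" and g: "mi_length \<gamma> < N"
    and T: "lcomb T e T 0 T" and fl: "\<And>j. lcomb (pmul (V j) T) (a j) (L1 j) (b j) (L2 j)"
  shows "ok (\<lambda>i t x. e * Y T (inc None \<gamma>) i t x + ((a 1 * Y (L1 1) (inc (Some 1) \<gamma>) i t x + b 1 * Y (L2 1) (inc (Some 1) \<gamma>) i t x)
    + (a 2 * Y (L1 2) (inc (Some 2) \<gamma>) i t x + b 2 * Y (L2 2) (inc (Some 2) \<gamma>) i t x)
    + (a 3 * Y (L1 3) (inc (Some 3) \<gamma>) i t x + b 3 * Y (L2 3) (inc (Some 3) \<gamma>) i t x)))"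
proof -
  have l: "mi_length (inc d \<gamma>) \<le> N" for d using g by simp
  show ?thesis
    by (rule ok_cong[OF ok_diff[OF W ok_add[OF ok_lcomb[OF T l] ok_add[OF ok_add[OF ok_lcomb[OF fl[of 1] l] ok_lcomb[OF fl[of 2] l]] ok_lcomb[OF fl[of 3] l]]], of None "Some 1" "Some 2" "Some 3"]])
      (simp add: W_def sum_3)
qed

lemmas lcomb_simps = CC_def DD_def off_def dif_def th_def pE_simps gmom_numeral

lemma lcomb_self: "lcomb T 1 T 0 T" by (simp add: lcomb_def)

lemma all_3: "P (1::3) \<Longrightarrow> P 2 \<Longrightarrow> P 3 \<Longrightarrow> P j"
  using exhaust_3[of j] by auto

text \<open>The hydrodynamic part of v_i^2 v_j for i different from j: the fluxes of the traceless
  second moments mix velocity and heat flux in this proportion.\<close>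

definition BB :: "3 \<Rightarrow> poly3" where "BB j = V j @ pscale (1/5) (DD j)"

lemma lcomb_BB: "lcomb (V j) 1 (BB j) (-1/5) (DD j)"
  by (rule all_3[of "\<lambda>j. lcomb (V j) 1 (BB j) (-1/5) (DD j)"]; rule lcombI; simp add: BB_def lcomb_simps)

lemma flux_pc: "lcomb (pmul (V j) (pc 1)) 1 (V j) 0 (V j)"
  by (rule all_3[of "\<lambda>j. lcomb (pmul (V j) (pc 1)) 1 (V j) 0 (V j)"]; rule lcombI; simp add: lcomb_simps)
lemma flux_V: "lcomb (pmul (V j) (V k)) (if j = k then 1 else 0) (pc 1) (if j = k then 1/3 else 0) CC"
  by (rule all_3[of "\<lambda>j. lcomb (pmul (V j) (V k)) (if j = k then 1 else 0) (pc 1) (if j = k then 1/3 else 0) CC"];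
      rule all_3[of "\<lambda>k. lcomb (pmul (V _) (V k)) (if _ = k then 1 else 0) (pc 1) (if _ = k then 1/3 else 0) CC"];
      rule lcombI; simp add: lcomb_simps)
lemma flux_CC: "lcomb (pmul (V j) CC) 2 (V j) 1 (DD j)"
  by (rule all_3[of "\<lambda>j. lcomb (pmul (V j) CC) 2 (V j) 1 (DD j)"]; rule lcombI; simp add: lcomb_simps)
lemma flux_DD: "lcomb (pmul (V j) (DD k)) (if j = k then 5/3 else 0) CC 0 CC"
  by (rule all_3[of "\<lambda>j. lcomb (pmul (V j) (DD k)) (if j = k then 5/3 else 0) CC 0 CC"];
      rule all_3[of "\<lambda>k. lcomb (pmul (V _) (DD k)) (if _ = k then 5/3 else 0) CC 0 CC"];
      rule lcombI; simp add: lcomb_simps)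

lemma lcomb_dev:
  assumes "p \<in> {(1,2),(1,3),(2,3)}" "T \<in> {off (fst p) (snd p), dif (fst p) (snd p), th (off (fst p) (snd p)), th (dif (fst p) (snd p))}"
  shows "lcomb T 0 T 0 T"
  using assms by (elim insertE emptyE; hypsubst; intro lcombI; simp add: lcomb_simps)

text \<open>In each case only two directions contribute, giving the symmetrized gradient entry and
  the difference of diagonal entries that \<open>Korn_Y\<close> asks for: for \<open>BB\<close> in
  the first two identities and for \<open>DD\<close> alone in the last two.\<close>

lemma flux_off:
  assumes "p \<in> {(1,2),(1,3),(2,3)}"
  shows "lcomb (pmul (V j) (off (fst p) (snd p))) (if j = fst p then 1 else 0) (BB (snd p)) (if j = snd p then 1 else 0) (BB (fst p))"
    "lcomb (pmul (V j) (dif (fst p) (snd p))) (if j = fst p then 2 else 0) (BB (fst p)) (if j = snd p then -2 else 0) (BB (snd p))"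
    "lcomb (pmul (V j) (th (off (fst p) (snd p)))) (if j = fst p then 7/5 else 0) (DD (snd p)) (if j = snd p then 7/5 else 0) (DD (fst p))"
    "lcomb (pmul (V j) (th (dif (fst p) (snd p)))) (if j = fst p then 14/5 else 0) (DD (fst p)) (if j = snd p then -14/5 else 0) (DD (snd p))"
  using assms exhaust_3[of j]
  by (elim insertE emptyE disjE; hypsubst; intro lcombI; simp add: BB_def lcomb_simps)+

end

section \<open>Gradients, time derivatives and means of the hydrodynamic moments\<close>

context macro_estimate
begin

lemma ok_W_cons: assumes g: "mi_length \<gamma> < N" shows "ok (W (pc 1) \<gamma>)" "ok (W (V j) \<gamma>)" "ok (W CC \<gamma>)"
proof -
  have n: "ok (W L \<gamma>)" if "\<And>i t. i \<in> S \<Longrightarrow> t \<in> Iv i \<Longrightarrow> n2 (W L \<gamma> i t) = 0" for L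
    by (rule ok_null[OF rg_W[OF g] that])
  show "ok (W (pc 1) \<gamma>)" "ok (W (V j) \<gamma>)" by (rule n; use l2b_W_cons g in simp)+
  have "ok (W CP \<gamma>)" by (rule n; use l2b_W_cons g in simp)
  from ok_cmult[OF this, of "sqrt 6"] show "ok (W CC \<gamma>)" by (simp add: CP_CC W_pscale)
qed

lemma ok_W_DD: assumes g: "mi_length \<gamma> < N" shows "ok (W (DD j) \<gamma>)"
proof -
  have "ok (W (DP j) \<gamma>)" by (rule ok_en[OF rg_W[OF g] l2b_W_DP[OF g]])
  from ok_cmult[OF this, of "sqrt 10"] show ?thesis by (simp add: DP_DD W_pscale)
qed

text \<open>The relaxation term is a multiple of a microscopic moment and hence admissible, so the
  transport side is admissible by itself.\<close>

lemma ok_W_dev: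
  assumes g: "mi_length \<gamma> < N" and p: "p \<in> {(1,2),(1,3),(2,3)}" and T: "T \<in> {off (fst p) (snd p), dif (fst p) (snd p), th (off (fst p) (snd p)), th (dif (fst p) (snd p))}"
  shows "ok (W T \<gamma>)"
proof -
  have l: "mi_length \<gamma> \<le> N" using g by simp
  have 1: "ok (\<lambda>i t x. W T \<gamma> i t x + 1/\<tau>\<^sub>0 * Y T \<gamma> i t x)"
    by (rule ok_en[OF rg_add[OF rg_W[OF g] rg_cmult[OF rg_Y[OF l]]] l2b_W_dev[OF g p T]])
  show ?thesis
    by (rule ok_cong[OF ok_diff[OF 1 ok_cmult[OF ok_lcomb[OF lcomb_dev[OF p T] l], of "1/\<tau>\<^sub>0"]]]) simp
qed

lemma symmetric_gradients:
  assumes g: "mi_length \<gamma> < N" and p: "p \<in> {(1,2),(1,3),(2,3)}"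
  shows "ok (\<lambda>i t x. Y (BB (snd p)) (inc (Some (fst p)) \<gamma>) i t x + Y (BB (fst p)) (inc (Some (snd p)) \<gamma>) i t x)"
    "ok (\<lambda>i t x. Y (BB (fst p)) (inc (Some (fst p)) \<gamma>) i t x - Y (BB (snd p)) (inc (Some (snd p)) \<gamma>) i t x)"
    "ok (\<lambda>i t x. Y (DD (snd p)) (inc (Some (fst p)) \<gamma>) i t x + Y (DD (fst p)) (inc (Some (snd p)) \<gamma>) i t x)"
    "ok (\<lambda>i t x. Y (DD (fst p)) (inc (Some (fst p)) \<gamma>) i t x - Y (DD (snd p)) (inc (Some (snd p)) \<gamma>) i t x)"
proof -
  have m: "off (fst p) (snd p) \<in> {off (fst p) (snd p), dif (fst p) (snd p), th (off (fst p) (snd p)), th (dif (fst p) (snd p))}"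
    "dif (fst p) (snd p) \<in> {off (fst p) (snd p), dif (fst p) (snd p), th (off (fst p) (snd p)), th (dif (fst p) (snd p))}"
    "th (off (fst p) (snd p)) \<in> {off (fst p) (snd p), dif (fst p) (snd p), th (off (fst p) (snd p)), th (dif (fst p) (snd p))}"
    "th (dif (fst p) (snd p)) \<in> {off (fst p) (snd p), dif (fst p) (snd p), th (off (fst p) (snd p)), th (dif (fst p) (snd p))}" by auto
  note fl = ok_flux[OF ok_W_dev[OF g p] g lcomb_dev[OF p]]
  show "ok (\<lambda>i t x. Y (BB (snd p)) (inc (Some (fst p)) \<gamma>) i t x + Y (BB (fst p)) (inc (Some (snd p)) \<gamma>) i t x)"
    by (rule ok_cong[OF fl[OF m(1) m(1) flux_off(1)[OF p]]]) (use p in auto)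
  show "ok (\<lambda>i t x. Y (BB (fst p)) (inc (Some (fst p)) \<gamma>) i t x - Y (BB (snd p)) (inc (Some (snd p)) \<gamma>) i t x)"
    by (rule ok_cong[OF ok_cmult[OF fl[OF m(2) m(2) flux_off(2)[OF p]], of "1/2"]]) (use p in auto)
  show "ok (\<lambda>i t x. Y (DD (snd p)) (inc (Some (fst p)) \<gamma>) i t x + Y (DD (fst p)) (inc (Some (snd p)) \<gamma>) i t x)"
    by (rule ok_cong[OF ok_cmult[OF fl[OF m(3) m(3) flux_off(3)[OF p]], of "5/7"]]) (use p in auto)
  show "ok (\<lambda>i t x. Y (DD (fst p)) (inc (Some (fst p)) \<gamma>) i t x - Y (DD (snd p)) (inc (Some (snd p)) \<gamma>) i t x)"
    by (rule ok_cong[OF ok_cmult[OF fl[OF m(4) m(4) flux_off(4)[OF p]], of "5/14"]]) (use p in auto)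
qed

lemma ok_Korn:
  assumes g: "mi_length \<gamma> < N"
    and s: "ok (\<lambda>i t z. Y L' (inc (Some x) \<gamma>) i t z + Y L (inc (Some y) \<gamma>) i t z)"
    and d: "ok (\<lambda>i t z. Y L (inc (Some x) \<gamma>) i t z - Y L' (inc (Some y) \<gamma>) i t z)"
  shows "ok (Y L (inc (Some x) \<gamma>))" "ok (Y L (inc (Some y) \<gamma>))" "ok (Y L' (inc (Some x) \<gamma>))" "ok (Y L' (inc (Some y) \<gamma>))"
proof -
  have r: "rg (Y L (inc e \<gamma>))" for L e by (rule rg_Y) (use g in simp)
  have le: "a \<le> a + b + c + e" "b \<le> a + b + c + e" "c \<le> a + b + c + e" "e \<le> a + b + c + e" for a b c e :: ennreal
    by (simp_all add: add_increasing add_increasing2)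
  show "ok (Y L (inc (Some x) \<gamma>))" "ok (Y L (inc (Some y) \<gamma>))" "ok (Y L' (inc (Some x) \<gamma>))" "ok (Y L' (inc (Some y) \<gamma>))"
    by (rule ok_dominated[OF r s d]; unfold Korn_Y[OF _ _ g, symmetric]; rule le)+
qed

text \<open>Any two indices lie in a common coordinate plane, so the three planes yield all nine
  gradient entries.\<close>

lemma pair_cover: "\<exists>p\<in>{(1,2),(1,3),(2,3)}. j \<in> {fst p, snd p} \<and> k \<in> {fst p, snd (p :: 3 \<times> 3)}"
  using exhaust_3[of j] exhaust_3[of k] by auto

lemma gradient_BB: assumes g: "mi_length \<gamma> < N" shows "ok (Y (BB j) (inc (Some k) \<gamma>))"
proof -
  obtain p where p: "p \<in> {(1,2),(1,3),(2,3)}" and jk: "j \<in> {fst p, snd p}" "k \<in> {fst p, snd p}" using pair_cover by blast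
  show ?thesis using ok_Korn[OF g symmetric_gradients(1,2)[OF g p]] jk by blast
qed

lemma gradient_DD: assumes g: "mi_length \<gamma> < N" shows "ok (Y (DD j) (inc (Some k) \<gamma>))"
proof -
  obtain p where p: "p \<in> {(1,2),(1,3),(2,3)}" and jk: "j \<in> {fst p, snd p}" "k \<in> {fst p, snd p}" using pair_cover by blast
  show ?thesis using ok_Korn[OF g symmetric_gradients(3,4)[OF g p]] jk by blast
qed

lemma gradient_V: assumes g: "mi_length \<gamma> < N" shows "ok (Y (V j) (inc (Some k) \<gamma>))"
proof -
  have l: "mi_length (inc (Some k) \<gamma>) \<le> N" using g by simp
  show ?thesis
    by (rule ok_cong[OF ok_add[OF ok_lcomb[OF lcomb_BB[of j] l] ok_add[OF ok_cmult[OF gradient_BB[OF g, of j k], of 1] ok_cmult[OF gradient_DD[OF g, of j k], of "-1/5"]]]]) simp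
qed

lemma time_pc: assumes g: "mi_length \<gamma> < N" shows "ok (Y (pc 1) (inc None \<gamma>))"
  by (rule ok_cong[OF ok_diff[OF ok_flux[OF ok_W_cons(1)[OF g] g lcomb_self flux_pc] ok_add[OF ok_add[OF gradient_V[OF g, of 1 1] gradient_V[OF g, of 2 2]] gradient_V[OF g, of 3 3]]]]) simp

lemma time_CC: assumes g: "mi_length \<gamma> < N" shows "ok (Y CC (inc None \<gamma>))"
  by (rule ok_cong[OF ok_diff[OF ok_flux[OF ok_W_cons(3)[OF g] g lcomb_self flux_CC]
     ok_add[OF ok_cmult[OF ok_add[OF ok_add[OF gradient_V[OF g, of 1 1] gradient_V[OF g, of 2 2]] gradient_V[OF g, of 3 3]], of 2]
       ok_add[OF ok_add[OF gradient_DD[OF g, of 1 1] gradient_DD[OF g, of 2 2]] gradient_DD[OF g, of 3 3]]]]]) (simp add: algebra_simps)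

text \<open>Ties the time derivative of the heat flux to the temperature gradient, so that a bound
  on one gives a bound on the other; \<open>balance_V\<close> does the same for the velocity and the
  pressure gradient.\<close>

lemma balance_DD: assumes g: "mi_length \<gamma> < N" shows "ok (\<lambda>i t x. Y (DD k) (inc None \<gamma>) i t x + 5/3 * Y CC (inc (Some k) \<gamma>) i t x)"
  by (rule ok_cong[OF ok_flux[OF ok_W_DD[OF g, where j=k] g lcomb_self flux_DD[where k=k]]]) (use exhaust_3[of k] in auto)

lemma balance_V: assumes g: "mi_length \<gamma> < N" shows "ok (\<lambda>i t x. Y (V k) (inc None \<gamma>) i t x + (Y (pc 1) (inc (Some k) \<gamma>) i t x + 1/3 * Y CC (inc (Some k) \<gamma>) i t x))"
  by (rule ok_cong[OF ok_flux[OF ok_W_cons(2)[OF g, where j=k] g lcomb_self flux_V[where k=k]]]) (use exhaust_3[of k] in auto)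

lemma l2b_mn:
  assumes "rg u" "l2b \<nu> u" "\<And>i t. i \<in> S \<Longrightarrow> t \<in> Iv i \<Longrightarrow> 0 \<le> \<nu> i t"
  shows "\<exists>C\<ge>0. \<forall>i\<in>S. \<forall>t\<in>Iv i. \<bar>mn (u i t)\<bar> \<le> C * \<nu> i t"
proof -
  obtain C where C: "C \<ge> 0" "\<And>i t. i \<in> S \<Longrightarrow> t \<in> Iv i \<Longrightarrow> n2 (u i t) \<le> ennreal ((C * \<nu> i t)\<^sup>2)"
    using assms(2) unfolding l2b_def by blast
  show ?thesis
  proof (intro exI[of _ C] conjI ballI C(1))
    fix i t assume i: "i \<in> S" "t \<in> Iv i"
    have "sq (u i t)" using rg_meas[OF assms(1) i] l2b_fin[OF assms(2) i] by (simp add: sq_def)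
    then have "\<bar>mn (u i t)\<bar> \<le> nr (u i t)" by (rule mn_le_nr)
    also have "\<dots> \<le> sqrt ((C * \<nu> i t)\<^sup>2)"
      unfolding nr_def by (intro real_sqrt_le_mono enn2real_leI C(2)[OF i]) simp
    also have "\<dots> = C * \<nu> i t" using C(1) assms(3)[OF i] by simp
    finally show "\<bar>mn (u i t)\<bar> \<le> C * \<nu> i t" .
  qed
qed

lemma ok_Poincare:
  assumes g: "mi_length \<gamma> < N" and gr: "\<And>j. ok (Y L (inc (Some j) \<gamma>))"
  shows "ok (\<lambda>i t x. Y L \<gamma> i t x - mn (Y L \<gamma> i t))"
  unfolding ok_def
proof
  have l: "mi_length \<gamma> \<le> N" "\<And>e. mi_length (inc e \<gamma>) \<le> N" using g by auto
  have "rg (\<lambda>i t x. - mn (Y L \<gamma> i t))" by (simp add: rg_def reg_def per_def)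
  from rg_add[OF rg_Y[OF l(1), of L] this] show "rg (\<lambda>i t x. Y L \<gamma> i t x - mn (Y L \<gamma> i t))" by simp
  obtain C where C: "\<And>j. C j \<ge> 0" "\<And>j i t. i \<in> S \<Longrightarrow> t \<in> Iv i \<Longrightarrow> n2 (Y L (inc (Some j) \<gamma>) i t) \<le> ennreal ((C j * \<kappa> i t)\<^sup>2)"
    using ok_n2[OF gr] by metis
  show "l2b \<kappa> (\<lambda>i t x. Y L \<gamma> i t x - mn (Y L \<gamma> i t))"
    unfolding l2b_def
  \<comment> \<open>The 3 comes from 8 \<le> 3^2, with 8 the constant of
    \<open>Poincare\<close>.\<close>
  proof (intro exI[of _ "3 * (C 1 + C 2 + C 3)"] conjI ballI)
    fix i t assume i: "i \<in> S" "t \<in> Iv i"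
    define k where "k = \<kappa> i t"
    have "n2 (\<lambda>x. Y L \<gamma> i t x - mn (Y L \<gamma> i t)) \<le> 8 * (n2 (Y L (inc (Some 1) \<gamma>) i t) + n2 (Y L (inc (Some 2) \<gamma>) i t) + n2 (Y L (inc (Some 3) \<gamma>) i t))"
      by (rule Poincare[where u'="\<lambda>j. Y L (inc (Some j) \<gamma>) i t" and c="Tm i - t", OF sq_Y[OF i l(1)] per_Y[OF i l(1)] dq_Y[OF i g]])
        (use sq_Y[OF i l(2)] i in \<open>auto simp: sq_def\<close>)
    also have "\<dots> \<le> 8 * (ennreal ((C 1 * k)\<^sup>2) + ennreal ((C 2 * k)\<^sup>2) + ennreal ((C 3 * k)\<^sup>2))"
      unfolding k_def by (intro mult_left_mono add_mono C(2)[OF i]) simp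
    also have "\<dots> = ennreal (8 * ((C 1 * k)\<^sup>2 + (C 2 * k)\<^sup>2 + (C 3 * k)\<^sup>2))"
      by (simp add: ennreal_mult)
    also have "\<dots> \<le> ennreal ((3 * (C 1 + C 2 + C 3) * k)\<^sup>2)"
    proof (rule ennreal_leI)
      have "(C 1)\<^sup>2 + (C 2)\<^sup>2 + (C 3)\<^sup>2 \<le> (C 1 + C 2 + C 3)\<^sup>2"
        using C(1)[of 1] C(1)[of 2] C(1)[of 3] by (simp add: power2_sum distrib_right)
      then have "((C 1)\<^sup>2 + (C 2)\<^sup>2 + (C 3)\<^sup>2) * k\<^sup>2 \<le> (C 1 + C 2 + C 3)\<^sup>2 * k\<^sup>2" by (rule mult_right_mono) simp
      moreover have "8 * ((C 1 * k)\<^sup>2 + (C 2 * k)\<^sup>2 + (C 3 * k)\<^sup>2) = 8 * (((C 1)\<^sup>2 + (C 2)\<^sup>2 + (C 3)\<^sup>2) * k\<^sup>2)"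
        by (simp add: power_mult_distrib distrib_right)
      moreover have "(3 * c * k)\<^sup>2 = 9 * (c\<^sup>2 * k\<^sup>2)" if "c = C 1 + C 2 + C 3" for c by (simp add: power_mult_distrib)
      note this[OF refl]
      moreover have "0 \<le> (C 1 + C 2 + C 3)\<^sup>2 * k\<^sup>2" by simp
      ultimately show "8 * ((C 1 * k)\<^sup>2 + (C 2 * k)\<^sup>2 + (C 3 * k)\<^sup>2) \<le> (3 * (C 1 + C 2 + C 3) * k)\<^sup>2" by linarith
    qed
    finally show "n2 (\<lambda>x. Y L \<gamma> i t x - mn (Y L \<gamma> i t)) \<le> ennreal ((3 * (C 1 + C 2 + C 3) * \<kappa> i t)\<^sup>2)" unfolding k_def .
  qed (use C(1) in simp)
qed

lemma ok_mean:
  assumes g: "mi_length \<gamma> < N" and gr: "\<And>j. ok (Y L (inc (Some j) \<gamma>))"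
    and m: "\<exists>C\<ge>0. \<forall>i\<in>S. \<forall>t\<in>Iv i. \<bar>mn (Y L \<gamma> i t)\<bar> \<le> C * \<kappa> i t"
  shows "ok (Y L \<gamma>)"
proof -
  obtain C where C: "C \<ge> 0" "\<And>i t. i \<in> S \<Longrightarrow> t \<in> Iv i \<Longrightarrow> \<bar>mn (Y L \<gamma> i t)\<bar> \<le> C * \<kappa> i t" using m by blast
  have a: "ok (\<lambda>i t x. Y L \<gamma> i t x - mn (Y L \<gamma> i t))" by (rule ok_Poincare[OF g gr])
  have b: "ok (\<lambda>i t x. mn (Y L \<gamma> i t))" by (rule ok_const_in_space[OF C])
  show ?thesis using ok_add[OF a b] by simp
qed

lemma mn_W: assumes i: "i \<in> S" "t \<in> Iv i" and g: "mi_length \<gamma> < N"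
  shows "mn (W L \<gamma> i t) = mn (Y L (inc None \<gamma>) i t)"
proof -
  have I: "integrable MQ (Y L (inc e \<gamma>) i t)" for e L by (rule sq_integrable1[OF sq_Y[OF i]]) (use g in simp)
  have "mn (W L \<gamma> i t) = mn (Y L (inc None \<gamma>) i t) + (\<Sum>j\<in>UNIV. mn (Y (pmul (V j) L) (inc (Some j) \<gamma>) i t))"
    unfolding mn_def W_def using I by (subst Bochner_Integration.integral_add) auto
  then show ?thesis by (simp add: mean_derivative[OF i g])
qed

text \<open>If \<gamma> has a space derivative, it is moved outermost and the gradient bound
  applies. For \<gamma> = 0, Poincare's inequality reduces the claim to the mean, which equals the
  mean of the transport side because fluxes integrate to zero. Pure time derivatives of higher order
  are out of reach at this stage.\<close>

lemma ok_time:
  assumes gr: "\<And>\<gamma> j. mi_length \<gamma> < N \<Longrightarrow> ok (Y L (inc (Some j) \<gamma>))" and W: "ok (W L 0)"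
    and g: "mi_length \<gamma> < N" "\<gamma> = 0 \<or> \<gamma> = inc (Some k) \<gamma>'"
  shows "ok (Y L (inc None \<gamma>))"
  using g(2)
proof
  assume 0: "\<gamma> = 0"
  have N: "mi_length (0::nat^4) < N" "mi_length (inc None 0) < N" using N3 by auto
  obtain C where C: "C \<ge> 0" "\<And>i t. i \<in> S \<Longrightarrow> t \<in> Iv i \<Longrightarrow> \<bar>mn (W L 0 i t)\<bar> \<le> C * \<kappa> i t"
    using l2b_mn[of "W L 0" \<kappa>] W kap_nonneg unfolding ok_def by blast
  show ?thesis unfolding 0
    by (rule ok_mean[OF N(2) gr[OF N(2)]]) (use C mn_W[OF _ _ N(1)] in auto)
next
  assume k: "\<gamma> = inc (Some k) \<gamma>'"
  have "ok (Y L (inc (Some k) (inc None \<gamma>')))" by (rule gr) (use g(1) k in simp)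
  then show ?thesis unfolding k inc_commute[of None] .
qed

lemma inc_cases: obtains "\<gamma> = 0" | k \<gamma>' where "\<gamma> = inc (Some k) \<gamma>'" | \<gamma>' where "\<gamma> = inc None \<gamma>'"
  by (metis multi_index_cases option.exhaust)

text \<open>If a time derivative can be split off \<gamma>, it is moved onto the temperature moment,
  whose time derivative is controlled by \<open>time_CC\<close>. If \<gamma> is 0 or a space
  derivative can be split off, \<open>ok_time\<close> bounds the time derivative of the heat flux
  and \<open>balance_DD\<close> gives the gradient. These cases cover every \<gamma>, which breaks
  the circularity.\<close>

lemma gradient_CC: assumes g: "mi_length \<gamma> < N" shows "ok (Y CC (inc (Some k) \<gamma>))"
proof -
  have *: ?thesis if "ok (Y (DD k) (inc None \<gamma>))"
    by (rule ok_cong[OF ok_cmult[OF ok_diff[OF balance_DD[OF g, of k] that], of "3/5"]]) simp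
  note t = ok_time[OF gradient_DD ok_W_DD g]
  show ?thesis
  proof (cases \<gamma> rule: inc_cases)
    case 1 show ?thesis by (rule *, rule t) (use N3 1 in auto)
  next
    case (2 j \<gamma>') show ?thesis by (rule *, rule t) (use N3 2 in auto)
  next
    case (3 \<gamma>')
    have "ok (Y CC (inc None (inc (Some k) \<gamma>')))" by (rule time_CC) (use g 3 in simp)
    then show ?thesis unfolding 3 inc_commute[of None] .
  qed
qed

lemma gradient_pc: assumes g: "mi_length \<gamma> < N" shows "ok (Y (pc 1) (inc (Some k) \<gamma>))"
proof -
  have *: ?thesis if "ok (Y (V k) (inc None \<gamma>))"
    by (rule ok_cong[OF ok_diff[OF balance_V[OF g, of k] ok_add[OF that ok_cmult[OF gradient_CC[OF g, of k], of "1/3"]]]]) simp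
  note t = ok_time[OF gradient_V ok_W_cons(2) g]
  show ?thesis
  proof (cases \<gamma> rule: inc_cases)
    case 1 show ?thesis by (rule *, rule t) (use N3 1 in auto)
  next
    case (2 j \<gamma>') show ?thesis by (rule *, rule t) (use N3 2 in auto)
  next
    case (3 \<gamma>')
    have "ok (Y (pc 1) (inc None (inc (Some k) \<gamma>')))" by (rule time_pc) (use g 3 in simp)
    then show ?thesis unfolding 3 inc_commute[of None] .
  qed
qed

text \<open>With the gradients known, the balance law now gives all time derivatives, including the
  pure ones that \<open>ok_time\<close> could not reach.\<close>

lemma time_DD: assumes g: "mi_length \<gamma> < N" shows "ok (Y (DD k) (inc None \<gamma>))"
  by (rule ok_cong[OF ok_diff[OF balance_DD[OF g, of k] ok_cmult[OF gradient_CC[OF g, of k], of "5/3"]]]) simp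

lemma time_V: assumes g: "mi_length \<gamma> < N" shows "ok (Y (V k) (inc None \<gamma>))"
  by (rule ok_cong[OF ok_diff[OF balance_V[OF g, of k] ok_add[OF gradient_pc[OF g, of k] ok_cmult[OF gradient_CC[OF g, of k], of "1/3"]]]]) simp

lemma ok_all:
  assumes t: "\<And>\<gamma>. mi_length \<gamma> < N \<Longrightarrow> ok (Y L (inc None \<gamma>))" and gr: "\<And>\<gamma> j. mi_length \<gamma> < N \<Longrightarrow> ok (Y L (inc (Some j) \<gamma>))"
    and m: "\<exists>C\<ge>0. \<forall>i\<in>S. \<forall>t\<in>Iv i. \<bar>mn (Y L 0 i t)\<bar> \<le> C * \<kappa> i t" and a: "mi_length \<alpha> \<le> N"
  shows "ok (Y L \<alpha>)"
proof (cases \<alpha> rule: inc_cases)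
  case 1 have "mi_length (0::nat^4) < N" using N3 by simp
  then show ?thesis unfolding 1 using ok_mean gr m by blast
qed (use t gr a in auto)

lemma mean_CC: "i \<in> S \<Longrightarrow> t \<in> Iv i \<Longrightarrow> mn (Y CC 0 i t) = 0"
proof -
  assume i: "i \<in> S" "t \<in> Iv i"
  have "mn (Y CC 0 i t) = mn (Y (N2 @ pscale (-3) (pc 1)) 0 i t)" by (rule mn_Y_cong) (simp add: CC_def)
  then show ?thesis using mn_Y_append[OF i, of 0 N2 "pscale (-3) (pc 1)"] mean_cons i by (simp add: mn_Y_pscale)
qed

lemma mean_DD0: "i \<in> S \<Longrightarrow> 0 < Tm i \<Longrightarrow> mn (Y (DD j) 0 i 0) = 0"
proof -
  assume i: "i \<in> S" "0 < Tm i"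
  then have t: "0 \<in> Iv i" by simp
  have "mn (Y (DD j) 0 i 0) = mn (Y (pmul (V j) N2 @ pscale (-5) (V j)) 0 i 0)" by (rule mn_Y_cong) (simp add: DD_def algebra_simps)
  then show ?thesis using mn_Y_append[OF i(1) t, of 0 "pmul (V j) N2" "pscale (-5) (V j)"] mean_cons(2)[OF i(1) t] mean_third[OF i] by (simp add: mn_Y_pscale)
qed

text \<open>The total heat flux vanishes initially, and its time derivative is quadratic.\<close>

lemma mean_DD: "\<exists>C\<ge>0. \<forall>i\<in>S. \<forall>t\<in>Iv i. \<bar>mn (Y (DD j) 0 i t)\<bar> \<le> C * \<kappa> i t"
proof -
  have N: "mi_length (0::nat^4) < N" using N3 by simp
  have W: "l2b (\<lambda>i t. en i t) (W (DD j) 0)"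
    using l2b_cmult[OF l2b_W_DP[OF N, of j] rg_W[OF N], of "sqrt 10"] by (simp add: DP_DD W_pscale)
  obtain C where C: "C \<ge> 0" "\<And>i t. i \<in> S \<Longrightarrow> t \<in> Iv i \<Longrightarrow> \<bar>mn (W (DD j) 0 i t)\<bar> \<le> C * en i t"
    using l2b_mn[OF rg_W[OF N] W en_nonneg] by blast
  show ?thesis
  proof (intro exI[of _ "C + 1"] conjI ballI)
    fix i t assume i: "i \<in> S" "t \<in> Iv i"
    have "\<bar>mn (Y (DD j) 0 i t) - mn (Y (DD j) 0 i 0)\<bar> \<le> (C + 1) * \<kappa> i t"
    proof (rule mean_time[OF i N _ _ kap_int[OF i] kap_nonneg[OF i]])
      fix s assume "s \<in> {0..t}"
      then have s: "s \<in> Iv i" using i by auto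
      show "\<bar>mn (Y (DD j) (inc None 0) i s)\<bar> \<le> (C + 1) * en i s"
        using C(2)[OF i(1) s] en_nonneg[of i s] by (simp add: mn_W[OF i(1) s N] distrib_right)
    qed (use C in simp)
    then show "\<bar>mn (Y (DD j) 0 i t)\<bar> \<le> (C + 1) * \<kappa> i t" using mean_DD0[of i j] i by simp
  qed (use C in simp)
qed

lemma ok_chi: assumes k: "k < 8" and a: "mi_length \<alpha> \<le> N" shows "ok (Y (chi k) \<alpha>)"
proof -
  have z: "\<exists>C\<ge>0. \<forall>i\<in>S. \<forall>t\<in>Iv i. \<bar>mn (Y L 0 i t)\<bar> \<le> C * \<kappa> i t"
    if "\<And>i t. i \<in> S \<Longrightarrow> t \<in> Iv i \<Longrightarrow> mn (Y L 0 i t) = 0" for L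
    using that by (intro exI[of _ 0]) auto
  have "ok (Y (pc 1) \<alpha>)" by (rule ok_all[OF time_pc gradient_pc z[OF mean_cons(1)] a])
  moreover have "ok (Y (V j) \<alpha>)" for j by (rule ok_all[OF time_V gradient_V z[OF mean_cons(2)] a])
  moreover have "ok (Y CC \<alpha>)" by (rule ok_all[OF time_CC gradient_CC z[OF mean_CC] a])
  moreover have "ok (Y (DD j) \<alpha>)" for j by (rule ok_all[OF time_DD gradient_DD mean_DD a])
  ultimately show ?thesis using k unfolding less_8 by (elim insertE emptyE; hypsubst; simp only: chi_simps)
qed

lemma macroscopic_estimate:
  "\<exists>C\<ge>0. \<forall>i\<in>S. \<forall>t\<in>Iv i. (\<Sum>\<alpha> | mi_length \<alpha> \<le> N. \<Sum>k<8. enn2real (n2 (\<lambda>x. chn k * Y (chi k) \<alpha> i t x))) \<le> C * (\<kappa> i t)\<^sup>2"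
proof -
  have "\<forall>k \<alpha>. k < 8 \<and> mi_length \<alpha> \<le> N \<longrightarrow> (\<exists>C\<ge>0. \<forall>i\<in>S. \<forall>t\<in>Iv i. n2 (\<lambda>x. chn k * Y (chi k) \<alpha> i t x) \<le> ennreal ((C * \<kappa> i t)\<^sup>2))"
    using ok_n2[OF ok_cmult[OF ok_chi]] by blast
  then obtain C where C: "\<And>k \<alpha> i t. k < 8 \<Longrightarrow> mi_length \<alpha> \<le> N \<Longrightarrow> i \<in> S \<Longrightarrow> t \<in> Iv i \<Longrightarrow> n2 (\<lambda>x. chn k * Y (chi k) \<alpha> i t x) \<le> ennreal ((C k \<alpha> * \<kappa> i t)\<^sup>2)"
    by metis
  show ?thesis
  proof (intro exI[of _ "\<Sum>\<alpha> | mi_length \<alpha> \<le> N. \<Sum>k<8. (C k \<alpha>)\<^sup>2"] conjI ballI)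
    fix i t assume i: "i \<in> S" "t \<in> Iv i"
    show "(\<Sum>\<alpha> | mi_length \<alpha> \<le> N. \<Sum>k<8. enn2real (n2 (\<lambda>x. chn k * Y (chi k) \<alpha> i t x))) \<le> (\<Sum>\<alpha> | mi_length \<alpha> \<le> N. \<Sum>k<8. (C k \<alpha>)\<^sup>2) * (\<kappa> i t)\<^sup>2"
      unfolding sum_distrib_right
      by (intro sum_mono) (use C i in \<open>auto simp: power_mult_distrib[symmetric] intro!: enn2real_leI\<close>)
  qed (simp add: sum_nonneg)
qed

end

subsection \<open>The linearized operator\<close>

lemma AE_phase_fst:
  assumes "AE x in MQ. P x"
  shows "AE p in PM. P (fst p)"
proof -
  interpret MP: pair_sigma_finite MQ "lborel :: (real^3) measure" ..
  obtain A where A: "{x \<in> space MQ. \<not> P x} \<subseteq> A" "emeasure MQ A = 0" "A \<in> sets MQ" using assms by (rule AE_E)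
  show ?thesis
  proof (rule AE_I)
    show "{p \<in> space PM. \<not> P (fst p)} \<subseteq> A \<times> UNIV"
      using A(1) by (auto simp: space_pair_measure)
    have U: "(UNIV :: (real^3) set) \<in> sets lborel" by simp
    show "A \<times> UNIV \<in> sets PM" using A(3) U by (rule pair_measureI)
    show "emeasure PM (A \<times> UNIV) = 0"
      using lborel.emeasure_pair_measure_Times[OF A(3) U] A(2) by simp
  qed
qed

lemma vec_moment:
  fixes w :: "real^3 \<Rightarrow> real^3"
  assumes h: "h \<in> borel_measurable borel" "sqn h < \<infinity>"
    and w: "w \<in> borel_measurable borel" "\<And>v. norm (w v) \<le> peval L v" "\<And>v. w v $ j = peval Lj v"
  shows "(LINT v|lborel. (h v * sqrt (maxwellian v)) *\<^sub>R w v) $ j = mom (peval Lj) h"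
proof -
  note [measurable] = h(1) w(1)
  have I: "integrable lborel (\<lambda>v. (h v * sqrt (maxwellian v)) *\<^sub>R w v)"
  proof (rule Bochner_Integration.integrable_bound[OF mom_integrable[OF h, of L]])
    show "AE v in lborel. norm ((h v * sqrt (maxwellian v)) *\<^sub>R w v) \<le> norm (h v * (wt L v))"
    proof (rule AE_I2)
      fix v
      have "0 \<le> peval L v" by (rule order_trans[OF norm_ge_zero w(2)])
      moreover have "\<bar>h v * sqrt (maxwellian v)\<bar> * norm (w v) \<le> \<bar>h v * sqrt (maxwellian v)\<bar> * peval L v"
        by (rule mult_left_mono[OF w(2)]) simp
      ultimately show "norm ((h v * sqrt (maxwellian v)) *\<^sub>R w v) \<le> norm (h v * (wt L v))"
        by (simp add: abs_mult mult_ac)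
    qed
  qed measurable
  have "(LINT v|lborel. (h v * sqrt (maxwellian v)) *\<^sub>R w v) $ j = (LINT v|lborel. ((h v * sqrt (maxwellian v)) *\<^sub>R w v) $ j)"
    by (rule integral_bounded_linear[OF bounded_linear_vec_nth I, symmetric])
  then show ?thesis by (simp add: w(3) mom_def mult_ac)
qed

text \<open>At Pr = 0 the operators \<open>P_c\<close> and \<open>P_nc\<close> enter with equal
  weight, and their sum is the orthogonal projection onto the eight directions. Finiteness of the
  norm is what allows the vector integrals to be taken componentwise.\<close>

lemma L_Pr_projection:
  assumes h: "h \<in> borel_measurable borel" "sqn h < \<infinity>"
  shows "L_Pr 0 h v = (\<Sum>k<8. (chn k)\<^sup>2 * mom (peval (chi k)) h * (wt (chi k) v)) - h v"
proof -
  have 1: "(LINT u|lborel. h u * sqrt (maxwellian u)) = mom (peval (pc 1)) h" by (simp add: mom_def)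
  have 2: "(LINT u|lborel. (h u * sqrt (maxwellian u)) *\<^sub>R u) $ j = mom (peval (V j)) h" for j
    by (rule vec_moment[OF h, where L="wsq"]) (auto simp: peval_wsq norm_le_poly)
  have 3: "(LINT u|lborel. h u * (((norm u)\<^sup>2 - 3) / sqrt 6) * sqrt (maxwellian u)) = 1 / sqrt 6 * mom (peval CC) h"
    unfolding mom_def integral_mult_right_zero[symmetric]
    by (rule Bochner_Integration.integral_cong) (simp_all add: CC_def)
  have b: "norm ((((norm u)\<^sup>2 - 5) / sqrt 10) *\<^sub>R u) \<le> peval (pmul (N2 @ pc 5) wsq) u" for u :: "real^3"
  proof -
    have "\<bar>(norm u)\<^sup>2 - 5\<bar> / sqrt 10 \<le> \<bar>(norm u)\<^sup>2 - 5\<bar> / 1" by (rule divide_left_mono) auto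
    then have "\<bar>((norm u)\<^sup>2 - 5) / sqrt 10\<bar> \<le> \<bar>(norm u)\<^sup>2 - 5\<bar>" by simp
    also have "\<dots> \<le> (norm u)\<^sup>2 + 5" by (rule abs_leI) (simp_all add: add_increasing)
    finally have "\<bar>((norm u)\<^sup>2 - 5) / sqrt 10\<bar> * norm u \<le> ((norm u)\<^sup>2 + 5) * (1 + (norm u)\<^sup>2)"
      by (intro mult_mono norm_le_poly) auto
    then show ?thesis by (simp add: peval_wsq)
  qed
  have 4: "(LINT u|lborel. (h u * sqrt (maxwellian u)) *\<^sub>R ((((norm u)\<^sup>2 - 5) / sqrt 10) *\<^sub>R u)) $ j = 1 / sqrt 10 * mom (peval (DD j)) h" for j
    unfolding mom_pscale[symmetric]
    by (rule vec_moment[OF h _ b]) (simp_all add: DD_def)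
  have S: "(\<Sum>k<8. F k) = F 0 + F 1 + F 2 + F 3 + F 4 + F 5 + F 6 + F (7::nat)" for F :: "nat \<Rightarrow> real"
    by (simp add: eval_nat_numeral)
  \<comment> \<open>Two factors 1 / sqrt r, one from the coefficient and one from the basis
    function, combine to the 1 / r contained in (chn k)^2.\<close>
  have sc: "(1 / sqrt r * m) * (x / sqrt r * y) = 1 / r * m * x * y" if "r > 0" for r m x y :: real
    using that by (simp add: field_simps)
  have c6: "(1 / sqrt 6 * mom (peval CC) h) * (((norm v)\<^sup>2 - 3) / sqrt 6) * sqrt (maxwellian v) = 1 / 6 * mom (peval CC) h * ((norm v)\<^sup>2 - 3) * sqrt (maxwellian v)"
    using sc[of 6 _ "(norm v)\<^sup>2 - 3" "sqrt (maxwellian v)"] by (simp only: mult.assoc)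
  have c10: "(1 / sqrt 10 * mom (peval (DD j)) h) * (((norm v)\<^sup>2 - 5) / sqrt 10 * v$j) = 1 / 10 * mom (peval (DD j)) h * ((norm v)\<^sup>2 - 5) * v$j" for j
    using sc[of 10 _ "(norm v)\<^sup>2 - 5" "v$j"] by (simp only: mult.assoc)
  have n: "(chn 0)\<^sup>2 = 1" "(chn 1)\<^sup>2 = 1" "(chn 2)\<^sup>2 = 1" "(chn 3)\<^sup>2 = 1" "(chn 4)\<^sup>2 = 1/6" "(chn 5)\<^sup>2 = 1/10" "(chn 6)\<^sup>2 = 1/10" "(chn 7)\<^sup>2 = 1/10"
    unfolding chn_simps by (simp_all add: power_divide)
  have pv: "peval CC v = (norm v)\<^sup>2 - 3" "\<And>j. peval (DD j) v = v$j * ((norm v)\<^sup>2 - 5)" by (simp_all add: CC_def DD_def)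
  show ?thesis
    unfolding L_Pr_def P_Pr_def P_c_def P_nc_def inner_vec_def sum_3 1 2 3 4 S chi_simps n pv vector_scaleR_component real_scaleR_def inner_real_def c6 c10 peval_pc peval_V
    by (simp only: algebra_simps diff_zero mult_1)
qed

context kinetic
begin

lemma moment_phase:
  assumes i: "i \<in> S" "t \<in> Iv i" and a: "mi_length \<alpha> \<le> N"
  shows "integrable PM (\<lambda>(x,v). Y L \<alpha> i t x * (wt L v) * g i \<alpha> t x v)"
    and "(LINT (x,v)|PM. Y L \<alpha> i t x * (wt L v) * g i \<alpha> t x v) = enn2real (n2 (Y L \<alpha> i t))"
proof -
  interpret P: pair_sigma_finite MQ "lborel :: (real^3) measure" ..
  note gm = phase_measurable[OF g_meas[OF i(1) a i(2)]]
  have [measurable]: "Y L \<alpha> i t \<in> borel_measurable MQ" by (rule measurable_MQ[OF rg_meas[OF rg_Y[OF a] i]])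
  let ?w = "\<lambda>(x, v). Y L \<alpha> i t x * (wt L v)"
  have wm: "?w \<in> borel_measurable PM" by measurable
  have g2: "integrable PM (\<lambda>p. ((\<lambda>(x,v). g i \<alpha> t x v) p)\<^sup>2)"
    using L2_fin[OF i(1) a i(2)] unfolding L2_norm_sq_iter(1)[OF g_meas[OF i(1) a i(2)]]
    by (subst integrable_sq_iff[OF gm]) (simp add: case_prod_beta')
  have w2: "integrable PM (\<lambda>p. (?w p)\<^sup>2)"
  proof (subst integrable_sq_iff[OF wm])
    have wm2: "(\<lambda>p. ennreal ((?w p)\<^sup>2)) \<in> borel_measurable PM" using wm by measurable
    have "(\<integral>\<^sup>+v. ennreal ((Y L \<alpha> i t x * (wt L v))\<^sup>2) \<partial>lborel) = ennreal ((Y L \<alpha> i t x)\<^sup>2) * ennreal (pE (pmul L L))" for x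
    proof -
      have "(\<integral>\<^sup>+v. ennreal ((Y L \<alpha> i t x * (wt L v))\<^sup>2) \<partial>lborel) = (\<integral>\<^sup>+v. ennreal ((Y L \<alpha> i t x)\<^sup>2) * ennreal (maxwellian v * peval (pmul L L) v) \<partial>lborel)"
      proof (rule nn_integral_cong)
        fix v
        have "(Y L \<alpha> i t x * (wt L v))\<^sup>2 = (Y L \<alpha> i t x)\<^sup>2 * (maxwellian v * peval (pmul L L) v)"
          by (simp add: power_mult_distrib) (simp add: power2_eq_square)
        then show "ennreal ((Y L \<alpha> i t x * (wt L v))\<^sup>2) = ennreal ((Y L \<alpha> i t x)\<^sup>2) * ennreal (maxwellian v * peval (pmul L L) v)"
          by (simp add: ennreal_mult'[symmetric])
      qed
      also have "\<dots> = ennreal ((Y L \<alpha> i t x)\<^sup>2) * (\<integral>\<^sup>+v. ennreal (maxwellian v * peval (pmul L L) v) \<partial>lborel)"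
        by (rule nn_integral_cmult) measurable
      also have "(\<integral>\<^sup>+v. ennreal (maxwellian v * peval (pmul L L) v) \<partial>lborel) = ennreal (pE (pmul L L))"
        unfolding integral_maxwellian_peval[symmetric] by (rule nn_integral_eq_integral[OF integrable_maxwellian_peval]) simp
      finally show ?thesis .
    qed
    then have "(\<integral>\<^sup>+p. ennreal ((?w p)\<^sup>2) \<partial>PM) = (\<integral>\<^sup>+x. ennreal ((Y L \<alpha> i t x)\<^sup>2) * ennreal (pE (pmul L L)) \<partial>MQ)"
      using lborel.nn_integral_fst[OF wm2] by simp
    also have "\<dots> = n2 (Y L \<alpha> i t) * ennreal (pE (pmul L L))"
      unfolding n2_def by (rule nn_integral_multc) measurable
    also have "\<dots> < \<infinity>" using sq_Y[OF i a] by (simp add: sq_def ennreal_mult_less_top)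
    finally show "(\<integral>\<^sup>+p. ennreal ((?w p)\<^sup>2) \<partial>PM) < \<infinity>" .
  qed
  show I: "integrable PM (\<lambda>(x,v). Y L \<alpha> i t x * (wt L v) * g i \<alpha> t x v)"
    using Cauchy_Schwarz_integral(1)[OF wm gm w2 g2] by (simp add: case_prod_beta')
  have "(LINT (x,v)|PM. Y L \<alpha> i t x * (wt L v) * g i \<alpha> t x v) = (LINT x|MQ. LINT v|lborel. Y L \<alpha> i t x * (wt L v) * g i \<alpha> t x v)"
    by (rule P.integral_fst[OF I, symmetric])
  also have "\<dots> = ip (Y L \<alpha> i t) (Y L \<alpha> i t)"
    unfolding ip_def
  proof (rule Bochner_Integration.integral_cong[OF refl])
    fix x
    have "(LINT v|lborel. Y L \<alpha> i t x * (wt L v) * g i \<alpha> t x v) = Y L \<alpha> i t x * (LINT v|lborel. g i \<alpha> t x v * (wt L v))"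
      unfolding integral_mult_right_zero[symmetric] by (rule Bochner_Integration.integral_cong) (simp_all add: mult_ac)
    then show "(LINT v|lborel. Y L \<alpha> i t x * (wt L v) * g i \<alpha> t x v) = Y L \<alpha> i t x * Y L \<alpha> i t x"
      by (simp add: Y_def mom_def)
  qed
  also have "\<dots> = enn2real (n2 (Y L \<alpha> i t))" unfolding n2_ip[OF sq_Y[OF i a]] by (simp add: ip_def)
  finally show "(LINT (x,v)|PM. Y L \<alpha> i t x * (wt L v) * g i \<alpha> t x v) = enn2real (n2 (Y L \<alpha> i t))" .
qed

text \<open>An exact identity: the form equals minus the squared norm of the microscopic part.
  \<open>L_Pr_projection\<close> supplies the pointwise formula for almost every x, where the
  velocity norm is finite.\<close>

lemma L2_inner_L:
  assumes i: "i \<in> S" "t \<in> Iv i" and a: "mi_length \<alpha> \<le> N"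
  shows "L2_inner (\<lambda>x. L_Pr 0 (g i \<alpha> t x)) (g i \<alpha> t)
    = (\<Sum>k<8. enn2real (n2 (\<lambda>x. chn k * Y (chi k) \<alpha> i t x))) - enn2real (L2_norm_sq (g i \<alpha> t))"
proof -
  interpret P: pair_sigma_finite MQ "lborel :: (real^3) measure" ..
  note gm = phase_measurable[OF g_meas[OF i(1) a i(2)]]
  have gm'[measurable]: "(\<lambda>p. g i \<alpha> t (fst p) (snd p)) \<in> borel_measurable PM" using gm by (simp add: case_prod_beta')
  let ?T = "\<lambda>k p. Y (chi k) \<alpha> i t (fst p) * (peval (chi k) (snd p) * sqrt (maxwellian (snd p))) * g i \<alpha> t (fst p) (snd p)"
  let ?H = "\<lambda>p. (\<Sum>k<8. (chn k)\<^sup>2 * ?T k p) - (g i \<alpha> t (fst p) (snd p))\<^sup>2"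
  have ae: "AE p in PM. L_Pr 0 (g i \<alpha> t (fst p)) (snd p) * g i \<alpha> t (fst p) (snd p) = ?H p"
    using AE_phase_fst[OF AE_fin_v0[OF i a]]
  proof (rule AE_mp, intro AE_I2 impI)
    fix p :: "(real^3) \<times> (real^3)" assume "(\<integral>\<^sup>+v. ennreal ((g i \<alpha> t (fst p) v)\<^sup>2) \<partial>lborel) < \<infinity>"
    from L_Pr_projection[OF g_meas_v[OF i(1) a i(2)] this, of "snd p"]
    have "L_Pr 0 (g i \<alpha> t (fst p)) (snd p) = (\<Sum>k<8. (chn k)\<^sup>2 * Y (chi k) \<alpha> i t (fst p) * (peval (chi k) (snd p) * sqrt (maxwellian (snd p)))) - g i \<alpha> t (fst p) (snd p)"
      by (simp add: Y_def)
    then show "L_Pr 0 (g i \<alpha> t (fst p)) (snd p) * g i \<alpha> t (fst p) (snd p) = ?H p"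
      by (simp only: left_diff_distrib sum_distrib_right power2_eq_square mult.assoc)
  qed
  have L[measurable]: "(\<lambda>p. L_Pr 0 (g i \<alpha> t (fst p)) (snd p)) \<in> borel_measurable PM"
  proof -
    have vi: "(\<lambda>x. LINT v|lborel. g i \<alpha> t x v * f v) \<in> borel_measurable MQ" if [measurable]: "f \<in> borel_measurable borel" for f
      using gm by measurable
    have vv: "(\<lambda>x. LINT v|lborel. (g i \<alpha> t x v * sqrt (maxwellian v)) *\<^sub>R w v) \<in> borel_measurable MQ" if [measurable]: "w \<in> borel_measurable borel" for w :: "real^3 \<Rightarrow> real^3"
      using gm by measurable
    note [measurable] = vi[of "\<lambda>v. sqrt (maxwellian v)"] vv[of "\<lambda>v. v"] vi[of "\<lambda>v. ((norm v)\<^sup>2 - 3) / sqrt 6 * sqrt (maxwellian v)"] vv[of "\<lambda>v. (((norm v)\<^sup>2 - 5) / sqrt 10) *\<^sub>R v"]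
    show ?thesis unfolding L_Pr_def P_Pr_def P_c_def P_nc_def mult.assoc[of "g i \<alpha> t _ _"] by measurable
  qed
  have I: "integrable PM (?T k)" for k
    using moment_phase(1)[OF i a, of "chi k"] by (simp add: case_prod_beta')
  have e: "(\<integral>p. ?T k p \<partial>PM) = enn2real (n2 (Y (chi k) \<alpha> i t))" for k
    using moment_phase(2)[OF i a, of "chi k"] by (simp add: case_prod_beta')
  have g2: "integrable PM (\<lambda>p. (g i \<alpha> t (fst p) (snd p))\<^sup>2)"
    using L2_fin[OF i(1) a i(2)] unfolding L2_norm_sq_iter(1)[OF g_meas[OF i(1) a i(2)]]
    by (subst integrable_sq_iff[OF gm']) simp
  have IS: "integrable PM (\<lambda>p. \<Sum>k<8. (chn k)\<^sup>2 * ?T k p)"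
    by (intro Bochner_Integration.integrable_sum integrable_mult_right I)
  have Hm: "?H \<in> borel_measurable PM"
    by (intro borel_measurable_diff borel_measurable_integrable[OF IS] borel_measurable_integrable[OF g2])
  have "L2_inner (\<lambda>x. L_Pr 0 (g i \<alpha> t x)) (g i \<alpha> t) = (\<integral>p. L_Pr 0 (g i \<alpha> t (fst p)) (snd p) * g i \<alpha> t (fst p) (snd p) \<partial>PM)"
    by (simp add: L2_inner_def phase_space_def case_prod_beta')
  also have "\<dots> = (\<integral>p. ?H p \<partial>PM)"
    by (rule integral_cong_AE[OF borel_measurable_times[OF L gm'] Hm ae])
  also have "\<dots> = (\<integral>p. (\<Sum>k<8. (chn k)\<^sup>2 * ?T k p) \<partial>PM) - (\<integral>p. (g i \<alpha> t (fst p) (snd p))\<^sup>2 \<partial>PM)"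
    by (rule Bochner_Integration.integral_diff[OF IS g2])
  also have "(\<integral>p. (\<Sum>k<8. (chn k)\<^sup>2 * ?T k p) \<partial>PM) = (\<Sum>k<8. (chn k)\<^sup>2 * enn2real (n2 (Y (chi k) \<alpha> i t)))"
    by (simp only: Bochner_Integration.integral_sum[OF integrable_mult_right[OF I]] integral_mult_right_zero e)
  also have "(\<integral>p. (g i \<alpha> t (fst p) (snd p))\<^sup>2 \<partial>PM) = enn2real (L2_norm_sq (g i \<alpha> t))"
    unfolding L2_norm_sq_iter(1)[OF g_meas[OF i(1) a i(2)]] using nn_integral_eq_integral[OF g2] by simp
  also have "(\<Sum>k<8. (chn k)\<^sup>2 * enn2real (n2 (Y (chi k) \<alpha> i t))) = (\<Sum>k<8. enn2real (n2 (\<lambda>x. chn k * Y (chi k) \<alpha> i t x)))"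
    using rg_meas[OF rg_Y[OF a] i] by (simp add: n2_cmult enn2real_mult)
  finally show ?thesis .
qed

lemma velocity_integral_phase:
  fixes h :: "real^3 \<Rightarrow> real"
  assumes h: "integrable lborel h"
  shows "integrable PM (\<lambda>(x::real^3, v). h v)" "(LINT (x,v)|PM. h v) = (LINT v|lborel. h v)"
proof -
  interpret P: pair_sigma_finite MQ "lborel :: (real^3) measure" ..
  have [measurable]: "h \<in> borel_measurable borel" using h by auto
  show I: "integrable PM (\<lambda>(x::real^3, v). h v)"
    by (rule P.Fubini_integrable) (use h in auto)
  show "(LINT (x,v)|PM. h v) = (LINT v|lborel. h v)"
    using MQ.prob_space unfolding P.integral_fst[OF I, symmetric] by simp
qed

end

subsection \<open>Commutation of partial derivatives\<close>

text \<open>The second mixed difference over the square [0,k]^2 is evaluated by the mean value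
  theorem in both orders, and k tends to 0. Half-open squares with one-sided derivatives make the
  statement usable at t = 0.\<close>

lemma Schwarz_corner:
  fixes a p q P Q :: "real \<Rightarrow> real \<Rightarrow> real"
  assumes h: "h > 0"
    and p: "\<And>s r. s \<in> {0..<h} \<Longrightarrow> r \<in> {0..<h} \<Longrightarrow> ((\<lambda>s. a s r) has_real_derivative p s r) (at s within {0..<h})"
    and q: "\<And>s r. s \<in> {0..<h} \<Longrightarrow> r \<in> {0..<h} \<Longrightarrow> ((\<lambda>r. a s r) has_real_derivative q s r) (at r within {0..<h})"
    and P: "\<And>s r. s \<in> {0..<h} \<Longrightarrow> r \<in> {0..<h} \<Longrightarrow> ((\<lambda>r. p s r) has_real_derivative P s r) (at r within {0..<h})"
    and Q: "\<And>s r. s \<in> {0..<h} \<Longrightarrow> r \<in> {0..<h} \<Longrightarrow> ((\<lambda>s. q s r) has_real_derivative Q s r) (at s within {0..<h})"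
    and c: "continuous_on ({0..<h} \<times> {0..<h}) (\<lambda>(s, r). P s r)" "continuous_on ({0..<h} \<times> {0..<h}) (\<lambda>(s, r). Q s r)"
  shows "P 0 0 = Q 0 0"
proof -
  have mvt: "\<exists>z\<in>{0<..<k}. f k - f 0 = k * f' z"
    if k: "0 < k" "k < h" and d: "\<And>s. s \<in> {0..<h} \<Longrightarrow> (f has_real_derivative f' s) (at s within {0..<h})" for k and f f' :: "real \<Rightarrow> real"
  proof -
    have "\<exists>z\<in>{0<..<k}. f k - f 0 = (\<lambda>y. f' z * y) (k - 0)"
    proof (rule mvt_simple[OF k(1)])
      fix s assume s: "0 \<le> s" "s \<le> k"
      have "(f has_real_derivative f' s) (at s within {0..k})"
        by (rule DERIV_subset[OF d]) (use s k in auto)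
      then show "(f has_derivative (\<lambda>y. f' s * y)) (at s within {0..k})" by (simp add: has_field_derivative_def)
    qed
    then show ?thesis by (simp add: mult.commute)
  qed
  define k where "k n = h / (real n + 2)" for n
  have k: "0 < k n" "k n < h" for n
    using h divide_strict_left_mono[of 1 "real n + 2" h] by (simp_all add: k_def)
  have k0: "k \<longlonglongrightarrow> 0" unfolding k_def by real_asymp
  have ex: "\<exists>z w. z \<in> {0<..<k n} \<times> {0<..<k n} \<and> w \<in> {0<..<k n} \<times> {0<..<k n} \<and> P (fst z) (snd z) = Q (fst w) (snd w)" for n
  proof -
    let ?k = "k n"
    have in0: "0 \<in> {0..<h}" "?k \<in> {0..<h}" using h k[of n] by auto
    obtain z1 where z1: "z1 \<in> {0<..<?k}" "(a ?k ?k - a ?k 0) - (a 0 ?k - a 0 0) = ?k * (p z1 ?k - p z1 0)"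
      using mvt[OF k[of n], of "\<lambda>s. a s ?k - a s 0" "\<lambda>s. p s ?k - p s 0"] DERIV_diff[OF p p] in0 by blast
    have z1h: "z1 \<in> {0..<h}" using z1(1) k[of n] by auto
    obtain z2 where z2: "z2 \<in> {0<..<?k}" "p z1 ?k - p z1 0 = ?k * P z1 z2"
      using mvt[OF k[of n], of "p z1" "P z1"] P[OF z1h] by blast
    obtain w2 where w2: "w2 \<in> {0<..<?k}" "(a ?k ?k - a 0 ?k) - (a ?k 0 - a 0 0) = ?k * (q ?k w2 - q 0 w2)"
      using mvt[OF k[of n], of "\<lambda>r. a ?k r - a 0 r" "\<lambda>r. q ?k r - q 0 r"] DERIV_diff[OF q q] in0 by blast
    have w2h: "w2 \<in> {0..<h}" using w2(1) k[of n] by auto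
    obtain w1 where w1: "w1 \<in> {0<..<?k}" "q ?k w2 - q 0 w2 = ?k * Q w1 w2"
      using mvt[OF k[of n], of "\<lambda>s. q s w2" "\<lambda>s. Q s w2"] Q[OF _ w2h] by blast
    have "?k * (?k * P z1 z2) = ?k * (?k * Q w1 w2)" using z1(2)[unfolded z2(2)] w2(2)[unfolded w1(2)] by linarith
    then have "P z1 z2 = Q w1 w2" using k[of n] by simp
    then show ?thesis using z1(1) z2(1) w1(1) w2(1) by (intro exI[of _ "(z1,z2)"] exI[of _ "(w1,w2)"]) simp
  qed
  then obtain z w where zw: "\<And>n. z n \<in> {0<..<k n} \<times> {0<..<k n}" "\<And>n. w n \<in> {0<..<k n} \<times> {0<..<k n}" "\<And>n. P (fst (z n)) (snd (z n)) = Q (fst (w n)) (snd (w n))"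
    by metis
  have lim: "u \<longlonglongrightarrow> (0, 0)" if "\<And>n. u n \<in> {0<..<k n} \<times> {0<..<k n}" for u
  proof -
    have "(\<lambda>n. fst (u n)) \<longlonglongrightarrow> 0" "(\<lambda>n. snd (u n)) \<longlonglongrightarrow> 0"
      by (rule tendsto_sandwich[OF _ _ tendsto_const k0]; use that in \<open>force simp: mem_Times_iff intro!: always_eventually less_imp_le\<close>)+
    then show ?thesis using tendsto_Pair[of "\<lambda>n. fst (u n)" 0 sequentially "\<lambda>n. snd (u n)" 0] by simp
  qed
  have inS: "u n \<in> {0..<h} \<times> {0..<h}" if "\<And>n. u n \<in> {0<..<k n} \<times> {0<..<k n}" for u n
    using that[of n] k[of n] by (auto simp: mem_Times_iff)
  have 0: "(0, 0) \<in> {0..<h} \<times> {0..<h}" using h by simp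
  have "(\<lambda>n. (\<lambda>(s, r). P s r) (z n)) \<longlonglongrightarrow> (\<lambda>(s, r). P s r) (0, 0)"
    by (rule continuous_on_tendsto_compose[OF c(1) lim[OF zw(1)] 0]) (use inS[OF zw(1)] in simp)
  moreover have "(\<lambda>n. (\<lambda>(s, r). Q s r) (w n)) \<longlonglongrightarrow> (\<lambda>(s, r). Q s r) (0, 0)"
    by (rule continuous_on_tendsto_compose[OF c(2) lim[OF zw(2)] 0]) (use inS[OF zw(2)] in simp)
  ultimately show ?thesis using LIMSEQ_unique zw(3) by (simp add: case_prod_beta')
qed

section \<open>Iterated classical derivatives in time and space\<close>

definition dv :: "3 option \<Rightarrow> kinetic_fn \<Rightarrow> kinetic_fn" where
  "dv e = (case e of None \<Rightarrow> deriv_t | Some j \<Rightarrow> deriv_x j)"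

text \<open>Equality on [0, T) only: nothing is known about a solution at later times, and
  derivatives at t < T do not see them.\<close>

definition agree :: "real \<Rightarrow> kinetic_fn \<Rightarrow> kinetic_fn \<Rightarrow> bool" where
  "agree T f g \<longleftrightarrow> (\<forall>t\<in>{0..<T}. f t = g t)"

lemma agree_refl: "agree T f f" by (simp add: agree_def)
lemma agree_trans: "agree T f g \<Longrightarrow> agree T g h \<Longrightarrow> agree T f h" by (simp add: agree_def)

lemma agree_dv: assumes "agree T f g" shows "agree T (dv e f) (dv e g)"
  unfolding agree_def
proof (intro ballI ext)
  fix t and x v :: "real^3" assume t: "t \<in> {0..<T}"
  show "dv e f t x v = dv e g t x v"
  proof (cases e)
    case None
    have tr: "((\<lambda>s. q s x v) has_vector_derivative d) (at t within {0..})"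
      if "((\<lambda>s. p s x v) has_vector_derivative d) (at t within {0..})" "agree T p q" for p q :: kinetic_fn and d
      unfolding has_vector_derivative_def
    proof (rule has_derivative_transform_within[OF that(1)[unfolded has_vector_derivative_def]])
      show "0 < T - t" "t \<in> {0..}" using t by auto
      show "p s x v = q s x v" if "s \<in> {0..}" "dist s t < T - t" for s
      proof -
        have "s \<in> {0..<T}" using that by (auto simp: dist_real_def)
        then show ?thesis using \<open>agree T p q\<close> by (simp add: agree_def)
      qed
    qed
    have "agree T g f" using assms by (simp add: agree_def)
    then have "((\<lambda>s. f s x v) has_vector_derivative d) (at t within {0..}) \<longleftrightarrow> ((\<lambda>s. g s x v) has_vector_derivative d) (at t within {0..})" for d
      using tr assms by blast
    then show ?thesis using None by (simp add: dv_def deriv_t_def vector_derivative_def)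
  next
    case (Some j)
    then show ?thesis using assms t by (simp add: dv_def deriv_x_def agree_def)
  qed
qed

lemma agree_pow: "agree T f g \<Longrightarrow> agree T ((dv e ^^ n) f) ((dv e ^^ n) g)"
  by (induction n) (auto intro: agree_dv)

lemma C_dv: "C_k_on (Suc k) T f \<Longrightarrow> C_k_on k T (dv e f)"
  by (cases e) (simp_all add: dv_def)

lemma C_pow: "C_k_on (n + k) T f \<Longrightarrow> C_k_on k T ((dv e ^^ n) f)"
proof (induction n arbitrary: k)
  case (Suc n)
  have "C_k_on (Suc k) T ((dv e ^^ n) f)" by (rule Suc.IH) (use Suc.prems in simp)
  then show ?case using C_dv by simp
qed simp

lemma C_cont: "C_k_on k T f \<Longrightarrow> continuous_on ({0..<T} \<times> UNIV \<times> UNIV) (\<lambda>(t, x, v). f t x v)"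
  by (cases k) auto

definition move :: "3 option \<Rightarrow> real \<Rightarrow> real \<times> (real^3) \<Rightarrow> real \<times> (real^3)" where
  "move e s q = (case e of None \<Rightarrow> (fst q + s, snd q) | Some j \<Rightarrow> (fst q, snd q + s *\<^sub>R axis j 1))"

lemma move_commute: "move e s (move e' r q) = move e' r (move e s q)"
  by (cases e; cases e') (simp_all add: move_def add_ac)
lemma move_0: "move e 0 q = q" by (cases e) (simp_all add: move_def)
lemma move_time: "0 \<le> s \<Longrightarrow> fst q \<le> fst (move e s q) \<and> fst (move e s q) \<le> fst q + s" by (cases e) (simp_all add: move_def)

lemma deriv_t_works:
  assumes "C_k_on (Suc k) T f" "t \<in> {0..<T}"
  shows "((\<lambda>s. f s x v) has_real_derivative deriv_t f t x v) (at t within {0..})"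
proof -
  have "(\<lambda>s. f s x v) differentiable (at t within {0..})" using assms by simp
  then show ?thesis
    unfolding vector_derivative_works deriv_t_def has_real_derivative_iff_has_vector_derivative .
qed

lemma deriv_x_works:
  assumes "C_k_on (Suc k) T f" "t \<in> {0..<T}"
  shows "((\<lambda>s. f t (x + s *\<^sub>R axis i 1) v) has_real_derivative deriv_x i f t x v) (at 0)"
proof -
  have "(\<lambda>s. f t (x + s *\<^sub>R axis i 1) v) differentiable (at 0)" using assms by simp
  then show ?thesis
    unfolding deriv_x_def by (simp add: field_differentiable_derivI DERIV_deriv_iff_real_differentiable)
qed

lemma dv_along:
  assumes f: "C_k_on (Suc k) T f" and q: "0 \<le> fst q" "fst q + h \<le> T" and s: "s \<in> {0..<h}"
  shows "((\<lambda>s. f (fst (move e s q)) (snd (move e s q)) v) has_real_derivative dv e f (fst (move e s q)) (snd (move e s q)) v) (at s within {0..<h})"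
proof (cases e)
  case None
  have "((\<lambda>s. f s (snd q) v) has_real_derivative deriv_t f (fst q + s) (snd q) v) (at (fst q + s) within {0..})"
    by (rule deriv_t_works[OF f]) (use q s in auto)
  then have "((\<lambda>s. f s (snd q) v) has_real_derivative deriv_t f (fst q + s) (snd q) v) (at (fst q + s) within (\<lambda>s. fst q + s) ` {0..<h})"
    by (rule DERIV_subset) (use q in auto)
  moreover have "((\<lambda>s. fst q + s) has_real_derivative 1) (at s within {0..<h})"
    by (auto intro!: derivative_eq_intros)
  ultimately have "((\<lambda>s. f s (snd q) v) \<circ> (\<lambda>s. fst q + s) has_real_derivative deriv_t f (fst q + s) (snd q) v * 1) (at s within {0..<h})"
    by (rule DERIV_image_chain)
  then show ?thesis using None by (simp add: o_def move_def dv_def)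
next
  case (Some j)
  define y where "y = snd q + s *\<^sub>R axis j 1"
  have "((\<lambda>r. f (fst q) (y + r *\<^sub>R axis j 1) v) has_real_derivative deriv_x j f (fst q) y v) (at (s - s))"
    using deriv_x_works[OF f, of "fst q" y j v] q s by simp
  moreover have "((\<lambda>r. r - s) has_real_derivative 1) (at s)" by (auto intro!: derivative_eq_intros)
  ultimately have "((\<lambda>r. f (fst q) (y + (r - s) *\<^sub>R axis j 1) v) has_real_derivative deriv_x j f (fst q) y v * 1) (at s)"
    by (rule DERIV_chain2)
  moreover have "y + (r - s) *\<^sub>R axis j 1 = snd q + r *\<^sub>R axis j 1" for r by (simp add: y_def scaleR_left_diff_distrib)
  ultimately have "((\<lambda>r. f (fst q) (snd q + r *\<^sub>R axis j 1) v) has_real_derivative deriv_x j f (fst q) y v) (at s)" by simp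
  then show ?thesis using Some
    by (simp add: move_def dv_def y_def has_field_derivative_at_within)
qed

lemma dv_commute:
  assumes f: "C_k_on (Suc (Suc k)) T f"
  shows "agree T (dv e (dv e' f)) (dv e' (dv e f))"
  unfolding agree_def
proof (intro ballI ext)
  fix t and x v :: "real^3" assume t: "t \<in> {0..<T}"
  \<comment> \<open>Both moves may be in time, so each gets half of the remaining lifetime.\<close>
  define h where "h = (T - t) / 2"
  have h: "h > 0" "t + h + h = T" using t by (auto simp: h_def field_simps)
  define q where "q = (t, x)"
  define F where "F g s r = g (fst (move e s (move e' r q))) (snd (move e s (move e' r q))) v" for g :: kinetic_fn and s r
  have F': "F g s r = g (fst (move e' r (move e s q))) (snd (move e' r (move e s q))) v" for g s r
    by (simp add: F_def move_commute)
  have tm: "0 \<le> fst (move d s q)" "fst (move d s q) + h \<le> T" if "s \<in> {0..<h}" for d s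
    using move_time[of s q d] that t h by (auto simp: q_def)
  have D1: "((\<lambda>s. F g s r) has_real_derivative F (dv e g) s r) (at s within {0..<h})" if "C_k_on (Suc n) T g" "s \<in> {0..<h}" "r \<in> {0..<h}" for g n s r
    unfolding F_def by (rule dv_along[OF that(1) tm[OF that(3)] that(2)])
  have D2: "((\<lambda>r. F g s r) has_real_derivative F (dv e' g) s r) (at r within {0..<h})" if "C_k_on (Suc n) T g" "s \<in> {0..<h}" "r \<in> {0..<h}" for g n s r
    unfolding F' by (rule dv_along[OF that(1) tm[OF that(2)] that(3)])
  have cF: "continuous_on ({0..<h} \<times> {0..<h}) (\<lambda>(s, r). F g s r)" if "C_k_on n T g" for g n
  proof -
    have m: "continuous_on ({0..<h} \<times> {0..<h}) (\<lambda>p. (fst (move e (fst p) (move e' (snd p) q)), snd (move e (fst p) (move e' (snd p) q)), v))"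
      by (cases e; cases e') (auto simp: move_def intro!: continuous_intros)
    have "continuous_on ({0..<h} \<times> {0..<h}) (\<lambda>p. (\<lambda>(t, x, v). g t x v) (fst (move e (fst p) (move e' (snd p) q)), snd (move e (fst p) (move e' (snd p) q)), v))"
    proof (rule continuous_on_compose2[OF C_cont[OF that] m])
      have "fst (move e s (move e' r q)) \<in> {0..<T}" if "s \<in> {0..<h}" "r \<in> {0..<h}" for s r
        using move_time[of s "move e' r q" e] move_time[of r q e'] that t h by (auto simp: q_def)
      then show "(\<lambda>p. (fst (move e (fst p) (move e' (snd p) q)), snd (move e (fst p) (move e' (snd p) q)), v)) ` ({0..<h} \<times> {0..<h}) \<subseteq> {0..<T} \<times> UNIV \<times> UNIV"
        by auto
    qed
    then show ?thesis by (simp add: F_def case_prod_beta')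
  qed
  note C1 = C_dv[OF f]
  have "F (dv e' (dv e f)) 0 0 = F (dv e (dv e' f)) 0 0"
    by (rule Schwarz_corner[OF h(1) D1[OF f] D2[OF f] D2[OF C1] D1[OF C1] cF[OF C_dv[OF C1]] cF[OF C_dv[OF C1]]])
  then show "dv e (dv e' f) t x v = dv e' (dv e f) t x v" by (simp add: F_def move_0 q_def)
qed

lemma dv_pow_commute: "C_k_on (Suc n + k) T f \<Longrightarrow> agree T (dv e ((dv e' ^^ n) f)) ((dv e' ^^ n) (dv e f))"
proof (induction n arbitrary: k)
  case 0 show ?case by (simp add: agree_refl)
next
  case (Suc n)
  have "C_k_on (Suc (Suc k)) T ((dv e' ^^ n) f)" by (rule C_pow) (use Suc.prems in simp)
  from dv_commute[OF this] have 1: "agree T (dv e (dv e' ((dv e' ^^ n) f))) (dv e' (dv e ((dv e' ^^ n) f)))" .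
  have "C_k_on (Suc n + Suc k) T f" using Suc.prems by simp
  from agree_trans[OF 1 agree_dv[OF Suc.IH[OF this]]] show ?case by simp
qed

lemma mult_deriv_dv:
  "mult_deriv \<alpha> 0 f = (dv None ^^ (\<alpha>$0)) ((dv (Some 1) ^^ (\<alpha>$1)) ((dv (Some 2) ^^ (\<alpha>$2)) ((dv (Some 3) ^^ (\<alpha>$3)) f)))"
  by (simp add: mult_deriv_def dv_def)

lemma four_zero: "(4::4) = 0" by simp

lemma mi_length_4: "mi_length (\<alpha>::nat^4) = \<alpha>$0 + \<alpha>$1 + \<alpha>$2 + \<alpha>$3"
  unfolding mi_length_def sum_4 four_zero by simp

lemma inc_nth: "inc e \<alpha> $ k = \<alpha>$k + (if k = ax e then 1 else 0)"
  by (simp add: inc_def axis_def)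

lemma mult_deriv_C:
  assumes "C_k_on N T f" "mi_length \<alpha> + k = N"
  shows "C_k_on k T (mult_deriv \<alpha> 0 f)"
  unfolding mult_deriv_dv
  by (intro C_pow) (use assms in \<open>simp add: mi_length_4 add_ac\<close>)

text \<open>\<open>mult_deriv\<close> applies its derivatives in a fixed order with time outermost;
  a further derivative has to be passed inwards through the blocks that precede its own.\<close>

lemma mult_deriv_inc:
  assumes f: "C_k_on N T f" and a: "mi_length \<alpha> < N"
  shows "agree T (dv e (mult_deriv \<alpha> 0 f)) (mult_deriv (inc e \<alpha>) 0 f)"
proof -
  define X3 where "X3 = (dv (Some 3) ^^ (\<alpha>$3)) f"
  define X2 where "X2 = (dv (Some 2) ^^ (\<alpha>$2)) X3"
  define X1 where "X1 = (dv (Some 1) ^^ (\<alpha>$1)) X2"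
  define k where "k = N - Suc (mi_length \<alpha>)"
  have C3: "C_k_on (\<alpha>$2 + (\<alpha>$1 + (\<alpha>$0 + Suc k))) T X3"
    unfolding X3_def by (rule C_pow) (use f a in \<open>simp add: k_def mi_length_4 add_ac\<close>)
  have C2: "C_k_on (\<alpha>$1 + (\<alpha>$0 + Suc k)) T X2" unfolding X2_def by (rule C_pow[OF C3])
  have C1: "C_k_on (\<alpha>$0 + Suc k) T X1" unfolding X1_def by (rule C_pow[OF C2])
  have C3': "C_k_on (Suc (\<alpha>$2) + (\<alpha>$1 + (\<alpha>$0 + k))) T X3" and C2': "C_k_on (Suc (\<alpha>$1) + (\<alpha>$0 + k)) T X2" and C1': "C_k_on (Suc (\<alpha>$0) + k) T X1"
    using C3 C2 C1 by simp_all
  have m: "mult_deriv \<alpha> 0 f = (dv None ^^ (\<alpha>$0)) X1" by (simp add: mult_deriv_dv X1_def X2_def X3_def)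
  have s1: "agree T (dv e (mult_deriv \<alpha> 0 f)) ((dv None ^^ (\<alpha>$0)) (dv e X1))"
    unfolding m by (rule dv_pow_commute[OF C1'])
  have s2: "agree T ((dv None ^^ (\<alpha>$0)) (dv e X1)) ((dv None ^^ (\<alpha>$0)) ((dv (Some 1) ^^ (\<alpha>$1)) (dv e X2)))"
    unfolding X1_def by (rule agree_pow[OF dv_pow_commute[OF C2']])
  have s3: "agree T ((dv None ^^ (\<alpha>$0)) ((dv (Some 1) ^^ (\<alpha>$1)) (dv e X2))) ((dv None ^^ (\<alpha>$0)) ((dv (Some 1) ^^ (\<alpha>$1)) ((dv (Some 2) ^^ (\<alpha>$2)) (dv e X3))))"
    unfolding X2_def by (rule agree_pow[OF agree_pow[OF dv_pow_commute[OF C3']]])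
  show ?thesis
  proof (cases e)
    case None
    then have "mult_deriv (inc e \<alpha>) 0 f = dv e (mult_deriv \<alpha> 0 f)"
      unfolding m by (simp add: mult_deriv_dv inc_nth ax_def X1_def X2_def X3_def)
    then show ?thesis by (simp add: agree_refl)
  next
    case (Some j)
    consider "j = 1" | "j = 2" | "j = 3" using exhaust_3[of j] by blast
    then show ?thesis
    proof cases
      case 1
      have "mult_deriv (inc e \<alpha>) 0 f = (dv None ^^ (\<alpha>$0)) (dv e X1)"
        by (simp add: Some 1 mult_deriv_dv inc_nth ax_def X1_def X2_def X3_def)
      then show ?thesis using s1 by simp
    next
      case 2
      have "mult_deriv (inc e \<alpha>) 0 f = (dv None ^^ (\<alpha>$0)) ((dv (Some 1) ^^ (\<alpha>$1)) (dv e X2))"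
        by (simp add: Some 2 mult_deriv_dv inc_nth ax_def X2_def X3_def)
      then show ?thesis using agree_trans[OF s1 s2] by simp
    next
      case 3
      have "mult_deriv (inc e \<alpha>) 0 f = (dv None ^^ (\<alpha>$0)) ((dv (Some 1) ^^ (\<alpha>$1)) ((dv (Some 2) ^^ (\<alpha>$2)) (dv e X3)))"
        by (simp add: Some 3 mult_deriv_dv inc_nth ax_def X3_def)
      then show ?thesis using agree_trans[OF agree_trans[OF s1 s2] s3] by simp
    qed
  qed
qed

text \<open>Differentiation commutes with translation by a period.\<close>

lemma mult_deriv_periodic:
  assumes f: "\<forall>t\<in>{0..<T}. torus_periodic (f t)"
  shows "\<forall>t\<in>{0..<T}. torus_periodic (mult_deriv \<alpha> 0 f t)"
proof -
  define tr where "tr i h t x v = (h t (x + axis i 1) v :: real)" for i :: 3 and h :: kinetic_fn and t x v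
  have dt: "dv e (tr i h) = tr i (dv e h)" for e i h
    by (cases e) (simp_all add: fun_eq_iff dv_def deriv_t_def deriv_x_def tr_def add_ac)
  have step: "agree T h (tr i h) \<Longrightarrow> agree T (dv e h) (tr i (dv e h))" for h i e
    using agree_dv[of T h "tr i h" e] by (simp add: dt)
  have pow: "agree T h (tr i h) \<Longrightarrow> agree T ((dv e ^^ n) h) (tr i ((dv e ^^ n) h))" for h i e n
    by (induction n) (auto intro: step)
  have "agree T f (tr i f)" for i
    using f by (auto simp: agree_def tr_def torus_periodic_def fun_eq_iff)
  then have "agree T (mult_deriv \<alpha> 0 f) (tr i (mult_deriv \<alpha> 0 f))" for i
    unfolding mult_deriv_dv by (intro pow)
  then show ?thesis unfolding agree_def tr_def torus_periodic_def by (metis (no_types, lifting))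
qed

subsection \<open>The energy\<close>

lemma sum_pairs_ge:
  fixes F :: "nat^4 \<Rightarrow> nat^3 \<Rightarrow> ennreal"
  shows "(\<Sum>\<alpha> | mi_length \<alpha> \<le> N. F \<alpha> 0) \<le> (\<Sum>(\<alpha>, \<beta>) | mi_length \<alpha> + mi_length \<beta> \<le> N. F \<alpha> \<beta>)"
proof -
  have fin: "finite {(\<alpha>::nat^4, \<beta>::nat^3). mi_length \<alpha> + mi_length \<beta> \<le> N}"
    by (rule finite_subset[of _ "{\<alpha>. mi_length \<alpha> \<le> N} \<times> {\<beta>. mi_length \<beta> \<le> N}"]) (auto intro: finite_mi_length)
  have "(\<Sum>\<alpha> | mi_length \<alpha> \<le> N. F \<alpha> 0) = (\<Sum>(\<alpha>, \<beta>)\<in>(\<lambda>\<alpha>. (\<alpha>, 0)) ` {\<alpha>. mi_length \<alpha> \<le> N}. F \<alpha> \<beta>)"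
    by (subst sum.reindex) (auto simp: inj_on_def)
  also have "\<dots> \<le> (\<Sum>(\<alpha>, \<beta>) | mi_length \<alpha> + mi_length \<beta> \<le> N. F \<alpha> \<beta>)"
    by (rule sum_mono2[OF fin]) auto
  finally show ?thesis .
qed

text \<open>All terms with velocity derivatives are dropped; the factor 2 undoes the 1/2 in the
  energy.\<close>

lemma energy_bounds:
  "(\<Sum>\<alpha> | mi_length \<alpha> \<le> N. L2_norm_sq (mult_deriv \<alpha> 0 f t)) \<le> 2 * energy N f t"
  "(\<Sum>\<alpha> | mi_length \<alpha> \<le> N. \<integral>\<^sup>+ s\<in>{0..t}. L2_norm_sq (mult_deriv \<alpha> 0 f s) \<partial>lborel) \<le> energy N f t"
proof -
  let ?A = "\<Sum>(\<alpha>, \<beta>) | mi_length \<alpha> + mi_length \<beta> \<le> N. L2_norm_sq (mult_deriv \<alpha> \<beta> f t)"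
  have h: "2 * (1 / 2 * x) = x" for x :: ennreal
  proof -
    have "(2::ennreal) * (1 / 2) = 1" by (simp add: ennreal_times_divide ennreal_divide_self)
    then show ?thesis by (simp add: mult.assoc[symmetric])
  qed
  have "(\<Sum>\<alpha> | mi_length \<alpha> \<le> N. L2_norm_sq (mult_deriv \<alpha> 0 f t)) \<le> ?A" by (rule sum_pairs_ge)
  also have "\<dots> = 2 * (1 / 2 * ?A)" by (rule h[symmetric])
  also have "\<dots> \<le> 2 * energy N f t" unfolding energy_def by (intro mult_left_mono) auto
  finally show "(\<Sum>\<alpha> | mi_length \<alpha> \<le> N. L2_norm_sq (mult_deriv \<alpha> 0 f t)) \<le> 2 * energy N f t" .
  have "(\<Sum>\<alpha> | mi_length \<alpha> \<le> N. \<integral>\<^sup>+ s\<in>{0..t}. L2_norm_sq (mult_deriv \<alpha> 0 f s) \<partial>lborel)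
     \<le> (\<Sum>(\<alpha>, \<beta>) | mi_length \<alpha> + mi_length \<beta> \<le> N. \<integral>\<^sup>+ s\<in>{0..t}. L2_norm_sq (mult_deriv \<alpha> \<beta> f s) \<partial>lborel)"
    by (rule sum_pairs_ge)
  also have "\<dots> \<le> energy N f t" unfolding energy_def by simp
  finally show "(\<Sum>\<alpha> | mi_length \<alpha> \<le> N. \<integral>\<^sup>+ s\<in>{0..t}. L2_norm_sq (mult_deriv \<alpha> 0 f s) \<partial>lborel) \<le> energy N f t" .
qed

section \<open>Bessel's inequality and moments over phase space\<close>

context kinetic
begin

text \<open>This is \<open>n2_res\<close> for the constant polynomial, with the residual dropped and
  the positive factor \<open>cw\<close> cancelled.\<close>

lemma Bessel:
  assumes i: "i \<in> S" "t \<in> Iv i" and a: "mi_length \<alpha> \<le> N"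
  shows "(\<Sum>k<8. enn2real (n2 (\<lambda>x. chn k * Y (chi k) \<alpha> i t x))) \<le> enn2real (L2_norm_sq (g i \<alpha> t))"
proof -
  have f: "n2 (\<lambda>x. chn k * Y (chi k) \<alpha> i t x) < top" for k
    using sq_cmult[OF sq_Y[OF i a]] by (simp add: sq_def)
  have "ennreal (cw (pc 1)) * (\<Sum>k<8. n2 (\<lambda>x. chn k * Y (chi k) \<alpha> i t x)) \<le> n2 (res (pc 1) \<alpha> i t) + ennreal (cw (pc 1)) * (\<Sum>k<8. n2 (\<lambda>x. chn k * Y (chi k) \<alpha> i t x))"
    by simp
  also note n2_res[OF i a, of "pc 1"]
  finally have "(\<Sum>k<8. n2 (\<lambda>x. chn k * Y (chi k) \<alpha> i t x)) \<le> L2_norm_sq (g i \<alpha> t)"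
    by (simp add: cw_basic ennreal_mult_le_mult_iff)
  moreover have "(\<Sum>k<8. n2 (\<lambda>x. chn k * Y (chi k) \<alpha> i t x)) = ennreal (\<Sum>k<8. enn2real (n2 (\<lambda>x. chn k * Y (chi k) \<alpha> i t x)))"
    using f by (simp add: sum_ennreal[symmetric] del: sum_ennreal)
  moreover have "L2_norm_sq (g i \<alpha> t) = ennreal (enn2real (L2_norm_sq (g i \<alpha> t)))" using L2_fin[OF i(1) a i(2)] by simp
  ultimately have "ennreal (\<Sum>k<8. enn2real (n2 (\<lambda>x. chn k * Y (chi k) \<alpha> i t x))) \<le> ennreal (enn2real (L2_norm_sq (g i \<alpha> t)))" by simp
  then show ?thesis by (subst (asm) ennreal_le_iff) auto
qed

text \<open>The Gaussian has no third moments, so the hypothesis on the third moment of F becomes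
  one on the perturbation.\<close>

lemma phase_moments:
  assumes i: "i \<in> S" "t \<in> Iv i" and a: "mi_length \<alpha> \<le> N"
  shows "collision_moments (g i \<alpha> t) = (mn (Y (pc 1) \<alpha> i t), \<chi> j. mn (Y (V j) \<alpha> i t), mn (Y N2 \<alpha> i t))"
    and "(LINT (x, v)|phase_space. perturbed (g i \<alpha> t x) v * (v$j * (norm v)\<^sup>2)) = mn (Y (pmul (V j) N2) \<alpha> i t)"
proof -
  note gm = phase_measurable[OF g_meas[OF i(1) a i(2)]]
  have gm'[measurable]: "(\<lambda>p. g i \<alpha> t (fst p) (snd p)) \<in> borel_measurable PM" using gm by (simp add: case_prod_beta')
  note ph = phase_Y[OF i a]
  have I: "integrable PM (\<lambda>p. (g i \<alpha> t (fst p) (snd p) * sqrt (maxwellian (snd p))) *\<^sub>R snd p)"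
  proof (rule Bochner_Integration.integrable_bound[OF ph(1)[of wsq]])
    show "AE p in PM. norm ((g i \<alpha> t (fst p) (snd p) * sqrt (maxwellian (snd p))) *\<^sub>R snd p) \<le> norm (case p of (x, v) \<Rightarrow> g i \<alpha> t x v * (wt wsq v))"
    proof (rule AE_I2)
      fix p :: "(real^3) \<times> (real^3)"
      have "\<bar>g i \<alpha> t (fst p) (snd p) * sqrt (maxwellian (snd p))\<bar> * norm (snd p) \<le> \<bar>g i \<alpha> t (fst p) (snd p) * sqrt (maxwellian (snd p))\<bar> * (1 + (norm (snd p))\<^sup>2)"
        by (rule mult_left_mono[OF norm_le_poly]) simp
      then show "norm ((g i \<alpha> t (fst p) (snd p) * sqrt (maxwellian (snd p))) *\<^sub>R snd p) \<le> norm (case p of (x, v) \<Rightarrow> g i \<alpha> t x v * (wt wsq v))"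
        by (simp add: case_prod_beta' abs_mult peval_wsq mult_ac)
    qed
    show "(\<lambda>p. (g i \<alpha> t (fst p) (snd p) * sqrt (maxwellian (snd p))) *\<^sub>R snd p) \<in> borel_measurable PM" by measurable
  qed
  have v: "(LINT p|PM. (g i \<alpha> t (fst p) (snd p) * sqrt (maxwellian (snd p))) *\<^sub>R snd p) $ j = mn (Y (V j) \<alpha> i t)" for j
    unfolding integral_bounded_linear[OF bounded_linear_vec_nth I, symmetric] ph(2)[symmetric]
    by (rule Bochner_Integration.integral_cong) (auto simp: mult_ac)
  have s: "(LINT p|PM. g i \<alpha> t (fst p) (snd p) * sqrt (maxwellian (snd p))) = mn (Y (pc 1) \<alpha> i t)"
    unfolding ph(2)[symmetric] by (rule Bochner_Integration.integral_cong) auto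
  have e: "(LINT p|PM. g i \<alpha> t (fst p) (snd p) * (norm (snd p))\<^sup>2 * sqrt (maxwellian (snd p))) = mn (Y N2 \<alpha> i t)"
    unfolding ph(2)[symmetric] by (rule Bochner_Integration.integral_cong) (auto simp: mult_ac)
  show "collision_moments (g i \<alpha> t) = (mn (Y (pc 1) \<alpha> i t), \<chi> j. mn (Y (V j) \<alpha> i t), mn (Y N2 \<alpha> i t))"
    using s v e by (simp add: collision_moments_def phase_space_def case_prod_beta' vec_eq_iff)
  let ?L = "pmul (V j) N2"
  note m = velocity_integral_phase[OF integrable_maxwellian_peval[of ?L]]
  have "(LINT (x, v)|phase_space. perturbed (g i \<alpha> t x) v * (v$j * (norm v)\<^sup>2))
    = (LINT p|PM. (case p of (x::real^3, v) \<Rightarrow> maxwellian v * peval ?L v) + (case p of (x,v) \<Rightarrow> g i \<alpha> t x v * (peval ?L v * sqrt (maxwellian v))))"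
    unfolding phase_space_def by (rule Bochner_Integration.integral_cong) (auto simp: perturbed_def algebra_simps)
  also have "\<dots> = pE ?L + mn (Y ?L \<alpha> i t)"
    unfolding Bochner_Integration.integral_add[OF m(1) ph(1)[of ?L]] ph(2) m(2) integral_maxwellian_peval ..
  finally show "(LINT (x, v)|phase_space. perturbed (g i \<alpha> t x) v * (v$j * (norm v)\<^sup>2)) = mn (Y ?L \<alpha> i t)"
    by (simp add: pE_basic)
qed

end

subsection \<open>Solutions with small energy\<close>

text \<open>The index set of the uniform estimates. With energy at most 10^-10 and \<open>en\<close>
  at most twice the energy, the threshold 10^-9 of \<open>shakhov_kinetic\<close> is met.\<close>

definition solutions :: "real \<Rightarrow> real \<Rightarrow> real \<Rightarrow> nat \<Rightarrow> (real \<times> kinetic_fn) set" where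
  "solutions \<tau>\<^sub>0 \<eta> w N = {(T, f). T > 0 \<and> classical_solution \<tau>\<^sub>0 \<eta> w 0 N T (f 0) f
     \<and> (SUP t\<in>{0..<T}. energy N f t) \<le> ennreal (1 / 10^10)
     \<and> (\<forall>t\<in>{0..<T}. collision_moments (f t) = (0, 0, 0))
     \<and> (\<forall>i. (LINT (x, v)|phase_space. perturbed (f 0 x) v * (v$i * (norm v)\<^sup>2)) = 0)}"

context
  fixes \<tau>\<^sub>0 \<eta> w :: real and N :: nat and i :: "real \<times> kinetic_fn"
  assumes i: "i \<in> solutions \<tau>\<^sub>0 \<eta> w N"
begin

lemma solution_T: "fst i > 0"
  and solution_per: "\<forall>t\<in>{0..<fst i}. torus_periodic (snd i t)"
  and solution_C: "C_k_on N (fst i) (snd i)"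
  and solution_eq: "t \<in> {0..<fst i} \<Longrightarrow> deriv_t (snd i) t x v + (\<Sum>j\<in>UNIV. v$j * deriv_x j (snd i) t x v)
          = 1 / \<tau>\<^sub>0 * L_Pr 0 (snd i t x) v + Gamma_Pr \<tau>\<^sub>0 \<eta> w 0 (snd i t x) v"
  and solution_moments: "t \<in> {0..<fst i} \<Longrightarrow> collision_moments (snd i t) = (0, 0, 0)"
  and solution_third: "(LINT (x, v)|phase_space. perturbed (snd i 0 x) v * (v$j * (norm v)\<^sup>2)) = 0"
  using i by (auto simp: solutions_def classical_solution_def)

lemma solution_energy: assumes "t \<in> {0..<fst i}" shows "energy N (snd i) t \<le> ennreal (1 / 10^10)"
proof -
  have "energy N (snd i) t \<le> (SUP t\<in>{0..<fst i}. energy N (snd i) t)" by (rule SUP_upper[OF assms])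
  also have "\<dots> \<le> ennreal (1 / 10^10)" using i by (auto simp: solutions_def)
  finally show ?thesis .
qed

lemma solution_L2_sum:
  assumes t: "t \<in> {0..<fst i}"
  shows "(\<Sum>\<alpha> | mi_length \<alpha> \<le> N. enn2real (L2_norm_sq (mult_deriv \<alpha> 0 (snd i) t))) \<le> 2 * enn2real (energy N (snd i) t)"
    and "mi_length \<alpha> \<le> N \<Longrightarrow> L2_norm_sq (mult_deriv \<alpha> 0 (snd i) t) \<le> ennreal 1"
    and "enn2real (energy N (snd i) t) \<le> 1 / 10^10"
proof -
  let ?L = "\<lambda>\<alpha>. L2_norm_sq (mult_deriv \<alpha> 0 (snd i) t)"
  \<comment> \<open>Finiteness excludes the default value 0 that \<open>enn2real\<close> takes at
    infinity.\<close>
  have Ef: "energy N (snd i) t < top" using solution_energy[OF t] le_less_trans ennreal_less_top by blast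
  then have E: "energy N (snd i) t = ennreal (enn2real (energy N (snd i) t))" by simp
  show E2: "enn2real (energy N (snd i) t) \<le> 1 / 10^10" by (rule enn2real_leI) (use solution_energy[OF t] in auto)
  have le: "(\<Sum>\<alpha> | mi_length \<alpha> \<le> N. ?L \<alpha>) \<le> ennreal (2 * enn2real (energy N (snd i) t))"
    using energy_bounds(1)[where N=N and f="snd i" and t=t] E by (simp add: ennreal_mult)
  have m: "?L \<alpha> \<le> ennreal (2 * enn2real (energy N (snd i) t))" if "mi_length \<alpha> \<le> N" for \<alpha>
  proof -
    have "?L \<alpha> \<le> (\<Sum>\<alpha> | mi_length \<alpha> \<le> N. ?L \<alpha>)" by (rule member_le_sum) (use that finite_mi_length in auto)
    then show ?thesis using le by (rule order_trans)
  qed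
  show "mi_length \<alpha> \<le> N \<Longrightarrow> ?L \<alpha> \<le> ennreal 1"
    by (rule order_trans[OF m ennreal_leI]) (use E2 in auto)
  have "ennreal (\<Sum>\<alpha> | mi_length \<alpha> \<le> N. enn2real (?L \<alpha>)) = (\<Sum>\<alpha> | mi_length \<alpha> \<le> N. ennreal (enn2real (?L \<alpha>)))"
    by (rule sum_ennreal[symmetric]) simp
  also have "\<dots> = (\<Sum>\<alpha> | mi_length \<alpha> \<le> N. ?L \<alpha>)"
  proof (rule sum.cong[OF refl])
    fix \<alpha> :: "nat^4" assume "\<alpha> \<in> {\<alpha>. mi_length \<alpha> \<le> N}"
    then have "?L \<alpha> < top" using m[of \<alpha>] le_less_trans ennreal_less_top by blast
    then show "ennreal (enn2real (?L \<alpha>)) = ?L \<alpha>" by simp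
  qed
  finally have "ennreal (\<Sum>\<alpha> | mi_length \<alpha> \<le> N. enn2real (?L \<alpha>)) \<le> ennreal (2 * enn2real (energy N (snd i) t))" using le by simp
  then show "(\<Sum>\<alpha> | mi_length \<alpha> \<le> N. enn2real (?L \<alpha>)) \<le> 2 * enn2real (energy N (snd i) t)"
    by (subst (asm) ennreal_le_iff) auto
qed

end

lemma mult_deriv_0: "mult_deriv 0 0 f = f" by (simp add: mult_deriv_dv)

lemma mult_deriv_inc_0: "mult_deriv (inc e 0) 0 f = dv e f"
proof (cases e)
  case None then show ?thesis by (simp add: mult_deriv_dv inc_nth ax_def)
next
  case (Some j) then show ?thesis using exhaust_3[of j] by (auto simp: mult_deriv_dv inc_nth ax_def)
qed

lemma kinetic_solutions:
  assumes N: "N \<ge> 3"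
  shows "kinetic (solutions \<tau>\<^sub>0 \<eta> w N) fst (\<lambda>i \<alpha>. mult_deriv \<alpha> 0 (snd i)) N 1"
proof
  show "3 \<le> N" by (rule N)
  show "0 \<le> (1::real)" by simp
  fix i :: "real \<times> kinetic_fn" and \<alpha> :: "nat^4" and t :: real and x v :: "real^3" and j
  assume i: "i \<in> solutions \<tau>\<^sub>0 \<eta> w N"
  note C = solution_C[OF i]
  show "continuous_on ({0..<fst i} \<times> UNIV \<times> UNIV) (\<lambda>(t, x, v). mult_deriv \<alpha> 0 (snd i) t x v)" if "mi_length \<alpha> \<le> N"
    by (rule C_cont[OF mult_deriv_C[OF C, of \<alpha> "N - mi_length \<alpha>"]]) (use that in simp)
  show "per (mult_deriv \<alpha> 0 (snd i) t)" if "mi_length \<alpha> \<le> N" "t \<in> {0..<fst i}"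
    using mult_deriv_periodic[OF solution_per[OF i], of \<alpha>] that by (auto simp: per_def torus_periodic_def fun_eq_iff)
  show "L2_norm_sq (mult_deriv \<alpha> 0 (snd i) t) \<le> ennreal 1" if "mi_length \<alpha> \<le> N" "t \<in> {0..<fst i}"
    by (rule solution_L2_sum(2)[OF i that(2,1)])
  assume a: "mi_length \<alpha> < N" and t: "t \<in> {0..<fst i}"
  have C': "C_k_on (Suc (N - Suc (mi_length \<alpha>))) (fst i) (mult_deriv \<alpha> 0 (snd i))"
    by (rule mult_deriv_C[OF C]) (use a in simp)
  have e: "mult_deriv (inc e \<alpha>) 0 (snd i) t x v = dv e (mult_deriv \<alpha> 0 (snd i)) t x v" for e
    using mult_deriv_inc[OF C a, of e] t by (simp add: agree_def)
  show "((\<lambda>s. mult_deriv \<alpha> 0 (snd i) s x v) has_real_derivative mult_deriv (inc None \<alpha>) 0 (snd i) t x v) (at t within {0..})"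
    unfolding e using deriv_t_works[OF C' t] by (simp add: dv_def)
  show "((\<lambda>s. mult_deriv \<alpha> 0 (snd i) t (x + s *\<^sub>R axis j 1) v) has_real_derivative mult_deriv (inc (Some j) \<alpha>) 0 (snd i) t x v) (at 0)"
    unfolding e using deriv_x_works[OF C' t] by (simp add: dv_def)
qed

lemma coercivity_for_solutions:
  assumes tau: "\<tau>\<^sub>0 > 0" and N: "N \<ge> 3"
  shows "\<exists>C\<ge>0. \<forall>(T, f)\<in>solutions \<tau>\<^sub>0 \<eta> w N. \<forall>t\<in>{0..<T}.
    (\<Sum>\<alpha> | mi_length \<alpha> \<le> N. L2_inner (\<lambda>x. L_Pr 0 (mult_deriv \<alpha> 0 f t x)) (mult_deriv \<alpha> 0 f t))
     \<le> - (1 / (1 + 2 * C)) * (\<Sum>\<alpha> | mi_length \<alpha> \<le> N. enn2real (L2_norm_sq (mult_deriv \<alpha> 0 f t)))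
       + 8 * C * (enn2real (energy N f t))\<^sup>2"
proof -
  let ?S = "solutions \<tau>\<^sub>0 \<eta> w N" and ?g = "\<lambda>i \<alpha>. mult_deriv \<alpha> 0 (snd (i :: real \<times> kinetic_fn))"
  interpret kinetic ?S fst ?g N 1 by (rule kinetic_solutions[OF N])
  define E where "E i t = enn2real (energy N (snd i) t)" for i :: "real \<times> kinetic_fn" and t
  define M where "M i t = (\<Sum>\<alpha> | mi_length \<alpha> \<le> N. \<Sum>k<8. enn2real (n2 (\<lambda>x. chn k * Y (chi k) \<alpha> i t x)))" for i t
  \<comment> \<open>The first summand makes \<kappa>^2 dominate the dissipation \<open>en\<close> -
    \<open>M\<close>; the second, 2 E, dominates both \<open>en\<close> and its time
    integral.\<close>
  define \<kappa> where "\<kappa> i t = sqrt (en i t - M i t) + 2 * E i t" for i t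
  have E0: "E i t \<ge> 0" for i t by (simp add: E_def)
  have enE: "en i t \<le> 2 * E i t" if "i \<in> ?S" "t \<in> {0..<fst i}" for i t
    using solution_L2_sum(1)[OF that] by (simp add: en_def E_def)
  have D0: "en i t - M i t \<ge> 0" if "i \<in> ?S" "t \<in> {0..<fst i}" for i t
  proof -
    have "M i t \<le> en i t" unfolding M_def en_def by (rule sum_mono) (use Bessel[OF that] in simp)
    then show ?thesis by simp
  qed
  have pcm: "mn (Y (pc 1) 0 i t) = 0" "mn (Y (V j) 0 i t) = 0" "mn (Y N2 0 i t) = 0" if "i \<in> ?S" "t \<in> {0..<fst i}" for i t j
    using phase_moments(1)[OF that, of 0] solution_moments[OF that] by (auto simp: mult_deriv_0 vec_eq_iff)
  interpret macro_estimate ?S fst ?g N 1 \<tau>\<^sub>0 \<eta> w \<kappa>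
  proof
    show "\<tau>\<^sub>0 > 0" by (rule tau)
    fix i t j assume i: "i \<in> ?S"
    show "mn (Y (pmul (V j) N2) 0 i 0) = 0"
      using phase_moments(2)[OF i, of 0 0 j] solution_third[OF i, of j] solution_T[OF i] by (simp add: mult_deriv_0)
    assume t: "t \<in> {0..<fst i}"
    show "en i t \<le> 1 / 10^9" using enE[OF i t] solution_L2_sum(3)[OF i t] by (simp add: E_def)
    show "?g i (inc None 0) t x v + (\<Sum>j\<in>UNIV. v$j * ?g i (inc (Some j) 0) t x v)
       = 1 / sqrt (maxwellian v) * (inv_tau \<tau>\<^sub>0 \<eta> w (perturbed (?g i 0 t x)) * (shakhov 0 (perturbed (?g i 0 t x)) v - perturbed (?g i 0 t x) v))" for x v
      using solution_eq[OF i t, of x v] by (simp add: mult_deriv_inc_0 mult_deriv_0 dv_def Gamma_Pr_def)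
    show "en i t \<le> \<kappa> i t" using enE[OF i t] D0[OF i t] by (simp add: \<kappa>_def add_increasing)
    have k: "E i t \<le> \<kappa> i t" using E0[of i t] D0[OF i t] by (simp add: \<kappa>_def add_increasing)
    have "energy N (snd i) t < top" using solution_energy[OF i t] le_less_trans ennreal_less_top by blast
    then have "(\<integral>\<^sup>+s\<in>{0..t}. ennreal (en i s) \<partial>lborel) \<le> ennreal (E i t)"
      unfolding integral_en[OF i t] using energy_bounds(2)[where N=N and f="snd i" and t=t] by (simp add: E_def)
    also have "\<dots> \<le> ennreal (\<kappa> i t)" by (rule ennreal_leI[OF k])
    finally show "(\<integral>\<^sup>+s\<in>{0..t}. ennreal (en i s) \<partial>lborel) \<le> ennreal (\<kappa> i t)" .
    have "en i t - M i t = (sqrt (en i t - M i t))\<^sup>2" using D0[OF i t] by simp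
    also have "\<dots> \<le> (\<kappa> i t)\<^sup>2" unfolding \<kappa>_def using E0[of i t] D0[OF i t] by (intro power_mono) auto
    finally show "en i t - (\<Sum>\<alpha> | mi_length \<alpha> \<le> N. \<Sum>k<8. enn2real (n2 (\<lambda>x. chn k * Y (chi k) \<alpha> i t x))) \<le> (\<kappa> i t)\<^sup>2"
      unfolding M_def .
    show "mn (Y (pc 1) 0 i t) = 0" "mn (Y (V j) 0 i t) = 0" "mn (Y N2 0 i t) = 0" using pcm[OF i t] by auto
  qed
  obtain C where C: "C \<ge> 0" "\<And>i t. i \<in> ?S \<Longrightarrow> t \<in> {0..<fst i} \<Longrightarrow> M i t \<le> C * (\<kappa> i t)\<^sup>2"
    using macroscopic_estimate unfolding M_def by blast
  have "(\<Sum>\<alpha> | mi_length \<alpha> \<le> N. L2_inner (\<lambda>x. L_Pr 0 (?g i \<alpha> t x)) (?g i \<alpha> t)) \<le> - (1 / (1 + 2 * C)) * en i t + 8 * C * (E i t)\<^sup>2"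
    if it: "i \<in> ?S" "t \<in> {0..<fst i}" for i t
  proof -
    define D where "D = en i t - M i t"
    have D: "D \<ge> 0" unfolding D_def by (rule D0[OF it])
    have "(\<Sum>\<alpha> | mi_length \<alpha> \<le> N. L2_inner (\<lambda>x. L_Pr 0 (?g i \<alpha> t x)) (?g i \<alpha> t))
       = (\<Sum>\<alpha> | mi_length \<alpha> \<le> N. (\<Sum>k<8. enn2real (n2 (\<lambda>x. chn k * Y (chi k) \<alpha> i t x))) - enn2real (L2_norm_sq (?g i \<alpha> t)))"
      by (rule sum.cong[OF refl]) (rule L2_inner_L[OF it], simp)
    then have L: "(\<Sum>\<alpha> | mi_length \<alpha> \<le> N. L2_inner (\<lambda>x. L_Pr 0 (?g i \<alpha> t x)) (?g i \<alpha> t)) = - D"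
      by (simp add: sum_subtractf D_def M_def en_def)
    have "(\<kappa> i t)\<^sup>2 \<le> 2 * (sqrt D)\<^sup>2 + 2 * (2 * E i t)\<^sup>2"
      unfolding \<kappa>_def D_def[symmetric] using sum_squares_bound[of "sqrt D" "2 * E i t"] by (simp add: power2_sum)
    then have k: "(\<kappa> i t)\<^sup>2 \<le> 2 * D + 8 * (E i t)\<^sup>2" using D by (simp add: power_mult_distrib)
    \<comment> \<open>Here \<open>en\<close> = D + M, so a bound of M by D and E^2 bounds
      \<open>en\<close>, and solving for D gives the coercivity constant 1 / (1 + 2 C).\<close>
    have "M i t \<le> C * (2 * D + 8 * (E i t)\<^sup>2)" by (rule order_trans[OF C(2)[OF it] mult_left_mono[OF k C(1)]])
    then have "en i t \<le> (1 + 2 * C) * D + 8 * C * (E i t)\<^sup>2" by (simp add: D_def algebra_simps)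
    \<comment> \<open>The factor 1 + 2 C \<ge> 1 is inserted into the last term so that the division
      leaves 8 C E^2.\<close>
    also have "\<dots> \<le> (1 + 2 * C) * D + (1 + 2 * C) * (8 * C * (E i t)\<^sup>2)"
      using C(1) mult_right_mono[of 1 "1 + 2 * C" "8 * C * (E i t)\<^sup>2"] by simp
    also have "\<dots> = (1 + 2 * C) * (D + 8 * C * (E i t)\<^sup>2)" by (simp only: distrib_left)
    finally have "en i t / (1 + 2 * C) \<le> D + 8 * C * (E i t)\<^sup>2" using C(1) by (simp add: pos_divide_le_eq mult.commute)
    then show ?thesis unfolding L by simp
  qed
  then have "\<forall>(T, f)\<in>?S. \<forall>t\<in>{0..<T}.
    (\<Sum>\<alpha> | mi_length \<alpha> \<le> N. L2_inner (\<lambda>x. L_Pr 0 (mult_deriv \<alpha> 0 f t x)) (mult_deriv \<alpha> 0 f t))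
     \<le> - (1 / (1 + 2 * C)) * (\<Sum>\<alpha> | mi_length \<alpha> \<le> N. enn2real (L2_norm_sq (mult_deriv \<alpha> 0 f t)))
       + 8 * C * (enn2real (energy N f t))\<^sup>2"
    by (auto simp: en_def E_def)
  then show ?thesis using C(1) by blast
qed

theorem theorem5p1:
  fixes \<tau>\<^sub>0 \<eta> w Pr :: real and N :: nat
  assumes "\<tau>\<^sub>0 > 0" and "\<eta> \<ge> 0" and "Pr = 0" and "N \<ge> 3"
  shows "\<exists>M\<^sub>0 \<delta> C :: real. M\<^sub>0 > 0 \<and> \<delta> > 0 \<and> C > 0 \<and>
    (\<forall>(T::real) (f\<^sub>0::phase_fn) (f::kinetic_fn).
       T > 0
       \<and> classical_solution \<tau>\<^sub>0 \<eta> w Pr N T f\<^sub>0 f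
       \<and> (\<forall>x v. perturbed (f\<^sub>0 x) v \<ge> 0)
       \<and> (\<forall>t\<in>{0..<T}. \<forall>x v. perturbed (f t x) v \<ge> 0)
       \<and> (\<forall>t\<in>{0..<T}. \<forall>x v. shakhov Pr (perturbed (f t x)) v \<ge> 0)
       \<and> (SUP t\<in>{0..<T}. energy N f t) \<le> ennreal M\<^sub>0
       \<and> (\<forall>t\<in>{0..<T}. collision_moments (f t) = collision_moments f\<^sub>0)
       \<and> collision_moments f\<^sub>0 = (0, 0, 0)
       \<and> (\<forall>i. (LINT (x, v)|phase_space. perturbed (f\<^sub>0 x) v * (v$i * (norm v)\<^sup>2)) = 0)
       \<longrightarrow>
       (\<forall>t\<in>{0..<T}.
          (\<Sum>\<alpha> | mi_length \<alpha> \<le> N.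
             L2_inner (\<lambda>x. L_Pr Pr (mult_deriv \<alpha> 0 f t x)) (mult_deriv \<alpha> 0 f t))
          \<le> - \<delta> * (\<Sum>\<alpha> | mi_length \<alpha> \<le> N. enn2real (L2_norm_sq (mult_deriv \<alpha> 0 f t)))
            + C * (enn2real (energy N f t))\<^sup>2))"
proof -
  obtain C where C: "C \<ge> 0" "\<forall>(T, f)\<in>solutions \<tau>\<^sub>0 \<eta> w N. \<forall>t\<in>{0..<T}.
    (\<Sum>\<alpha> | mi_length \<alpha> \<le> N. L2_inner (\<lambda>x. L_Pr 0 (mult_deriv \<alpha> 0 f t x)) (mult_deriv \<alpha> 0 f t))
     \<le> - (1 / (1 + 2 * C)) * (\<Sum>\<alpha> | mi_length \<alpha> \<le> N. enn2real (L2_norm_sq (mult_deriv \<alpha> 0 f t)))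
       + 8 * C * (enn2real (energy N f t))\<^sup>2"
    using coercivity_for_solutions[OF assms(1,4)] by blast
  show ?thesis
  \<comment> \<open>The first witness is the energy threshold built into \<open>solutions\<close>.
    The summand 1 in \<open>8 * C + 1\<close> is there because \<open>C\<close> may be 0 while the
    statement asks for a positive constant.\<close>
  proof (rule exI[of _ "1 / 10^10"], rule exI[of _ "1 / (1 + 2 * C)"], rule exI[of _ "8 * C + 1"], intro conjI allI impI ballI)
    fix T f\<^sub>0 f t
    assume H: "T > 0
       \<and> classical_solution \<tau>\<^sub>0 \<eta> w Pr N T f\<^sub>0 f
       \<and> (\<forall>x v. perturbed (f\<^sub>0 x) v \<ge> 0)
       \<and> (\<forall>t\<in>{0..<T}. \<forall>x v. perturbed (f t x) v \<ge> 0)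
       \<and> (\<forall>t\<in>{0..<T}. \<forall>x v. shakhov Pr (perturbed (f t x)) v \<ge> 0)
       \<and> (SUP t\<in>{0..<T}. energy N f t) \<le> ennreal (1 / 10^10)
       \<and> (\<forall>t\<in>{0..<T}. collision_moments (f t) = collision_moments f\<^sub>0)
       \<and> collision_moments f\<^sub>0 = (0, 0, 0)
       \<and> (\<forall>i. (LINT (x, v)|phase_space. perturbed (f\<^sub>0 x) v * (v$i * (norm v)\<^sup>2)) = 0)"
      and t: "t \<in> {0..<T}"
    have f0: "f 0 = f\<^sub>0" using H by (auto simp: classical_solution_def fun_eq_iff)
    have "(T, f) \<in> solutions \<tau>\<^sub>0 \<eta> w N" using H assms(3) by (auto simp: solutions_def f0)
    with C(2) t have "(\<Sum>\<alpha> | mi_length \<alpha> \<le> N. L2_inner (\<lambda>x. L_Pr Pr (mult_deriv \<alpha> 0 f t x)) (mult_deriv \<alpha> 0 f t))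
     \<le> - (1 / (1 + 2 * C)) * (\<Sum>\<alpha> | mi_length \<alpha> \<le> N. enn2real (L2_norm_sq (mult_deriv \<alpha> 0 f t)))
       + 8 * C * (enn2real (energy N f t))\<^sup>2" using assms(3) by auto
    also have "\<dots> \<le> - (1 / (1 + 2 * C)) * (\<Sum>\<alpha> | mi_length \<alpha> \<le> N. enn2real (L2_norm_sq (mult_deriv \<alpha> 0 f t)))
       + (8 * C + 1) * (enn2real (energy N f t))\<^sup>2" by (simp add: distrib_right)
    finally show "(\<Sum>\<alpha> | mi_length \<alpha> \<le> N. L2_inner (\<lambda>x. L_Pr Pr (mult_deriv \<alpha> 0 f t x)) (mult_deriv \<alpha> 0 f t))
     \<le> - (1 / (1 + 2 * C)) * (\<Sum>\<alpha> | mi_length \<alpha> \<le> N. enn2real (L2_norm_sq (mult_deriv \<alpha> 0 f t)))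
       + (8 * C + 1) * (enn2real (energy N f t))\<^sup>2" .
  qed (use C(1) in auto)
qed

end
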